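(* Let $\mathcal{T}_h$ be a triangulation of a domain $\Omega\subset\mathbb{R}^2$ as described in the context, and let $V_h\subset C^1(\Omega)$ be the corresponding global finite element space of Hsieh-Clough-Tocher (HCT) elements. Let $u\in C^1(\Omega)\cap H^4(\mathcal{T}_h)$. There exists $\chi\in V_h$ such that for every $K\in\mathcal{T}_h$ and $l=0,\dots,4$, $$|u-\chi|_{l,K}\le c\,h^{4-l}\,|u|_{4,\omega_K},\qquad h=\max_{K'\in\omega_K}h_{K'},$$ where $\omega_K$ is the collection of triangles that share a vertex with $K$ and $c$ is a constant independent of $u$ and of the mesh sizes.
   Context: $\mathcal{T}_h$ is a two-dimensional partition of $\Omega$ into triangles, or more precisely tri-sided cells: the peripheral cells (those having a side on $\partial\Omega$) may have one curved side, are convex, and contain a regular (straight-sided) triangle which is used to define the nodes. All triangles are shape-regular (minimum angle condition) and the mesh is locally quasi-uniform, i.e. diameters of adjacent triangles are commensurate. The cells are Lipschitz and starlike, in the sense that the set $S$ of points $\mathbf p$ of $K$ with $[\mathbf p,\mathbf x]\subset K$ for all $\mathbf x\in K$ has positive measure, and for some $\mathbf p\in S$ and constant $c_0>0$, $(\mathbf x-\mathbf p)\cdot\boldsymbol\nu\ge c_0\,\mathrm{diam}(K)$ for almost all $\mathbf x\in\partial K$, $\boldsymbol\nu$ being the unit outward normal. $h_K=\mathrm{diam}(K)$. HCT element: the triangle $K$ with vertices $\mathbf a_1,\mathbf a_2,\mathbf a_3$ is divided into three triangles $K_1,K_2,K_3$ by joining a point $\mathbf a_K$ interior to $K$ to the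 three vertices; $\mathbf b_1,\mathbf b_2,\mathbf b_3$ are the midpoints of the sides of $K$ (for peripheral cells the vertices and sides are those of the contained straight triangle). Then $$\mathcal{P}_K=\{p\in C^1(K):\ p|_{K_i}\in\mathcal{P}_3(K_i),\ 1\le i\le 3\},\qquad \dim\mathcal{P}_K=12,$$ $$\Sigma_K=\{p(\mathbf a_i),\ \partial_1p(\mathbf a_i),\ \partial_2p(\mathbf a_i),\ \partial_\nu p(\mathbf b_i),\ 1\le i\le 3\},$$ where $\mathcal{P}_3$ denotes polynomials of total degree at most $3$ and $\partial_\nu$ is the derivative in a unit normal direction to the side. $V_h$ is spanned by the functions obtained by summing, for each node (vertex or edge midpoint) and each degree of freedom at that node, the local canonical (dual) basis functions over all cells containing the node, the normal direction at an edge midpoint being common to the two cells sharing the edge; $V_h$ is a subspace of $C^1(\Omega)$ whose elements restrict to $\mathcal{P}_K$ on each $K$. $H^m(\mathcal{T}_h)$ is the broken Sobolev space of functions whose restriction to each $K\in\mathcal{T}_h$ is in $H^m(K)$. $|\cdot|_{l,K}$ is the seminorm of $H^l(K)$, $|v|_{l,K}^2=\sum_{|\alpha|=l}\|\partial^\alpha v\|_{L^2(K)}^2$, and $|v|_{l,\omega_K}^2=\sum_{K'\in\omega_K}|v|_{l,K'}^2$ (with $K\in\omega_K$).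
   Formalization: The domain has no slits and the cells around each vertex are linked through common sides (automatic for Lipschitz domains; false otherwise); shape regularity includes the three subtriangles and comparable size of a curved cell and its triangle; for l=3,4 seminorms are taken over the K_i. *)

theory Defs
  imports "HOL-Analysis.Analysis"
begin

type_synonym pt = "real^2"

section \<open>Weak derivatives and Sobolev seminorms in the plane\<close>

definition partial :: "2 \<Rightarrow> (pt \<Rightarrow> real) \<Rightarrow> pt \<Rightarrow> real" where
  "partial i f = (\<lambda>x. frechet_derivative f (at x) (axis i 1))"

text \<open>Smoothness asks every iterated partial derivative, in any order of differentiation,
  to be (Frechet) differentiable everywhere.\<close>

definition smooth :: "(pt \<Rightarrow> real) \<Rightarrow> bool" where
  "smooth f \<longleftrightarrow> (\<forall>is::2 list. foldr partial is f differentiable_on UNIV)"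

definition test_function :: "pt set \<Rightarrow> (pt \<Rightarrow> real) \<Rightarrow> bool" where
  "test_function S \<phi> \<longleftrightarrow>
     smooth \<phi> \<and> compact (closure {x. \<phi> x \<noteq> 0}) \<and> closure {x. \<phi> x \<noteq> 0} \<subseteq> S"

type_synonym multi_index = "nat \<times> nat"

definition mi_order :: "multi_index \<Rightarrow> nat" where
  "mi_order \<alpha> = fst \<alpha> + snd \<alpha>"

definition mixed_deriv :: "multi_index \<Rightarrow> (pt \<Rightarrow> real) \<Rightarrow> pt \<Rightarrow> real" where
  "mixed_deriv \<alpha> f = (partial 1 ^^ fst \<alpha>) ((partial 2 ^^ snd \<alpha>) f)"

definition L2_on :: "pt set \<Rightarrow> (pt \<Rightarrow> real) \<Rightarrow> bool" where
  "L2_on S f \<longleftrightarrow>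
     f \<in> borel_measurable (lebesgue_on S) \<and> integrable (lebesgue_on S) (\<lambda>x. (f x)\<^sup>2)"

definition is_weak_deriv ::
    "pt set \<Rightarrow> multi_index \<Rightarrow> (pt \<Rightarrow> real) \<Rightarrow> (pt \<Rightarrow> real) \<Rightarrow> bool" where
  "is_weak_deriv S \<alpha> f g \<longleftrightarrow>
     (\<forall>\<phi>. test_function S \<phi> \<longrightarrow>
        integral\<^sup>L (lebesgue_on S) (\<lambda>x. f x * mixed_deriv \<alpha> \<phi> x) =
        (-1) ^ mi_order \<alpha> * integral\<^sup>L (lebesgue_on S) (\<lambda>x. g x * \<phi> x))"

text \<open>\<open>S\<close> is meant to be open.\<close>

definition sobolev :: "nat \<Rightarrow> pt set \<Rightarrow> (pt \<Rightarrow> real) \<Rightarrow> bool" where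
  "sobolev m S f \<longleftrightarrow>
     L2_on S f \<and> (\<forall>\<alpha>. mi_order \<alpha> \<le> m \<longrightarrow> (\<exists>g. L2_on S g \<and> is_weak_deriv S \<alpha> f g))"

text \<open>A weak derivative is unique up to a null set, so the choice does not affect the
  seminorm below. The seminorm is only meaningful for functions in the Sobolev space.\<close>

definition weak_deriv :: "pt set \<Rightarrow> multi_index \<Rightarrow> (pt \<Rightarrow> real) \<Rightarrow> pt \<Rightarrow> real" where
  "weak_deriv S \<alpha> f = (SOME g. L2_on S g \<and> is_weak_deriv S \<alpha> f g)"

definition sobolev_seminorm :: "nat \<Rightarrow> pt set \<Rightarrow> (pt \<Rightarrow> real) \<Rightarrow> real" where
  "sobolev_seminorm l S f =
     sqrt (\<Sum>\<alpha> | mi_order \<alpha> = l. integral\<^sup>L (lebesgue_on S) (\<lambda>x. (weak_deriv S \<alpha> f x)\<^sup>2))"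

text \<open>\<open>S\<close> is either open or a convex body; in both cases derivatives within \<open>S\<close> are unique.\<close>

definition C1_on :: "pt set \<Rightarrow> (pt \<Rightarrow> real) \<Rightarrow> bool" where
  "C1_on S f \<longleftrightarrow>
     (\<exists>g. continuous_on S g \<and> (\<forall>x\<in>S. (f has_derivative (\<lambda>h. g x \<bullet> h)) (at x within S)))"

definition P3_on :: "pt set \<Rightarrow> (pt \<Rightarrow> real) \<Rightarrow> bool" where
  "P3_on S f \<longleftrightarrow>
     (\<exists>c :: nat \<Rightarrow> nat \<Rightarrow> real. \<forall>x\<in>S. f x = (\<Sum>(i, j) | i + j \<le> 3. c i j * (x $ 1) ^ i * (x $ 2) ^ j))"

section \<open>Cells and triangulations\<close>

text \<open>The field \<open>verts\<close> holds the three vertices of the straight triangle defining the nodes;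
  \<open>region\<close> is the closed cell itself, which differs from that triangle when one side is
  curved; \<open>centre\<close> is the interior point used to split the cell into three.\<close>

record cell =
  region :: "pt set"
  verts :: "pt set"
  centre :: pt

abbreviation cell_interior :: "cell \<Rightarrow> pt set" where
  "cell_interior K \<equiv> interior (region K)"

definition triangle :: "cell \<Rightarrow> pt set" where
  "triangle K = convex hull (verts K)"

text \<open>A side is encoded by its pair of end points; the segment itself is its convex hull.\<close>

definition sides :: "cell \<Rightarrow> pt set set" where
  "sides K = {e. e \<subseteq> verts K \<and> card e = 2}"

text \<open>The part of the cell seen from the centre through the side \<open>e\<close>. For a straight cell it
  is the triangle spanned by the centre and \<open>e\<close>; for a curved side it extends up to the curve.\<close>

definition subcell :: "cell \<Rightarrow> pt set \<Rightarrow> pt set" where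
  "subcell K e =
     {x \<in> region K. \<exists>s. (\<forall>v\<in>e. 0 \<le> s v) \<and> x = centre K + (\<Sum>v\<in>e. s v *\<^sub>R (v - centre K))}"

text \<open>In the curved case, two sides of the cell are straight and the rest of its boundary
  (the curve replacing the chord \<open>e\<close>) lies on the boundary of \<open>\<Omega>\<close>. Convex sets with nonempty
  interior are automatically Lipschitz.\<close>

definition is_cell :: "pt set \<Rightarrow> cell \<Rightarrow> bool" where
  "is_cell \<Omega> K \<longleftrightarrow>
     card (verts K) = 3 \<and> \<not> affine_dependent (verts K) \<and>
     centre K \<in> interior (triangle K) \<and>
     (region K = triangle K \<or>
      compact (region K) \<and> convex (region K) \<and> triangle K \<subseteq> region K \<and>
      (\<exists>e\<in>sides K.
         (\<forall>f\<in>sides K - {e}. convex hull f \<subseteq> frontier (region K)) \<and>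
         frontier (region K) - (\<Union>f\<in>sides K - {e}. convex hull f) \<subseteq> frontier \<Omega>))"

definition adjacent :: "cell \<Rightarrow> cell \<Rightarrow> bool" where
  "adjacent K L \<longleftrightarrow> K \<noteq> L \<and> card (verts K \<inter> verts L) = 2"

text \<open>Two distinct cells meet in nothing, a common vertex, or a common straight side. Taking
  \<open>\<Omega>\<close> to be the interior of the union excludes slits. The last condition excludes pinch points:
  the cells around a vertex form a chain of neighbours, which always holds if \<open>\<Omega>\<close> is a Lipschitz
  domain. Without it a function in \<open>C\<^sup>1(\<Omega>)\<close> could have two different limits at a boundary
  vertex.\<close>

definition hct_triangulation :: "pt set \<Rightarrow> cell set \<Rightarrow> bool" where
  "hct_triangulation \<Omega> \<T> \<longleftrightarrow>
     finite \<T> \<and> (\<forall>K\<in>\<T>. is_cell \<Omega> K) \<and>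
     \<Omega> = interior (\<Union>K\<in>\<T>. region K) \<and>
     (\<forall>K\<in>\<T>. \<forall>L\<in>\<T>. K \<noteq> L \<longrightarrow>
        cell_interior K \<inter> cell_interior L = {} \<and> region K \<inter> region L = convex hull (verts K \<inter> verts L)) \<and>
     (\<forall>a. \<forall>K\<in>\<T>. \<forall>L\<in>\<T>. a \<in> verts K \<and> a \<in> verts L \<longrightarrow>
        (K, L) \<in> {(K', L'). K' \<in> \<T> \<and> L' \<in> \<T> \<and> a \<in> verts K' \<inter> verts L' \<and> adjacent K' L'}\<^sup>*)"

definition patch :: "cell set \<Rightarrow> cell \<Rightarrow> cell set" where
  "patch \<T> K = {L\<in>\<T>. verts L \<inter> verts K \<noteq> {}}"

definition min_angle_ge :: "real \<Rightarrow> pt set \<Rightarrow> bool" where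
  "min_angle_ge \<theta> V \<longleftrightarrow>
     (\<forall>a\<in>V. \<forall>b\<in>V. \<forall>c\<in>V. a \<noteq> b \<and> b \<noteq> c \<and> a \<noteq> c \<longrightarrow>
        \<theta> \<le> arccos (((a - b) \<bullet> (c - b)) / (norm (a - b) * norm (c - b))))"

text \<open>Sets of vanishing one-dimensional Hausdorff measure, i.e. negligible sets for arc length.\<close>

definition arclength_null :: "pt set \<Rightarrow> bool" where
  "arclength_null N \<longleftrightarrow>
     (\<forall>\<epsilon>>0. \<exists>A :: nat \<Rightarrow> pt set. N \<subseteq> (\<Union>n. A n) \<and> (\<forall>n. bounded (A n)) \<and>
        summable (\<lambda>n. diameter (A n)) \<and> (\<Sum>n. diameter (A n)) < \<epsilon>)"

text \<open>\<open>K\<close> is tangent at \<open>x\<close> to the half-plane with outer unit normal \<open>\<nu>\<close>.\<close>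

definition outward_normal :: "pt set \<Rightarrow> pt \<Rightarrow> pt \<Rightarrow> bool" where
  "outward_normal K x \<nu> \<longleftrightarrow> norm \<nu> = 1 \<and>
     (\<forall>\<epsilon>>0. \<exists>\<delta>>0. \<forall>y\<in>ball x \<delta>.
        (y \<in> K \<longrightarrow> \<nu> \<bullet> (y - x) \<le> \<epsilon> * norm (y - x)) \<and>
        (y \<notin> K \<longrightarrow> \<nu> \<bullet> (y - x) \<ge> - \<epsilon> * norm (y - x)))"

definition star_set :: "pt set \<Rightarrow> pt set" where
  "star_set K = {p\<in>K. \<forall>x\<in>K. closed_segment p x \<subseteq> K}"

definition starlike_cell :: "real \<Rightarrow> pt set \<Rightarrow> bool" where
  "starlike_cell c\<^sub>0 K \<longleftrightarrow>
     star_set K \<in> sets lebesgue \<and> emeasure lebesgue (star_set K) > 0 \<and>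
     (\<exists>p\<in>star_set K. \<exists>N. arclength_null N \<and>
        (\<forall>x\<in>frontier K - N. \<exists>\<nu>. outward_normal K x \<nu> \<and> (x - p) \<bullet> \<nu> \<ge> c\<^sub>0 * diameter K))"

text \<open>Shape-regularity concerns the triangle of each cell and the three triangles into which it
  is split; the triangle contained in a curved cell is of size comparable to the cell. The final
  clause is local quasi-uniformity.\<close>

definition regular_mesh :: "real \<Rightarrow> real \<Rightarrow> real \<Rightarrow> cell set \<Rightarrow> bool" where
  "regular_mesh \<theta> \<kappa> c\<^sub>0 \<T> \<longleftrightarrow>
     (\<forall>K\<in>\<T>. min_angle_ge \<theta> (verts K) \<and>
        (\<forall>e\<in>sides K. min_angle_ge \<theta> (insert (centre K) e)) \<and>
        diameter (region K) \<le> \<kappa> * diameter (triangle K) \<and>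
        starlike_cell c\<^sub>0 (region K)) \<and>
     (\<forall>K\<in>\<T>. \<forall>L\<in>\<T>. adjacent K L \<longrightarrow> diameter (region K) \<le> \<kappa> * diameter (region L))"

section \<open>The HCT element\<close>

text \<open>Elements of the local space are functions on the whole plane of which only the values on
  the cell matter.\<close>

definition HCT :: "cell \<Rightarrow> (pt \<Rightarrow> real) set" where
  "HCT K = {p. C1_on (region K) p \<and> (\<forall>e\<in>sides K. P3_on (subcell K e) p)}"

datatype dof = Val pt | Deriv 2 pt | Normal "pt set"

definition dofs :: "cell \<Rightarrow> dof set" where
  "dofs K = Val ` verts K \<union> {Deriv i a | i a. a \<in> verts K} \<union> Normal ` sides K"

definition midpt :: "pt set \<Rightarrow> pt" where
  "midpt e = (1/2) *\<^sub>R (\<Sum>v\<in>e. v)"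

text \<open>The normal is chosen from the side alone, hence is common to the cells sharing it.\<close>

definition side_normal :: "pt set \<Rightarrow> pt" where
  "side_normal e = (SOME \<nu>. norm \<nu> = 1 \<and> (\<forall>x\<in>e. \<forall>y\<in>e. \<nu> \<bullet> (x - y) = 0))"

fun dof_value :: "cell \<Rightarrow> (pt \<Rightarrow> real) \<Rightarrow> dof \<Rightarrow> real" where
  "dof_value K f (Val a) = f a"
| "dof_value K f (Deriv i a) = frechet_derivative f (at a within region K) (axis i 1)"
| "dof_value K f (Normal e) =
     frechet_derivative f (at (midpt e) within region K) (side_normal e)"

definition dual_basis_fun :: "cell \<Rightarrow> dof \<Rightarrow> (pt \<Rightarrow> real) \<Rightarrow> bool" where
  "dual_basis_fun K d p \<longleftrightarrow>
     p \<in> HCT K \<and> (\<forall>d'\<in>dofs K. dof_value K p d' = (if d' = d then 1 else 0))"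

text \<open>The sum of local basis functions over the cells containing a node is rendered by gluing:
  the global function restricts to the local one on each such cell and vanishes on the others. A
  literal sum of extensions by zero would count the values on shared sides twice.\<close>

definition global_basis_fun :: "cell set \<Rightarrow> dof \<Rightarrow> (pt \<Rightarrow> real) \<Rightarrow> bool" where
  "global_basis_fun \<T> d \<phi> \<longleftrightarrow>
     (\<forall>K\<in>\<T>. if d \<in> dofs K then dual_basis_fun K d \<phi> else (\<forall>x\<in>region K. \<phi> x = 0)) \<and>
     (\<forall>x. x \<notin> (\<Union>K\<in>\<T>. region K) \<longrightarrow> \<phi> x = 0)"

definition global_dofs :: "cell set \<Rightarrow> dof set" where
  "global_dofs \<T> = (\<Union>K\<in>\<T>. dofs K)"

definition HCT_global :: "cell set \<Rightarrow> (pt \<Rightarrow> real) set" where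
  "HCT_global \<T> =
     {(\<lambda>x. \<Sum>d\<in>global_dofs \<T>. c d * \<Phi> d x) | c \<Phi>. \<forall>d\<in>global_dofs \<T>. global_basis_fun \<T> d (\<Phi> d)}"

section \<open>Broken spaces and seminorms\<close>

definition broken_sobolev :: "nat \<Rightarrow> cell set \<Rightarrow> (pt \<Rightarrow> real) \<Rightarrow> bool" where
  "broken_sobolev m \<T> f \<longleftrightarrow> (\<forall>K\<in>\<T>. sobolev m (cell_interior K) f)"

definition patch_seminorm :: "nat \<Rightarrow> cell set \<Rightarrow> cell \<Rightarrow> (pt \<Rightarrow> real) \<Rightarrow> real" where
  "patch_seminorm l \<T> K f = sqrt (\<Sum>L\<in>patch \<T> K. (sobolev_seminorm l (cell_interior L) f)\<^sup>2)"

definition patch_size :: "cell set \<Rightarrow> cell \<Rightarrow> real" where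
  "patch_size \<T> K = (MAX L\<in>patch \<T> K. diameter (region L))"

text \<open>HCT functions are in general only in \<open>H\<^sup>2\<close> of a cell. For orders 3 and 4 membership and
  seminorm are therefore taken piecewise on the three subcells, where they are polynomials.\<close>

definition cell_sobolev :: "nat \<Rightarrow> cell \<Rightarrow> (pt \<Rightarrow> real) \<Rightarrow> bool" where
  "cell_sobolev l K f \<longleftrightarrow>
     (if l \<le> 2 then sobolev l (cell_interior K) f
      else \<forall>e\<in>sides K. sobolev l (interior (subcell K e)) f)"

definition cell_seminorm :: "nat \<Rightarrow> cell \<Rightarrow> (pt \<Rightarrow> real) \<Rightarrow> real" where
  "cell_seminorm l K f =
     (if l \<le> 2 then sobolev_seminorm l (cell_interior K) f
      else sqrt (\<Sum>e\<in>sides K. (sobolev_seminorm l (interior (subcell K e)) f)\<^sup>2))"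

end

theory Submission
  imports Defs "HOL-Computational_Algebra.Polynomial"
begin

text \<open>The interpolant of \<open>u\<close> is the element of the global HCT space whose degrees of freedom are the limits
  of \<open>u\<close> and \<open>\<nabla>u\<close> at the nodes, taken from inside a cell. The estimate is then local to each cell \<open>K\<close> of
  diameter \<open>h\<close>: for a cubic polynomial \<open>q\<close>,
    \<open>u - \<chi> = (u - q) - (\<chi> - q)\<close>  on \<open>K\<close>,
  and both terms are controlled by \<open>E = |u|\<^sub>4\<^sub>,\<^sub>K\<^sup>2\<close>.

  For the first term \<open>q\<close> is chosen such that all derivatives of \<open>u - q\<close> up to order three have mean zero. The
  Poincare inequality on the convex cell, applied repeatedly, bounds the \<open>L\<^sup>2\<close> norms of the derivatives of
  \<open>u - q\<close>, and a Sobolev inequality turns this into pointwise bounds of \<open>u - q\<close> by \<open>h\<^sup>3 \<surd>E\<close> and of its gradient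
  by \<open>h\<^sup>2 \<surd>E\<close> (\<open>cubic_approximation\<close>). Both inequalities are proved for smooth functions by integration along
  segments and transferred by mollification. They show moreover that \<open>u\<close> and its gradient are Lipschitz in the
  interior of \<open>K\<close>, so that the limits at the nodes exist (\<open>cell_extension\<close>).

  For the second term, the HCT function with given degrees of freedom is written down explicitly in terms of the
  barycentric coordinates of the splitting point (locale \<open>hct_data\<close>). It depends linearly on the data and
  reproduces cubics (\<open>hct_reproduces_cubics\<close>), so \<open>\<chi> - q\<close> is the HCT function with the nodal values of \<open>u - q\<close>,
  which have just been bounded. Shape regularity bounds the coordinate functions by multiples of \<open>1/h\<close>, and a
  direct scaling argument gives pointwise bounds for all derivatives up to order four
  (\<open>interpolation_error\<close>).

  Two points are global. On a side, an HCT function is the cubic Hermite interpolant of its end data, so local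
  functions with common degrees of freedom fit together (\<open>nodal_interpolant_global\<close>). And different cells must see
  the same limits of \<open>u\<close>: the relative interior of a common side lies in \<open>\<Omega>\<close>, because the third vertices lie on
  opposite sides of it, so two adjacent cells agree there and, in the limit, at the end points; chains of
  adjacent cells connect all cells around a vertex (\<open>nodal_values\<close>).

  Finally, HCT functions are \<open>C\<^sup>1\<close> and piecewise cubic, whence their second derivatives, taken piecewise, are weak
  derivatives on the cell (\<open>hct_weak_family\<close>); beyond order two the estimate is made on each subcell.\<close>

section \<open>Mollifiers\<close>

text \<open>Functions of the form \<open>p(1/t) exp(-1/t)\<close> for \<open>t > 0\<close>, extended by zero, form a class that is closed under
  differentiation.\<close>

definition flat :: "real poly \<Rightarrow> real \<Rightarrow> real" where
  "flat p t = (if t > 0 then poly p (1/t) * exp (-(1/t)) else 0)"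

definition flat_step :: "real poly \<Rightarrow> real poly" where
  "flat_step p = (p - pderiv p) * [:0, 0, 1:]"

lemma poly_times_exp_tendsto_0:
  "((\<lambda>y. y ^ k * poly p y * exp (- y)) \<longlongrightarrow> (0::real)) at_top"
proof (induction p arbitrary: k)
  case 0
  then show ?case by simp
next
  case (pCons a p)
  have "((\<lambda>y. a * (y ^ k / exp y) + y ^ Suc k * poly p y * exp (- y)) \<longlongrightarrow> a * 0 + 0) at_top"
    by (intro tendsto_intros tendsto_power_div_exp_0 pCons.IH)
  then show ?case
    by (simp add: algebra_simps exp_minus divide_inverse)
qed

lemma flat_has_derivative:
  "(flat p has_real_derivative flat (flat_step p) t) (at t)"
proof -
  consider "t > 0" | "t < 0" | "t = 0" by linarith
  then show ?thesis
  proof cases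
    case 1
    have "((\<lambda>t. poly p (1/t) * exp (-(1/t))) has_real_derivative flat (flat_step p) t) (at t)"
      using 1 by (auto intro!: derivative_eq_intros DERIV_chain2[OF poly_DERIV]
          simp: flat_def flat_step_def field_simps power2_eq_square)
    then show ?thesis
      apply (rule has_field_derivative_transform_within_open[where S = "{0<..}"])
      using 1 by (auto simp: flat_def)
  next
    case 2
    have "((\<lambda>t. 0) has_real_derivative flat (flat_step p) t) (at t)"
      using 2 by (auto simp: flat_def)
    then show ?thesis
      apply (rule has_field_derivative_transform_within_open[where S = "{..<0}"])
      using 2 by (auto simp: flat_def)
  next
    case 3
    have "((\<lambda>y. y ^ 1 * poly p y * exp (- y)) \<longlongrightarrow> 0) at_top"
      by (rule poly_times_exp_tendsto_0)
    then have "((\<lambda>h. inverse h ^ 1 * poly p (inverse h) * exp (- inverse h)) \<longlongrightarrow> 0) (at_right 0)"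
      by (rule filterlim_compose[OF _ filterlim_inverse_at_top_right])
    then have r: "((\<lambda>h. flat p h / h) \<longlongrightarrow> 0) (at_right 0)"
      by (rule Lim_transform_eventually)
        (auto simp: flat_def eventually_at_right_less divide_inverse mult_ac intro!: eventually_mono[OF eventually_at_right_less])
    have l: "((\<lambda>h. flat p h / h) \<longlongrightarrow> 0) (at_left 0)"
      by (rule Lim_transform_eventually[OF tendsto_const])
        (auto simp: flat_def eventually_at_filter)
    show ?thesis
      using filterlim_split_at[OF l r] 3
      by (simp add: has_field_derivative_iff flat_def)
  qed
qed

text \<open>A sum of products of a function of \<open>e + t\<close> with one of \<open>e - t\<close>; this form is stable under
  differentiation by the product rule alone.\<close>

definition bump :: "real \<Rightarrow> (real poly \<times> real poly) list \<Rightarrow> real \<Rightarrow> real" where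
  "bump e ps t = (\<Sum>(p, q) \<leftarrow> ps. flat p (e + t) * flat q (e - t))"

definition bump_step :: "(real poly \<times> real poly) list \<Rightarrow> (real poly \<times> real poly) list" where
  "bump_step ps = concat (map (\<lambda>(p, q). [(flat_step p, q), (p, - flat_step q)]) ps)"

lemma flat_uminus: "flat (- p) t = - flat p t"
  by (simp add: flat_def)

lemma bump_has_derivative:
  "(bump e ps has_real_derivative bump e (bump_step ps) t) (at t)"
proof (induction ps)
  case Nil
  then show ?case by (simp add: bump_def[abs_def] bump_step_def)
next
  case (Cons a ps)
  obtain p q where a: "a = (p, q)" by force
  have *: "bump e (a # ps) = (\<lambda>t. flat p (e + t) * flat q (e - t) + bump e ps t)"
    by (auto simp: bump_def a)
  have "((\<lambda>t. flat p (e + t) * flat q (e - t) + bump e ps t) has_real_derivative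
      (flat (flat_step p) (e + t) * 1) * flat q (e - t) + (flat (flat_step q) (e - t) * (-1)) * flat p (e + t)
        + bump e (bump_step ps) t) (at t)"
    apply (intro DERIV_add DERIV_mult DERIV_chain2[OF flat_has_derivative] Cons.IH)
    by (auto intro!: derivative_eq_intros)
  then show ?case
    unfolding * by (simp add: bump_def bump_step_def a flat_uminus algebra_simps)
qed

lemma ex_smooth_bump:
  assumes "e > 0"
  shows "\<exists>b::nat \<Rightarrow> real \<Rightarrow> real. (\<forall>k t. (b k has_real_derivative b (Suc k) t) (at t)) \<and>
     (\<forall>k t. \<bar>t\<bar> \<ge> e \<longrightarrow> b k t = 0) \<and> (\<forall>t. b 0 t \<ge> 0) \<and> b 0 0 > 0"
proof -
  define b where "b k = bump e ((bump_step ^^ k) [(1, 1)])" for k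
  have "bump e ps t = 0" if "\<bar>t\<bar> \<ge> e" for ps t
    using that assms by (induction ps) (auto simp: bump_def flat_def)
  moreover have "b 0 t \<ge> 0" for t by (simp add: b_def bump_def flat_def)
  moreover have "b 0 0 > 0" using assms by (simp add: b_def bump_def flat_def)
  ultimately show ?thesis
    using bump_has_derivative by (intro exI[of _ b]) (simp add: b_def)
qed

abbreviation sqnorm :: "(pt \<Rightarrow> real) \<Rightarrow> real" where "sqnorm f \<equiv> \<integral>x. (f x)\<^sup>2 \<partial>lborel"
abbreviation square_integrable :: "(pt \<Rightarrow> real) \<Rightarrow> bool" where "square_integrable f \<equiv> integrable lborel (\<lambda>x. (f x)\<^sup>2)"

lemma norm_real2_le: "norm (x::pt) \<le> \<bar>x $ 1\<bar> + \<bar>x $ 2\<bar>"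
  using norm_le_l1_cart[of x] by (simp add: sum_2)

lemma nth_has_derivative: "((\<lambda>x::pt. x $ i) has_derivative (\<lambda>h. h $ i)) (at x within S)"
  by (rule bounded_linear_imp_has_derivative) (rule bounded_linear_vec_nth)

lemma integrable_continuous_compact_support:
  fixes f :: "pt \<Rightarrow> real"
  assumes "continuous_on UNIV f" and "\<And>x. norm x \<ge> R \<Longrightarrow> f x = 0"
  shows "integrable lborel f"
proof -
  have "integrable lborel (\<lambda>x. indicator (cball 0 R) x *\<^sub>R f x)"
    by (rule borel_integrable_compact) (auto intro: continuous_on_subset[OF assms(1)])
  moreover have "(\<lambda>x. indicator (cball 0 R) x *\<^sub>R f x) = f"
    using assms(2) by (fastforce simp: indicator_def)
  ultimately show ?thesis by simp
qed

text \<open>All that is used of a mollifier of radius \<open>e\<close>: a family indexed by the order of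
  differentiation, with support in a ball, whose member of order zero is a probability density.\<close>

definition mollifier :: "real \<Rightarrow> (nat \<Rightarrow> nat \<Rightarrow> pt \<Rightarrow> real) \<Rightarrow> bool" where
  "mollifier e \<eta> \<longleftrightarrow>
     (\<forall>i j x. (\<eta> i j has_derivative (\<lambda>h. \<eta> (Suc i) j x * h $ 1 + \<eta> i (Suc j) x * h $ 2)) (at x)) \<and>
     (\<forall>i j x. norm x \<ge> e \<longrightarrow> \<eta> i j x = 0) \<and> (\<forall>x. \<eta> 0 0 x \<ge> 0) \<and> integral\<^sup>L lborel (\<eta> 0 0) = 1"

text \<open>A normalised product of two one-dimensional bumps supported in \<open>[-e/2, e/2]\<close>.\<close>

lemma ex_mollifier:
  assumes "e > 0"
  shows "\<exists>\<eta>. mollifier e \<eta>"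
proof -
  obtain b :: "nat \<Rightarrow> real \<Rightarrow> real" where b: "\<And>k t. (b k has_real_derivative b (Suc k) t) (at t)"
    "\<And>k t. \<bar>t\<bar> \<ge> e/2 \<Longrightarrow> b k t = 0" "\<And>t. b 0 t \<ge> 0" "b 0 0 > 0"
    using ex_smooth_bump[of "e/2"] assms by auto
  define f where "f i j x = b i (x $ 1) * b j (x $ 2)" for i j and x :: pt
  have df: "(f i j has_derivative (\<lambda>h. f (Suc i) j x * h $ 1 + f i (Suc j) x * h $ 2)) (at x)" for i j x
    unfolding f_def
    by (rule has_derivative_eq_rhs[OF has_derivative_mult[OF
          has_derivative_compose[OF nth_has_derivative] has_derivative_compose[OF nth_has_derivative]]])
      (use b(1) in \<open>auto simp: has_field_derivative_def algebra_simps fun_eq_iff\<close>)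
  have sf: "f i j x = 0" if "norm x \<ge> e" for i j x
  proof -
    have "\<bar>x $ 1\<bar> \<ge> e/2 \<or> \<bar>x $ 2\<bar> \<ge> e/2" using norm_real2_le[of x] that by linarith
    then show ?thesis using b(2) by (auto simp: f_def)
  qed
  have cont: "continuous_on UNIV (f 0 0)"
    by (meson df has_derivative_continuous continuous_at_imp_continuous_on)
  have int: "integrable lborel (f 0 0)"
    by (rule integrable_continuous_compact_support[OF cont sf])
  have f0: "f 0 0 0 > 0" using b(4) by (simp add: f_def)
  have fnn: "f 0 0 x \<ge> 0" for x using b(3) by (simp add: f_def)
  have "integral\<^sup>L lborel (f 0 0) \<noteq> 0"
  proof
    assume "integral\<^sup>L lborel (f 0 0) = 0"
    then have "AE x in lborel. f 0 0 x = 0"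
      using integral_nonneg_eq_0_iff_AE[OF int] fnn by simp
    then have "AE x in lebesgue. f 0 0 x = 0" by (rule AE_completion)
    then have "negligible {x. f 0 0 x \<noteq> 0}"
      by (simp add: eventually_ae_filter_negligible) (metis (no_types, lifting) mem_Collect_eq negligible_subset subset_iff)
    moreover have "open {x. f 0 0 x \<noteq> 0}"
      using cont by (simp add: open_Collect_neq)
    ultimately have "{x. f 0 0 x \<noteq> 0} = {}" using open_not_negligible by blast
    then show False using f0 by simp
  qed
  then have pos: "integral\<^sup>L lborel (f 0 0) > 0"
    using integral_nonneg_AE[of "f 0 0" lborel] fnn by (simp add: order_less_le)
  define c where "c = 1 / integral\<^sup>L lborel (f 0 0)"
  have "((\<lambda>x. c * f i j x) has_derivative
      (\<lambda>h. c * f (Suc i) j x * h $ 1 + c * f i (Suc j) x * h $ 2)) (at x)" for i j x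
    using has_derivative_mult_right[OF df, of c] by (simp add: algebra_simps)
  then have "mollifier e (\<lambda>i j x. c * f i j x)"
    unfolding mollifier_def using sf fnn pos c_def by auto
  then show ?thesis by blast
qed

section \<open>Test functions and weak derivatives in terms of Borel functions\<close>

lemma integral_lebesgue_on_eq_lborel:
  fixes F F' :: "pt \<Rightarrow> real"
  assumes S: "S \<in> sets borel" and F: "F \<in> borel_measurable (lebesgue_on S)"
    and F': "F' \<in> borel_measurable borel" and ae: "AE x in lborel. x \<in> S \<longrightarrow> F x = F' x"
  shows "integral\<^sup>L (lebesgue_on S) F = (\<integral>x. indicator S x * F' x \<partial>lborel)"
    and "integrable (lebesgue_on S) F \<longleftrightarrow> integrable lborel (\<lambda>x. indicator S x * F' x)"
proof -
  have Sl: "S \<inter> space lebesgue \<in> sets lebesgue" using S by simp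
  have m1: "(\<lambda>x. indicator S x *\<^sub>R F x) \<in> borel_measurable lebesgue"
    using F borel_measurable_restrict_space_iff[OF Sl] by blast
  have m2': "(\<lambda>x. indicator S x * F' x) \<in> borel_measurable lborel"
    using S F' by simp
  then have m2: "(\<lambda>x. indicator S x * F' x) \<in> borel_measurable lebesgue"
    by (rule measurable_completion)
  have ae': "AE x in lebesgue. indicator S x *\<^sub>R F x = indicator S x * F' x"
    using AE_completion[OF ae] by eventually_elim (auto simp: indicator_def)
  show "integral\<^sup>L (lebesgue_on S) F = (\<integral>x. indicator S x * F' x \<partial>lborel)"
    using integral_cong_AE[OF m1 m2 ae'] integral_completion[OF m2']
    by (simp add: integral_restrict_space[OF Sl])
  show "integrable (lebesgue_on S) F \<longleftrightarrow> integrable lborel (\<lambda>x. indicator S x * F' x)"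
    using integrable_cong_AE[OF m1 m2 ae'] integrable_completion[OF m2']
    by (simp add: integrable_restrict_space[OF Sl])
qed

text \<open>Borel representatives on the whole plane make Fubini and affine substitutions for \<open>lborel\<close> available.\<close>

lemma ex_borel_representative:
  fixes f :: "pt \<Rightarrow> real"
  assumes S: "S \<in> sets borel" and f: "f \<in> borel_measurable (lebesgue_on S)"
  shows "\<exists>f'\<in>borel_measurable borel. (\<forall>x. x \<notin> S \<longrightarrow> f' x = 0) \<and> (AE x in lborel. x \<in> S \<longrightarrow> f x = f' x)"
proof -
  have Sl: "S \<inter> space lebesgue \<in> sets lebesgue" using S by simp
  have "(\<lambda>x. indicator S x *\<^sub>R f x) \<in> borel_measurable lebesgue"
    using f borel_measurable_restrict_space_iff[OF Sl] by blast
  from completion_ex_borel_measurable_real[OF this]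
  obtain g where g: "g \<in> borel_measurable lborel" "AE x in lborel. indicator S x *\<^sub>R f x = g x" by blast
  then have "(\<lambda>x. indicator S x * g x) \<in> borel_measurable borel" using S by simp
  moreover have "AE x in lborel. x \<in> S \<longrightarrow> f x = indicator S x * g x"
    using g(2) by eventually_elim (auto simp: indicator_def)
  ultimately show ?thesis by (intro bexI[of _ "\<lambda>x. indicator S x * g x"]) auto
qed

lemma borel_imp_measurable_lebesgue_on:
  assumes "f \<in> borel_measurable (borel::pt measure)"
  shows "f \<in> borel_measurable (lebesgue_on S)"
  using assms by (intro measurable_restrict_space1 measurable_completion) simp

lemma smooth_differentiable:
  assumes "smooth \<phi>" shows "\<phi> differentiable (at x)"
  using assms[unfolded smooth_def, rule_format, of "[]"] by (simp add: differentiable_on_def)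

lemma smooth_partial:
  assumes "smooth \<phi>" shows "smooth (partial i \<phi>)"
  unfolding smooth_def
proof
  fix js :: "2 list"
  show "foldr partial js (partial i \<phi>) differentiable_on UNIV"
    using assms[unfolded smooth_def, rule_format, of "js @ [i]"] by simp
qed

lemma axis_expand: "(h::pt) = h $ 1 *\<^sub>R axis 1 1 + h $ 2 *\<^sub>R axis 2 1"
  by (simp add: vec_eq_iff forall_2 axis_def)

lemma has_derivative_partials:
  assumes "f differentiable (at x)"
  shows "(f has_derivative (\<lambda>h. partial 1 f x * h $ 1 + partial 2 f x * h $ 2)) (at x)"
proof -
  have d: "(f has_derivative frechet_derivative f (at x)) (at x)"
    using assms frechet_derivative_works by blast
  then have l: "linear (frechet_derivative f (at x))" by (rule has_derivative_linear)
  have "frechet_derivative f (at x) h = partial 1 f x * h $ 1 + partial 2 f x * h $ 2" for h :: pt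
    using l[THEN linear_add, of "h $ 1 *\<^sub>R axis 1 1" "h $ 2 *\<^sub>R axis 2 1"]
      l[THEN linear_scale, of "h $ 1" "axis 1 1"] l[THEN linear_scale, of "h $ 2" "axis 2 1"]
    by (simp add: partial_def mult.commute axis_expand[symmetric])
  then have "frechet_derivative f (at x) = (\<lambda>h. partial 1 f x * h $ 1 + partial 2 f x * h $ 2)"
    by blast
  with d show ?thesis by simp
qed

lemma partial_eq:
  assumes "(f has_derivative (\<lambda>h. a * h $ 1 + b * h $ 2)) (at x)"
  shows "partial 1 f x = a" "partial 2 f x = b"
  using frechet_derivative_at[OF assms, symmetric] by (simp_all add: partial_def axis_def)

lemma smooth_has_derivative:
  assumes "smooth f"
  shows "(f has_derivative (\<lambda>h. partial 1 f x * h $ 1 + partial 2 f x * h $ 2)) (at x)"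
  using has_derivative_partials smooth_differentiable assms by blast

lemma smooth_continuous: "smooth f \<Longrightarrow> continuous_on UNIV f"
  by (meson smooth_has_derivative has_derivative_continuous continuous_at_imp_continuous_on)

lemma partial_zero_outside_support:
  assumes "x \<notin> closure {x. \<phi> x \<noteq> 0}"
  shows "partial i \<phi> x = 0"
proof -
  have "(\<phi> has_derivative (\<lambda>h. 0)) (at x)"
    apply (rule has_derivative_transform_within_open[of "\<lambda>x. 0" _ _ _ "- closure {x. \<phi> x \<noteq> 0}"])
    using assms closure_subset[of "{x. \<phi> x \<noteq> 0}"] by auto
  from frechet_derivative_at[OF this, symmetric] show ?thesis
    by (simp add: partial_def)
qed

lemma test_function_partial:
  assumes "test_function S \<phi>"
  shows "test_function S (partial i \<phi>)"
proof -
  have "{x. partial i \<phi> x \<noteq> 0} \<subseteq> closure {x. \<phi> x \<noteq> 0}"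
    using partial_zero_outside_support by blast
  then have "closure {x. partial i \<phi> x \<noteq> 0} \<subseteq> closure {x. \<phi> x \<noteq> 0}"
    by (simp add: closure_minimal)
  with assms show ?thesis
    unfolding test_function_def
    by (meson closed_closure closure_closure compact_eq_bounded_closed bounded_subset smooth_partial subset_trans)
qed

lemma test_function_partial_power:
  assumes "test_function S \<phi>"
  shows "test_function S ((partial i ^^ n) \<phi>)"
  using assms by (induction n) (auto intro: test_function_partial)

lemma test_function_mixed_deriv:
  assumes "test_function S \<phi>"
  shows "test_function S (mixed_deriv \<alpha> \<phi>)"
  unfolding mixed_deriv_def by (intro test_function_partial_power assms)

lemma test_function_continuous: "test_function S \<phi> \<Longrightarrow> continuous_on UNIV \<phi>"
  by (simp add: test_function_def smooth_continuous)

lemma test_function_zero: "test_function S \<phi> \<Longrightarrow> x \<notin> S \<Longrightarrow> \<phi> x = 0"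
  using closure_subset[of "{x. \<phi> x \<noteq> 0}"] by (auto simp: test_function_def)

lemma indicator_times_test:
  fixes f :: "pt \<Rightarrow> real"
  assumes "test_function S \<psi>"
  shows "(\<integral>x. indicator S x * f x * \<psi> x \<partial>lborel) = (\<integral>x. f x * \<psi> x \<partial>lborel)"
proof -
  have "(\<lambda>x. indicator S x * f x * \<psi> x) = (\<lambda>x. f x * \<psi> x)"
    using test_function_zero[OF assms] by (auto simp: fun_eq_iff indicator_def)
  then show ?thesis by (simp only:)
qed

lemma test_function_mono: "test_function S \<phi> \<Longrightarrow> S \<subseteq> T \<Longrightarrow> test_function T \<phi>"
  by (auto simp: test_function_def)

lemma test_function_support:
  assumes "test_function S \<phi>"
  obtains R where "R > 0" "\<And>x. norm x \<ge> R \<Longrightarrow> \<phi> x = 0"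
proof -
  have "bounded (closure {x. \<phi> x \<noteq> 0})" using assms by (simp add: test_function_def compact_imp_bounded)
  then obtain R where R: "\<And>x. x \<in> closure {x. \<phi> x \<noteq> 0} \<Longrightarrow> norm x \<le> R" by (auto simp: bounded_iff)
  show ?thesis
  proof (rule that[of "\<bar>R\<bar> + 1"])
    fix x :: pt assume "\<bar>R\<bar> + 1 \<le> norm x"
    then have "x \<notin> closure {x. \<phi> x \<noteq> 0}" using R[of x] by linarith
    then show "\<phi> x = 0" using closure_subset[of "{x. \<phi> x \<noteq> 0}"] by blast
  qed simp
qed

lemma compact_support_bounded:
  fixes f :: "pt \<Rightarrow> real"
  assumes c: "continuous_on UNIV f" and z: "\<And>x. norm x \<ge> R \<Longrightarrow> f x = 0"
  obtains B where "B > 0" "\<And>x. \<bar>f x\<bar> \<le> B"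
proof -
  have "compact (f ` cball 0 R)"
    by (intro compact_continuous_image continuous_on_subset[OF c]) auto
  then obtain B where B: "\<And>x. x \<in> cball 0 R \<Longrightarrow> \<bar>f x\<bar> \<le> B"
    using compact_imp_bounded bounded_iff by (metis image_eqI real_norm_def)
  have "\<bar>f x\<bar> \<le> max B 1" for x
    using B[of x] z[of x] by (cases "norm x \<le> R") auto
  then show ?thesis using that[of "max B 1"] by auto
qed

lemma integrable_mult_bounded_continuous:
  fixes f k :: "pt \<Rightarrow> real"
  assumes f: "integrable lborel f" and k: "continuous_on UNIV k" "\<And>x. \<bar>k x\<bar> \<le> B"
  shows "integrable lborel (\<lambda>x. f x * k x)"
proof (rule Bochner_Integration.integrable_bound)
  show "integrable lborel (\<lambda>x. B * \<bar>f x\<bar>)" using f by simp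
  show "(\<lambda>x. f x * k x) \<in> borel_measurable lborel"
    using f k(1) borel_measurable_continuous_onI[of k] by auto
  have "B \<ge> 0" using k(2)[of undefined] by linarith
  then show "AE x in lborel. norm (f x * k x) \<le> norm (B * \<bar>f x\<bar>)"
    using k(2) by (intro AE_I2) (simp add: abs_mult mult.commute[of "\<bar>f _\<bar>"] mult_right_mono)
qed

lemma integrable_mult_test:
  assumes "integrable lborel f" "test_function S \<phi>"
  shows "integrable lborel (\<lambda>x. f x * \<phi> x)"
proof -
  obtain R where R: "\<And>x. norm x \<ge> R \<Longrightarrow> \<phi> x = 0" using test_function_support[OF assms(2)] by blast
  obtain B where "\<And>x. \<bar>\<phi> x\<bar> \<le> B"
    using compact_support_bounded[OF test_function_continuous[OF assms(2)] R] by blast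
  then show ?thesis
    by (rule integrable_mult_bounded_continuous[OF assms(1) test_function_continuous[OF assms(2)]])
qed

lemma integrable_indicator_bounded:
  fixes S :: "pt set"
  assumes "S \<in> sets borel" "bounded S"
  shows "integrable lborel (indicator S :: pt \<Rightarrow> real)"
  using assms emeasure_bounded_finite[of S] by (simp add: integrable_indicator_iff)

lemma L2_imp_integrable:
  fixes f :: "pt \<Rightarrow> real"
  assumes S: "S \<in> sets borel" "bounded S" and f: "f \<in> borel_measurable borel"
    and z: "\<And>x. x \<notin> S \<Longrightarrow> f x = 0" and i: "square_integrable f"
  shows "integrable lborel f"
proof (rule Bochner_Integration.integrable_bound)
  show "integrable lborel (\<lambda>x. indicator S x + (f x)\<^sup>2)"
    using integrable_indicator_bounded[OF S] i by (rule Bochner_Integration.integrable_add)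
  show "f \<in> borel_measurable lborel" using f by simp
  have "\<bar>f x\<bar> \<le> indicator S x + (f x)\<^sup>2" for x
  proof (cases "x \<in> S")
    case True
    have "0 \<le> (\<bar>f x\<bar> - 1/2)\<^sup>2" by simp
    also have "\<dots> = (f x)\<^sup>2 - \<bar>f x\<bar> + 1/4" by (simp add: power2_eq_square algebra_simps)
    finally show ?thesis using True by simp
  qed (use z in simp)
  then show "AE x in lborel. norm (f x) \<le> norm (indicator S x + (f x)\<^sup>2)"
    by (auto intro!: AE_I2 order_trans[OF _ abs_ge_self])
qed

lemma integral_lborel_translate:
  fixes f :: "pt \<Rightarrow> real"
  assumes "f \<in> borel_measurable borel"
  shows "(\<integral>x. f (x + v) \<partial>lborel) = (\<integral>x. f x \<partial>lborel)"
proof -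
  have "(\<integral>x. f x \<partial>lborel) = (\<integral>x. f x \<partial>(distr lborel borel ((+) v)))"
    by (simp add: lborel_distr_plus)
  also have "\<dots> = (\<integral>x. f (v + x) \<partial>lborel)"
    by (rule integral_distr) (use assms in auto)
  finally show ?thesis by (simp add: add.commute)
qed

text \<open>The integral of a difference quotient of a compactly supported function vanishes by translation invariance, and
  the Lipschitz bound allows passing to the limit. Differentiability almost everywhere suffices, which admits
  piecewise smooth functions.\<close>

lemma integral_directional_derivative_zero:
  fixes \<psi> \<psi>' :: "pt \<Rightarrow> real"
  assumes lip: "\<And>x y. \<bar>\<psi> x - \<psi> y\<bar> \<le> L * norm (x - y)"
    and z: "\<And>x. norm x \<ge> R \<Longrightarrow> \<psi> x = 0"
    and m: "\<psi>' \<in> borel_measurable borel"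
    and lim: "AE x in lborel. (\<lambda>n. (\<psi> (x + (1 / real (Suc n)) *\<^sub>R e) - \<psi> x) * real (Suc n)) \<longlonglongrightarrow> \<psi>' x"
  shows "integral\<^sup>L lborel \<psi>' = 0" "integrable lborel \<psi>'"
proof -
  have L: "L \<ge> 0" using lip[of "axis 1 1" 0] by (simp add: norm_axis_1)
  have cont: "continuous_on UNIV \<psi>"
    by (rule lipschitz_on_continuous_on[OF lipschitz_onI[OF _ L]]) (simp add: dist_norm lip)
  then have mp: "\<psi> \<in> borel_measurable borel" by (rule borel_measurable_continuous_onI)
  define q where "q n x = (\<psi> (x + (1 / real (Suc n)) *\<^sub>R e) - \<psi> x) * real (Suc n)" for n x
  define w where "w x = L * norm e * indicator (cball 0 (R + norm e)) x" for x :: pt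
  have i\<psi>: "integrable lborel \<psi>" by (rule integrable_continuous_compact_support[OF cont z])
  have it: "integrable lborel (\<lambda>x. \<psi> (x + v))" for v
  proof (rule integrable_continuous_compact_support[where R = "R + norm v"])
    show "continuous_on UNIV (\<lambda>x. \<psi> (x + v))"
      by (rule continuous_on_compose2[OF cont]) (auto intro!: continuous_intros)
    fix x :: pt assume "R + norm v \<le> norm x"
    then show "\<psi> (x + v) = 0"
      using norm_triangle_ineq2[of x "- v"] z[of "x + v"] by simp
  qed
  have q0: "integral\<^sup>L lborel (q n) = 0" for n
    unfolding q_def using it i\<psi> integral_lborel_translate[OF mp] by simp
  have wi: "integrable lborel w"
    unfolding w_def using integrable_indicator_bounded[of "cball 0 (R + norm e)"] by simp
  have qm: "q n \<in> borel_measurable lborel" for n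
    unfolding q_def by (intro borel_measurable_times borel_measurable_diff borel_measurable_const
        borel_measurable_integrable[OF it] borel_measurable_integrable[OF i\<psi>])
  have bd: "norm (q n x) \<le> w x" for n x
  proof (cases "norm x \<le> R + norm e")
    case True
    have "\<bar>q n x\<bar> = \<bar>\<psi> (x + (1 / real (Suc n)) *\<^sub>R e) - \<psi> x\<bar> * real (Suc n)"
      by (simp add: q_def abs_mult)
    also have "\<dots> \<le> (L * norm ((1 / real (Suc n)) *\<^sub>R e)) * real (Suc n)"
      using lip[of "x + (1 / real (Suc n)) *\<^sub>R e" x] by (intro mult_right_mono) auto
    also have "\<dots> = L * norm e" by simp
    finally show ?thesis using True by (simp add: w_def)
  next
    case False
    have "norm ((1 / real (Suc n)) *\<^sub>R e) \<le> norm e"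
      by (simp add: divide_le_eq mult_left_le field_simps)
    moreover have "norm x - norm ((1 / real (Suc n)) *\<^sub>R e) \<le> norm (x + (1 / real (Suc n)) *\<^sub>R e)"
      using norm_triangle_ineq2[of x "- ((1 / real (Suc n)) *\<^sub>R e)"] by simp
    ultimately have "norm (x + (1 / real (Suc n)) *\<^sub>R e) \<ge> R" using False by linarith
    moreover have "norm x \<ge> R" using False norm_ge_zero[of e] by linarith
    ultimately have "q n x = 0" using z unfolding q_def by simp
    then show ?thesis using L by (simp add: w_def)
  qed
  have "(\<lambda>n. integral\<^sup>L lborel (q n)) \<longlonglongrightarrow> integral\<^sup>L lborel \<psi>'"
    by (rule integral_dominated_convergence[where w = w])
      (use m qm wi lim bd in \<open>auto simp: q_def\<close>)
  then show "integral\<^sup>L lborel \<psi>' = 0"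
    unfolding q0 by (simp add: LIMSEQ_const_iff)
  show "integrable lborel \<psi>'"
    by (rule integrable_dominated_convergence[where w = w and s = q])
      (use m qm wi lim bd in \<open>auto simp: q_def\<close>)
qed

lemma directional_quotient_tendsto:
  fixes f :: "pt \<Rightarrow> real"
  assumes "(f has_derivative D) (at x)"
  shows "(\<lambda>n. (f (x + (1 / real (Suc n)) *\<^sub>R e) - f x) * real (Suc n)) \<longlonglongrightarrow> D e"
proof -
  have lin: "linear D" using assms has_derivative_linear by blast
  have "((\<lambda>t. x + t *\<^sub>R e) has_derivative (\<lambda>t. t *\<^sub>R e)) (at (0::real))"
    by (auto intro!: derivative_eq_intros)
  then have "((\<lambda>t. f (x + t *\<^sub>R e)) has_derivative (\<lambda>t. D (t *\<^sub>R e))) (at (0::real))"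
    by (rule has_derivative_compose) (use assms in simp)
  then have "((\<lambda>t. f (x + t *\<^sub>R e)) has_real_derivative D e) (at 0)"
    by (rule has_derivative_imp_has_field_derivative) (simp add: linear_scale[OF lin])
  then have "((\<lambda>t. (f (x + t *\<^sub>R e) - f x) / t) \<longlongrightarrow> D e) (at 0)"
    by (simp add: has_field_derivative_iff)
  moreover have "filterlim (\<lambda>n. 1 / real (Suc n)) (at 0) sequentially"
    unfolding filterlim_at using LIMSEQ_inverse_real_of_nat
    by (simp add: divide_inverse)
  ultimately have "(\<lambda>n. (f (x + (1 / real (Suc n)) *\<^sub>R e) - f x) / (1 / real (Suc n))) \<longlonglongrightarrow> D e"
    by (rule filterlim_compose)
  then show ?thesis by simp
qed

section \<open>Mollification\<close>

lemma mollifierD: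
  assumes "mollifier e \<eta>"
  shows "(\<eta> i j has_derivative (\<lambda>h. \<eta> (Suc i) j x * h $ 1 + \<eta> i (Suc j) x * h $ 2)) (at x)"
    and "norm x \<ge> e \<Longrightarrow> \<eta> i j x = 0" and "\<eta> 0 0 x \<ge> 0" and "integral\<^sup>L lborel (\<eta> 0 0) = 1"
  using assms by (auto simp: mollifier_def)

lemma mollifier_continuous: "mollifier e \<eta> \<Longrightarrow> continuous_on UNIV (\<eta> i j)"
  by (meson mollifierD(1) has_derivative_continuous continuous_at_imp_continuous_on)

lemma mollifier_reflected_derivative:
  assumes "mollifier e \<eta>"
  shows "((\<lambda>y. c * \<eta> i j (x - y)) has_derivative
    (\<lambda>h. (- c * \<eta> (Suc i) j (x - y)) * h $ 1 + (- c * \<eta> i (Suc j) (x - y)) * h $ 2)) (at y)"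
proof -
  have "((\<lambda>y. x - y) has_derivative (\<lambda>h. - h)) (at y)"
    by (auto intro!: derivative_eq_intros)
  then have "((\<lambda>y. \<eta> i j (x - y)) has_derivative
      (\<lambda>h. \<eta> (Suc i) j (x - y) * (- h) $ 1 + \<eta> i (Suc j) (x - y) * (- h) $ 2)) (at y)"
    by (rule has_derivative_compose) (rule mollifierD(1)[OF assms])
  from has_derivative_mult_right[OF this, of c] show ?thesis by (simp add: algebra_simps)
qed

lemma mollifier_reflected_partial:
  assumes "mollifier e \<eta>"
  shows "partial 1 (\<lambda>y. c * \<eta> i j (x - y)) = (\<lambda>y. - c * \<eta> (Suc i) j (x - y))"
    and "partial 2 (\<lambda>y. c * \<eta> i j (x - y)) = (\<lambda>y. - c * \<eta> i (Suc j) (x - y))"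
  using partial_eq[OF mollifier_reflected_derivative[OF assms]] by auto

text \<open>The kernel centred at \<open>x\<close>, as a function of the integration variable, is an admissible test function as long as
  its support stays in \<open>S\<close>. This turns weak derivatives of a function into derivatives of its mollification.\<close>

lemma mollifier_test_function:
  assumes \<eta>: "mollifier e \<eta>" and S: "cball x e \<subseteq> S"
  shows "test_function S (\<lambda>y. \<eta> 0 0 (x - y))"
    and "mixed_deriv (i, j) (\<lambda>y. \<eta> 0 0 (x - y)) = (\<lambda>y. (-1) ^ (i + j) * \<eta> i j (x - y))"
proof -
  have "\<exists>c i j. foldr partial js (\<lambda>y. \<eta> 0 0 (x - y)) = (\<lambda>y. c * \<eta> i j (x - y))" for js
  proof (induction js)
    case Nil
    show ?case by (rule exI[of _ 1], rule exI[of _ 0], rule exI[of _ 0]) simp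
  next
    case (Cons k js)
    then obtain c i j where *: "foldr partial js (\<lambda>y. \<eta> 0 0 (x - y)) = (\<lambda>y. c * \<eta> i j (x - y))" by blast
    from exhaust_2[of k] show ?case
    proof
      assume "k = 1"
      then show ?case
        using mollifier_reflected_partial(1)[OF \<eta>, of c i j x]
        by (intro exI[of _ "- c"] exI[of _ "Suc i"] exI[of _ "j"]) (simp add: *)
    next
      assume "k = 2"
      then show ?case
        using mollifier_reflected_partial(2)[OF \<eta>, of c i j x]
        by (intro exI[of _ "- c"] exI[of _ "i"] exI[of _ "Suc j"]) (simp add: *)
    qed
  qed
  note iter = this
  have "smooth (\<lambda>y. \<eta> 0 0 (x - y))"
    unfolding smooth_def differentiable_on_def
  proof (intro allI ballI)
    fix js :: "2 list" and w :: pt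
    from iter[of js] obtain c i j where *: "foldr partial js (\<lambda>y. \<eta> 0 0 (x - y)) = (\<lambda>y. c * \<eta> i j (x - y))"
      by blast
    show "foldr partial js (\<lambda>y. \<eta> 0 0 (x - y)) differentiable (at w)"
      unfolding * by (rule differentiableI[OF mollifier_reflected_derivative[OF \<eta>]])
  qed
  moreover have "{y. \<eta> 0 0 (x - y) \<noteq> 0} \<subseteq> cball x e"
    using mollifierD(2)[OF \<eta>] by (force simp: dist_norm)
  then have *: "closure {y. \<eta> 0 0 (x - y) \<noteq> 0} \<subseteq> cball x e" by (simp add: closure_minimal)
  ultimately show "test_function S (\<lambda>y. \<eta> 0 0 (x - y))"
    unfolding test_function_def using S
    by (meson bounded_cball bounded_subset closed_closure compact_eq_bounded_closed subset_trans)
  have 2: "(partial 2 ^^ j) (\<lambda>y. \<eta> 0 0 (x - y)) = (\<lambda>y. (-1) ^ j * \<eta> 0 j (x - y))"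
  proof (induction j)
    case (Suc j)
    then show ?case by (simp add: mollifier_reflected_partial[OF \<eta>])
  qed simp
  have 1: "(partial 1 ^^ i) (\<lambda>y. c * \<eta> 0 j (x - y)) = (\<lambda>y. c * (-1) ^ i * \<eta> i j (x - y))" for c
  proof (induction i)
    case (Suc i)
    then show ?case by (simp add: mollifier_reflected_partial[OF \<eta>])
  qed simp
  show "mixed_deriv (i, j) (\<lambda>y. \<eta> 0 0 (x - y)) = (\<lambda>y. (-1) ^ (i + j) * \<eta> i j (x - y))"
    by (simp add: mixed_deriv_def 1 2 power_add mult_ac)
qed

definition moll :: "(pt \<Rightarrow> real) \<Rightarrow> (pt \<Rightarrow> real) \<Rightarrow> pt \<Rightarrow> real" where
  "moll f k x = (\<integral>y. f y * k (x - y) \<partial>lborel)"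

lemma uniformly_continuous_compact_support:
  fixes k :: "pt \<Rightarrow> real"
  assumes c: "continuous_on UNIV k" and z: "\<And>x. norm x \<ge> R \<Longrightarrow> k x = 0" and e: "e > 0"
  obtains d where "d > 0" "\<And>x y. norm (x - y) < d \<Longrightarrow> \<bar>k x - k y\<bar> < e"
proof -
  have "uniformly_continuous_on (cball 0 (R + 1)) k"
    by (rule compact_uniformly_continuous[OF continuous_on_subset[OF c]]) auto
  then obtain d where d: "d > 0" "\<And>x y. x \<in> cball 0 (R + 1) \<Longrightarrow> y \<in> cball 0 (R + 1) \<Longrightarrow> dist x y < d \<Longrightarrow> dist (k x) (k y) < e"
    using e unfolding uniformly_continuous_on_def by metis
  show ?thesis
  proof (rule that[of "min d 1"])
    fix x y :: pt assume *: "norm (x - y) < min d 1"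
    show "\<bar>k x - k y\<bar> < e"
    proof (cases "norm x \<le> R + 1 \<and> norm y \<le> R + 1")
      case True
      then show ?thesis using d(2)[of x y] * by (auto simp: dist_norm)
    next
      case False
      have "\<bar>norm x - norm y\<bar> < 1" using * norm_triangle_ineq3[of x y] by linarith
      with False have "norm x \<ge> R" "norm y \<ge> R" by auto
      then show ?thesis using z e by simp
    qed
  qed (use d in auto)
qed

lemma integrable_moll:
  fixes f k :: "pt \<Rightarrow> real"
  assumes f: "integrable lborel f" and c: "continuous_on UNIV k" and z: "\<And>x::pt. norm x \<ge> R \<Longrightarrow> k x = 0"
  shows "integrable lborel (\<lambda>y. f y * k (x - y))"
proof -
  obtain B where B: "\<And>x. \<bar>k x\<bar> \<le> B" using compact_support_bounded[OF c z] by blast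
  have "continuous_on UNIV (\<lambda>y. k (x - y))"
    by (rule continuous_on_compose2[OF c]) (auto intro!: continuous_intros)
  then show ?thesis by (rule integrable_mult_bounded_continuous[OF f]) (rule B)
qed

lemma moll_has_derivative:
  assumes \<eta>: "mollifier e \<eta>" and f: "integrable lborel f"
  shows "(moll f (\<eta> i j) has_derivative (\<lambda>h. moll f (\<eta> (Suc i) j) x * h $ 1 + moll f (\<eta> i (Suc j)) x * h $ 2)) (at x)"
  unfolding has_derivative_at_alt
proof (intro conjI allI impI)
  show "bounded_linear (\<lambda>h::pt. moll f (\<eta> (Suc i) j) x * h $ 1 + moll f (\<eta> i (Suc j)) x * h $ 2)"
    by (intro bounded_linear_add bounded_linear_const_mult bounded_linear_vec_nth)
  fix \<epsilon> :: real assume "\<epsilon> > 0"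
  define M where "M = (\<integral>y. \<bar>f y\<bar> \<partial>lborel)"
  have M: "M \<ge> 0" by (simp add: M_def)
  define r where "r = \<epsilon> / (2 * (M + 1))"
  have r: "r > 0" using \<open>\<epsilon> > 0\<close> M by (simp add: r_def)
  have c: "continuous_on UNIV (\<eta> i j)" for i j by (rule mollifier_continuous[OF \<eta>])
  have z: "norm x \<ge> e \<Longrightarrow> \<eta> i j x = 0" for i j x by (rule mollifierD(2)[OF \<eta>])
  obtain d1 where d1: "d1 > 0" "\<And>x y. norm (x - y) < d1 \<Longrightarrow> \<bar>\<eta> (Suc i) j x - \<eta> (Suc i) j y\<bar> < r"
    using uniformly_continuous_compact_support[OF c z r] by blast
  obtain d2 where d2: "d2 > 0" "\<And>x y. norm (x - y) < d2 \<Longrightarrow> \<bar>\<eta> i (Suc j) x - \<eta> i (Suc j) y\<bar> < r"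
    using uniformly_continuous_compact_support[OF c z r] by blast
  define d where "d = min d1 d2"
  have lin: "\<bar>\<eta> i j z' - \<eta> i j z - (\<eta> (Suc i) j z * (z' - z) $ 1 + \<eta> i (Suc j) z * (z' - z) $ 2)\<bar> \<le> norm (z' - z) * (2 * r)"
    if "norm (z' - z) < d" for z z'
  proof -
    let ?f' = "\<lambda>x (h::pt). \<eta> (Suc i) j x * h $ 1 + \<eta> i (Suc j) x * h $ 2"
    have "norm (\<eta> i j z' - \<eta> i j z - ?f' z (z' - z)) \<le> norm (z' - z) * (2 * r)"
    proof (rule differentiable_bound_linearization[where S = "ball z d" and f' = ?f'])
      fix t :: real assume t: "t \<in> {0..1}"
      have "norm (t *\<^sub>R (z' - z)) \<le> norm (z' - z)" using t by (simp add: mult_left_le_one_le)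
      then show "z + t *\<^sub>R (z' - z) \<in> ball z d" using that by (simp add: dist_norm)
    next
      fix x assume "x \<in> ball z d"
      show "(\<eta> i j has_derivative ?f' x) (at x within ball z d)"
        by (rule has_derivative_at_withinI[OF mollifierD(1)[OF \<eta>]])
      have n: "norm (x - z) < d1" "norm (x - z) < d2"
        using \<open>x \<in> ball z d\<close> by (auto simp: d_def dist_norm norm_minus_commute)
      show "onorm (?f' x - ?f' z) \<le> 2 * r"
      proof (rule onorm_bound)
        fix h :: pt
        have "\<bar>(?f' x - ?f' z) h\<bar> = \<bar>(\<eta> (Suc i) j x - \<eta> (Suc i) j z) * h $ 1 + (\<eta> i (Suc j) x - \<eta> i (Suc j) z) * h $ 2\<bar>"
          by (simp add: algebra_simps)
        also have "\<dots> \<le> r * norm h + r * norm h"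
          using d1(2)[OF n(1)] d2(2)[OF n(2)] component_le_norm_cart[of h 1] component_le_norm_cart[of h 2]
          by (intro order_trans[OF abs_triangle_ineq] add_mono) (auto simp: abs_mult intro!: mult_mono)
        finally show "norm ((?f' x - ?f' z) h) \<le> 2 * r * norm h" by simp
      qed (use r in simp)
    qed (use d1 d2 d_def in auto)
    then show ?thesis by simp
  qed
  show "\<exists>d>0. \<forall>y. norm (y - x) < d \<longrightarrow>
       norm (moll f (\<eta> i j) y - moll f (\<eta> i j) x - (moll f (\<eta> (Suc i) j) x * (y - x) $ 1 + moll f (\<eta> i (Suc j)) x * (y - x) $ 2))
        \<le> \<epsilon> * norm (y - x)"
  proof (intro exI[of _ d] conjI allI impI)
    fix y assume y: "norm (y - x) < d"
    note im = integrable_moll[OF f c z]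
    let ?g = "\<lambda>w. f w * (\<eta> i j (y - w) - \<eta> i j (x - w) - (\<eta> (Suc i) j (x - w) * (y - x) $ 1 + \<eta> i (Suc j) (x - w) * (y - x) $ 2))"
    have eq: "?g = (\<lambda>w. f w * \<eta> i j (y - w) - f w * \<eta> i j (x - w) - (f w * \<eta> (Suc i) j (x - w) * (y - x) $ 1 + f w * \<eta> i (Suc j) (x - w) * (y - x) $ 2))"
      by (auto simp: algebra_simps)
    have ig: "integrable lborel ?g"
      unfolding eq by (intro Bochner_Integration.integrable_diff Bochner_Integration.integrable_add integrable_mult_left im)
    have "moll f (\<eta> i j) y - moll f (\<eta> i j) x - (moll f (\<eta> (Suc i) j) x * (y - x) $ 1 + moll f (\<eta> i (Suc j)) x * (y - x) $ 2)
      = integral\<^sup>L lborel ?g"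
      unfolding eq moll_def using im by simp
    also have "\<bar>\<dots>\<bar> \<le> (\<integral>w. \<bar>f w\<bar> * (norm (y - x) * (2 * r)) \<partial>lborel)"
    proof -
      have "\<bar>?g w\<bar> \<le> \<bar>f w\<bar> * (norm (y - x) * (2 * r))" for w
        using lin[of "y - w" "x - w"] y by (auto simp: abs_mult intro!: mult_left_mono)
      then show ?thesis
        using f ig by (intro order_trans[OF integral_abs_bound] integral_mono) auto
    qed
    also have "\<dots> = M * (norm (y - x) * (2 * r))" by (simp add: M_def)
    also have "\<dots> \<le> (M + 1) * (norm (y - x) * (2 * r))" using r by (intro mult_right_mono) auto
    also have "\<dots> = \<epsilon> * norm (y - x)" using M by (simp add: r_def field_simps)
    finally show "norm (moll f (\<eta> i j) y - moll f (\<eta> i j) x - (moll f (\<eta> (Suc i) j) x * (y - x) $ 1 + moll f (\<eta> i (Suc j)) x * (y - x) $ 2))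
        \<le> \<epsilon> * norm (y - x)" by simp
  qed (use d1 d2 d_def in auto)
qed

lemma moll_continuous:
  assumes "mollifier e \<eta>" and "integrable lborel f"
  shows "continuous_on UNIV (moll f (\<eta> i j))"
  by (meson moll_has_derivative[OF assms] has_derivative_continuous continuous_at_imp_continuous_on)

subsection \<open>Affine changes of variable\<close>

lemma nn_integral_lborel_affine:
  fixes f :: "pt \<Rightarrow> ennreal"
  assumes [measurable]: "f \<in> borel_measurable borel" and c: "c \<noteq> 0"
  shows "(\<integral>\<^sup>+x. f x \<partial>lborel) = ennreal (c\<^sup>2) * (\<integral>\<^sup>+x. f (t + c *\<^sub>R x) \<partial>lborel)"
  by (subst lborel_affine[OF c, of t])
     (simp add: nn_integral_density nn_integral_distr nn_integral_cmult)

lemma mollifier_integral_1: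
  assumes \<eta>: "mollifier e \<eta>"
  shows "(\<integral>\<^sup>+x. ennreal (\<eta> 0 0 (x - y)) \<partial>lborel) = 1" "(\<integral>y. \<eta> 0 0 (x - y) \<partial>lborel) = 1"
    "integrable lborel (\<lambda>y. \<eta> 0 0 (x - y))"
proof -
  have c: "continuous_on UNIV (\<eta> 0 0)" by (rule mollifier_continuous[OF \<eta>])
  have m: "\<eta> 0 0 \<in> borel_measurable borel" using c by (rule borel_measurable_continuous_onI)
  have i: "integrable lborel (\<eta> 0 0)"
    by (rule integrable_continuous_compact_support[OF c mollifierD(2)[OF \<eta>]])
  have n: "(\<integral>\<^sup>+x. ennreal (\<eta> 0 0 x) \<partial>lborel) = 1"
    using nn_integral_eq_integral[OF i] mollifierD(3,4)[OF \<eta>] by simp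
  show "(\<integral>\<^sup>+x. ennreal (\<eta> 0 0 (x - y)) \<partial>lborel) = 1"
    using nn_integral_lborel_affine[of "\<lambda>x. ennreal (\<eta> 0 0 x)" 1 "- y"] m n by simp
  have 2: "(\<integral>\<^sup>+y. ennreal (\<eta> 0 0 (x - y)) \<partial>lborel) = 1"
    using nn_integral_lborel_affine[of "\<lambda>x. ennreal (\<eta> 0 0 x)" "- 1" "x"] m n by simp
  then show "(\<integral>y. \<eta> 0 0 (x - y) \<partial>lborel) = 1"
    using m mollifierD(3)[OF \<eta>] by (subst integral_eq_nn_integral) auto
  show "integrable lborel (\<lambda>y. \<eta> 0 0 (x - y))"
    using m mollifierD(3)[OF \<eta>] 2 by (intro integrableI_nonneg) auto
qed

subsection \<open>Convergence in the mean square\<close>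

text \<open>The kernel is a probability density: Cauchy-Schwarz pointwise, then Fubini.\<close>

lemma moll_L2_bound:
  assumes \<eta>: "mollifier e \<eta>" and f: "integrable lborel f" and f2: "square_integrable f"
  shows "square_integrable (moll f (\<eta> 0 0))"
    and "sqnorm (moll f (\<eta> 0 0)) \<le> sqnorm f"
proof -
  let ?k = "\<eta> 0 0"
  have c: "continuous_on UNIV ?k" by (rule mollifier_continuous[OF \<eta>])
  have k[measurable]: "?k \<in> borel_measurable borel" using c by (rule borel_measurable_continuous_onI)
  have [measurable]: "f \<in> borel_measurable borel" using f by simp
  have mm[measurable]: "moll f ?k \<in> borel_measurable borel"
    using moll_continuous[OF \<eta> f] by (rule borel_measurable_continuous_onI)
  note z = mollifierD(2)[OF \<eta>]
  have jensen: "(moll f ?k x)\<^sup>2 \<le> (\<integral>y. (f y)\<^sup>2 * ?k (x - y) \<partial>lborel)" for x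
  proof -
    let ?m = "moll f ?k x"
    have i1: "integrable lborel (\<lambda>y. (f y)\<^sup>2 * ?k (x - y))" by (rule integrable_moll[OF f2 c z])
    have i2: "integrable lborel (\<lambda>y. f y * ?k (x - y))" by (rule integrable_moll[OF f c z])
    have i3: "integrable lborel (\<lambda>y. ?k (x - y))" by (rule mollifier_integral_1(3)[OF \<eta>])
    have "0 \<le> (\<integral>y. (f y - ?m)\<^sup>2 * ?k (x - y) \<partial>lborel)"
      using mollifierD(3)[OF \<eta>] by (intro Bochner_Integration.integral_nonneg) auto
    also have "\<dots> = (\<integral>y. (f y)\<^sup>2 * ?k (x - y) - 2 * ?m * (f y * ?k (x - y)) + ?m\<^sup>2 * ?k (x - y) \<partial>lborel)"
      by (simp add: power2_eq_square algebra_simps)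
    also have "\<dots> = (\<integral>y. (f y)\<^sup>2 * ?k (x - y) \<partial>lborel) - 2 * ?m * ?m + ?m\<^sup>2"
      using i1 i2 i3 mollifier_integral_1(2)[OF \<eta>, of x]
      by (simp add: moll_def)
    finally show ?thesis by (simp add: power2_eq_square)
  qed
  have "(\<integral>\<^sup>+x. ennreal ((moll f ?k x)\<^sup>2) \<partial>lborel) \<le> (\<integral>\<^sup>+x. (\<integral>\<^sup>+y. ennreal ((f y)\<^sup>2 * ?k (x - y)) \<partial>lborel) \<partial>lborel)"
  proof (rule nn_integral_mono)
    fix x
    have "ennreal (\<integral>y. (f y)\<^sup>2 * ?k (x - y) \<partial>lborel) = (\<integral>\<^sup>+y. ennreal ((f y)\<^sup>2 * ?k (x - y)) \<partial>lborel)"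
      using mollifierD(3)[OF \<eta>] by (subst nn_integral_eq_integral[OF integrable_moll[OF f2 c z]]) auto
    then show "ennreal ((moll f ?k x)\<^sup>2) \<le> (\<integral>\<^sup>+y. ennreal ((f y)\<^sup>2 * ?k (x - y)) \<partial>lborel)"
      using ennreal_leI[OF jensen[of x]] by simp
  qed
  also have "\<dots> = (\<integral>\<^sup>+y. (\<integral>\<^sup>+x. ennreal ((f y)\<^sup>2 * ?k (x - y)) \<partial>lborel) \<partial>lborel)"
    by (rule lborel_pair.Fubini') measurable
  also have "\<dots> = (\<integral>\<^sup>+y. ennreal ((f y)\<^sup>2) * (\<integral>\<^sup>+x. ennreal (?k (x - y)) \<partial>lborel) \<partial>lborel)"
    by (simp add: ennreal_mult mollifierD(3)[OF \<eta>] nn_integral_cmult)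
  also have "\<dots> = (\<integral>\<^sup>+y. ennreal ((f y)\<^sup>2) \<partial>lborel)"
    by (simp add: mollifier_integral_1(1)[OF \<eta>])
  also have "\<dots> = ennreal (sqnorm f)" by (rule nn_integral_eq_integral[OF f2]) simp
  finally have *: "(\<integral>\<^sup>+x. ennreal ((moll f ?k x)\<^sup>2) \<partial>lborel) \<le> ennreal (sqnorm f)" .
  show i: "integrable lborel (\<lambda>x. (moll f ?k x)\<^sup>2)"
    using le_less_trans[OF * ennreal_less_top] by (intro integrableI_nonneg) auto
  show "(\<integral>x. (moll f ?k x)\<^sup>2 \<partial>lborel) \<le> sqnorm f"
    using * by (subst (asm) nn_integral_eq_integral[OF i]) auto
qed

text \<open>At these points mollification with radius \<open>e\<close> depends only on the values in \<open>S\<close>.\<close>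

definition erode :: "pt set \<Rightarrow> real \<Rightarrow> pt set" where
  "erode S e = {x. cball x e \<subseteq> S}"

lemma open_erode:
  assumes "open S" shows "open (erode S e)"
proof -
  have "- erode S e = (\<Union>x\<in>- S. \<Union>y\<in>cball 0 e. {x + y})"
  proof (intro set_eqI iffI)
    fix x assume "x \<in> - erode S e"
    then obtain a where "a \<in> cball x e" "a \<notin> S" unfolding erode_def by blast
    then have "a \<in> - S" "x - a \<in> cball 0 e" "x = a + (x - a)" by (auto simp: dist_norm norm_minus_commute)
    then show "x \<in> (\<Union>x\<in>- S. \<Union>y\<in>cball 0 e. {x + y})" by blast
  next
    fix x assume "x \<in> (\<Union>x\<in>- S. \<Union>y\<in>cball 0 e. {x + y})"
    then obtain a b where "a \<notin> S" "norm b \<le> e" "x = a + b" by auto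
    then have "a \<in> cball x e" by (simp add: dist_norm)
    then show "x \<in> - erode S e" using \<open>a \<notin> S\<close> by (auto simp: erode_def)
  qed
  moreover have "closed (\<Union>x\<in>- S. \<Union>y\<in>cball 0 e. {x + y})"
    using assms by (intro closed_compact_sums) auto
  ultimately show ?thesis by (metis open_closed)
qed

lemma convex_erode:
  assumes "convex S" shows "convex (erode S e)"
  unfolding convex_def
proof (intro ballI allI impI)
  fix x y :: pt and u v :: real
  assume *: "x \<in> erode S e" "y \<in> erode S e" "0 \<le> u" "0 \<le> v" "u + v = 1"
  show "u *\<^sub>R x + v *\<^sub>R y \<in> erode S e"
    unfolding erode_def
  proof clarify
    fix z assume z: "z \<in> cball (u *\<^sub>R x + v *\<^sub>R y) e"
    define d where "d = z - (u *\<^sub>R x + v *\<^sub>R y)"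
    have "norm d \<le> e" using z by (simp add: d_def dist_norm norm_minus_commute)
    then have "x + d \<in> S" "y + d \<in> S" using * by (auto simp: erode_def dist_norm)
    then have "u *\<^sub>R (x + d) + v *\<^sub>R (y + d) \<in> S"
      using assms * by (simp add: convex_def)
    moreover have "u *\<^sub>R (x + d) + v *\<^sub>R (y + d) = z"
      using scaleR_add_left[of u v d] * by (simp add: d_def algebra_simps)
    ultimately show "z \<in> S" by simp
  qed
qed

lemma erode_subset: "e \<ge> 0 \<Longrightarrow> erode S e \<subseteq> S"
  by (auto simp: erode_def)

lemma eventually_in_erode:
  assumes "open S" "x \<in> S"
  shows "\<forall>\<^sub>F n in sequentially. x \<in> erode S (1 / real (Suc n))"
proof -
  obtain e where e: "e > 0" "cball x e \<subseteq> S" using assms open_contains_cball by blast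
  have "\<forall>\<^sub>F n in sequentially. 1 / real (Suc n) < e"
    using LIMSEQ_inverse_real_of_nat e(1) by (auto simp: divide_inverse intro: order_tendstoD)
  then show ?thesis
    by eventually_elim (use e in \<open>force simp: erode_def\<close>)
qed

lemma negligible_imp_AE:
  assumes "negligible N" shows "AE x in lborel. x \<notin> N"
  using assms AE_completion_iff by (metis AE_not_in negligible_iff_null_sets)

lemma L2_continuous_approximation:
  fixes f :: "pt \<Rightarrow> real"
  assumes S: "S \<in> sets borel" "bounded S" and f: "f \<in> borel_measurable borel"
    and z: "\<And>x. x \<notin> S \<Longrightarrow> f x = 0" and i: "square_integrable f" and "\<epsilon> > 0"
  obtains c k where "continuous_on UNIV c" "\<And>x. \<bar>c x\<bar> \<le> k" "(\<integral>x. indicator S x * (f x - c x)\<^sup>2 \<partial>lborel) < \<epsilon>"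
proof -
  note [measurable] = f S(1)
  define clip where "clip k t = max (- k) (min k t)" for k t :: real
  have cc: "continuous_on UNIV (clip k)" for k unfolding clip_def by (intro continuous_intros)
  have cm[measurable]: "clip k \<in> borel_measurable borel" for k using cc by (rule borel_measurable_continuous_onI)
  have cb: "\<bar>clip k t\<bar> \<le> k" if "k \<ge> 0" for k t using that by (auto simp: clip_def)
  have "(\<lambda>n. \<integral>x. (f x - clip (real n) (f x))\<^sup>2 \<partial>lborel) \<longlonglongrightarrow> (\<integral>x. 0 \<partial>(lborel :: pt measure))"
  proof (rule integral_dominated_convergence[where w = "\<lambda>x. (f x)\<^sup>2"])
    show "AE x in lborel. (\<lambda>n. (f x - clip (real n) (f x))\<^sup>2) \<longlonglongrightarrow> 0"
    proof (rule AE_I2)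
      fix x :: pt
      have "\<forall>\<^sub>F n in sequentially. \<bar>f x\<bar> \<le> real n"
        by (meson eventually_sequentiallyI nat_ceiling_le_eq)
      then have "\<forall>\<^sub>F n in sequentially. (f x - clip (real n) (f x))\<^sup>2 = 0"
        by eventually_elim (auto simp: clip_def)
      then show "(\<lambda>n. (f x - clip (real n) (f x))\<^sup>2) \<longlonglongrightarrow> 0" by (rule tendsto_eventually)
    qed
    show "AE x in lborel. norm ((f x - clip (real n) (f x))\<^sup>2) \<le> (f x)\<^sup>2" for n
      by (rule AE_I2) (auto simp: clip_def abs_le_square_iff[symmetric])
  qed (use i in auto)
  then have "\<forall>\<^sub>F n in sequentially. (\<integral>x. (f x - clip (real n) (f x))\<^sup>2 \<partial>lborel) < \<epsilon> / 4"
    using \<open>\<epsilon> > 0\<close> by (intro order_tendstoD) auto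
  then obtain n where n: "(\<integral>x. (f x - clip (real n) (f x))\<^sup>2 \<partial>lborel) < \<epsilon> / 4"
    by (auto simp: eventually_sequentially)
  have "f measurable_on UNIV"
    by (rule lebesgue_measurable_imp_measurable_on) (use f in \<open>auto intro: measurable_completion\<close>)
  then obtain N g where N: "negligible N" and g: "\<And>n. continuous_on UNIV (g n)"
    and lim: "\<And>x. x \<notin> N \<Longrightarrow> (\<lambda>n. g n x) \<longlonglongrightarrow> f x"
    unfolding measurable_on_def by auto
  have gm[measurable]: "g m \<in> borel_measurable borel" for m using g by (rule borel_measurable_continuous_onI)
  have iS: "integrable lborel (\<lambda>x. indicator S x * k)" for k :: real
    using integrable_indicator_bounded[OF S] by simp
  have "(\<lambda>m. \<integral>x. indicator S x * (clip (real n) (f x) - clip (real n) (g m x))\<^sup>2 \<partial>lborel) \<longlonglongrightarrow> (\<integral>x. 0 \<partial>(lborel :: pt measure))"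
  proof (rule integral_dominated_convergence[where w = "\<lambda>x. indicator S x * (2 * real n)\<^sup>2"])
    show "AE x in lborel. (\<lambda>m. indicator S x * (clip (real n) (f x) - clip (real n) (g m x))\<^sup>2) \<longlonglongrightarrow> 0"
      using negligible_imp_AE[OF N]
    proof eventually_elim
      case (elim x)
      have "(\<lambda>m. clip (real n) (g m x)) \<longlonglongrightarrow> clip (real n) (f x)"
        using cc lim[OF elim] by (metis UNIV_I continuous_on_tendsto_compose eventually_sequentiallyI)
      then have "(\<lambda>m. indicator S x * (clip (real n) (f x) - clip (real n) (g m x))\<^sup>2)
         \<longlonglongrightarrow> indicator S x * (clip (real n) (f x) - clip (real n) (f x))\<^sup>2"
        by (intro tendsto_intros)
      then show ?case by simp
    qed
    fix m
    have "\<bar>clip (real n) (f x) - clip (real n) (g m x)\<bar> \<le> \<bar>2 * real n\<bar>" for x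
      using cb[of "real n" "f x"] cb[of "real n" "g m x"] by linarith
    then show "AE x in lborel. norm (indicator S x * (clip (real n) (f x) - clip (real n) (g m x))\<^sup>2) \<le> indicator S x * (2 * real n)\<^sup>2"
      unfolding abs_le_square_iff by (intro AE_I2) (auto simp: indicator_def)
  qed (use iS in auto)
  then have "\<forall>\<^sub>F m in sequentially. (\<integral>x. indicator S x * (clip (real n) (f x) - clip (real n) (g m x))\<^sup>2 \<partial>lborel) < \<epsilon> / 4"
    using \<open>\<epsilon> > 0\<close> by (intro order_tendstoD) auto
  then obtain m where m: "(\<integral>x. indicator S x * (clip (real n) (f x) - clip (real n) (g m x))\<^sup>2 \<partial>lborel) < \<epsilon> / 4"
    by (auto simp: eventually_sequentially)
  define c where "c x = clip (real n) (g m x)" for x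
  have i1: "integrable lborel (\<lambda>x. (f x - clip (real n) (f x))\<^sup>2)"
    by (rule Bochner_Integration.integrable_bound[OF i]) (auto simp: clip_def abs_le_square_iff[symmetric])
  have i2: "integrable lborel (\<lambda>x. indicator S x * (clip (real n) (f x) - c x)\<^sup>2)"
  proof (rule Bochner_Integration.integrable_bound[OF iS[of "(2 * real n)\<^sup>2"]])
    have "\<bar>clip (real n) (f x) - c x\<bar> \<le> \<bar>2 * real n\<bar>" for x
      unfolding c_def using cb[of "real n" "f x"] cb[of "real n" "g m x"] by linarith
    then show "AE x in lborel. norm (indicator S x * (clip (real n) (f x) - c x)\<^sup>2) \<le> norm (indicator S x * (2 * real n)\<^sup>2)"
      unfolding abs_le_square_iff by (intro AE_I2) (auto simp: indicator_def)
  qed (simp add: c_def)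
  have sq: "(a - b)\<^sup>2 \<le> 2 * (a - e)\<^sup>2 + 2 * (e - b)\<^sup>2" for a b e :: real
    using zero_le_power2[of "(a - e) - (e - b)"] by (simp add: power2_eq_square algebra_simps)
  show ?thesis
  proof (rule that)
    show "continuous_on UNIV c" unfolding c_def
      by (rule continuous_on_compose2[OF cc g]) auto
    show "\<bar>c x\<bar> \<le> real n" for x unfolding c_def by (rule cb) simp
    have "(\<integral>x. indicator S x * (f x - c x)\<^sup>2 \<partial>lborel) \<le>
      (\<integral>x. 2 * (f x - clip (real n) (f x))\<^sup>2 + 2 * (indicator S x * (clip (real n) (f x) - c x)\<^sup>2) \<partial>lborel)"
    proof (rule integral_mono')
      show "integrable lborel (\<lambda>x. 2 * (f x - clip (real n) (f x))\<^sup>2 + 2 * (indicator S x * (clip (real n) (f x) - c x)\<^sup>2))"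
        using i1 i2 by simp
      show "indicator S x * (f x - c x)\<^sup>2 \<le> 2 * (f x - clip (real n) (f x))\<^sup>2 + 2 * (indicator S x * (clip (real n) (f x) - c x)\<^sup>2)" for x
        using sq[of "f x" "c x" "clip (real n) (f x)"] by (cases "x \<in> S") auto
      show "0 \<le> 2 * (f x - clip (real n) (f x))\<^sup>2 + 2 * (indicator S x * (clip (real n) (f x) - c x)\<^sup>2)" for x
        by simp
    qed
    also have "\<dots> = 2 * (\<integral>x. (f x - clip (real n) (f x))\<^sup>2 \<partial>lborel) + 2 * (\<integral>x. indicator S x * (clip (real n) (f x) - c x)\<^sup>2 \<partial>lborel)"
      using i1 i2 by simp
    also have "\<dots> < \<epsilon>" using n m by (simp add: c_def)
    finally show "(\<integral>x. indicator S x * (f x - c x)\<^sup>2 \<partial>lborel) < \<epsilon>" .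
  qed
qed

lemma moll_near_continuous:
  assumes \<eta>: "mollifier e \<eta>" and S: "cball x e \<subseteq> S" and i: "integrable lborel (\<lambda>y. indicator S y * c y)"
    and w: "\<And>y. norm (x - y) < e \<Longrightarrow> \<bar>c y - c x\<bar> \<le> \<omega>"
  shows "\<bar>moll (\<lambda>y. indicator S y * c y) (\<eta> 0 0) x - c x\<bar> \<le> \<omega>"
proof -
  let ?k = "\<eta> 0 0"
  have im: "integrable lborel (\<lambda>y. indicator S y * c y * ?k (x - y))"
    by (rule integrable_moll[OF i mollifier_continuous[OF \<eta>] mollifierD(2)[OF \<eta>]])
  have ik: "integrable lborel (\<lambda>y. ?k (x - y))" by (rule mollifier_integral_1[OF \<eta>])
  have "moll (\<lambda>y. indicator S y * c y) ?k x - c x = (\<integral>y. indicator S y * c y * ?k (x - y) - c x * ?k (x - y) \<partial>lborel)"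
    using im ik mollifier_integral_1(2)[OF \<eta>, of x] by (simp add: moll_def)
  also have "\<bar>\<dots>\<bar> \<le> (\<integral>y. \<omega> * ?k (x - y) \<partial>lborel)"
  proof (rule order_trans[OF integral_abs_bound], rule integral_mono)
    fix y
    show "\<bar>indicator S y * c y * ?k (x - y) - c x * ?k (x - y)\<bar> \<le> \<omega> * ?k (x - y)"
    proof (cases "norm (x - y) < e")
      case True
      then have "y \<in> S" using S by (auto simp: dist_norm)
      have "\<bar>c y * ?k (x - y) - c x * ?k (x - y)\<bar> = \<bar>c y - c x\<bar> * ?k (x - y)"
        using mollifierD(3)[OF \<eta>, of "x - y"] by (simp add: left_diff_distrib[symmetric] abs_mult)
      also have "\<dots> \<le> \<omega> * ?k (x - y)"
        using w[OF True] mollifierD(3)[OF \<eta>] by (rule mult_right_mono)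
      finally show ?thesis using \<open>y \<in> S\<close> by simp
    next
      case False
      then show ?thesis using mollifierD(2)[OF \<eta>, of "x - y" 0 0] by simp
    qed
  qed (use im ik in auto)
  also have "\<dots> = \<omega>" using mollifier_integral_1(2)[OF \<eta>, of x] by simp
  finally show ?thesis .
qed

text \<open>For continuous functions the mollifications converge pointwise and boundedly; by \<open>moll_L2_bound\<close> neither the
  function nor its mollification moves much if it is replaced by a nearby continuous function.\<close>

lemma moll_L2_convergence:
  fixes f :: "pt \<Rightarrow> real"
  assumes S: "open S" "bounded S" and f: "f \<in> borel_measurable borel"
    and z: "\<And>x. x \<notin> S \<Longrightarrow> f x = 0" and i2: "square_integrable f"
    and \<eta>: "\<And>n. mollifier (1 / real (Suc n)) (\<eta> n)"
  shows "(\<lambda>n. \<integral>x. (indicator (erode S (1 / real (Suc n))) x * moll f (\<eta> n 0 0) x - f x)\<^sup>2 \<partial>lborel) \<longlonglongrightarrow> 0"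
proof -
  have Sb[measurable]: "S \<in> sets borel" using S by simp
  note [measurable] = f
  have i: "integrable lborel f" by (rule L2_imp_integrable[OF Sb S(2) f z i2])
  define A where "A n = erode S (1 / real (Suc n))" for n
  have A[measurable]: "A n \<in> sets borel" for n using open_erode[OF S(1)] by (simp add: A_def)
  have AS: "A n \<subseteq> S" for n unfolding A_def by (rule erode_subset) simp
  have "(\<lambda>n. \<integral>x. (1 - indicator (A n) x) * (f x)\<^sup>2 \<partial>lborel) \<longlonglongrightarrow> (\<integral>x. 0 \<partial>(lborel :: pt measure))"
  proof (rule integral_dominated_convergence[where w = "\<lambda>x. (f x)\<^sup>2"])
    show "AE x in lborel. (\<lambda>n. (1 - indicator (A n) x) * (f x)\<^sup>2) \<longlonglongrightarrow> 0"
    proof (rule AE_I2)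
      fix x
      show "(\<lambda>n. (1 - indicator (A n) x) * (f x)\<^sup>2) \<longlonglongrightarrow> 0"
      proof (cases "x \<in> S")
        case True
        have "\<forall>\<^sub>F n in sequentially. (1 - indicator (A n) x) * (f x)\<^sup>2 = 0"
          using eventually_in_erode[OF S(1) True] by eventually_elim (simp add: A_def)
        then show ?thesis by (rule tendsto_eventually)
      qed (use z in simp)
    qed
    show "AE x in lborel. norm ((1 - indicator (A n) x) * (f x)\<^sup>2) \<le> (f x)\<^sup>2" for n
      by (rule AE_I2) (auto simp: indicator_def)
  qed (use i2 in auto)
  then have part2: "(\<lambda>n. \<integral>x. (1 - indicator (A n) x) * (f x)\<^sup>2 \<partial>lborel) \<longlonglongrightarrow> 0" by simp
  define m where "m n = moll f (\<eta> n 0 0)" for n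
  have mm[measurable]: "m n \<in> borel_measurable borel" for n
    unfolding m_def using moll_continuous[OF \<eta> i] by (rule borel_measurable_continuous_onI)
  have im2: "square_integrable (m n)" for n
    unfolding m_def by (rule moll_L2_bound[OF \<eta> i i2])
  have iA: "integrable lborel (\<lambda>x. indicator (A n) x * (m n x - f x)\<^sup>2)" for n
  proof (rule Bochner_Integration.integrable_bound)
    show "integrable lborel (\<lambda>x. 2 * (m n x)\<^sup>2 + 2 * (f x)\<^sup>2)" using im2 i2 by simp
    have "(m n x - f x)\<^sup>2 \<le> 2 * (m n x)\<^sup>2 + 2 * (f x)\<^sup>2" for x
      using zero_le_power2[of "m n x + f x"] by (simp add: power2_eq_square algebra_simps)
    then show "AE x in lborel. norm (indicator (A n) x * (m n x - f x)\<^sup>2) \<le> norm (2 * (m n x)\<^sup>2 + 2 * (f x)\<^sup>2)"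
      by (intro AE_I2) (auto simp: indicator_def)
  qed simp
  have part1: "(\<lambda>n. \<integral>x. indicator (A n) x * (m n x - f x)\<^sup>2 \<partial>lborel) \<longlonglongrightarrow> 0"
  proof (rule LIMSEQ_I)
    fix \<epsilon> :: real assume \<epsilon>: "\<epsilon> > 0"
    obtain c k where c: "continuous_on UNIV c" and ck: "\<And>x. \<bar>c x\<bar> \<le> k" and
      r: "(\<integral>x. indicator S x * (f x - c x)\<^sup>2 \<partial>lborel) < \<epsilon> / 12"
      using L2_continuous_approximation[OF Sb S(2) f z i2, of "\<epsilon>/12"] \<epsilon> by auto
    have cm[measurable]: "c \<in> borel_measurable borel" using c by (rule borel_measurable_continuous_onI)
    define r' where "r' x = indicator S x * (f x - c x)" for x
    have r'2: "(r' x)\<^sup>2 = indicator S x * (f x - c x)\<^sup>2" for x by (auto simp: r'_def indicator_def)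
    define \<mu> where "\<mu> = (\<integral>x. indicator S x \<partial>(lborel :: pt measure)) + (1::real)"
    have \<mu>: "\<mu> \<ge> 1" by (simp add: \<mu>_def)
    define \<omega> where "\<omega> = sqrt (\<epsilon> / (12 * \<mu>))"
    have \<omega>: "\<omega> > 0" using \<epsilon> \<mu> by (simp add: \<omega>_def)
    obtain R where "\<forall>x\<in>S. norm x \<le> R" using S(2) by (auto simp: bounded_iff)
    then have R: "S \<subseteq> cball 0 R" by auto
    have "uniformly_continuous_on (cball 0 R) c"
      by (rule compact_uniformly_continuous[OF continuous_on_subset[OF c]]) auto
    then obtain d where d: "d > 0" "\<And>x y. x \<in> cball 0 R \<Longrightarrow> y \<in> cball 0 R \<Longrightarrow> dist y x < d \<Longrightarrow> dist (c y) (c x) < \<omega>"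
      using \<omega> unfolding uniformly_continuous_on_def by metis
    have "\<forall>\<^sub>F n in sequentially. 1 / real (Suc n) < d"
      using LIMSEQ_inverse_real_of_nat d(1) by (auto simp: divide_inverse intro: order_tendstoD)
    then obtain N where N: "\<And>n. n \<ge> N \<Longrightarrow> 1 / real (Suc n) < d" by (auto simp: eventually_sequentially)
    have ic: "integrable lborel (\<lambda>y. indicator S y * c y)"
      using integrable_mult_bounded_continuous[OF integrable_indicator_bounded[OF Sb S(2)] c ck] .
    have f_eq: "f y = indicator S y * c y + r' y" for y using z[of y] by (auto simp: r'_def indicator_def)
    have ir: "integrable lborel r'"
    proof -
      have "r' = (\<lambda>y. f y - indicator S y * c y)" using f_eq by (auto simp: fun_eq_iff)
      then show ?thesis using i ic by simp
    qed
    have ic2: "integrable lborel (\<lambda>y. indicator S y * k\<^sup>2 :: real)"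
      using integrable_indicator_bounded[OF Sb S(2)] by simp
    have ir2: "integrable lborel (\<lambda>y. (r' y)\<^sup>2)"
    proof (rule Bochner_Integration.integrable_bound)
      show "integrable lborel (\<lambda>x. 2 * (f x)\<^sup>2 + 2 * (indicator S x * k\<^sup>2))" using i2 ic2 by simp
      have "(f x - c x)\<^sup>2 \<le> 2 * (f x)\<^sup>2 + 2 * k\<^sup>2" for x
      proof -
        have "(f x - c x)\<^sup>2 \<le> 2 * (f x)\<^sup>2 + 2 * (c x)\<^sup>2"
          using zero_le_power2[of "f x + c x"] by (simp add: power2_eq_square algebra_simps)
        moreover have "(c x)\<^sup>2 \<le> k\<^sup>2" using ck[of x] by (metis abs_ge_zero power2_abs power_mono)
        ultimately show ?thesis by linarith
      qed
      then show "AE x in lborel. norm ((r' x)\<^sup>2) \<le> norm (2 * (f x)\<^sup>2 + 2 * (indicator S x * k\<^sup>2))"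
        unfolding r'2 by (intro AE_I2) (auto simp: indicator_def)
    qed (simp add: r'_def)
    show "\<exists>N. \<forall>n\<ge>N. norm ((\<integral>x. indicator (A n) x * (m n x - f x)\<^sup>2 \<partial>lborel) - 0) < \<epsilon>"
    proof (intro exI[of _ N] allI impI)
      fix n assume n: "n \<ge> N"
      have pw: "indicator (A n) x * (m n x - f x)\<^sup>2 \<le> 3 * (moll r' (\<eta> n 0 0) x)\<^sup>2 + 3 * (r' x)\<^sup>2 + 3 * (\<omega>\<^sup>2 * indicator S x)" for x
      proof (cases "x \<in> A n")
        case True
        then have x: "cball x (1 / real (Suc n)) \<subseteq> S" "x \<in> S" using AS by (auto simp: A_def erode_def)
        have "m n x = moll (\<lambda>y. indicator S y * c y) (\<eta> n 0 0) x + moll r' (\<eta> n 0 0) x"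
        proof -
          have "m n x = (\<integral>y. indicator S y * c y * \<eta> n 0 0 (x - y) + r' y * \<eta> n 0 0 (x - y) \<partial>lborel)"
            unfolding m_def moll_def by (subst f_eq) (simp add: distrib_right)
          also have "\<dots> = moll (\<lambda>y. indicator S y * c y) (\<eta> n 0 0) x + moll r' (\<eta> n 0 0) x"
            unfolding moll_def
            by (intro Bochner_Integration.integral_add integrable_moll[OF _ mollifier_continuous[OF \<eta>] mollifierD(2)[OF \<eta>]] ic ir)
          finally show ?thesis .
        qed
        moreover have "\<bar>moll (\<lambda>y. indicator S y * c y) (\<eta> n 0 0) x - c x\<bar> \<le> \<omega>"
        proof (rule moll_near_continuous[OF \<eta> x(1) ic])
          fix y assume y: "norm (x - y) < 1 / real (Suc n)"
          then have "y \<in> cball x (1 / real (Suc n))" by (simp add: dist_norm)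
          then have "y \<in> cball 0 R" "x \<in> cball 0 R" using x R by blast+
          then show "\<bar>c y - c x\<bar> \<le> \<omega>" using d(2)[of x y] y N[OF n] by (force simp: dist_norm norm_minus_commute)
        qed
        ultimately have e: "\<bar>m n x - f x - moll r' (\<eta> n 0 0) x + r' x\<bar> \<le> \<omega>"
          using f_eq[of x] x(2) by simp
        define p where "p = m n x - f x - moll r' (\<eta> n 0 0) x + r' x"
        have "p\<^sup>2 \<le> \<omega>\<^sup>2" using e \<omega> unfolding p_def[symmetric] by (metis abs_ge_zero power2_abs power_mono)
        moreover have "(a + b + q)\<^sup>2 \<le> 3 * a\<^sup>2 + 3 * b\<^sup>2 + 3 * q\<^sup>2" for a b q :: real
        proof -
          have "0 \<le> (a - b)\<^sup>2 + (a - q)\<^sup>2 + (b - q)\<^sup>2" by simp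
          then show ?thesis by (simp add: power2_eq_square algebra_simps)
        qed
        from this[of "moll r' (\<eta> n 0 0) x" "- r' x" p] have "(m n x - f x)\<^sup>2 \<le> 3 * (moll r' (\<eta> n 0 0) x)\<^sup>2 + 3 * (r' x)\<^sup>2 + 3 * p\<^sup>2"
          by (simp add: p_def)
        ultimately show ?thesis using True x(2) by simp
      qed simp
      have "(\<integral>x. indicator (A n) x * (m n x - f x)\<^sup>2 \<partial>lborel) \<le>
        (\<integral>x. 3 * (moll r' (\<eta> n 0 0) x)\<^sup>2 + 3 * (r' x)\<^sup>2 + 3 * (\<omega>\<^sup>2 * indicator S x) \<partial>lborel)"
        using iA moll_L2_bound(1)[OF \<eta> ir ir2] ir2 integrable_indicator_bounded[OF Sb S(2)] pw
        by (intro integral_mono) auto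
      also have "\<dots> = 3 * sqnorm (moll r' (\<eta> n 0 0)) + 3 * sqnorm r' + 3 * (\<omega>\<^sup>2 * (\<mu> - 1))"
        using moll_L2_bound(1)[OF \<eta> ir ir2] ir2 integrable_indicator_bounded[OF Sb S(2)]
        by (simp add: \<mu>_def)
      also have "\<dots> \<le> 6 * sqnorm r' + 3 * (\<omega>\<^sup>2 * \<mu>)"
      proof -
        have "3 * (\<omega>\<^sup>2 * (\<mu> - 1)) \<le> 3 * (\<omega>\<^sup>2 * \<mu>)" by (intro mult_left_mono) auto
        then show ?thesis using moll_L2_bound(2)[OF \<eta> ir ir2, of n] by linarith
      qed
      also have "\<dots> < \<epsilon>"
        using r \<epsilon> \<mu> unfolding r'2 \<omega>_def by (simp add: field_simps)
      finally have "(\<integral>x. indicator (A n) x * (m n x - f x)\<^sup>2 \<partial>lborel) < \<epsilon>" .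
      moreover have "(\<integral>x. indicator (A n) x * (m n x - f x)\<^sup>2 \<partial>lborel) \<ge> 0"
        by (intro Bochner_Integration.integral_nonneg) auto
      ultimately show "norm ((\<integral>x. indicator (A n) x * (m n x - f x)\<^sup>2 \<partial>lborel) - 0) < \<epsilon>" by simp
    qed
  qed
  have "(\<integral>x. (indicator (A n) x * m n x - f x)\<^sup>2 \<partial>lborel) =
     (\<integral>x. indicator (A n) x * (m n x - f x)\<^sup>2 \<partial>lborel) + (\<integral>x. (1 - indicator (A n) x) * (f x)\<^sup>2 \<partial>lborel)" for n
  proof -
    have "integrable lborel (\<lambda>x. (1 - indicator (A n) x) * (f x)\<^sup>2)"
      by (rule Bochner_Integration.integrable_bound[OF i2]) (auto simp: indicator_def)
    moreover have "(indicator (A n) x * m n x - f x)\<^sup>2 = indicator (A n) x * (m n x - f x)\<^sup>2 + (1 - indicator (A n) x) * (f x)\<^sup>2" for x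
      by (auto simp: indicator_def)
    ultimately show ?thesis using iA by simp
  qed
  then show ?thesis
    using tendsto_add[OF part1 part2] by (simp add: A_def m_def)
qed

lemma L2_mult_integrable:
  fixes p q :: "pt \<Rightarrow> real"
  assumes "p \<in> borel_measurable borel" "q \<in> borel_measurable borel"
    and "square_integrable p" "square_integrable q"
  shows "integrable lborel (\<lambda>x. p x * q x)"
proof (rule Bochner_Integration.integrable_bound)
  show "integrable lborel (\<lambda>x. (p x)\<^sup>2 + (q x)\<^sup>2)" using assms by simp
  have "\<bar>p x * q x\<bar> \<le> (p x)\<^sup>2 + (q x)\<^sup>2" for x
  proof -
    have "0 \<le> \<bar>p x\<bar> * \<bar>q x\<bar>" by simp
    then show ?thesis using sum_squares_bound[of "\<bar>p x\<bar>" "\<bar>q x\<bar>"] unfolding abs_mult power2_abs by linarith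
  qed
  then show "AE x in lborel. norm (p x * q x) \<le> norm ((p x)\<^sup>2 + (q x)\<^sup>2)"
    by (intro AE_I2) simp
qed (use assms in simp)

lemma L2_Cauchy_Schwarz:
  fixes p q :: "pt \<Rightarrow> real"
  assumes m: "p \<in> borel_measurable borel" "q \<in> borel_measurable borel"
    and i: "square_integrable p" "square_integrable q"
  shows "(\<integral>x. p x * q x \<partial>lborel)\<^sup>2 \<le> sqnorm p * sqnorm q"
proof -
  define A B C where "A = sqnorm p" "B = (\<integral>x. p x * q x \<partial>lborel)" "C = sqnorm q"
  note pq = L2_mult_integrable[OF m i]
  have *: "0 \<le> A - 2 * t * B + t\<^sup>2 * C" for t
  proof -
    have "0 \<le> (\<integral>x. (p x - t * q x)\<^sup>2 \<partial>lborel)" by (rule Bochner_Integration.integral_nonneg) simp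
    also have "\<dots> = (\<integral>x. (p x)\<^sup>2 - 2 * t * (p x * q x) + t\<^sup>2 * (q x)\<^sup>2 \<partial>lborel)"
      by (simp add: power2_eq_square algebra_simps)
    also have "\<dots> = A - 2 * t * B + t\<^sup>2 * C"
      using i pq by (simp add: A_B_C_def)
    finally show ?thesis .
  qed
  have C: "C \<ge> 0" unfolding A_B_C_def by (rule Bochner_Integration.integral_nonneg) simp
  have "B\<^sup>2 \<le> A * C"
  proof (cases "C = 0")
    case True
    have "B = 0"
    proof (rule ccontr)
      assume "B \<noteq> 0"
      then have "2 * ((A + 1) / (2 * B)) * B = A + 1" by simp
      then show False using *[of "(A + 1) / (2 * B)"] True by simp
    qed
    then show ?thesis using True by simp
  next
    case False
    with C have "C > 0" by simp
    then show ?thesis using *[of "B / C"] by (simp add: field_simps power2_eq_square)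
  qed
  then show ?thesis by (simp add: A_B_C_def)
qed

lemma L2_limits:
  fixes a :: "nat \<Rightarrow> pt \<Rightarrow> real" and f w :: "pt \<Rightarrow> real"
  assumes a: "\<And>n. a n \<in> borel_measurable borel" "\<And>n. square_integrable (a n)"
    and f: "f \<in> borel_measurable borel" "square_integrable f"
    and lim: "(\<lambda>n. \<integral>x. (a n x - f x)\<^sup>2 \<partial>lborel) \<longlonglongrightarrow> 0"
  shows "w \<in> borel_measurable borel \<Longrightarrow> square_integrable w \<Longrightarrow>
      (\<lambda>n. \<integral>x. a n x * w x \<partial>lborel) \<longlonglongrightarrow> (\<integral>x. f x * w x \<partial>lborel)"
    and "(\<lambda>n. sqnorm (a n)) \<longlonglongrightarrow> sqnorm f"
proof -
  note [measurable] = a(1) f(1)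
  have id: "integrable lborel (\<lambda>x. (a n x - f x)\<^sup>2)" for n
  proof (rule Bochner_Integration.integrable_bound)
    show "integrable lborel (\<lambda>x. 2 * (a n x)\<^sup>2 + 2 * (f x)\<^sup>2)" using a f by simp
    have "(a n x - f x)\<^sup>2 \<le> 2 * (a n x)\<^sup>2 + 2 * (f x)\<^sup>2" for x
      using zero_le_power2[of "a n x + f x"] by (simp add: power2_eq_square algebra_simps)
    then show "AE x in lborel. norm ((a n x - f x)\<^sup>2) \<le> norm (2 * (a n x)\<^sup>2 + 2 * (f x)\<^sup>2)"
      by (intro AE_I2) simp
  qed simp
  have 1: "(\<lambda>n. \<integral>x. a n x * w x \<partial>lborel) \<longlonglongrightarrow> (\<integral>x. f x * w x \<partial>lborel)"
    if w[measurable]: "w \<in> borel_measurable borel" and w2: "square_integrable w" for w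
  proof -
    have "(\<lambda>n. (\<integral>x. (a n x - f x) * w x \<partial>lborel)\<^sup>2) \<longlonglongrightarrow> 0"
    proof (rule tendsto_sandwich[OF _ _ tendsto_const])
      show "(\<lambda>n. (\<integral>x. (a n x - f x)\<^sup>2 \<partial>lborel) * sqnorm w) \<longlonglongrightarrow> 0"
        using tendsto_mult_left_zero[OF lim] by simp
      show "\<forall>\<^sub>F n in sequentially. (\<integral>x. (a n x - f x) * w x \<partial>lborel)\<^sup>2 \<le> (\<integral>x. (a n x - f x)\<^sup>2 \<partial>lborel) * sqnorm w"
        using id w2 by (intro always_eventually allI L2_Cauchy_Schwarz) auto
    qed simp
    then have "(\<lambda>n. (\<integral>x. (a n x - f x) * w x \<partial>lborel)) \<longlonglongrightarrow> 0"
      using tendsto_real_sqrt by (fastforce intro: tendsto_rabs_zero_cancel)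
    moreover have "(\<integral>x. (a n x - f x) * w x \<partial>lborel) = (\<integral>x. a n x * w x \<partial>lborel) - (\<integral>x. f x * w x \<partial>lborel)" for n
      using L2_mult_integrable[OF a(1) w a(2) w2] L2_mult_integrable[OF f(1) w f(2) w2]
      by (simp add: left_diff_distrib)
    ultimately show ?thesis by (simp add: LIM_zero_iff)
  qed
  then show "w \<in> borel_measurable borel \<Longrightarrow> square_integrable w \<Longrightarrow>
      (\<lambda>n. \<integral>x. a n x * w x \<partial>lborel) \<longlonglongrightarrow> (\<integral>x. f x * w x \<partial>lborel)" .
  have "sqnorm (a n) = (\<integral>x. (a n x - f x)\<^sup>2 \<partial>lborel) + 2 * (\<integral>x. a n x * f x \<partial>lborel) - sqnorm f" for n
  proof -
    have "sqnorm (a n) = (\<integral>x. (a n x - f x)\<^sup>2 + 2 * (a n x * f x) - (f x)\<^sup>2 \<partial>lborel)"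
      by (simp add: power2_eq_square algebra_simps)
    then show ?thesis using id L2_mult_integrable[OF a(1) f(1) a(2) f(2)] f(2) by simp
  qed
  moreover have "(\<lambda>n. (\<integral>x. (a n x - f x)\<^sup>2 \<partial>lborel) + 2 * (\<integral>x. a n x * f x \<partial>lborel) - sqnorm f)
     \<longlonglongrightarrow> 0 + 2 * (\<integral>x. f x * f x \<partial>lborel) - sqnorm f"
    by (intro tendsto_intros lim 1 f)
  ultimately show "(\<lambda>n. sqnorm (a n)) \<longlonglongrightarrow> sqnorm f"
    by (simp add: power2_eq_square)
qed

text \<open>On the eroded set the mollifications are integrals against test functions, hence zero, and they converge to
  \<open>h\<close>.\<close>

lemma orthogonal_to_tests_imp_AE_zero:
  fixes h :: "pt \<Rightarrow> real"
  assumes S: "open S" "bounded S" and h: "h \<in> borel_measurable borel"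
    and z: "\<And>x. x \<notin> S \<Longrightarrow> h x = 0" and i2: "square_integrable h"
    and t: "\<And>\<phi>. test_function S \<phi> \<Longrightarrow> (\<integral>x. h x * \<phi> x \<partial>lborel) = 0"
  shows "AE x in lborel. h x = 0"
proof -
  have "\<forall>n. \<exists>\<eta>. mollifier (1 / real (Suc n)) \<eta>" using ex_mollifier by simp
  then obtain \<eta> where \<eta>: "\<And>n. mollifier (1 / real (Suc n)) (\<eta> n)" by metis
  have "moll h (\<eta> n 0 0) x = 0" if "x \<in> erode S (1 / real (Suc n))" for n x
    unfolding moll_def using that
    by (intro t mollifier_test_function(1)[OF \<eta>]) (simp add: erode_def)
  then have "(indicator (erode S (1 / real (Suc n))) x * moll h (\<eta> n 0 0) x - h x)\<^sup>2 = (h x)\<^sup>2" for n x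
    by (auto simp: indicator_def)
  then have "(\<lambda>n::nat. sqnorm h) \<longlonglongrightarrow> 0"
    using moll_L2_convergence[OF S h z i2 \<eta>] by simp
  then have "sqnorm h = 0" by (simp add: LIMSEQ_const_iff)
  then have "AE x in lborel. (h x)\<^sup>2 = 0"
    using integral_nonneg_eq_0_iff_AE[OF i2] by simp
  then show ?thesis by simp
qed

text \<open>\<open>f'\<close> is a Borel version of the extension of \<open>f\<close> by zero, so that integrals of \<open>f\<close> over \<open>S\<close> become integrals of
  \<open>f'\<close> over the plane.\<close>

definition represents :: "pt set \<Rightarrow> (pt \<Rightarrow> real) \<Rightarrow> (pt \<Rightarrow> real) \<Rightarrow> bool" where
  "represents S f f' \<longleftrightarrow> f \<in> borel_measurable (lebesgue_on S) \<and> f' \<in> borel_measurable borel \<and>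
     (\<forall>x. x \<notin> S \<longrightarrow> f' x = 0) \<and> (AE x in lborel. x \<in> S \<longrightarrow> f x = f' x)"

lemma represents_integral:
  assumes S: "open S" and r: "represents S f f'" and k: "k \<in> borel_measurable borel"
  shows "integral\<^sup>L (lebesgue_on S) (\<lambda>x. f x * k x) = (\<integral>x. f' x * k x \<partial>lborel)"
proof -
  have "integral\<^sup>L (lebesgue_on S) (\<lambda>x. f x * k x) = (\<integral>x. indicator S x * (f' x * k x) \<partial>lborel)"
    by (rule integral_lebesgue_on_eq_lborel)
      (use r k S borel_imp_measurable_lebesgue_on[OF k, of S] in \<open>auto simp: represents_def\<close>)
  also have "(\<lambda>x. indicator S x * (f' x * k x)) = (\<lambda>x. f' x * k x)"
    using r by (auto simp: represents_def indicator_def fun_eq_iff)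
  finally show ?thesis .
qed

lemma represents_square:
  assumes S: "open S" and r: "represents S f f'"
  shows "integral\<^sup>L (lebesgue_on S) (\<lambda>x. (f x)\<^sup>2) = sqnorm f'"
    and "integrable (lebesgue_on S) (\<lambda>x. (f x)\<^sup>2) \<longleftrightarrow> square_integrable f'"
proof -
  have *: "S \<in> sets borel" "(\<lambda>x. (f x)\<^sup>2) \<in> borel_measurable (lebesgue_on S)" "(\<lambda>x. (f' x)\<^sup>2) \<in> borel_measurable borel"
    "AE x in lborel. x \<in> S \<longrightarrow> (f x)\<^sup>2 = (f' x)\<^sup>2"
    using r S by (auto simp: represents_def)
  have e: "(\<lambda>x. indicator S x * (f' x)\<^sup>2) = (\<lambda>x. (f' x)\<^sup>2)"
    using r by (auto simp: represents_def indicator_def fun_eq_iff)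
  show "integral\<^sup>L (lebesgue_on S) (\<lambda>x. (f x)\<^sup>2) = sqnorm f'"
    "integrable (lebesgue_on S) (\<lambda>x. (f x)\<^sup>2) \<longleftrightarrow> square_integrable f'"
    using integral_lebesgue_on_eq_lborel[OF *] by (simp_all add: e)
qed

lemma represents_self:
  assumes "f \<in> borel_measurable borel" "\<And>x. x \<notin> S \<Longrightarrow> f x = 0"
  shows "represents S f f"
  using assms borel_imp_measurable_lebesgue_on by (auto simp: represents_def)

lemma represents_weak_deriv:
  assumes S: "open S" and f: "represents S f f'" and g: "represents S g g'"
  shows "is_weak_deriv S \<alpha> f g \<longleftrightarrow> (\<forall>\<phi>. test_function S \<phi> \<longrightarrow>
     (\<integral>x. f' x * mixed_deriv \<alpha> \<phi> x \<partial>lborel) = (-1) ^ mi_order \<alpha> * (\<integral>x. g' x * \<phi> x \<partial>lborel))"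
proof -
  have "integral\<^sup>L (lebesgue_on S) (\<lambda>x. f x * mixed_deriv \<alpha> \<phi> x) = (\<integral>x. f' x * mixed_deriv \<alpha> \<phi> x \<partial>lborel)"
    "integral\<^sup>L (lebesgue_on S) (\<lambda>x. g x * \<phi> x) = (\<integral>x. g' x * \<phi> x \<partial>lborel)" if "test_function S \<phi>" for \<phi>
    using test_function_continuous[OF that] test_function_continuous[OF test_function_mixed_deriv[OF that, of \<alpha>]]
    by (auto intro!: represents_integral S f g borel_measurable_continuous_onI)
  then show ?thesis by (auto simp: is_weak_deriv_def)
qed

text \<open>A square-integrable function together with its weak derivatives up to order \<open>m\<close>. Fixing representatives once
  and for all avoids the choice made by \<^const>\<open>weak_deriv\<close>.\<close>

definition weak_family :: "nat \<Rightarrow> pt set \<Rightarrow> (nat \<Rightarrow> nat \<Rightarrow> pt \<Rightarrow> real) \<Rightarrow> bool" where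
  "weak_family m S G \<longleftrightarrow> (\<forall>i j. i + j \<le> m \<longrightarrow>
     G i j \<in> borel_measurable borel \<and> (\<forall>x. x \<notin> S \<longrightarrow> G i j x = 0) \<and> square_integrable (G i j) \<and>
     (\<forall>\<phi>. test_function S \<phi> \<longrightarrow>
        (\<integral>x. G 0 0 x * mixed_deriv (i, j) \<phi> x \<partial>lborel) = (-1) ^ (i + j) * (\<integral>x. G i j x * \<phi> x \<partial>lborel)))"

lemma weak_familyD:
  assumes "weak_family m S G" "i + j \<le> m"
  shows "G i j \<in> borel_measurable borel" "x \<notin> S \<Longrightarrow> G i j x = 0" "square_integrable (G i j)"
    "test_function S \<phi> \<Longrightarrow>
        (\<integral>x. G 0 0 x * mixed_deriv (i, j) \<phi> x \<partial>lborel) = (-1) ^ (i + j) * (\<integral>x. G i j x * \<phi> x \<partial>lborel)"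
proof -
  note * = assms(1)[unfolded weak_family_def, THEN spec, THEN spec, THEN mp, OF assms(2)]
  show "G i j \<in> borel_measurable borel" "square_integrable (G i j)" using * by simp_all
  show "x \<notin> S \<Longrightarrow> G i j x = 0" using * by simp
  show "test_function S \<phi> \<Longrightarrow>
        (\<integral>x. G 0 0 x * mixed_deriv (i, j) \<phi> x \<partial>lborel) = (-1) ^ (i + j) * (\<integral>x. G i j x * \<phi> x \<partial>lborel)"
    using * by simp
qed

lemma weak_family_integrable:
  assumes "open S" "bounded S" "weak_family m S G" "i + j \<le> m"
  shows "integrable lborel (G i j)"
proof (rule L2_imp_integrable[OF _ assms(2)])
  show "S \<in> sets borel" using assms(1) by simp
qed (rule weak_familyD(1-3)[OF assms(3,4)]; assumption)+

lemma sobolev_imp_weak_family: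
  assumes S: "open S" and f: "sobolev m S f"
  obtains G where "weak_family m S G" "represents S f (G 0 0)"
proof -
  have "\<exists>g. L2_on S g \<and> is_weak_deriv S (i, j) f g \<and> (i = 0 \<and> j = 0 \<longrightarrow> g = f)" if "i + j \<le> m" for i j
  proof (cases "i = 0 \<and> j = 0")
    case True
    have "is_weak_deriv S (0, 0) f f" by (simp add: is_weak_deriv_def mixed_deriv_def mi_order_def)
    then show ?thesis using True f by (auto simp: sobolev_def)
  next
    case False
    then show ?thesis using f that by (fastforce simp: sobolev_def mi_order_def)
  qed
  then obtain g where g: "\<And>i j. i + j \<le> m \<Longrightarrow> L2_on S (g i j) \<and> is_weak_deriv S (i, j) f (g i j) \<and> (i = 0 \<and> j = 0 \<longrightarrow> g i j = f)"
    by metis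
  have "\<exists>G. represents S (g i j) G" if "i + j \<le> m" for i j
    using ex_borel_representative[of S "g i j"] g[OF that] S by (auto simp: L2_on_def represents_def)
  then obtain G where G: "\<And>i j. i + j \<le> m \<Longrightarrow> represents S (g i j) (G i j)" by metis
  have G0: "represents S f (G 0 0)" using G[of 0 0] g[of 0 0] by simp
  have "weak_family m S G"
    unfolding weak_family_def
  proof (intro allI impI)
    fix i j assume ij: "i + j \<le> m"
    have "is_weak_deriv S (i, j) f (g i j)" using g[OF ij] by blast
    then show "G i j \<in> borel_measurable borel \<and> (\<forall>x. x \<notin> S \<longrightarrow> G i j x = 0) \<and> square_integrable (G i j) \<and>
     (\<forall>\<phi>. test_function S \<phi> \<longrightarrow>
        (\<integral>x. G 0 0 x * mixed_deriv (i, j) \<phi> x \<partial>lborel) = (-1) ^ (i + j) * (\<integral>x. G i j x * \<phi> x \<partial>lborel))"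
      using represents_weak_deriv[OF S G0 G[OF ij], of "(i, j)"] G[OF ij] g[OF ij]
        represents_square(2)[OF S G[OF ij]]
      by (auto simp: represents_def L2_on_def mi_order_def)
  qed
  then show ?thesis using G0 that by blast
qed

lemma weak_family_is_weak_deriv:
  assumes S: "open S" and G: "weak_family m S G" and f: "represents S f (G 0 0)" and ij: "i + j \<le> m"
  shows "L2_on S (G i j)" "is_weak_deriv S (i, j) f (G i j)"
proof -
  have r: "represents S (G i j) (G i j)" by (rule represents_self) (rule weak_familyD(1,2)[OF G ij]; assumption)+
  then show "L2_on S (G i j)"
    using weak_familyD(3)[OF G ij] represents_square(2)[OF S r] by (auto simp: L2_on_def represents_def)
  show "is_weak_deriv S (i, j) f (G i j)"
    using represents_weak_deriv[OF S f r] weak_familyD(4)[OF G ij] by (simp add: mi_order_def)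
qed

lemma weak_family_imp_sobolev:
  assumes S: "open S" and G: "weak_family m S G" and f: "represents S f (G 0 0)"
  shows "sobolev m S f"
proof -
  have "L2_on S f"
    using f represents_square(2)[OF S f] weak_familyD(3)[OF G, of 0 0] by (auto simp: L2_on_def represents_def)
  then show ?thesis
    using weak_family_is_weak_deriv[OF S G f] by (fastforce simp: sobolev_def mi_order_def)
qed

text \<open>Weak derivatives are unique up to null sets by \<open>orthogonal_to_tests_imp_AE_zero\<close>, so any family computes the
  seminorm.\<close>

lemma weak_family_seminorm:
  assumes S: "open S" "bounded S" and G: "weak_family m S G" and f: "represents S f (G 0 0)" and l: "l \<le> m"
  shows "sobolev_seminorm l S f = sqrt (\<Sum>(i, j) | i + j = l. sqnorm (G i j))"
proof -
  have "integral\<^sup>L (lebesgue_on S) (\<lambda>x. (weak_deriv S (i, j) f x)\<^sup>2) = sqnorm (G i j)" if ij: "i + j = l" for i j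
  proof -
    have ijm: "i + j \<le> m" using ij l by simp
    let ?w = "weak_deriv S (i, j) f"
    have w: "L2_on S ?w \<and> is_weak_deriv S (i, j) f ?w"
      using someI[of "\<lambda>g. L2_on S g \<and> is_weak_deriv S (i, j) f g" "G i j"]
        weak_family_is_weak_deriv[OF S(1) G f ijm]
      unfolding weak_deriv_def by blast
    obtain w' where w': "represents S ?w w'"
      using ex_borel_representative[of S ?w] w S by (auto simp: L2_on_def represents_def)
    have weak: "(\<integral>x. G 0 0 x * mixed_deriv (i, j) \<phi> x \<partial>lborel) = (-1) ^ (i + j) * (\<integral>x. w' x * \<phi> x \<partial>lborel)"
      if "test_function S \<phi>" for \<phi>
      using represents_weak_deriv[OF S(1) f w'] w that by (simp add: mi_order_def)
    have w'2: "square_integrable w'"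
      using represents_square(2)[OF S(1) w'] w by (simp add: L2_on_def)
    have g: "G i j \<in> borel_measurable borel" "\<And>x. x \<notin> S \<Longrightarrow> G i j x = 0" "square_integrable (G i j)"
      by (rule weak_familyD(1-3)[OF G ijm]; assumption)+
    have wb: "w' \<in> borel_measurable borel" "\<And>x. x \<notin> S \<Longrightarrow> w' x = 0" using w' by (auto simp: represents_def)
    have "AE x in lborel. w' x - G i j x = 0"
    proof (rule orthogonal_to_tests_imp_AE_zero[OF S])
      show "integrable lborel (\<lambda>x. (w' x - G i j x)\<^sup>2)"
      proof (rule Bochner_Integration.integrable_bound)
        show "integrable lborel (\<lambda>x. 2 * (w' x)\<^sup>2 + 2 * (G i j x)\<^sup>2)" using g(3) w'2 by simp
        have "(w' x - G i j x)\<^sup>2 \<le> 2 * (w' x)\<^sup>2 + 2 * (G i j x)\<^sup>2" for x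
          using zero_le_power2[of "w' x + G i j x"] by (simp add: power2_eq_square algebra_simps)
        then show "AE x in lborel. norm ((w' x - G i j x)\<^sup>2) \<le> norm (2 * (w' x)\<^sup>2 + 2 * (G i j x)\<^sup>2)"
          by (intro AE_I2) simp
      qed (use g(1) wb(1) in simp)
      fix \<phi> assume t: "test_function S \<phi>"
      have iw: "integrable lborel w'" using S by (intro L2_imp_integrable[OF _ S(2) wb w'2]) auto
      have "(\<integral>x. G i j x * \<phi> x \<partial>lborel) = (\<integral>x. w' x * \<phi> x \<partial>lborel)"
        using weak[OF t] weak_familyD(4)[OF G ijm t] by simp
      then show "(\<integral>x. (w' x - G i j x) * \<phi> x \<partial>lborel) = 0"
        using integrable_mult_test[OF weak_family_integrable[OF S G ijm] t] integrable_mult_test[OF iw t]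
        by (simp add: left_diff_distrib)
    qed (use g(1,2) wb(1,2) in \<open>simp_all\<close>)
    then have "AE x in lborel. (w' x)\<^sup>2 = (G i j x)\<^sup>2" by eventually_elim simp
    then have "sqnorm w' = sqnorm (G i j)"
      using g(1) wb(1) by (intro integral_cong_AE) auto
    then show ?thesis using represents_square(1)[OF S(1) w'] by simp
  qed
  then have "(\<Sum>\<alpha> | mi_order \<alpha> = l. integral\<^sup>L (lebesgue_on S) (\<lambda>x. (weak_deriv S \<alpha> f x)\<^sup>2))
    = (\<Sum>(i, j) | i + j = l. sqnorm (G i j))"
    by (intro sum.cong) (auto simp: mi_order_def)
  then show ?thesis by (simp add: sobolev_seminorm_def)
qed

section \<open>Poincare and Sobolev inequalities on convex sets\<close>

text \<open>A contraction towards a point of a convex set maps the set into itself; it scales area by \<open>t\<^sup>2\<close>.\<close>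

lemma nn_integral_contraction:
  fixes \<phi> :: "pt \<Rightarrow> ennreal"
  assumes [measurable]: "\<phi> \<in> borel_measurable borel" "D \<in> sets borel"
    and D: "convex D" and y: "y \<in> D" and t: "0 < t" "t \<le> 1"
  shows "(\<integral>\<^sup>+x. indicator D x * \<phi> ((1 - t) *\<^sub>R y + t *\<^sub>R x) \<partial>lborel)
     \<le> ennreal (1 / t\<^sup>2) * (\<integral>\<^sup>+z. indicator D z * \<phi> z \<partial>lborel)"
proof -
  define f where "f z = indicator D z * \<phi> z" for z
  have [measurable]: "f \<in> borel_measurable borel" unfolding f_def by measurable
  have "(\<integral>\<^sup>+x. indicator D x * \<phi> ((1 - t) *\<^sub>R y + t *\<^sub>R x) \<partial>lborel) \<le> (\<integral>\<^sup>+x. f ((1 - t) *\<^sub>R y + t *\<^sub>R x) \<partial>lborel)"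
  proof (rule nn_integral_mono)
    fix x
    have "(1 - t) *\<^sub>R y + t *\<^sub>R x \<in> D" if "x \<in> D" using D y that t by (simp add: convex_alt)
    then show "indicator D x * \<phi> ((1 - t) *\<^sub>R y + t *\<^sub>R x) \<le> f ((1 - t) *\<^sub>R y + t *\<^sub>R x)"
      by (auto simp: f_def indicator_def)
  qed
  also have "\<dots> = ennreal (1 / t\<^sup>2) * (ennreal (t\<^sup>2) * (\<integral>\<^sup>+x. f ((1 - t) *\<^sub>R y + t *\<^sub>R x) \<partial>lborel))"
    using t by (simp add: mult.assoc[symmetric] ennreal_mult[symmetric])
  also have "ennreal (t\<^sup>2) * (\<integral>\<^sup>+x. f ((1 - t) *\<^sub>R y + t *\<^sub>R x) \<partial>lborel) = (\<integral>\<^sup>+z. f z \<partial>lborel)"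
    using t by (subst nn_integral_lborel_affine[of f t "(1 - t) *\<^sub>R y"]) auto
  finally show ?thesis by (simp add: f_def)
qed

lemma square_integral_le_01:
  fixes f :: "real \<Rightarrow> real"
  assumes c: "continuous_on {0..1} f"
  shows "(integral {0..1} f)\<^sup>2 \<le> integral {0..1} (\<lambda>t. (f t)\<^sup>2)"
proof -
  define m where "m = integral {0..1} f"
  have i: "f integrable_on {0..1}" "(\<lambda>t. (f t)\<^sup>2) integrable_on {0..1}"
    using c by (auto intro!: integrable_continuous_interval continuous_intros)
  have "0 \<le> integral {0..1} (\<lambda>t. (f t - m)\<^sup>2)"
    by (rule integral_nonneg) (auto intro!: integrable_continuous_interval continuous_intros c)
  also have "\<dots> = integral {0..1} (\<lambda>t. (f t)\<^sup>2 - 2 * m * f t + m\<^sup>2)"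
    by (simp add: power2_eq_square algebra_simps)
  also have "\<dots> = integral {0..1} (\<lambda>t. (f t)\<^sup>2) - 2 * m * m + m\<^sup>2"
  proof (rule integral_unique)
    have "((\<lambda>t. (f t)\<^sup>2 - 2 * m * f t + m\<^sup>2) has_integral integral {0..1} (\<lambda>t. (f t)\<^sup>2) - 2 * m * m + measure lborel {0..1::real} *\<^sub>R m\<^sup>2) {0..1}"
      unfolding m_def by (intro has_integral_add has_integral_diff has_integral_mult_right integrable_integral i has_integral_const_real)
    then show "((\<lambda>t. (f t)\<^sup>2 - 2 * m * f t + m\<^sup>2) has_integral integral {0..1} (\<lambda>t. (f t)\<^sup>2) - 2 * m * m + m\<^sup>2) {0..1}"
      by simp
  qed
  finally show ?thesis by (simp add: m_def power2_eq_square)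
qed

lemma nn_integral_01:
  fixes f :: "real \<Rightarrow> real"
  assumes c: "continuous_on {0..1} f" and nn: "\<And>t. t \<in> {0..1} \<Longrightarrow> f t \<ge> 0"
  shows "(\<integral>\<^sup>+t. indicator {0..1} t * ennreal (f t) \<partial>lborel) = ennreal (integral {0..1} f)"
proof -
  have i: "integrable lborel (\<lambda>t. indicator {0..1} t *\<^sub>R f t)"
    using c by (intro borel_integrable_compact) auto
  have "(\<integral>\<^sup>+t. indicator {0..1} t * ennreal (f t) \<partial>lborel) = (\<integral>\<^sup>+t. ennreal (indicator {0..1} t *\<^sub>R f t) \<partial>lborel)"
    by (intro nn_integral_cong) (auto simp: indicator_def)
  also have "\<dots> = ennreal (\<integral>t. indicator {0..1} t *\<^sub>R f t \<partial>lborel)"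
    using nn by (intro nn_integral_eq_integral i) (auto simp: indicator_def)
  also have "(\<integral>t. indicator {0..1} t *\<^sub>R f t \<partial>lborel) = integral {0..1} f"
    using set_borel_integral_eq_integral(2)[of "{0..1}" f] i
    by (simp add: set_integrable_def set_lebesgue_integral_def)
  finally show ?thesis .
qed

definition partials :: "(pt \<Rightarrow> real) \<Rightarrow> (pt \<Rightarrow> real) \<Rightarrow> (pt \<Rightarrow> real) \<Rightarrow> bool" where
  "partials w w1 w2 \<longleftrightarrow> (\<forall>x. (w has_derivative (\<lambda>h. w1 x * h $ 1 + w2 x * h $ 2)) (at x))"

lemma partials_continuous: "partials w w1 w2 \<Longrightarrow> continuous_on UNIV w"
  unfolding partials_def by (meson has_derivative_continuous continuous_at_imp_continuous_on)

lemma partials_line: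
  assumes "partials w w1 w2"
  shows "((\<lambda>t. w ((1 - t) *\<^sub>R y + t *\<^sub>R x)) has_real_derivative
    w1 ((1 - t) *\<^sub>R y + t *\<^sub>R x) * (x - y) $ 1 + w2 ((1 - t) *\<^sub>R y + t *\<^sub>R x) * (x - y) $ 2) (at t within S)"
proof -
  have "((\<lambda>t. (1 - t) *\<^sub>R y + t *\<^sub>R x) has_derivative (\<lambda>s. s *\<^sub>R (x - y))) (at t within S)"
    by (auto intro!: derivative_eq_intros simp: algebra_simps)
  then have "((\<lambda>t. w ((1 - t) *\<^sub>R y + t *\<^sub>R x)) has_derivative
     (\<lambda>s. w1 ((1 - t) *\<^sub>R y + t *\<^sub>R x) * (s *\<^sub>R (x - y)) $ 1 + w2 ((1 - t) *\<^sub>R y + t *\<^sub>R x) * (s *\<^sub>R (x - y)) $ 2)) (at t within S)"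
    by (rule has_derivative_compose) (use assms in \<open>simp add: partials_def\<close>)
  then show ?thesis
    by (rule has_derivative_imp_has_field_derivative) (simp add: algebra_simps)
qed

lemma continuous_on_line:
  assumes "continuous_on UNIV (f :: pt \<Rightarrow> real)"
  shows "continuous_on S (\<lambda>t. f ((1 - t) *\<^sub>R y + t *\<^sub>R x))"
  by (rule continuous_on_compose2[OF assms]) (auto intro!: continuous_intros)

lemma norm_real2: "(norm (v::pt))\<^sup>2 = (v $ 1)\<^sup>2 + (v $ 2)\<^sup>2"
  by (simp add: norm_vec_def L2_set_def sum_2)

lemma directional_square_le:
  fixes a b :: real
  shows "(a * (v::pt) $ 1 + b * v $ 2)\<^sup>2 \<le> (norm v)\<^sup>2 * (a\<^sup>2 + b\<^sup>2)"
proof -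
  have "(norm v)\<^sup>2 * (a\<^sup>2 + b\<^sup>2) - (a * v $ 1 + b * v $ 2)\<^sup>2 = (a * v $ 2 - b * v $ 1)\<^sup>2"
    unfolding norm_real2 by (simp add: power2_eq_square algebra_simps)
  then show ?thesis by (metis diff_ge_0_iff_ge zero_le_power2)
qed

lemma difference_square_le_line_integral:
  assumes w: "partials w w1 w2" and c: "continuous_on UNIV w1" "continuous_on UNIV w2" and h: "norm (x - y) \<le> h"
  shows "ennreal ((w x - w y)\<^sup>2) \<le> ennreal (h\<^sup>2) *
     (\<integral>\<^sup>+t. indicator {0..1} t * ennreal ((w1 ((1 - t) *\<^sub>R y + t *\<^sub>R x))\<^sup>2 + (w2 ((1 - t) *\<^sub>R y + t *\<^sub>R x))\<^sup>2) \<partial>lborel)"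
proof -
  let ?p = "\<lambda>t. (1 - t) *\<^sub>R y + t *\<^sub>R x"
  let ?g' = "\<lambda>t. w1 (?p t) * (x - y) $ 1 + w2 (?p t) * (x - y) $ 2"
  let ?\<Phi> = "\<lambda>t. (w1 (?p t))\<^sup>2 + (w2 (?p t))\<^sup>2"
  have cp: "continuous_on {0..1} (\<lambda>t. w1 (?p t))" "continuous_on {0..1} (\<lambda>t. w2 (?p t))"
    by (intro continuous_on_line c)+
  then have cg: "continuous_on {0..1} ?g'" and c\<Phi>: "continuous_on {0..1} ?\<Phi>" by (intro continuous_intros; simp)+
  have "(?g' has_integral w (?p 1) - w (?p 0)) {0..1}"
    by (rule fundamental_theorem_of_calculus)
      (use partials_line[OF w] in \<open>auto simp: has_real_derivative_iff_has_vector_derivative[symmetric]\<close>)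
  then have "(w x - w y)\<^sup>2 = (integral {0..1} ?g')\<^sup>2" by (simp add: integral_unique)
  also have "\<dots> \<le> integral {0..1} (\<lambda>t. (?g' t)\<^sup>2)" by (rule square_integral_le_01[OF cg])
  also have "\<dots> \<le> integral {0..1} (\<lambda>t. h\<^sup>2 * ?\<Phi> t)"
  proof (rule integral_le)
    show "(\<lambda>t. (?g' t)\<^sup>2) integrable_on {0..1}" "(\<lambda>t. h\<^sup>2 * ?\<Phi> t) integrable_on {0..1}"
      by (rule integrable_continuous_interval[OF continuous_on_power[OF cg]])
        (rule integrable_continuous_interval[OF continuous_on_mult_left[OF c\<Phi>]])
    fix t
    have "(norm (x - y))\<^sup>2 \<le> h\<^sup>2" using h by (intro power_mono) auto
    then have "(norm (x - y))\<^sup>2 * ?\<Phi> t \<le> h\<^sup>2 * ?\<Phi> t" by (intro mult_right_mono) auto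
    then show "(?g' t)\<^sup>2 \<le> h\<^sup>2 * ?\<Phi> t"
      using directional_square_le[of "w1 (?p t)" "x - y" "w2 (?p t)"] by linarith
  qed
  also have "\<dots> = h\<^sup>2 * integral {0..1} ?\<Phi>" by simp
  finally have "ennreal ((w x - w y)\<^sup>2) \<le> ennreal (h\<^sup>2 * integral {0..1} ?\<Phi>)" by (rule ennreal_leI)
  also have "\<dots> = ennreal (h\<^sup>2) * ennreal (integral {0..1} ?\<Phi>)"
    by (rule ennreal_mult) (auto intro!: integral_nonneg integrable_continuous_interval c\<Phi>)
  also have "ennreal (integral {0..1} ?\<Phi>) = (\<integral>\<^sup>+t. indicator {0..1} t * ennreal (?\<Phi> t) \<partial>lborel)"
    by (rule nn_integral_01[OF c\<Phi>, symmetric]) simp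
  finally show ?thesis .
qed

lemma integrable_indicator_continuous:
  fixes f :: "pt \<Rightarrow> real"
  assumes "D \<in> sets borel" "bounded D" "continuous_on UNIV f"
  shows "integrable lborel (\<lambda>x. indicator D x * f x)"
proof -
  have "compact (closure D)" using assms(2) by simp
  then have "integrable lborel (\<lambda>x. indicator (closure D) x *\<^sub>R f x)"
    by (rule borel_integrable_compact) (rule continuous_on_subset[OF assms(3)], simp)
  then have "integrable lborel (\<lambda>x. indicator D x *\<^sub>R (indicator (closure D) x *\<^sub>R f x))"
    by (rule integrable_mult_indicator[rotated]) (use assms in auto)
  moreover have "(\<lambda>x. indicator D x *\<^sub>R (indicator (closure D) x *\<^sub>R f x)) = (\<lambda>x. indicator D x * f x)"
    using closure_subset[of D] by (auto simp: indicator_def fun_eq_iff)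
  ultimately show ?thesis by (simp only:)
qed

lemma nn_integral_indicator_continuous:
  fixes f :: "pt \<Rightarrow> real"
  assumes "D \<in> sets borel" "bounded D" "continuous_on UNIV f" "\<And>x. f x \<ge> 0"
  shows "(\<integral>\<^sup>+x. indicator D x * ennreal (f x) \<partial>lborel) = ennreal (\<integral>x. indicator D x * f x \<partial>lborel)"
proof -
  have "(\<integral>\<^sup>+x. indicator D x * ennreal (f x) \<partial>lborel) = (\<integral>\<^sup>+x. ennreal (indicator D x * f x) \<partial>lborel)"
    by (intro nn_integral_cong) (auto simp: indicator_def)
  also have "\<dots> = ennreal (\<integral>x. indicator D x * f x \<partial>lborel)"
    using assms(4) by (intro nn_integral_eq_integral integrable_indicator_continuous assms) auto
  finally show ?thesis .
qed

text \<open>On the half of the segment that is close to \<open>x\<close> one substitutes for \<open>x\<close>, on the other half for \<open>y\<close>. The scaling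
  factor in \<open>nn_integral_contraction\<close> is then at most 4 throughout.\<close>

lemma integral_segments_le:
  fixes \<Phi> :: "pt \<Rightarrow> real"
  assumes D[measurable]: "D \<in> sets borel" and cD: "convex D"
    and [measurable]: "\<Phi> \<in> borel_measurable borel"
  shows "(\<integral>\<^sup>+x. indicator D x * (\<integral>\<^sup>+y. indicator D y *
       (\<integral>\<^sup>+t. indicator {0..1} t * ennreal (\<Phi> ((1 - t) *\<^sub>R y + t *\<^sub>R x)) \<partial>lborel) \<partial>lborel) \<partial>lborel)
     \<le> 4 * emeasure lborel D * (\<integral>\<^sup>+z. indicator D z * ennreal (\<Phi> z) \<partial>lborel)" (is "?T \<le> 4 * ?V * ?I")
proof -
  let ?k = "\<lambda>x y t. indicator D x * (indicator D y * (indicator {0..1::real} t * ennreal (\<Phi> ((1 - t) *\<^sub>R y + t *\<^sub>R x))))"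
  have "?T = (\<integral>\<^sup>+x. \<integral>\<^sup>+y. \<integral>\<^sup>+t. ?k x y t \<partial>lborel \<partial>lborel \<partial>lborel)"
    by (simp add: nn_integral_cmult)
  also have "\<dots> = (\<integral>\<^sup>+x. \<integral>\<^sup>+t. \<integral>\<^sup>+y. ?k x y t \<partial>lborel \<partial>lborel \<partial>lborel)"
    by (intro nn_integral_cong lborel_pair.Fubini') measurable
  also have "\<dots> = (\<integral>\<^sup>+t. \<integral>\<^sup>+x. \<integral>\<^sup>+y. ?k x y t \<partial>lborel \<partial>lborel \<partial>lborel)"
    by (intro lborel_pair.Fubini') measurable
  also have "\<dots> \<le> (\<integral>\<^sup>+t. indicator {0..1::real} t * (4 * ?V * ?I) \<partial>lborel)"
  proof (rule nn_integral_mono)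
    fix t :: real
    consider "t \<notin> {0..1}" | "0 \<le> t" "t < 1/2" | "1/2 \<le> t" "t \<le> 1" by force
    then show "(\<integral>\<^sup>+x. \<integral>\<^sup>+y. ?k x y t \<partial>lborel \<partial>lborel) \<le> indicator {0..1} t * (4 * ?V * ?I)"
    proof cases
      case 1
      then show ?thesis by simp
    next
      case 2
      have s: "1 / (1 - t)\<^sup>2 \<le> 4"
      proof -
        have "(1/2)\<^sup>2 \<le> (1 - t)\<^sup>2" using 2 by (intro power_mono) auto
        then show ?thesis using 2 by (simp add: field_simps power2_eq_square)
      qed
      have "(\<integral>\<^sup>+x. \<integral>\<^sup>+y. ?k x y t \<partial>lborel \<partial>lborel) =
         (\<integral>\<^sup>+x. indicator D x * (\<integral>\<^sup>+y. indicator D y * ennreal (\<Phi> ((1 - (1 - t)) *\<^sub>R x + (1 - t) *\<^sub>R y)) \<partial>lborel) \<partial>lborel)"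
        using 2 by (simp add: nn_integral_cmult add.commute)
      also have "\<dots> \<le> (\<integral>\<^sup>+x. indicator D x * (4 * ?I) \<partial>lborel)"
      proof (rule nn_integral_mono)
        fix x
        show "indicator D x * (\<integral>\<^sup>+y. indicator D y * ennreal (\<Phi> ((1 - (1 - t)) *\<^sub>R x + (1 - t) *\<^sub>R y)) \<partial>lborel) \<le> indicator D x * (4 * ?I)"
        proof (cases "x \<in> D")
          case True
          have "(\<integral>\<^sup>+y. indicator D y * ennreal (\<Phi> ((1 - (1 - t)) *\<^sub>R x + (1 - t) *\<^sub>R y)) \<partial>lborel) \<le> ennreal (1 / (1 - t)\<^sup>2) * ?I"
            by (rule nn_integral_contraction[of "\<lambda>z. ennreal (\<Phi> z)", OF _ D cD True]) (use 2 in auto)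
          also have "\<dots> \<le> 4 * ?I"
            using ennreal_leI[OF s] by (intro mult_right_mono) auto
          finally show ?thesis using True by simp
        qed simp
      qed
      also have "\<dots> = 4 * ?V * ?I"
        by (simp add: nn_integral_multc mult_ac)
      finally show ?thesis using 2 by simp
    next
      case 3
      have s: "1 / t\<^sup>2 \<le> 4"
      proof -
        have "(1/2)\<^sup>2 \<le> t\<^sup>2" using 3 by (intro power_mono) auto
        then show ?thesis using 3 by (simp add: field_simps power2_eq_square)
      qed
      have "(\<integral>\<^sup>+x. \<integral>\<^sup>+y. ?k x y t \<partial>lborel \<partial>lborel) = (\<integral>\<^sup>+y. \<integral>\<^sup>+x. ?k x y t \<partial>lborel \<partial>lborel)"
        by (intro lborel_pair.Fubini') measurable
      also have "\<dots> = (\<integral>\<^sup>+y. indicator D y * (\<integral>\<^sup>+x. indicator D x * ennreal (\<Phi> ((1 - t) *\<^sub>R y + t *\<^sub>R x)) \<partial>lborel) \<partial>lborel)"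
        using 3 by (simp add: nn_integral_cmult[symmetric] mult_ac)
      also have "\<dots> \<le> (\<integral>\<^sup>+y. indicator D y * (4 * ?I) \<partial>lborel)"
      proof (rule nn_integral_mono)
        fix y
        show "indicator D y * (\<integral>\<^sup>+x. indicator D x * ennreal (\<Phi> ((1 - t) *\<^sub>R y + t *\<^sub>R x)) \<partial>lborel) \<le> indicator D y * (4 * ?I)"
        proof (cases "y \<in> D")
          case True
          have "(\<integral>\<^sup>+x. indicator D x * ennreal (\<Phi> ((1 - t) *\<^sub>R y + t *\<^sub>R x)) \<partial>lborel) \<le> ennreal (1 / t\<^sup>2) * ?I"
            by (rule nn_integral_contraction[of "\<lambda>z. ennreal (\<Phi> z)", OF _ D cD True]) (use 3 in auto)
          also have "\<dots> \<le> 4 * ?I"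
            using ennreal_leI[OF s] by (intro mult_right_mono) auto
          finally show ?thesis using True by simp
        qed simp
      qed
      also have "\<dots> = 4 * ?V * ?I"
        by (simp add: nn_integral_multc mult_ac)
      finally show ?thesis using 3 by simp
    qed
  qed
  also have "\<dots> = 4 * ?V * ?I"
    by (simp add: nn_integral_multc)
  finally show ?thesis .
qed

text \<open>The left-hand side is half the double integral of \<open>(w x - w y)\<^sup>2\<close>, and each difference is an integral of the
  gradient along the segment from \<open>y\<close> to \<open>x\<close>.\<close>

lemma poincare_smooth:
  assumes D: "D \<in> sets borel" "bounded D" "convex D" and h: "\<And>x y. x \<in> D \<Longrightarrow> y \<in> D \<Longrightarrow> norm (x - y) \<le> h"
    and w: "partials w w1 w2" and c: "continuous_on UNIV w1" "continuous_on UNIV w2"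
  shows "measure lborel D * (\<integral>x. indicator D x * (w x)\<^sup>2 \<partial>lborel) - (\<integral>x. indicator D x * w x \<partial>lborel)\<^sup>2
     \<le> 2 * h\<^sup>2 * measure lborel D * (\<integral>x. indicator D x * ((w1 x)\<^sup>2 + (w2 x)\<^sup>2) \<partial>lborel)"
proof -
  define V where "V = measure lborel D"
  define m1 where "m1 = (\<integral>x. indicator D x * w x \<partial>lborel)"
  define m2 where "m2 = (\<integral>x. indicator D x * (w x)\<^sup>2 \<partial>lborel)"
  define I where "I = (\<integral>x. indicator D x * ((w1 x)\<^sup>2 + (w2 x)\<^sup>2) \<partial>lborel)"
  let ?\<Phi> = "\<lambda>x. (w1 x)\<^sup>2 + (w2 x)\<^sup>2"
  have cw: "continuous_on UNIV w" by (rule partials_continuous[OF w])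
  have c\<Phi>: "continuous_on UNIV ?\<Phi>" using c by (intro continuous_intros)
  have m\<Phi>[measurable]: "?\<Phi> \<in> borel_measurable borel" using c\<Phi> by (rule borel_measurable_continuous_onI)
  have mw[measurable]: "w \<in> borel_measurable borel" using cw by (rule borel_measurable_continuous_onI)
  note [measurable] = D(1)
  have eV: "emeasure lborel D = ennreal V"
    unfolding V_def using emeasure_bounded_finite[OF D(2)] by (intro emeasure_eq_ennreal_measure) auto
  have iw: "integrable lborel (\<lambda>x. indicator D x * w x)" "integrable lborel (\<lambda>x. indicator D x * (w x)\<^sup>2)"
    "integrable lborel (indicator D :: pt \<Rightarrow> real)"
    using D cw by (auto intro!: integrable_indicator_continuous integrable_indicator_bounded continuous_intros)
  have V0: "V \<ge> 0" by (simp add: V_def)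
  have I0: "I \<ge> 0" unfolding I_def by (intro Bochner_Integration.integral_nonneg) auto
  have inner: "(\<integral>\<^sup>+y. indicator D y * ennreal ((w x - w y)\<^sup>2) \<partial>lborel) = ennreal (V * (w x)\<^sup>2 - 2 * w x * m1 + m2)" for x
  proof -
    have "(\<integral>\<^sup>+y. indicator D y * ennreal ((w x - w y)\<^sup>2) \<partial>lborel) = ennreal (\<integral>y. indicator D y * (w x - w y)\<^sup>2 \<partial>lborel)"
      using D cw by (intro nn_integral_indicator_continuous continuous_intros) auto
    also have "(\<integral>y. indicator D y * (w x - w y)\<^sup>2 \<partial>lborel) =
       (\<integral>y. (w x)\<^sup>2 * indicator D y - 2 * w x * (indicator D y * w y) + indicator D y * (w y)\<^sup>2 \<partial>lborel)"
      by (simp add: power2_eq_square algebra_simps)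
    also have "\<dots> = V * (w x)\<^sup>2 - 2 * w x * m1 + m2"
      using iw by (simp add: m1_def m2_def V_def)
    finally show ?thesis .
  qed
  have nn: "V * (w x)\<^sup>2 - 2 * w x * m1 + m2 \<ge> 0" for x
  proof -
    have "(\<integral>y. (w x)\<^sup>2 * indicator D y - 2 * w x * (indicator D y * w y) + indicator D y * (w y)\<^sup>2 \<partial>lborel) = V * (w x)\<^sup>2 - 2 * w x * m1 + m2"
      using iw by (simp add: m1_def m2_def V_def)
    moreover have "(w x)\<^sup>2 * indicator D y - 2 * w x * (indicator D y * w y) + indicator D y * (w y)\<^sup>2 = indicator D y * (w x - w y)\<^sup>2" for y
      by (simp add: power2_eq_square algebra_simps)
    ultimately show ?thesis by (metis (mono_tags, lifting) Bochner_Integration.integral_nonneg indicator_pos_le mult_nonneg_nonneg zero_le_power2)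
  qed
  have "ennreal (2 * (V * m2 - m1\<^sup>2)) = ennreal (\<integral>x. indicator D x * (V * (w x)\<^sup>2 - 2 * w x * m1 + m2) \<partial>lborel)"
  proof -
    have "(\<integral>x. indicator D x * (V * (w x)\<^sup>2 - 2 * w x * m1 + m2) \<partial>lborel) =
      (\<integral>x. V * (indicator D x * (w x)\<^sup>2) - 2 * m1 * (indicator D x * w x) + m2 * indicator D x \<partial>lborel)"
      by (simp add: algebra_simps)
    also have "\<dots> = V * m2 - 2 * m1 * m1 + m2 * V"
      using iw by (simp add: m1_def m2_def V_def)
    also have "\<dots> = 2 * (V * m2 - m1\<^sup>2)" by (simp add: power2_eq_square algebra_simps)
    finally show ?thesis by (rule arg_cong[OF sym])
  qed
  also have "\<dots> = (\<integral>\<^sup>+x. indicator D x * ennreal (V * (w x)\<^sup>2 - 2 * w x * m1 + m2) \<partial>lborel)"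
    using D cw nn by (intro nn_integral_indicator_continuous[symmetric] continuous_intros) auto
  also have "\<dots> = (\<integral>\<^sup>+x. indicator D x * (\<integral>\<^sup>+y. indicator D y * ennreal ((w x - w y)\<^sup>2) \<partial>lborel) \<partial>lborel)"
    by (simp add: inner)
  also have "\<dots> \<le> (\<integral>\<^sup>+x. indicator D x * (\<integral>\<^sup>+y. indicator D y * (ennreal (h\<^sup>2) *
       (\<integral>\<^sup>+t. indicator {0..1} t * ennreal (?\<Phi> ((1 - t) *\<^sub>R y + t *\<^sub>R x)) \<partial>lborel)) \<partial>lborel) \<partial>lborel)"
  proof (rule nn_integral_mono)
    fix x
    show "indicator D x * (\<integral>\<^sup>+y. indicator D y * ennreal ((w x - w y)\<^sup>2) \<partial>lborel) \<le> indicator D x * (\<integral>\<^sup>+y. indicator D y * (ennreal (h\<^sup>2) *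
       (\<integral>\<^sup>+t. indicator {0..1} t * ennreal (?\<Phi> ((1 - t) *\<^sub>R y + t *\<^sub>R x)) \<partial>lborel)) \<partial>lborel)"
    proof (cases "x \<in> D")
      case True
      have "indicator D y * ennreal ((w x - w y)\<^sup>2) \<le> indicator D y * (ennreal (h\<^sup>2) *
       (\<integral>\<^sup>+t. indicator {0..1} t * ennreal (?\<Phi> ((1 - t) *\<^sub>R y + t *\<^sub>R x)) \<partial>lborel))" for y
        using difference_square_le_line_integral[OF w c h[OF True], of y] by (cases "y \<in> D") auto
      then show ?thesis using True by (simp add: nn_integral_mono)
    qed simp
  qed
  also have "\<dots> = ennreal (h\<^sup>2) * (\<integral>\<^sup>+x. indicator D x * (\<integral>\<^sup>+y. indicator D y *
       (\<integral>\<^sup>+t. indicator {0..1} t * ennreal (?\<Phi> ((1 - t) *\<^sub>R y + t *\<^sub>R x)) \<partial>lborel) \<partial>lborel) \<partial>lborel)"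
  proof -
    define L where "L x y = (\<integral>\<^sup>+t. indicator {0..1} t * ennreal (?\<Phi> ((1 - t) *\<^sub>R y + t *\<^sub>R x)) \<partial>lborel)" for x y
    have m1: "(\<lambda>y. indicator D y * L x y) \<in> borel_measurable lborel" for x unfolding L_def by measurable
    have m2: "(\<lambda>x. indicator D x * (\<integral>\<^sup>+y. indicator D y * L x y \<partial>lborel)) \<in> borel_measurable lborel"
      unfolding L_def by measurable
    have "(\<integral>\<^sup>+x. indicator D x * (\<integral>\<^sup>+y. indicator D y * (ennreal (h\<^sup>2) * L x y) \<partial>lborel) \<partial>lborel) =
       (\<integral>\<^sup>+x. indicator D x * (\<integral>\<^sup>+y. ennreal (h\<^sup>2) * (indicator D y * L x y) \<partial>lborel) \<partial>lborel)"
      by (simp only: mult.left_commute)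
    also have "\<dots> = (\<integral>\<^sup>+x. ennreal (h\<^sup>2) * (indicator D x * (\<integral>\<^sup>+y. indicator D y * L x y \<partial>lborel)) \<partial>lborel)"
      by (simp only: nn_integral_cmult[OF m1]) (simp only: mult.left_commute)
    also have "\<dots> = ennreal (h\<^sup>2) * (\<integral>\<^sup>+x. indicator D x * (\<integral>\<^sup>+y. indicator D y * L x y \<partial>lborel) \<partial>lborel)"
      by (rule nn_integral_cmult[OF m2])
    finally show ?thesis unfolding L_def .
  qed
  also have "\<dots> \<le> ennreal (h\<^sup>2) * (4 * emeasure lborel D * (\<integral>\<^sup>+z. indicator D z * ennreal (?\<Phi> z) \<partial>lborel))"
    by (intro mult_left_mono integral_segments_le D) auto
  also have "(\<integral>\<^sup>+z. indicator D z * ennreal (?\<Phi> z) \<partial>lborel) = ennreal I"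
    unfolding I_def using D c\<Phi> by (intro nn_integral_indicator_continuous) auto
  also have "ennreal (h\<^sup>2) * (4 * emeasure lborel D * ennreal I) = ennreal (h\<^sup>2 * (4 * V * I))"
    unfolding eV using V0 I0 by (simp add: ennreal_mult ennreal_mult'')
  finally have "2 * (V * m2 - m1\<^sup>2) \<le> h\<^sup>2 * (4 * V * I)"
    using V0 I0 by (subst (asm) ennreal_le_iff) auto
  then show ?thesis by (simp add: V_def m1_def m2_def I_def)
qed

text \<open>The second-order Taylor expansion about \<open>y\<close>, evaluated at \<open>x\<close>, with integral remainder. The weight \<open>t\<^sup>2\<close> of the
  remainder is what compensates the contraction towards \<open>x\<close> when this is averaged over \<open>y\<close>.\<close>

lemma value_square_le_line_integral:
  assumes w: "partials w w1 w2" "partials w1 w11 w12" "partials w2 w12 w22"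
    and c: "continuous_on UNIV w11" "continuous_on UNIV w12" "continuous_on UNIV w22" and h: "norm (y - x) \<le> h"
  shows "(w x)\<^sup>2 \<le> 3 * (w y)\<^sup>2 + 3 * h\<^sup>2 * ((w1 y)\<^sup>2 + (w2 y)\<^sup>2) + 3 * h ^ 4 * integral {0..1} (\<lambda>t. t\<^sup>2 *
     ((w11 ((1 - t) *\<^sub>R x + t *\<^sub>R y))\<^sup>2 + 2 * (w12 ((1 - t) *\<^sub>R x + t *\<^sub>R y))\<^sup>2 + (w22 ((1 - t) *\<^sub>R x + t *\<^sub>R y))\<^sup>2))"
proof -
  let ?p = "\<lambda>t. (1 - t) *\<^sub>R x + t *\<^sub>R y"
  define v where "v = y - x"
  have vh: "(norm v)\<^sup>2 \<le> h\<^sup>2" using h unfolding v_def by (intro power_mono) auto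
  define g1 where "g1 t = w1 (?p t) * v $ 1 + w2 (?p t) * v $ 2" for t
  define g2 where "g2 t = (w11 (?p t) * v $ 1 + w12 (?p t) * v $ 2) * v $ 1 + (w12 (?p t) * v $ 1 + w22 (?p t) * v $ 2) * v $ 2" for t
  let ?\<Phi> = "\<lambda>t. (w11 (?p t))\<^sup>2 + 2 * (w12 (?p t))\<^sup>2 + (w22 (?p t))\<^sup>2"
  have d1: "((\<lambda>t. w (?p t)) has_real_derivative g1 t) (at t within S)" for t S
    using partials_line[OF w(1), of x y t S] by (simp add: g1_def v_def)
  have d2: "(g1 has_real_derivative g2 t) (at t within S)" for t S
    unfolding g1_def g2_def v_def
    by (intro DERIV_add DERIV_cmult_right partials_line w)
  have cp: "continuous_on {0..1} (\<lambda>t. w11 (?p t))" "continuous_on {0..1} (\<lambda>t. w12 (?p t))" "continuous_on {0..1} (\<lambda>t. w22 (?p t))"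
    by (intro continuous_on_line c)+
  have cg: "continuous_on {0..1} g2" unfolding g2_def by (intro continuous_intros cp)
  have c\<Phi>: "continuous_on {0..1} ?\<Phi>" by (intro continuous_intros cp)
  define J where "J = integral {0..1} (\<lambda>t. t * g2 t)"
  have cJ: "continuous_on {0..1} (\<lambda>t. t * g2 t)" by (intro continuous_intros cg)
  have "((\<lambda>t. - (t * g2 t)) has_integral (w (?p 1) - 1 * g1 1) - (w (?p 0) - 0 * g1 0)) {0..1}"
  proof (rule fundamental_theorem_of_calculus)
    fix t :: real
    have "((\<lambda>t. w (?p t) - t * g1 t) has_real_derivative g1 t - (1 * g1 t + g2 t * t)) (at t within {0..1})"
      by (intro DERIV_diff DERIV_mult d1 d2 DERIV_ident)
    then show "((\<lambda>t. w (?p t) - t * g1 t) has_vector_derivative - (t * g2 t)) (at t within {0..1})"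
      unfolding has_real_derivative_iff_has_vector_derivative[symmetric] by (simp add: mult.commute)
  qed simp
  note FT = this
  have "((\<lambda>t. - (t * g2 t)) has_integral - J) {0..1}"
    unfolding J_def by (intro has_integral_neg integrable_integral integrable_continuous_interval cJ)
  from has_integral_unique[OF this FT] have "- J = w y - g1 1 - w x" by simp
  then have wx: "w x = w y + (- g1 1) + J" by simp
  have sq3: "(a + b + q)\<^sup>2 \<le> 3 * a\<^sup>2 + 3 * b\<^sup>2 + 3 * q\<^sup>2" for a b q :: real
  proof -
    have "0 \<le> (a - b)\<^sup>2 + (a - q)\<^sup>2 + (b - q)\<^sup>2" by simp
    then show ?thesis by (simp add: power2_eq_square algebra_simps)
  qed
  have 1: "(g1 1)\<^sup>2 \<le> h\<^sup>2 * ((w1 y)\<^sup>2 + (w2 y)\<^sup>2)"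
  proof -
    have "(g1 1)\<^sup>2 \<le> (norm v)\<^sup>2 * ((w1 y)\<^sup>2 + (w2 y)\<^sup>2)"
      using directional_square_le[of "w1 y" v "w2 y"] by (simp add: g1_def)
    also have "\<dots> \<le> h\<^sup>2 * ((w1 y)\<^sup>2 + (w2 y)\<^sup>2)" using vh by (intro mult_right_mono) auto
    finally show ?thesis .
  qed
  have 2: "(g2 t)\<^sup>2 \<le> h ^ 4 * ?\<Phi> t" for t
  proof -
    have "(g2 t)\<^sup>2 \<le> (norm v)\<^sup>2 * ((w11 (?p t) * v $ 1 + w12 (?p t) * v $ 2)\<^sup>2 + (w12 (?p t) * v $ 1 + w22 (?p t) * v $ 2)\<^sup>2)"
      unfolding g2_def by (rule directional_square_le)
    also have "\<dots> \<le> (norm v)\<^sup>2 * ((norm v)\<^sup>2 * ((w11 (?p t))\<^sup>2 + (w12 (?p t))\<^sup>2) + (norm v)\<^sup>2 * ((w12 (?p t))\<^sup>2 + (w22 (?p t))\<^sup>2))"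
      by (intro mult_left_mono add_mono directional_square_le) auto
    also have "\<dots> = ((norm v)\<^sup>2)\<^sup>2 * ?\<Phi> t" by (simp add: power2_eq_square algebra_simps)
    also have "\<dots> \<le> (h\<^sup>2)\<^sup>2 * ?\<Phi> t" by (intro mult_right_mono power_mono[OF vh]) auto
    finally show ?thesis by (simp add: power_mult[symmetric])
  qed
  have "J\<^sup>2 \<le> integral {0..1} (\<lambda>t. (t * g2 t)\<^sup>2)" unfolding J_def by (rule square_integral_le_01[OF cJ])
  also have "\<dots> \<le> integral {0..1} (\<lambda>t. h ^ 4 * (t\<^sup>2 * ?\<Phi> t))"
  proof (rule integral_le)
    show "(\<lambda>t. (t * g2 t)\<^sup>2) integrable_on {0..1}" "(\<lambda>t. h ^ 4 * (t\<^sup>2 * ?\<Phi> t)) integrable_on {0..1}"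
      by (intro integrable_continuous_interval continuous_intros cg cp)+
    show "(t * g2 t)\<^sup>2 \<le> h ^ 4 * (t\<^sup>2 * ?\<Phi> t)" for t
      using mult_left_mono[OF 2[of t], of "t\<^sup>2"] by (simp add: power_mult_distrib mult_ac)
  qed
  also have "\<dots> = h ^ 4 * integral {0..1} (\<lambda>t. t\<^sup>2 * ?\<Phi> t)" by simp
  finally have 3: "J\<^sup>2 \<le> h ^ 4 * integral {0..1} (\<lambda>t. t\<^sup>2 * ?\<Phi> t)" .
  show ?thesis using sq3[of "w y" "- g1 1" J] 1 3 unfolding wx by (simp only: power2_minus)
qed

text \<open>Averaging \<open>value_square_le_line_integral\<close> over \<open>y\<close>. Two derivatives in \<open>L\<^sup>2\<close> control point values in the plane.\<close>

lemma sobolev_smooth: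
  assumes D: "D \<in> sets borel" "bounded D" "convex D" and x: "x \<in> D" and h: "\<And>x y. x \<in> D \<Longrightarrow> y \<in> D \<Longrightarrow> norm (x - y) \<le> h"
    and w: "partials w w1 w2" "partials w1 w11 w12" "partials w2 w12 w22"
    and c: "continuous_on UNIV w11" "continuous_on UNIV w12" "continuous_on UNIV w22"
  shows "measure lborel D * (w x)\<^sup>2 \<le> 3 * (\<integral>y. indicator D y * (w y)\<^sup>2 \<partial>lborel)
     + 3 * h\<^sup>2 * (\<integral>y. indicator D y * ((w1 y)\<^sup>2 + (w2 y)\<^sup>2) \<partial>lborel)
     + 3 * h ^ 4 * (\<integral>y. indicator D y * ((w11 y)\<^sup>2 + 2 * (w12 y)\<^sup>2 + (w22 y)\<^sup>2) \<partial>lborel)"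
proof -
  note [measurable] = D(1)
  let ?\<Phi> = "\<lambda>y. (w11 y)\<^sup>2 + 2 * (w12 y)\<^sup>2 + (w22 y)\<^sup>2"
  let ?A = "\<lambda>y. 3 * (w y)\<^sup>2 + 3 * h\<^sup>2 * ((w1 y)\<^sup>2 + (w2 y)\<^sup>2)"
  let ?p = "\<lambda>t y. (1 - t) *\<^sub>R x + t *\<^sub>R y"
  have cw: "continuous_on UNIV w" "continuous_on UNIV w1" "continuous_on UNIV w2"
    using w by (auto intro: partials_continuous)
  have c\<Phi>: "continuous_on UNIV ?\<Phi>" using c by (intro continuous_intros)
  have m\<Phi>[measurable]: "?\<Phi> \<in> borel_measurable borel" using c\<Phi> by (rule borel_measurable_continuous_onI)
  have m\<Phi>': "(\<lambda>z. ennreal (?\<Phi> z)) \<in> borel_measurable borel" using m\<Phi> by (rule measurable_compose) simp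
  have cA: "continuous_on UNIV ?A" using cw by (intro continuous_intros)
  have mA[measurable]: "?A \<in> borel_measurable borel" using cA by (rule borel_measurable_continuous_onI)
  define V where "V = measure lborel D"
  have eV: "emeasure lborel D = ennreal V"
    unfolding V_def using emeasure_bounded_finite[OF D(2)] by (intro emeasure_eq_ennreal_measure) auto
  define I where "I = (\<integral>y. indicator D y * ?\<Phi> y \<partial>lborel)"
  define IA where "IA = (\<integral>y. indicator D y * ?A y \<partial>lborel)"
  have I0: "I \<ge> 0" "IA \<ge> 0" "V \<ge> 0" unfolding I_def IA_def V_def by (auto intro!: Bochner_Integration.integral_nonneg)
  have eI: "(\<integral>\<^sup>+z. indicator D z * ennreal (?\<Phi> z) \<partial>lborel) = ennreal I"
    unfolding I_def using D c\<Phi> by (intro nn_integral_indicator_continuous) auto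
  have pw: "ennreal ((w x)\<^sup>2) \<le> ennreal (?A y) + ennreal (3 * h ^ 4) * (\<integral>\<^sup>+t. indicator {0..1} t * ennreal (t\<^sup>2 * ?\<Phi> (?p t y)) \<partial>lborel)"
    if y: "y \<in> D" for y
  proof -
    have ct: "continuous_on {0..1} (\<lambda>t. t\<^sup>2 * ?\<Phi> (?p t y))"
      by (intro continuous_intros continuous_on_line c)
    have nn: "0 \<le> integral {0..1} (\<lambda>t. t\<^sup>2 * ?\<Phi> (?p t y))"
      by (intro integral_nonneg integrable_continuous_interval ct) auto
    have h4: "0 \<le> h ^ 4" by simp
    have "ennreal ((w x)\<^sup>2) \<le> ennreal (?A y + 3 * h ^ 4 * integral {0..1} (\<lambda>t. t\<^sup>2 * ?\<Phi> (?p t y)))"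
      by (rule ennreal_leI) (rule value_square_le_line_integral[OF w c h[OF y x]])
    also have "\<dots> = ennreal (?A y) + ennreal (3 * h ^ 4) * ennreal (integral {0..1} (\<lambda>t. t\<^sup>2 * ?\<Phi> (?p t y)))"
      using nn h4 by (subst ennreal_plus) (auto simp: ennreal_mult)
    also have "ennreal (integral {0..1} (\<lambda>t. t\<^sup>2 * ?\<Phi> (?p t y))) = (\<integral>\<^sup>+t. indicator {0..1} t * ennreal (t\<^sup>2 * ?\<Phi> (?p t y)) \<partial>lborel)"
      by (rule nn_integral_01[OF ct, symmetric]) simp
    finally show ?thesis .
  qed
  have third: "(\<integral>\<^sup>+y. indicator D y * (\<integral>\<^sup>+t. indicator {0..1} t * ennreal (t\<^sup>2 * ?\<Phi> (?p t y)) \<partial>lborel) \<partial>lborel) \<le> ennreal I"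
  proof -
    have "(\<integral>\<^sup>+y. indicator D y * (\<integral>\<^sup>+t. indicator {0..1} t * ennreal (t\<^sup>2 * ?\<Phi> (?p t y)) \<partial>lborel) \<partial>lborel) =
      (\<integral>\<^sup>+y. (\<integral>\<^sup>+t. indicator D y * (indicator {0..1} t * ennreal (t\<^sup>2 * ?\<Phi> (?p t y))) \<partial>lborel) \<partial>lborel)"
      by (simp add: nn_integral_cmult)
    also have "\<dots> = (\<integral>\<^sup>+t. (\<integral>\<^sup>+y. indicator D y * (indicator {0..1} t * ennreal (t\<^sup>2 * ?\<Phi> (?p t y))) \<partial>lborel) \<partial>lborel)"
      by (intro lborel_pair.Fubini') measurable
    also have "\<dots> \<le> (\<integral>\<^sup>+t. indicator {0..1::real} t * ennreal I \<partial>lborel)"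
    proof (rule nn_integral_mono)
      fix t :: real
      consider "t \<notin> {0..1}" | "t = 0" | "0 < t" "t \<le> 1" by force
      then show "(\<integral>\<^sup>+y. indicator D y * (indicator {0..1} t * ennreal (t\<^sup>2 * ?\<Phi> (?p t y))) \<partial>lborel) \<le> indicator {0..1::real} t * ennreal I"
      proof cases
        case 3
        have "(\<integral>\<^sup>+y. indicator D y * (indicator {0..1} t * ennreal (t\<^sup>2 * ?\<Phi> (?p t y))) \<partial>lborel) =
           (\<integral>\<^sup>+y. ennreal (t\<^sup>2) * (indicator D y * ennreal (?\<Phi> (?p t y))) \<partial>lborel)"
          using 3 by (intro nn_integral_cong) (simp add: ennreal_mult mult_ac)
        also have "\<dots> = ennreal (t\<^sup>2) * (\<integral>\<^sup>+y. indicator D y * ennreal (?\<Phi> (?p t y)) \<partial>lborel)"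
          by (rule nn_integral_cmult) measurable
        also have "\<dots> \<le> ennreal (t\<^sup>2) * (ennreal (1 / t\<^sup>2) * ennreal I)"
          unfolding eI[symmetric]
          by (intro mult_left_mono nn_integral_contraction[OF m\<Phi>' D(1,3) x]) (use 3 in auto)
        also have "\<dots> = ennreal I" using 3 by (simp add: mult.assoc[symmetric] ennreal_mult[symmetric])
        finally show ?thesis using 3 by simp
      qed simp_all
    qed
    also have "\<dots> = ennreal I" by (simp add: nn_integral_multc)
    finally show ?thesis .
  qed
  have "ennreal (V * (w x)\<^sup>2) = (\<integral>\<^sup>+y. indicator D y * ennreal ((w x)\<^sup>2) \<partial>lborel)"
    using I0 by (simp add: nn_integral_multc eV ennreal_mult)
  also have "\<dots> \<le> (\<integral>\<^sup>+y. indicator D y * (ennreal (?A y) + ennreal (3 * h ^ 4) * (\<integral>\<^sup>+t. indicator {0..1} t * ennreal (t\<^sup>2 * ?\<Phi> (?p t y)) \<partial>lborel)) \<partial>lborel)"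
  proof (rule nn_integral_mono)
    fix y
    show "indicator D y * ennreal ((w x)\<^sup>2) \<le> indicator D y * (ennreal (?A y) + ennreal (3 * h ^ 4) * (\<integral>\<^sup>+t. indicator {0..1} t * ennreal (t\<^sup>2 * ?\<Phi> (?p t y)) \<partial>lborel))"
      using pw[of y] by (cases "y \<in> D") auto
  qed
  also have "\<dots> = (\<integral>\<^sup>+y. indicator D y * ennreal (?A y) + ennreal (3 * h ^ 4) * (indicator D y * (\<integral>\<^sup>+t. indicator {0..1} t * ennreal (t\<^sup>2 * ?\<Phi> (?p t y)) \<partial>lborel)) \<partial>lborel)"
    by (intro nn_integral_cong) (simp add: indicator_def)
  also have "\<dots> = (\<integral>\<^sup>+y. indicator D y * ennreal (?A y) \<partial>lborel) + ennreal (3 * h ^ 4) * (\<integral>\<^sup>+y. indicator D y * (\<integral>\<^sup>+t. indicator {0..1} t * ennreal (t\<^sup>2 * ?\<Phi> (?p t y)) \<partial>lborel) \<partial>lborel)"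
  proof -
    define L where "L y = (\<integral>\<^sup>+t. indicator {0..1} t * ennreal (t\<^sup>2 * ?\<Phi> (?p t y)) \<partial>lborel)" for y
    have m1: "(\<lambda>y. indicator D y * ennreal (?A y)) \<in> borel_measurable lborel" by measurable
    have m2: "(\<lambda>y. indicator D y * L y) \<in> borel_measurable lborel" unfolding L_def by measurable
    have m3: "(\<lambda>y. ennreal (3 * h ^ 4) * (indicator D y * L y)) \<in> borel_measurable lborel"
      using m2 by measurable
    show ?thesis unfolding L_def[symmetric]
      by (simp only: nn_integral_add[OF m1 m3] nn_integral_cmult[OF m2])
  qed
  also have "\<dots> \<le> ennreal IA + ennreal (3 * h ^ 4) * ennreal I"
  proof (intro add_mono mult_left_mono third)
    show "(\<integral>\<^sup>+y. indicator D y * ennreal (?A y) \<partial>lborel) \<le> ennreal IA"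
      unfolding IA_def using D cA by (subst nn_integral_indicator_continuous) auto
  qed simp
  also have "\<dots> = ennreal (IA + 3 * h ^ 4 * I)"
    using I0 zero_le_even_power[of 4 h] by (simp add: ennreal_mult)
  finally have "V * (w x)\<^sup>2 \<le> IA + 3 * h ^ 4 * I"
    using I0 zero_le_even_power[of 4 h] by (subst (asm) ennreal_le_iff) auto
  moreover have "IA = 3 * (\<integral>y. indicator D y * (w y)\<^sup>2 \<partial>lborel) + 3 * h\<^sup>2 * (\<integral>y. indicator D y * ((w1 y)\<^sup>2 + (w2 y)\<^sup>2) \<partial>lborel)"
  proof -
    have "integrable lborel (\<lambda>y. indicator D y * (w y)\<^sup>2)" "integrable lborel (\<lambda>y. indicator D y * ((w1 y)\<^sup>2 + (w2 y)\<^sup>2))"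
      using D cw by (auto intro!: integrable_indicator_continuous continuous_intros)
    moreover have "indicator D y * ?A y = 3 * (indicator D y * (w y)\<^sup>2) + 3 * h\<^sup>2 * (indicator D y * ((w1 y)\<^sup>2 + (w2 y)\<^sup>2))" for y
      by (simp add: algebra_simps)
    ultimately show ?thesis unfolding IA_def by simp
  qed
  ultimately show ?thesis by (simp add: V_def I_def)
qed

section \<open>Passing to the limit in the inequalities\<close>

text \<open>The product with a test function, extended by zero, is Lipschitz with compact support.\<close>

lemma C1_integration_by_parts:
  assumes D: "open D" and d: "\<And>x. x \<in> D \<Longrightarrow> (u has_derivative (\<lambda>h. g1 x * h $ 1 + g2 x * h $ 2)) (at x)"
    and c: "continuous_on D g1" "continuous_on D g2" and t: "test_function D \<phi>"
  shows "(\<integral>x. indicator D x * u x * partial 1 \<phi> x \<partial>lborel) = - (\<integral>x. indicator D x * g1 x * \<phi> x \<partial>lborel)"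
    and "(\<integral>x. indicator D x * u x * partial 2 \<phi> x \<partial>lborel) = - (\<integral>x. indicator D x * g2 x * \<phi> x \<partial>lborel)"
proof -
  define K where "K = closure {x. \<phi> x \<noteq> 0}"
  have K: "compact K" "K \<subseteq> D" and sm: "smooth \<phi>" using t by (auto simp: test_function_def K_def)
  have zK: "\<phi> x = 0" "partial i \<phi> x = 0" if "x \<notin> K" for x i
    using that partial_zero_outside_support[of x \<phi> i] closure_subset[of "{x. \<phi> x \<noteq> 0}"] by (auto simp: K_def)
  define \<psi> where "\<psi> x = indicator D x * u x * \<phi> x" for x
  define p1 where "p1 x = indicator D x * (g1 x * \<phi> x + u x * partial 1 \<phi> x)" for x
  define p2 where "p2 x = indicator D x * (g2 x * \<phi> x + u x * partial 2 \<phi> x)" for x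
  have d\<psi>: "(\<psi> has_derivative (\<lambda>h. p1 x * h $ 1 + p2 x * h $ 2)) (at x)" for x
  proof (cases "x \<in> D")
    case True
    have "((\<lambda>x. u x * \<phi> x) has_derivative (\<lambda>h. u x * (partial 1 \<phi> x * h $ 1 + partial 2 \<phi> x * h $ 2) + (g1 x * h $ 1 + g2 x * h $ 2) * \<phi> x)) (at x)"
      by (rule has_derivative_mult[OF d[OF True] smooth_has_derivative[OF sm]])
    then have "((\<lambda>x. u x * \<phi> x) has_derivative (\<lambda>h. p1 x * h $ 1 + p2 x * h $ 2)) (at x)"
      using True by (simp add: p1_def p2_def algebra_simps)
    then show ?thesis
      by (rule has_derivative_transform_within_open[OF _ D True]) (simp add: \<psi>_def)
  next
    case False
    have "((\<lambda>x. 0) has_derivative (\<lambda>h. p1 x * h $ 1 + p2 x * h $ 2)) (at x)"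
      using False by (simp add: p1_def p2_def)
    then show ?thesis
      by (rule has_derivative_transform_within_open[of _ _ _ _ "- K"])
        (use K False zK in \<open>auto simp: \<psi>_def compact_imp_closed\<close>)
  qed
  have cu: "continuous_on D u"
    by (meson d has_derivative_continuous continuous_at_imp_continuous_on)
  have c\<phi>: "continuous_on A \<phi>" "continuous_on A (partial i \<phi>)" for A i
    using test_function_continuous[OF t] test_function_continuous[OF test_function_partial[OF t]]
    by (auto intro: continuous_on_subset)
  have bounded: "\<exists>B. \<forall>x. \<bar>p x\<bar> \<le> B"
    if p: "continuous_on D f" "continuous_on D k" "p = (\<lambda>x. indicator D x * (f x * \<phi> x + u x * partial i \<phi> x))" for p f k i
  proof -
    have "continuous_on K (\<lambda>x. f x * \<phi> x + u x * partial i \<phi> x)"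
      by (intro continuous_intros c\<phi> continuous_on_subset[OF p(1) K(2)] continuous_on_subset[OF cu K(2)])
    then have "bounded ((\<lambda>x. f x * \<phi> x + u x * partial i \<phi> x) ` K)"
      by (intro compact_imp_bounded compact_continuous_image K)
    then obtain B where B: "\<And>x. x \<in> K \<Longrightarrow> \<bar>f x * \<phi> x + u x * partial i \<phi> x\<bar> \<le> B"
      by (auto simp: bounded_iff)
    have "\<bar>p x\<bar> \<le> max B 0" for x
      using B[of x] zK[of x] K(2) by (cases "x \<in> K") (auto simp: p(3) indicator_def)
    then show ?thesis by blast
  qed
  obtain B1 where B1: "\<And>x. \<bar>p1 x\<bar> \<le> B1" using bounded[OF c(1) c(1), of p1 1] by (auto simp: p1_def[abs_def])
  obtain B2 where B2: "\<And>x. \<bar>p2 x\<bar> \<le> B2" using bounded[OF c(2) c(2), of p2 2] by (auto simp: p2_def[abs_def])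
  have lip: "\<bar>\<psi> x - \<psi> y\<bar> \<le> (B1 + B2) * norm (x - y)" for x y
  proof -
    have "norm (\<psi> x - \<psi> y) \<le> (B1 + B2) * norm (x - y)"
    proof (rule differentiable_bound[of UNIV _ "\<lambda>x h. p1 x * h $ 1 + p2 x * h $ 2"])
      fix x
      show "onorm (\<lambda>h::pt. p1 x * h $ 1 + p2 x * h $ 2) \<le> B1 + B2"
      proof (rule onorm_bound)
        fix h :: pt
        have "\<bar>p1 x * h $ 1 + p2 x * h $ 2\<bar> \<le> B1 * norm h + B2 * norm h"
          using B1[of x] B2[of x] component_le_norm_cart[of h 1] component_le_norm_cart[of h 2]
          by (intro order_trans[OF abs_triangle_ineq] add_mono) (auto simp: abs_mult intro!: mult_mono)
        then show "norm (p1 x * h $ 1 + p2 x * h $ 2) \<le> (B1 + B2) * norm h" by (simp add: algebra_simps)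
      qed (use B1[of x] B2[of x] in linarith)
    qed (auto intro: d\<psi> has_derivative_at_withinI)
    then show ?thesis by simp
  qed
  obtain R where R: "\<And>x. norm x \<ge> R \<Longrightarrow> \<phi> x = 0" using test_function_support[OF t] by blast
  have z\<psi>: "\<psi> x = 0" if "norm x \<ge> R" for x using R[OF that] by (simp add: \<psi>_def)
  have meas: "(\<lambda>x. indicator D x * f x) \<in> borel_measurable borel" if "continuous_on D f" for f :: "pt \<Rightarrow> real"
    using borel_measurable_continuous_on_indicator[of D f] that D by simp
  have m: "p1 \<in> borel_measurable borel" "p2 \<in> borel_measurable borel"
    unfolding p1_def p2_def by (intro meas continuous_intros c c\<phi> cu)+
  have q: "(\<lambda>n. (\<psi> (x + (1 / real (Suc n)) *\<^sub>R axis 1 1) - \<psi> x) * real (Suc n)) \<longlonglongrightarrow> p1 x"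
    "(\<lambda>n. (\<psi> (x + (1 / real (Suc n)) *\<^sub>R axis 2 1) - \<psi> x) * real (Suc n)) \<longlonglongrightarrow> p2 x" for x
    using directional_quotient_tendsto[OF d\<psi>, of x "axis 1 1"] directional_quotient_tendsto[OF d\<psi>, of x "axis 2 1"]
    by (simp_all add: axis_def)
  have i0: "integral\<^sup>L lborel p1 = 0" "integral\<^sup>L lborel p2 = 0"
    by (rule integral_directional_derivative_zero(1)[OF lip z\<psi> m(1) AE_I2[OF q(1)]], assumption)
      (rule integral_directional_derivative_zero(1)[OF lip z\<psi> m(2) AE_I2[OF q(2)]], assumption)
  have int: "integrable lborel (\<lambda>x. indicator D x * f x * k x)"
    if "continuous_on D f" "continuous_on UNIV k" "\<And>x. x \<notin> K \<Longrightarrow> k x = 0" for f k :: "pt \<Rightarrow> real"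
  proof -
    have "integrable lborel (\<lambda>x. indicator K x *\<^sub>R (f x * k x))"
      by (rule borel_integrable_compact[OF K(1)])
        (intro continuous_on_mult continuous_on_subset[OF that(1) K(2)] continuous_on_subset[OF that(2)] subset_UNIV)
    moreover have "(\<lambda>x. indicator K x *\<^sub>R (f x * k x)) = (\<lambda>x. indicator D x * f x * k x)"
      using that(3) K(2) by (auto simp: fun_eq_iff indicator_def)
    ultimately show ?thesis by (simp only:)
  qed
  have e1: "p1 = (\<lambda>x. indicator D x * g1 x * \<phi> x + indicator D x * u x * partial 1 \<phi> x)"
    and e2: "p2 = (\<lambda>x. indicator D x * g2 x * \<phi> x + indicator D x * u x * partial 2 \<phi> x)"
    by (auto simp: p1_def p2_def algebra_simps)
  note ii = int[OF c(1) c\<phi>(1)[of UNIV]] int[OF c(2) c\<phi>(1)[of UNIV]] int[OF cu c\<phi>(2)[of UNIV]]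
  have "integral\<^sup>L lborel p1 = (\<integral>x. indicator D x * g1 x * \<phi> x \<partial>lborel) + (\<integral>x. indicator D x * u x * partial 1 \<phi> x \<partial>lborel)"
    unfolding e1 by (rule Bochner_Integration.integral_add) (use ii zK in auto)
  then show "(\<integral>x. indicator D x * u x * partial 1 \<phi> x \<partial>lborel) = - (\<integral>x. indicator D x * g1 x * \<phi> x \<partial>lborel)"
    using i0 by simp
  have "integral\<^sup>L lborel p2 = (\<integral>x. indicator D x * g2 x * \<phi> x \<partial>lborel) + (\<integral>x. indicator D x * u x * partial 2 \<phi> x \<partial>lborel)"
    unfolding e2 by (rule Bochner_Integration.integral_add) (use ii zK in auto)
  then show "(\<integral>x. indicator D x * u x * partial 2 \<phi> x \<partial>lborel) = - (\<integral>x. indicator D x * g2 x * \<phi> x \<partial>lborel)"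
    using i0 by simp
qed

text \<open>Mollifications of a weak family at the scales \<open>1/(n+1)\<close>, on the correspondingly eroded sets \<open>A n\<close>. These sets are
  convex, so the inequalities for smooth functions hold there and survive the limit.\<close>

locale mollified_family =
  fixes D :: "pt set" and m :: nat and G :: "nat \<Rightarrow> nat \<Rightarrow> pt \<Rightarrow> real" and \<eta> :: "nat \<Rightarrow> nat \<Rightarrow> nat \<Rightarrow> pt \<Rightarrow> real"
  assumes D: "open D" "bounded D" "convex D" and G: "weak_family m D G"
    and \<eta>: "mollifier (1 / real (Suc n)) (\<eta> n)"
begin

definition A :: "nat \<Rightarrow> pt set" where "A n = erode D (1 / real (Suc n))"

definition F :: "nat \<Rightarrow> nat \<Rightarrow> nat \<Rightarrow> pt \<Rightarrow> real" where "F n i j = moll (G 0 0) (\<eta> n i j)"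

lemma A_open: "open (A n)" unfolding A_def by (rule open_erode[OF D(1)])
lemma A_convex: "convex (A n)" unfolding A_def by (rule convex_erode[OF D(3)])
lemma A_subset: "A n \<subseteq> D" unfolding A_def by (rule erode_subset) simp
lemma A_borel: "A n \<in> sets borel" using A_open by simp
lemma A_bounded: "bounded (A n)" using D(2) A_subset by (rule bounded_subset)
lemma eventually_A: "x \<in> D \<Longrightarrow> \<forall>\<^sub>F n in sequentially. x \<in> A n"
  unfolding A_def by (rule eventually_in_erode[OF D(1)])

lemma G0_integrable: "integrable lborel (G 0 0)"
  by (rule weak_family_integrable[OF D(1,2) G]) simp

lemma F_partials: "partials (F n i j) (F n (Suc i) j) (F n i (Suc j))"
  unfolding partials_def F_def using moll_has_derivative[OF \<eta> G0_integrable] by blast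

lemma F_continuous: "continuous_on UNIV (F n i j)"
  by (rule partials_continuous[OF F_partials])

text \<open>Inside \<open>A n\<close> the derivatives of the mollification are the mollifications of the weak derivatives.\<close>

lemma F_eq: "F n i j x = moll (G i j) (\<eta> n 0 0) x" if "x \<in> A n" "i + j \<le> m"
proof -
  have s: "cball x (1 / real (Suc n)) \<subseteq> D" using that(1) by (simp add: A_def erode_def)
  have "(\<integral>y. G 0 0 y * ((-1) ^ (i + j) * \<eta> n i j (x - y)) \<partial>lborel) = (-1) ^ (i + j) * (\<integral>y. G i j y * \<eta> n 0 0 (x - y) \<partial>lborel)"
    using weak_familyD(4)[OF G that(2) mollifier_test_function(1)[OF \<eta> s]]
    unfolding mollifier_test_function(2)[OF \<eta> s] .
  moreover have "(\<integral>y. G 0 0 y * ((-1) ^ (i + j) * \<eta> n i j (x - y)) \<partial>lborel) = (-1) ^ (i + j) * F n i j x"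
  proof -
    have "(\<lambda>y. G 0 0 y * ((-1) ^ (i + j) * \<eta> n i j (x - y))) = (\<lambda>y. (-1) ^ (i + j) * (G 0 0 y * \<eta> n i j (x - y)))"
      by (simp add: fun_eq_iff mult_ac)
    then show ?thesis by (simp only: F_def moll_def integral_mult_right_zero)
  qed
  ultimately show ?thesis by (simp add: moll_def)
qed

lemma F_limits:
  assumes ij: "i + j \<le> m"
  shows "(\<lambda>n. \<integral>x. indicator (A n) x * (F n i j x)\<^sup>2 \<partial>lborel) \<longlonglongrightarrow> sqnorm (G i j)"
    and "(\<lambda>n. \<integral>x. indicator (A n) x * F n i j x \<partial>lborel) \<longlonglongrightarrow> (\<integral>x. G i j x \<partial>lborel)"
proof -
  define a where "a n x = indicator (A n) x * F n i j x" for n x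
  have am: "a n \<in> borel_measurable borel" for n
    unfolding a_def using A_borel borel_measurable_continuous_onI[OF F_continuous] by simp
  have asq: "(a n x)\<^sup>2 = indicator (A n) x * (F n i j x)\<^sup>2" for n x by (auto simp: a_def indicator_def)
  have a2: "square_integrable (a n)" for n
    unfolding asq by (intro integrable_indicator_continuous A_borel A_bounded continuous_intros F_continuous)
  have "a n x = indicator (erode D (1 / real (Suc n))) x * moll (G i j) (\<eta> n 0 0) x" for n x
    using F_eq[OF _ ij, of x n] by (auto simp: a_def A_def indicator_def)
  then have lim: "(\<lambda>n. \<integral>x. (a n x - G i j x)\<^sup>2 \<partial>lborel) \<longlonglongrightarrow> 0"
    using moll_L2_convergence[OF D(1,2) weak_familyD(1)[OF G ij] weak_familyD(2)[OF G ij] weak_familyD(3)[OF G ij] \<eta>] by simp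
  note L = L2_limits[OF am a2 weak_familyD(1)[OF G ij] weak_familyD(3)[OF G ij] lim]
  show "(\<lambda>n. \<integral>x. indicator (A n) x * (F n i j x)\<^sup>2 \<partial>lborel) \<longlonglongrightarrow> sqnorm (G i j)"
    using L(2) by (simp add: asq)
  have "integrable lborel (\<lambda>x. (indicator D x)\<^sup>2 :: real)"
  proof -
    have "(\<lambda>x. (indicator D x)\<^sup>2 :: real) = indicator D" by (auto simp: fun_eq_iff indicator_def)
    then show ?thesis using integrable_indicator_bounded[of D] D by simp
  qed
  then have "(\<lambda>n. \<integral>x. a n x * indicator D x \<partial>lborel) \<longlonglongrightarrow> (\<integral>x. G i j x * indicator D x \<partial>lborel)"
    using D(1) by (intro L(1)) auto
  moreover have "(\<lambda>x. a n x * indicator D x) = (\<lambda>x. indicator (A n) x * F n i j x)" for n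
    using A_subset[of n] by (auto simp: a_def indicator_def fun_eq_iff)
  moreover have "(\<lambda>x. G i j x * indicator D x) = G i j"
    using weak_familyD(2)[OF G ij] by (force simp: indicator_def fun_eq_iff)
  ultimately show "(\<lambda>n. \<integral>x. indicator (A n) x * F n i j x \<partial>lborel) \<longlonglongrightarrow> (\<integral>x. G i j x \<partial>lborel)"
    by (simp only:)
qed

lemma measure_A_limit: "(\<lambda>n. measure lborel (A n)) \<longlonglongrightarrow> measure lborel D"
proof -
  have "(\<lambda>n. \<integral>x. indicator (A n) x \<partial>(lborel :: pt measure)) \<longlonglongrightarrow> (\<integral>x. indicator D x \<partial>(lborel :: pt measure) :: real)"
  proof (rule integral_dominated_convergence[where w = "indicator D"])
    show "AE x in lborel. (\<lambda>n. indicator (A n) x) \<longlonglongrightarrow> (indicator D x :: real)"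
    proof (rule AE_I2)
      fix x
      show "(\<lambda>n. indicator (A n) x) \<longlonglongrightarrow> (indicator D x :: real)"
      proof (cases "x \<in> D")
        case True
        then have "\<forall>\<^sub>F n in sequentially. indicator (A n) x = (indicator D x :: real)"
          using eventually_A[OF True] by (auto elim: eventually_mono)
        then show ?thesis by (rule tendsto_eventually)
      next
        case False
        then have "x \<notin> A n" for n using A_subset by blast
        then show ?thesis using False by simp
      qed
    qed
    show "AE x in lborel. norm (indicator (A n) x :: real) \<le> indicator D x" for n
      using A_subset[of n] by (intro AE_I2) (auto simp: indicator_def)
  qed (use D A_borel integrable_indicator_bounded[of D] in auto)
  then show ?thesis by simp
qed

lemma sum_indicator_integral:
  "(\<integral>x. indicator (A n) x * ((F n i j x)\<^sup>2 + (F n k l x)\<^sup>2) \<partial>lborel) =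
     (\<integral>x. indicator (A n) x * (F n i j x)\<^sup>2 \<partial>lborel) + (\<integral>x. indicator (A n) x * (F n k l x)\<^sup>2 \<partial>lborel)"
proof -
  have "integrable lborel (\<lambda>x. indicator (A n) x * (F n i j x)\<^sup>2)" for i j
    by (intro integrable_indicator_continuous A_borel A_bounded continuous_intros F_continuous)
  then show ?thesis by (simp add: distrib_left)
qed

lemma poincare_weak:
  assumes h: "\<And>x y. x \<in> D \<Longrightarrow> y \<in> D \<Longrightarrow> norm (x - y) \<le> h" and ij: "Suc (i + j) \<le> m"
  shows "measure lborel D * sqnorm (G i j) - (\<integral>x. G i j x \<partial>lborel)\<^sup>2
     \<le> 2 * h\<^sup>2 * measure lborel D * (sqnorm (G (Suc i) j) + sqnorm (G i (Suc j)))"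
proof (rule LIMSEQ_le)
  show "(\<lambda>n. measure lborel (A n) * (\<integral>x. indicator (A n) x * (F n i j x)\<^sup>2 \<partial>lborel) - (\<integral>x. indicator (A n) x * F n i j x \<partial>lborel)\<^sup>2)
    \<longlonglongrightarrow> measure lborel D * sqnorm (G i j) - (\<integral>x. G i j x \<partial>lborel)\<^sup>2"
    using ij by (intro tendsto_intros F_limits measure_A_limit) auto
  show "(\<lambda>n. 2 * h\<^sup>2 * measure lborel (A n) * ((\<integral>x. indicator (A n) x * (F n (Suc i) j x)\<^sup>2 \<partial>lborel) + (\<integral>x. indicator (A n) x * (F n i (Suc j) x)\<^sup>2 \<partial>lborel)))
    \<longlonglongrightarrow> 2 * h\<^sup>2 * measure lborel D * (sqnorm (G (Suc i) j) + sqnorm (G i (Suc j)))"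
    using ij by (intro tendsto_intros F_limits measure_A_limit) auto
  have "measure lborel (A n) * (\<integral>x. indicator (A n) x * (F n i j x)\<^sup>2 \<partial>lborel) - (\<integral>x. indicator (A n) x * F n i j x \<partial>lborel)\<^sup>2
      \<le> 2 * h\<^sup>2 * measure lborel (A n) * ((\<integral>x. indicator (A n) x * (F n (Suc i) j x)\<^sup>2 \<partial>lborel) + (\<integral>x. indicator (A n) x * (F n i (Suc j) x)\<^sup>2 \<partial>lborel))" for n
    using poincare_smooth[OF A_borel A_bounded A_convex _ F_partials[of n i j] F_continuous F_continuous, of n h] h A_subset[of n]
    by (auto simp: sum_indicator_integral subset_iff)
  then show "\<exists>N. \<forall>n\<ge>N. measure lborel (A n) * (\<integral>x. indicator (A n) x * (F n i j x)\<^sup>2 \<partial>lborel) - (\<integral>x. indicator (A n) x * F n i j x \<partial>lborel)\<^sup>2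
      \<le> 2 * h\<^sup>2 * measure lborel (A n) * ((\<integral>x. indicator (A n) x * (F n (Suc i) j x)\<^sup>2 \<partial>lborel) + (\<integral>x. indicator (A n) x * (F n i (Suc j) x)\<^sup>2 \<partial>lborel))"
    by blast
qed

text \<open>The right-hand side of \<open>sobolev_smooth\<close> for \<open>F n i j\<close> on \<open>A n\<close>, and its limit.\<close>

definition sobolev_bound_at :: "nat \<Rightarrow> real \<Rightarrow> nat \<Rightarrow> nat \<Rightarrow> real" where
  "sobolev_bound_at n h i j = 3 * (\<integral>x. indicator (A n) x * (F n i j x)\<^sup>2 \<partial>lborel)
     + 3 * h\<^sup>2 * ((\<integral>x. indicator (A n) x * (F n (Suc i) j x)\<^sup>2 \<partial>lborel) + (\<integral>x. indicator (A n) x * (F n i (Suc j) x)\<^sup>2 \<partial>lborel))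
     + 3 * h ^ 4 * ((\<integral>x. indicator (A n) x * (F n (Suc (Suc i)) j x)\<^sup>2 \<partial>lborel)
        + 2 * (\<integral>x. indicator (A n) x * (F n (Suc i) (Suc j) x)\<^sup>2 \<partial>lborel) + (\<integral>x. indicator (A n) x * (F n i (Suc (Suc j)) x)\<^sup>2 \<partial>lborel))"

definition sobolev_bound :: "real \<Rightarrow> nat \<Rightarrow> nat \<Rightarrow> real" where
  "sobolev_bound h i j = 3 * sqnorm (G i j)
     + 3 * h\<^sup>2 * (sqnorm (G (Suc i) j) + sqnorm (G i (Suc j)))
     + 3 * h ^ 4 * (sqnorm (G (Suc (Suc i)) j)
        + 2 * sqnorm (G (Suc i) (Suc j)) + sqnorm (G i (Suc (Suc j))))"

lemma sobolev_bound_limit: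
  assumes "Suc (Suc (i + j)) \<le> m"
  shows "(\<lambda>n. sobolev_bound_at n h i j) \<longlonglongrightarrow> sobolev_bound h i j"
  unfolding sobolev_bound_at_def sobolev_bound_def
  using assms by (intro tendsto_intros F_limits) auto

lemma sobolev_at:
  assumes h: "\<And>x y. x \<in> D \<Longrightarrow> y \<in> D \<Longrightarrow> norm (x - y) \<le> h" and x: "x \<in> A n"
  shows "measure lborel (A n) * (F n i j x)\<^sup>2 \<le> sobolev_bound_at n h i j"
proof -
  have ii: "integrable lborel (\<lambda>x. indicator (A n) x * (F n i j x)\<^sup>2)" for i j
    by (intro integrable_indicator_continuous A_borel A_bounded continuous_intros F_continuous)
  have "measure lborel (A n) * (F n i j x)\<^sup>2 \<le> 3 * (\<integral>y. indicator (A n) y * (F n i j y)\<^sup>2 \<partial>lborel)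
     + 3 * h\<^sup>2 * (\<integral>y. indicator (A n) y * ((F n (Suc i) j y)\<^sup>2 + (F n i (Suc j) y)\<^sup>2) \<partial>lborel)
     + 3 * h ^ 4 * (\<integral>y. indicator (A n) y * ((F n (Suc (Suc i)) j y)\<^sup>2 + 2 * (F n (Suc i) (Suc j) y)\<^sup>2 + (F n i (Suc (Suc j)) y)\<^sup>2) \<partial>lborel)"
    by (rule sobolev_smooth[OF A_borel A_bounded A_convex x _ F_partials F_partials F_partials F_continuous F_continuous F_continuous])
      (use h A_subset[of n] in auto)
  also have "(\<integral>y. indicator (A n) y * ((F n (Suc (Suc i)) j y)\<^sup>2 + 2 * (F n (Suc i) (Suc j) y)\<^sup>2 + (F n i (Suc (Suc j)) y)\<^sup>2) \<partial>lborel)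
    = (\<integral>y. indicator (A n) y * (F n (Suc (Suc i)) j y)\<^sup>2 + 2 * (indicator (A n) y * (F n (Suc i) (Suc j) y)\<^sup>2) + indicator (A n) y * (F n i (Suc (Suc j)) y)\<^sup>2 \<partial>lborel)"
    by (simp add: algebra_simps)
  also have "\<dots> = (\<integral>x. indicator (A n) x * (F n (Suc (Suc i)) j x)\<^sup>2 \<partial>lborel)
        + 2 * (\<integral>x. indicator (A n) x * (F n (Suc i) (Suc j) x)\<^sup>2 \<partial>lborel) + (\<integral>x. indicator (A n) x * (F n i (Suc (Suc j)) x)\<^sup>2 \<partial>lborel)"
    using ii by simp
  finally show ?thesis unfolding sobolev_bound_at_def sum_indicator_integral .
qed

lemma sobolev_weak:
  assumes h: "\<And>x y. x \<in> D \<Longrightarrow> y \<in> D \<Longrightarrow> norm (x - y) \<le> h" and x: "x \<in> D" and ij: "Suc (Suc (i + j)) \<le> m"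
    and lim: "(\<lambda>n. F n i j x) \<longlonglongrightarrow> l"
  shows "measure lborel D * l\<^sup>2 \<le> sobolev_bound h i j"
proof (rule LIMSEQ_le)
  show "(\<lambda>n. measure lborel (A n) * (F n i j x)\<^sup>2) \<longlonglongrightarrow> measure lborel D * l\<^sup>2"
    by (intro tendsto_intros measure_A_limit lim)
  show "(\<lambda>n. sobolev_bound_at n h i j) \<longlonglongrightarrow> sobolev_bound h i j"
    by (rule sobolev_bound_limit[OF ij])
  show "\<exists>N. \<forall>n\<ge>N. measure lborel (A n) * (F n i j x)\<^sup>2 \<le> sobolev_bound_at n h i j"
    using eventually_A[OF x] sobolev_at[OF h] unfolding eventually_sequentially by blast
qed

lemma F_uniformly_bounded:
  assumes ne: "D \<noteq> {}" and ij: "Suc (Suc (i + j)) \<le> m"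
  obtains M where "\<forall>\<^sub>F n in sequentially. \<forall>x\<in>A n. \<bar>F n i j x\<bar> \<le> M"
proof -
  obtain R where R: "\<forall>x\<in>D. norm x \<le> R" using D(2) by (auto simp: bounded_iff)
  have h: "norm (x - y) \<le> 2 * R" if "x \<in> D" "y \<in> D" for x y
    using norm_triangle_ineq4[of x y] R that by (smt (verit))
  have V: "measure lborel D > 0"
  proof -
    have "emeasure lborel D \<noteq> 0"
      using open_not_negligible[OF D(1) ne] D(1) by (simp add: negligible_iff_null_sets null_sets_def)
    moreover have "emeasure lborel D = ennreal (measure lborel D)"
      using emeasure_bounded_finite[OF D(2)] by (intro emeasure_eq_ennreal_measure) auto
    ultimately show ?thesis using zero_less_measure_iff by fastforce
  qed
  let ?B = "sobolev_bound (2 * R) i j + 1"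
  have "\<forall>\<^sub>F n in sequentially. measure lborel (A n) > measure lborel D / 2"
    using V by (intro order_tendstoD[OF measure_A_limit]) auto
  moreover have "\<forall>\<^sub>F n in sequentially. sobolev_bound_at n (2 * R) i j < ?B"
    by (intro order_tendstoD[OF sobolev_bound_limit[OF ij]]) auto
  ultimately have "\<forall>\<^sub>F n in sequentially. \<forall>x\<in>A n. \<bar>F n i j x\<bar> \<le> sqrt (?B / (measure lborel D / 2))"
  proof eventually_elim
    case (elim n)
    show ?case
    proof
      fix x assume "x \<in> A n"
      have "measure lborel D / 2 * (F n i j x)\<^sup>2 \<le> measure lborel (A n) * (F n i j x)\<^sup>2"
        using elim by (intro mult_right_mono) auto
      also have "\<dots> \<le> ?B" using sobolev_at[OF h \<open>x \<in> A n\<close>, of i j] elim by simp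
      finally have "(F n i j x)\<^sup>2 \<le> ?B / (measure lborel D / 2)" using V by (simp add: field_simps)
      then show "\<bar>F n i j x\<bar> \<le> sqrt (?B / (measure lborel D / 2))" by (rule real_le_rsqrt[of "\<bar>_\<bar>", simplified])
    qed
  qed
  then show ?thesis by (rule that)
qed

text \<open>The gradient of \<open>F n i j\<close> is bounded on \<open>A n\<close> uniformly in \<open>n\<close> by the Sobolev inequality, which involves
  derivatives of total order \<open>i + j + 3\<close>.\<close>

lemma limit_Lipschitz:
  assumes ne: "D \<noteq> {}" and ij: "Suc (Suc (Suc (i + j))) \<le> m" and lim: "\<And>x. x \<in> D \<Longrightarrow> (\<lambda>n. F n i j x) \<longlonglongrightarrow> f x"
  obtains L where "L \<ge> 0" "\<And>x y. x \<in> D \<Longrightarrow> y \<in> D \<Longrightarrow> \<bar>f x - f y\<bar> \<le> L * norm (x - y)"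
proof -
  obtain M1 where M1: "\<forall>\<^sub>F n in sequentially. \<forall>x\<in>A n. \<bar>F n (Suc i) j x\<bar> \<le> M1"
    using F_uniformly_bounded[OF ne, of "Suc i" j] ij by auto
  obtain M2 where M2: "\<forall>\<^sub>F n in sequentially. \<forall>x\<in>A n. \<bar>F n i (Suc j) x\<bar> \<le> M2"
    using F_uniformly_bounded[OF ne, of i "Suc j"] ij by auto
  have "\<bar>f x - f y\<bar> \<le> (\<bar>M1\<bar> + \<bar>M2\<bar>) * norm (x - y)" if xy: "x \<in> D" "y \<in> D" for x y
  proof (rule tendsto_upperbound)
    show "(\<lambda>n. \<bar>F n i j x - F n i j y\<bar>) \<longlonglongrightarrow> \<bar>f x - f y\<bar>"
      by (intro tendsto_intros lim xy)
    show "\<forall>\<^sub>F n in sequentially. \<bar>F n i j x - F n i j y\<bar> \<le> (\<bar>M1\<bar> + \<bar>M2\<bar>) * norm (x - y)"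
      using M1 M2 eventually_A[OF xy(1)] eventually_A[OF xy(2)]
    proof eventually_elim
      case (elim n)
      have "norm (F n i j x - F n i j y) \<le> (\<bar>M1\<bar> + \<bar>M2\<bar>) * norm (x - y)"
      proof (rule differentiable_bound[OF A_convex[of n], of _ "\<lambda>z h. F n (Suc i) j z * h $ 1 + F n i (Suc j) z * h $ 2"])
        fix z assume z: "z \<in> A n"
        show "(F n i j has_derivative (\<lambda>h. F n (Suc i) j z * h $ 1 + F n i (Suc j) z * h $ 2)) (at z within A n)"
          using F_partials unfolding partials_def by (blast intro: has_derivative_at_withinI)
        show "onorm (\<lambda>h::pt. F n (Suc i) j z * h $ 1 + F n i (Suc j) z * h $ 2) \<le> \<bar>M1\<bar> + \<bar>M2\<bar>"
        proof (rule onorm_bound)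
          fix h :: pt
          have "\<bar>F n (Suc i) j z * h $ 1 + F n i (Suc j) z * h $ 2\<bar> \<le> \<bar>M1\<bar> * norm h + \<bar>M2\<bar> * norm h"
            using elim(1,2)[rule_format, OF z] component_le_norm_cart[of h 1] component_le_norm_cart[of h 2]
            by (intro order_trans[OF abs_triangle_ineq] add_mono) (auto simp: abs_mult intro!: mult_mono)
          then show "norm (F n (Suc i) j z * h $ 1 + F n i (Suc j) z * h $ 2) \<le> (\<bar>M1\<bar> + \<bar>M2\<bar>) * norm h" by (simp add: algebra_simps)
        qed simp
      qed (use elim in auto)
      then show ?case by simp
    qed
  qed simp
  then show ?thesis by (intro that[of "\<bar>M1\<bar> + \<bar>M2\<bar>"]) auto
qed

end

section \<open>Cubic polynomials in affine coordinates\<close>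

text \<open>A cubic in the affine coordinates \<open>a \<bullet> (x - z)\<close> and \<open>b \<bullet> (x - z)\<close>, given by its derivatives at \<open>z\<close> with respect to
  these coordinates. Partial derivatives then act linearly on the coefficients, by shifts (\<open>dcub\<close>), and \<open>jet\<close>
  gives the coefficients of a mixed partial derivative.\<close>

definition cub :: "(nat \<Rightarrow> nat \<Rightarrow> real) \<Rightarrow> pt \<Rightarrow> pt \<Rightarrow> pt \<Rightarrow> pt \<Rightarrow> real" where
  "cub c a b z x = (\<Sum>i\<le>3. \<Sum>j\<le>3. c i j * ((a \<bullet> (x - z)) ^ i / fact i) * ((b \<bullet> (x - z)) ^ j / fact j))"

definition dcub :: "real \<Rightarrow> real \<Rightarrow> (nat \<Rightarrow> nat \<Rightarrow> real) \<Rightarrow> nat \<Rightarrow> nat \<Rightarrow> real" where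
  "dcub \<alpha> \<beta> c i j = \<alpha> * c (Suc i) j + \<beta> * c i (Suc j)"

definition jet :: "(nat \<Rightarrow> nat \<Rightarrow> real) \<Rightarrow> pt \<Rightarrow> pt \<Rightarrow> nat \<Rightarrow> nat \<Rightarrow> nat \<Rightarrow> nat \<Rightarrow> real" where
  "jet c a b i j = (dcub (a $ 1) (b $ 1) ^^ i) ((dcub (a $ 2) (b $ 2) ^^ j) c)"

definition deg_le :: "nat \<Rightarrow> (nat \<Rightarrow> nat \<Rightarrow> real) \<Rightarrow> bool" where
  "deg_le d c \<longleftrightarrow> (\<forall>i j. i + j > d \<longrightarrow> c i j = 0)"

lemma dcub_commute: "dcub \<alpha> \<beta> (dcub \<gamma> \<delta> c) = dcub \<gamma> \<delta> (dcub \<alpha> \<beta> c)"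
  by (auto simp: dcub_def fun_eq_iff algebra_simps)

lemma dcub_power_commute: "dcub \<alpha> \<beta> ((dcub \<gamma> \<delta> ^^ n) c) = (dcub \<gamma> \<delta> ^^ n) (dcub \<alpha> \<beta> c)"
proof (induction n)
  case (Suc n)
  then show ?case using dcub_commute[of \<alpha> \<beta> \<gamma> \<delta> "(dcub \<gamma> \<delta> ^^ n) c"] by simp
qed simp

lemma jet_simps:
  "jet c a b 0 0 = c"
  "jet c a b (Suc i) j = dcub (a $ 1) (b $ 1) (jet c a b i j)"
  "jet c a b i (Suc j) = dcub (a $ 2) (b $ 2) (jet c a b i j)"
  by (simp_all add: jet_def dcub_power_commute)

lemma deg_le_dcub: "deg_le d c \<Longrightarrow> deg_le d (dcub \<alpha> \<beta> c)"
  by (simp add: deg_le_def dcub_def)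

lemma deg_le_jet: "deg_le 3 c \<Longrightarrow> deg_le 3 (jet c a b i j)"
proof (induction i)
  case 0
  show ?case using 0 by (induction j) (simp_all add: jet_simps deg_le_dcub)
qed (simp add: jet_simps deg_le_dcub)

lemma jet_vanishes:
  assumes "deg_le 3 c" "p + q + (i + j) > 3"
  shows "jet c a b i j p q = 0"
proof -
  have 2: "(dcub (a $ 2) (b $ 2) ^^ j) c p q = 0" if "p + q + j > 3" for p q
    using that by (induction j arbitrary: p q) (use assms(1) in \<open>auto simp: deg_le_def dcub_def\<close>)
  show ?thesis
    using assms(2) by (induction i arbitrary: p q) (auto simp: jet_def dcub_def 2)
qed

lemma power_fact_has_derivative:
  fixes a :: pt
  shows "((\<lambda>x. (a \<bullet> (x - z)) ^ i / fact i) has_derivative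
     (\<lambda>h. (if i = 0 then 0 else (a \<bullet> (x - z)) ^ (i - 1) / fact (i - 1)) * (a \<bullet> h))) (at x)"
proof -
  have "((\<lambda>s::real. s ^ i / fact i) has_real_derivative (if i = 0 then 0 else (a \<bullet> (x - z)) ^ (i - 1) / fact (i - 1))) (at (a \<bullet> (x - z)))"
  proof (cases i)
    case (Suc k)
    let ?y = "a \<bullet> (x - z)"
    have e: "real (Suc k) * ?y ^ (Suc k - Suc 0) / fact (Suc k) = ?y ^ k / fact k"
      by (simp add: fact_Suc del: of_nat_Suc)
    have "((\<lambda>s::real. s ^ Suc k / fact (Suc k)) has_real_derivative real (Suc k) * ?y ^ (Suc k - Suc 0) / fact (Suc k)) (at ?y)"
      by (rule DERIV_cdivide[OF DERIV_pow])
    from DERIV_cong[OF this e] show ?thesis by (simp only: Suc nat.simps if_False diff_Suc_1)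
  qed simp
  then have o: "((\<lambda>s::real. s ^ i / fact i) has_derivative (*) (if i = 0 then 0 else (a \<bullet> (x - z)) ^ (i - 1) / fact (i - 1))) (at (a \<bullet> (x - z)))"
    by (simp add: has_field_derivative_def)
  have "((\<lambda>x. a \<bullet> (x - z)) has_derivative (\<lambda>h. a \<bullet> h)) (at x)"
    by (auto intro!: derivative_eq_intros)
  from has_derivative_compose[OF this o] show ?thesis .
qed

lemma cub_has_derivative_aux:
  assumes "deg_le 3 c"
  shows "(cub c a b z has_derivative (\<lambda>h. cub (dcub (a \<bullet> h) (b \<bullet> h) c) a b z x)) (at x)"
proof -
  let ?s = "a \<bullet> (x - z)" and ?t = "b \<bullet> (x - z)"
  let ?p = "\<lambda>s i. s ^ i / fact i :: real" and ?d = "\<lambda>s i. if i = 0 then 0 else s ^ (i - 1) / fact (i - 1) :: real"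
  have "(cub c a b z has_derivative (\<lambda>h. \<Sum>i\<le>3. \<Sum>j\<le>3. (c i j * ?p ?s i) * (?d ?t j * (b \<bullet> h)) + c i j * (?d ?s i * (a \<bullet> h)) * ?p ?t j)) (at x)"
    unfolding cub_def[abs_def]
    by (intro has_derivative_sum has_derivative_mult has_derivative_mult_right power_fact_has_derivative)
  moreover have "(\<Sum>i\<le>3. \<Sum>j\<le>3. (c i j * ?p ?s i) * (?d ?t j * (b \<bullet> h)) + c i j * (?d ?s i * (a \<bullet> h)) * ?p ?t j) =
    cub (dcub (a \<bullet> h) (b \<bullet> h) c) a b z x" for h
  proof -
    have c0: "c i j = 0" if "i + j > 3" for i j using assms that by (simp add: deg_le_def)
    have 1: "(\<Sum>j\<le>3. f j * ?d t j) = (\<Sum>j\<le>3. f (Suc j) * ?p t j)" if "f 4 = 0" for f :: "nat \<Rightarrow> real" and t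
      using that by (simp add: numeral_3_eq_3 numeral_eq_Suc)
    have "(\<Sum>i\<le>3. \<Sum>j\<le>3. c i j * ?p ?s i * (?d ?t j * (b \<bullet> h)) + c i j * (?d ?s i * (a \<bullet> h)) * ?p ?t j) =
      (b \<bullet> h) * (\<Sum>i\<le>3. (\<Sum>j\<le>3. c i j * ?d ?t j) * ?p ?s i) + (a \<bullet> h) * (\<Sum>j\<le>3. (\<Sum>i\<le>3. c i j * ?d ?s i) * ?p ?t j)"
    proof -
      have "(\<Sum>i\<le>3. \<Sum>j\<le>3. c i j * (?d ?s i * (a \<bullet> h)) * ?p ?t j) = (a \<bullet> h) * (\<Sum>j\<le>3. (\<Sum>i\<le>3. c i j * ?d ?s i) * ?p ?t j)"
        by (subst sum.swap) (simp add: sum_distrib_left sum_distrib_right mult_ac)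
      moreover have "(\<Sum>i\<le>3. \<Sum>j\<le>3. c i j * ?p ?s i * (?d ?t j * (b \<bullet> h))) = (b \<bullet> h) * (\<Sum>i\<le>3. (\<Sum>j\<le>3. c i j * ?d ?t j) * ?p ?s i)"
        by (simp add: sum_distrib_left sum_distrib_right mult_ac)
      ultimately show ?thesis by (simp add: sum.distrib)
    qed
    also have "\<dots> = (b \<bullet> h) * (\<Sum>i\<le>3. (\<Sum>j\<le>3. c i (Suc j) * ?p ?t j) * ?p ?s i) + (a \<bullet> h) * (\<Sum>j\<le>3. (\<Sum>i\<le>3. c (Suc i) j * ?p ?s i) * ?p ?t j)"
      by (simp only: 1 c0)
    also have "(\<Sum>j\<le>3. (\<Sum>i\<le>3. c (Suc i) j * ?p ?s i) * ?p ?t j) = (\<Sum>i\<le>3. \<Sum>j\<le>3. c (Suc i) j * ?p ?s i * ?p ?t j)"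
      by (subst sum.swap) (simp add: sum_distrib_right sum_divide_distrib)
    also have "(b \<bullet> h) * (\<Sum>i\<le>3. (\<Sum>j\<le>3. c i (Suc j) * ?p ?t j) * ?p ?s i) + (a \<bullet> h) * (\<Sum>i\<le>3. \<Sum>j\<le>3. c (Suc i) j * ?p ?s i * ?p ?t j)
       = cub (dcub (a \<bullet> h) (b \<bullet> h) c) a b z x"
      unfolding cub_def dcub_def
      by (simp only: sum_distrib_left sum_distrib_right sum.distrib[symmetric]) (intro sum.cong refl, simp add: algebra_simps)
    finally show ?thesis .
  qed
  ultimately show ?thesis by simp
qed

lemma cub_linear: "cub (\<lambda>i j. r * c i j + s * d i j) a b z x = r * cub c a b z x + s * cub d a b z x"
  by (simp add: cub_def sum_distrib_left sum.distrib[symmetric] algebra_simps add_divide_distrib)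

lemma inner_pt: "(a::pt) \<bullet> h = a $ 1 * h $ 1 + a $ 2 * h $ 2"
  by (simp add: inner_vec_def sum_2)

lemma cub_partials:
  assumes "deg_le 3 c"
  shows "partials (cub (jet c a b i j) a b z) (cub (jet c a b (Suc i) j) a b z) (cub (jet c a b i (Suc j)) a b z)"
  unfolding partials_def
proof
  fix x
  let ?c = "jet c a b i j"
  have e: "dcub (a \<bullet> h) (b \<bullet> h) ?c = (\<lambda>p q. h $ 1 * dcub (a $ 1) (b $ 1) ?c p q + h $ 2 * dcub (a $ 2) (b $ 2) ?c p q)" for h
    by (simp add: dcub_def fun_eq_iff inner_pt algebra_simps)
  show "(cub ?c a b z has_derivative (\<lambda>h. cub (jet c a b (Suc i) j) a b z x * h $ 1 + cub (jet c a b i (Suc j)) a b z x * h $ 2)) (at x)"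
    using cub_has_derivative_aux[OF deg_le_jet[OF assms, of a b i j], of a b z x]
    unfolding e cub_linear jet_simps by (simp add: mult.commute)
qed

lemma jet_bound:
  assumes c: "\<And>p q. \<bar>c p q\<bar> \<le> M" and N: "norm a \<le> N" "norm b \<le> N"
  shows "\<bar>jet c a b i j p q\<bar> \<le> (2 * N) ^ (i + j) * M"
proof -
  have N0: "N \<ge> 0" using N(1) norm_ge_zero[of a] by linarith
  have step: "\<bar>dcub (a $ k) (b $ k) d p q\<bar> \<le> 2 * N * M'" if "\<And>p q. \<bar>d p q\<bar> \<le> M'" for d M' p q and k :: 2
  proof -
    have "\<bar>a $ k\<bar> \<le> N" "\<bar>b $ k\<bar> \<le> N" using N component_le_norm_cart[of a k] component_le_norm_cart[of b k] by auto
    then have "\<bar>a $ k * d (Suc p) q + b $ k * d p (Suc q)\<bar> \<le> N * M' + N * M'"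
      using that N0 by (intro order_trans[OF abs_triangle_ineq] add_mono) (auto simp: abs_mult intro!: mult_mono)
    then show ?thesis by (simp add: dcub_def mult_ac)
  qed
  have "\<bar>jet c a b 0 j p q\<bar> \<le> (2 * N) ^ j * M" for p q
  proof (induction j arbitrary: p q)
    case (Suc j)
    show ?case using step[OF Suc] by (simp add: jet_simps mult.assoc)
  qed (simp add: jet_simps c)
  then show ?thesis
  proof (induction i arbitrary: p q)
    case (Suc i)
    show ?case using step[OF Suc.IH[OF Suc.prems]] by (simp add: jet_simps mult.assoc)
  qed simp
qed

lemma cub_bound:
  assumes c: "\<And>p q. \<bar>c p q\<bar> \<le> M" and R: "R \<ge> 1" "\<bar>a \<bullet> (x - z)\<bar> \<le> R" "\<bar>b \<bullet> (x - z)\<bar> \<le> R"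
  shows "\<bar>cub c a b z x\<bar> \<le> 16 * M * R ^ 6"
proof -
  have M: "M \<ge> 0" using c[of 0 0] by linarith
  have t: "\<bar>s ^ i / fact i\<bar> \<le> R ^ 3" if "\<bar>s\<bar> \<le> R" "i \<le> 3" for s :: real and i
  proof -
    have "\<bar>s ^ i / fact i\<bar> \<le> \<bar>s\<bar> ^ i"
      by (simp add: abs_mult power_abs divide_le_eq mult_left_le mult_le_cancel_left1 fact_ge_1)
    also have "\<dots> \<le> R ^ i" using that by (intro power_mono) auto
    also have "\<dots> \<le> R ^ 3" using R(1) that(2) by (rule power_increasing[rotated])
    finally show ?thesis .
  qed
  have "\<bar>cub c a b z x\<bar> \<le> (\<Sum>i\<le>3. \<Sum>j\<le>3. \<bar>c i j * ((a \<bullet> (x - z)) ^ i / fact i) * ((b \<bullet> (x - z)) ^ j / fact j)\<bar>)"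
    unfolding cub_def by (intro order_trans[OF sum_abs] sum_mono sum_abs)
  also have "\<dots> \<le> (\<Sum>i\<le>3::nat. \<Sum>j\<le>3::nat. M * R ^ 3 * R ^ 3)"
    unfolding abs_mult using t[OF R(2)] t[OF R(3)] c M R(1) by (intro sum_mono mult_mono) auto
  also have "\<dots> = 16 * M * R ^ 6" by (simp add: power_add[symmetric])
  finally show ?thesis .
qed

section \<open>Weak derivatives of smooth functions\<close>

lemma weak_family_smooth:
  assumes S: "open S" "bounded S" and P: "\<And>i j. partials (P i j) (P (Suc i) j) (P i (Suc j))"
  shows "weak_family m S (\<lambda>i j x. indicator S x * P i j x)"
  unfolding weak_family_def
proof (intro allI impI conjI)
  fix i j :: nat
  have c: "continuous_on UNIV (P i j)" for i j by (rule partials_continuous[OF P])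
  have cS: "continuous_on S (P i j)" for i j using c by (rule continuous_on_subset) simp
  show "(\<lambda>x. indicator S x * P i j x) \<in> borel_measurable borel"
    using S borel_measurable_continuous_onI[OF c] by simp
  show "indicator S x * P i j x = 0" if "x \<notin> S" for x using that by simp
  have "integrable lborel (\<lambda>x. indicator S x * (P i j x)\<^sup>2)"
    using S by (intro integrable_indicator_continuous continuous_intros c) auto
  moreover have "(indicator S x * P i j x)\<^sup>2 = indicator S x * (P i j x)\<^sup>2" for x by (auto simp: indicator_def)
  ultimately show "integrable lborel (\<lambda>x. (indicator S x * P i j x)\<^sup>2)" by simp
  fix \<phi> assume t: "test_function S \<phi>"
  have d: "(P i j has_derivative (\<lambda>h. P (Suc i) j x * h $ 1 + P i (Suc j) x * h $ 2)) (at x)" for i j x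
    using P by (simp add: partials_def)
  have 1: "(\<integral>x. indicator S x * P a b x * (partial 1 ^^ k) \<psi> x \<partial>lborel) = (-1) ^ k * (\<integral>x. indicator S x * P (a + k) b x * \<psi> x \<partial>lborel)"
    if "test_function S \<psi>" for a b k \<psi>
  proof (induction k arbitrary: a)
    case (Suc k)
    have "(\<integral>x. indicator S x * P a b x * (partial 1 ^^ Suc k) \<psi> x \<partial>lborel) = - (\<integral>x. indicator S x * P (Suc a) b x * (partial 1 ^^ k) \<psi> x \<partial>lborel)"
      using C1_integration_by_parts(1)[OF S(1) d cS cS test_function_partial_power[OF that]] by simp
    then show ?case using Suc.IH[of "Suc a"] by simp
  qed simp
  have 2: "(\<integral>x. indicator S x * P a b x * (partial 2 ^^ k) \<psi> x \<partial>lborel) = (-1) ^ k * (\<integral>x. indicator S x * P a (b + k) x * \<psi> x \<partial>lborel)"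
    if "test_function S \<psi>" for a b k \<psi>
  proof (induction k arbitrary: b)
    case (Suc k)
    have "(\<integral>x. indicator S x * P a b x * (partial 2 ^^ Suc k) \<psi> x \<partial>lborel) = - (\<integral>x. indicator S x * P a (Suc b) x * (partial 2 ^^ k) \<psi> x \<partial>lborel)"
      using C1_integration_by_parts(2)[OF S(1) d cS cS test_function_partial_power[OF that]] by simp
    then show ?case using Suc.IH[of "Suc b"] by simp
  qed simp
  show "(\<integral>x. indicator S x * P 0 0 x * mixed_deriv (i, j) \<phi> x \<partial>lborel) = (-1) ^ (i + j) * (\<integral>x. indicator S x * P i j x * \<phi> x \<partial>lborel)"
    using 1[OF test_function_partial_power[OF t, of j 2], of 0 0 i] 2[OF t, of i 0 j]
    by (simp add: mixed_deriv_def power_add)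
qed

lemma weak_family_diff:
  assumes S: "open S" "bounded S" and G: "weak_family m S G" and H: "weak_family m S H"
  shows "weak_family m S (\<lambda>i j x. G i j x - H i j x)"
  unfolding weak_family_def
proof (intro allI impI conjI)
  fix i j assume ij: "i + j \<le> m"
  note g = weak_familyD(1,3)[OF G ij] and h = weak_familyD(1,3)[OF H ij]
  show "(\<lambda>x. G i j x - H i j x) \<in> borel_measurable borel" using g h by simp
  show "G i j x - H i j x = 0" if "x \<notin> S" for x
    using weak_familyD(2)[OF G ij that] weak_familyD(2)[OF H ij that] by simp
  show "integrable lborel (\<lambda>x. (G i j x - H i j x)\<^sup>2)"
  proof (rule Bochner_Integration.integrable_bound)
    show "integrable lborel (\<lambda>x. 2 * (G i j x)\<^sup>2 + 2 * (H i j x)\<^sup>2)" using g h by simp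
    have "(G i j x - H i j x)\<^sup>2 \<le> 2 * (G i j x)\<^sup>2 + 2 * (H i j x)\<^sup>2" for x
      using zero_le_power2[of "G i j x + H i j x"] by (simp add: power2_eq_square algebra_simps)
    then show "AE x in lborel. norm ((G i j x - H i j x)\<^sup>2) \<le> norm (2 * (G i j x)\<^sup>2 + 2 * (H i j x)\<^sup>2)"
      by (intro AE_I2) simp
  qed (use g h in simp)
  fix \<phi> assume t: "test_function S \<phi>"
  note t' = test_function_mixed_deriv[OF t, of "(i, j)"]
  have z: "0 + 0 \<le> m" by simp
  have i: "integrable lborel (\<lambda>x. G 0 0 x * mixed_deriv (i, j) \<phi> x)" "integrable lborel (\<lambda>x. H 0 0 x * mixed_deriv (i, j) \<phi> x)"
    "integrable lborel (\<lambda>x. G i j x * \<phi> x)" "integrable lborel (\<lambda>x. H i j x * \<phi> x)"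
    by (rule integrable_mult_test[OF weak_family_integrable[OF S G z] t'] integrable_mult_test[OF weak_family_integrable[OF S H z] t']
      integrable_mult_test[OF weak_family_integrable[OF S G ij] t] integrable_mult_test[OF weak_family_integrable[OF S H ij] t])+
  show "(\<integral>x. (G 0 0 x - H 0 0 x) * mixed_deriv (i, j) \<phi> x \<partial>lborel) = (-1) ^ (i + j) * (\<integral>x. (G i j x - H i j x) * \<phi> x \<partial>lborel)"
    unfolding left_diff_distrib Bochner_Integration.integral_diff[OF i(1,2)] Bochner_Integration.integral_diff[OF i(3,4)]
      weak_familyD(4)[OF G ij t] weak_familyD(4)[OF H ij t]
    by (simp add: right_diff_distrib)
qed

text \<open>The classical derivatives of \<open>u\<close> are weak derivatives, so the derivatives of the mollifications are
  mollifications of continuous functions, which converge at every point.\<close>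

lemma (in mollified_family) C1_limits:
  assumes d: "\<And>x. x \<in> D \<Longrightarrow> (u has_derivative (\<lambda>h. g1 x * h $ 1 + g2 x * h $ 2)) (at x)"
    and c: "continuous_on D g1" "continuous_on D g2"
    and ae: "AE x in lborel. x \<in> D \<longrightarrow> u x = G 0 0 x" and x: "x \<in> D"
  shows "(\<lambda>n. F n 0 0 x) \<longlonglongrightarrow> u x" "(\<lambda>n. F n 1 0 x) \<longlonglongrightarrow> g1 x" "(\<lambda>n. F n 0 1 x) \<longlonglongrightarrow> g2 x"
proof -
  have cu: "continuous_on D u"
    by (meson d has_derivative_continuous continuous_at_imp_continuous_on)
  have lim: "(\<lambda>n. \<integral>y. indicator D y * f y * \<eta> n 0 0 (x - y) \<partial>lborel) \<longlonglongrightarrow> f x" if f: "continuous_on D f" for f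
  proof (rule LIMSEQ_I)
    fix r :: real assume r: "r > 0"
    obtain \<delta> where \<delta>: "\<delta> > 0" "\<And>y. y \<in> D \<Longrightarrow> dist y x < \<delta> \<Longrightarrow> dist (f y) (f x) < r / 2"
      using f x r unfolding continuous_on_iff by (metis half_gt_zero)
    have "\<forall>\<^sub>F n in sequentially. 1 / real (Suc n) < \<delta>"
      using LIMSEQ_inverse_real_of_nat \<delta>(1) by (auto simp: divide_inverse intro: order_tendstoD)
    with eventually_A[OF x]
    have "\<forall>\<^sub>F n in sequentially. norm ((\<integral>y. indicator D y * f y * \<eta> n 0 0 (x - y) \<partial>lborel) - f x) < r"
    proof eventually_elim
      case (elim n)
      define B where "B = cball x (1 / real (Suc n))"
      have BD: "B \<subseteq> D" using elim(1) by (simp add: A_def erode_def B_def)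
      have i: "integrable lborel (\<lambda>y. indicator B y * f y)"
        using borel_integrable_compact[of B f] continuous_on_subset[OF f BD] by (simp add: B_def)
      have "\<bar>moll (\<lambda>y. indicator B y * f y) (\<eta> n 0 0) x - f x\<bar> \<le> r / 2"
      proof (rule moll_near_continuous[OF \<eta> _ i])
        show "cball x (1 / real (Suc n)) \<subseteq> B" by (simp add: B_def)
        fix y assume y: "norm (x - y) < 1 / real (Suc n)"
        then have "y \<in> D" using BD by (auto simp: B_def dist_norm)
        then show "\<bar>f y - f x\<bar> \<le> r / 2" using \<delta>(2)[of y] y elim(2) by (simp add: dist_norm norm_minus_commute)
      qed
      moreover have "(\<lambda>y. indicator B y * f y * \<eta> n 0 0 (x - y)) = (\<lambda>y. indicator D y * f y * \<eta> n 0 0 (x - y))"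
      proof
        fix y
        show "indicator B y * f y * \<eta> n 0 0 (x - y) = indicator D y * f y * \<eta> n 0 0 (x - y)"
          using BD mollifierD(2)[OF \<eta>, of n "x - y" 0 0] by (cases "y \<in> B") (auto simp: B_def dist_norm)
      qed
      ultimately show ?case using r by (simp add: moll_def)
    qed
    then show "\<exists>N. \<forall>n\<ge>N. norm ((\<integral>y. indicator D y * f y * \<eta> n 0 0 (x - y) \<partial>lborel) - f x) < r"
      by (simp add: eventually_sequentially)
  qed
  have meas: "(\<lambda>x. indicator D x * f x) \<in> borel_measurable borel" if "continuous_on D f" for f :: "pt \<Rightarrow> real"
    using borel_measurable_continuous_on_indicator[of D f] that D by simp
  have eqk: "(\<integral>y. G 0 0 y * k (x - y) \<partial>lborel) = (\<integral>y. indicator D y * u y * k (x - y) \<partial>lborel)"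
    if "continuous_on UNIV k" for k
  proof (rule integral_cong_AE)
    have "continuous_on UNIV (\<lambda>y. k (x - y))"
      by (rule continuous_on_compose2[OF that]) (auto intro!: continuous_intros)
    then have k: "(\<lambda>y. k (x - y)) \<in> borel_measurable borel" by (rule borel_measurable_continuous_onI)
    show "(\<lambda>y. G 0 0 y * k (x - y)) \<in> borel_measurable lborel"
      using weak_familyD(1)[OF G, of 0 0] k by simp
    show "(\<lambda>y. indicator D y * u y * k (x - y)) \<in> borel_measurable lborel"
      using borel_measurable_times[OF meas[OF cu] k] by simp
    show "AE y in lborel. G 0 0 y * k (x - y) = indicator D y * u y * k (x - y)"
      using ae
    proof eventually_elim
      case (elim y)
      have "G 0 0 y = 0" if "y \<notin> D" by (rule weak_familyD(2)[OF G _ that]) simp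
      then show ?case using elim by (cases "y \<in> D") auto
    qed
  qed
  show "(\<lambda>n. F n 0 0 x) \<longlonglongrightarrow> u x"
    using lim[OF cu] eqk[OF mollifier_continuous[OF \<eta>]] by (simp add: F_def moll_def)
  have F1: "F n 1 0 x = (\<integral>y. indicator D y * g1 y * \<eta> n 0 0 (x - y) \<partial>lborel)"
    and F2: "F n 0 1 x = (\<integral>y. indicator D y * g2 y * \<eta> n 0 0 (x - y) \<partial>lborel)" if "x \<in> A n" for n
  proof -
    have s: "cball x (1 / real (Suc n)) \<subseteq> D" using that by (simp add: A_def erode_def)
    note t = mollifier_test_function(1)[OF \<eta> s]
    have p: "partial 1 (\<lambda>y. \<eta> n 0 0 (x - y)) = (\<lambda>y. - \<eta> n 1 0 (x - y))"
      "partial 2 (\<lambda>y. \<eta> n 0 0 (x - y)) = (\<lambda>y. - \<eta> n 0 1 (x - y))"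
      using mollifier_reflected_partial[OF \<eta>, of 1 n 0 0 x] by simp_all
    show "F n 1 0 x = (\<integral>y. indicator D y * g1 y * \<eta> n 0 0 (x - y) \<partial>lborel)"
      using C1_integration_by_parts(1)[OF D(1) d c t] eqk[OF mollifier_continuous[OF \<eta>], of n 1 0]
      by (simp add: F_def moll_def p)
    show "F n 0 1 x = (\<integral>y. indicator D y * g2 y * \<eta> n 0 0 (x - y) \<partial>lborel)"
      using C1_integration_by_parts(2)[OF D(1) d c t] eqk[OF mollifier_continuous[OF \<eta>], of n 0 1]
      by (simp add: F_def moll_def p)
  qed
  show "(\<lambda>n. F n 1 0 x) \<longlonglongrightarrow> g1 x"
    by (rule Lim_transform_eventually[OF lim[OF c(1)]])
      (use eventually_A[OF x] F1 in \<open>auto elim: eventually_mono\<close>)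
  show "(\<lambda>n. F n 0 1 x) \<longlonglongrightarrow> g2 x"
    by (rule Lim_transform_eventually[OF lim[OF c(2)]])
      (use eventually_A[OF x] F2 in \<open>auto elim: eventually_mono\<close>)
qed

section \<open>Approximation by cubic polynomials\<close>

text \<open>The system is triangular: the equations with \<open>i + j = l\<close> determine the coefficients of degree \<open>l\<close> from those of
  higher degree. With \<open>\<mu> p q\<close> the moments of a set and \<open>t i j\<close> the integrals of the derivatives of a function, it
  expresses that all derivatives up to order three have the right means.\<close>

lemma moment_fit:
  fixes \<mu> t :: "nat \<Rightarrow> nat \<Rightarrow> real"
  assumes \<mu>: "\<mu> 0 0 \<noteq> 0"
  shows "\<exists>c. deg_le 3 c \<and> (\<forall>i j. i + j \<le> 3 \<longrightarrow> (\<Sum>p\<le>3. \<Sum>q\<le>3. c (p + i) (q + j) * \<mu> p q) = t i j)"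
proof -
  have "\<exists>c. deg_le 3 c \<and> (\<forall>i j. i + j \<le> 3 \<and> 4 \<le> k + (i + j) \<longrightarrow> (\<Sum>p\<le>3. \<Sum>q\<le>3. c (p + i) (q + j) * \<mu> p q) = t i j)"
    if "k \<le> 4" for k
    using that
  proof (induction k)
    case 0
    show ?case by (rule exI[of _ "\<lambda>_ _. 0"]) (auto simp: deg_le_def)
  next
    case (Suc k)
    then obtain c where c: "deg_le 3 c" and ceq: "\<And>i j. i + j \<le> 3 \<Longrightarrow> 4 \<le> k + (i + j) \<Longrightarrow> (\<Sum>p\<le>3. \<Sum>q\<le>3. c (p + i) (q + j) * \<mu> p q) = t i j"
      by auto
    define l where "l = 3 - k"
    have kl: "k + l = 3" using Suc.prems by (simp add: l_def)
    define c0 where "c0 i j = (if i + j > l then c i j else 0)" for i j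
    define T where "T i j = (\<Sum>p\<le>3. \<Sum>q\<le>3. c0 (p + i) (q + j) * \<mu> p q)" for i j
    define c' where "c' i j = (if i + j > l then c i j else if i + j = l then (t i j - T i j) / \<mu> 0 0 else 0)" for i j
    have "deg_le 3 c'" using c kl by (auto simp: deg_le_def c'_def)
    moreover have "(\<Sum>p\<le>3. \<Sum>q\<le>3. c' (p + i) (q + j) * \<mu> p q) = t i j" if ij: "i + j \<le> 3" "4 \<le> Suc k + (i + j)" for i j
    proof (cases "i + j = l")
      case True
      have "c' (p + i) (q + j) * \<mu> p q = c0 (p + i) (q + j) * \<mu> p q + (if p = 0 then (if q = 0 then t i j - T i j else 0) else 0)" for p q
        using True \<mu> by (auto simp: c'_def c0_def)
      then have "(\<Sum>p\<le>3. \<Sum>q\<le>3. c' (p + i) (q + j) * \<mu> p q) = T i j + (\<Sum>p\<le>3::nat. \<Sum>q\<le>3::nat. (if p = 0 then (if q = 0 then t i j - T i j else 0) else 0))"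
        by (simp only: T_def sum.distrib)
      also have "(\<Sum>p\<le>3::nat. \<Sum>q\<le>3::nat. (if p = 0 then (if q = 0 then t i j - T i j else 0) else (0::real))) = t i j - T i j"
        by (simp add: numeral_3_eq_3)
      finally show ?thesis by simp
    next
      case False
      then have "i + j > l" using ij kl by linarith
      then have "c' (p + i) (q + j) = c (p + i) (q + j)" for p q by (simp add: c'_def)
      then show ?thesis using ceq[of i j] \<open>i + j > l\<close> ij kl by simp
    qed
    ultimately show ?case by blast
  qed
  from this[of 4] show ?thesis by auto
qed

abbreviation e1 :: pt where "e1 \<equiv> axis 1 1"
abbreviation e2 :: pt where "e2 \<equiv> axis 2 1"

lemma jet_axis: "jet c e1 e2 i j p q = c (p + i) (q + j)"
proof -
  have a: "e1 $ 1 = 1" "e1 $ 2 = 0" "e2 $ 1 = 0" "e2 $ 2 = 1" by (simp_all add: axis_def)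
  have 2: "jet c e1 e2 0 j p q = c p (q + j)" for p q
    by (induction j arbitrary: p q) (simp_all add: jet_simps dcub_def a)
  show ?thesis
    by (induction i arbitrary: p q) (simp_all add: jet_simps dcub_def a 2)
qed

abbreviation pol :: "(nat \<Rightarrow> nat \<Rightarrow> real) \<Rightarrow> nat \<Rightarrow> nat \<Rightarrow> pt \<Rightarrow> real" where
  "pol c i j \<equiv> cub (jet c e1 e2 i j) e1 e2 0"

lemma finite_pairs: "finite {(i, j). i + j = (l::nat)}"
  by (rule finite_subset[of _ "{..l} \<times> {..l}"]) auto

lemma measure_open_pos:
  fixes D :: "pt set"
  assumes "open D" "bounded D" "D \<noteq> {}"
  shows "measure lborel D > 0"
proof -
  have "emeasure lborel D \<noteq> 0"
    using open_not_negligible[OF assms(1,3)] assms(1) by (simp add: negligible_iff_null_sets null_sets_def)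
  moreover have "emeasure lborel D = ennreal (measure lborel D)"
    using emeasure_bounded_finite[OF assms(2)] by (intro emeasure_eq_ennreal_measure) auto
  ultimately show ?thesis using zero_less_measure_iff by fastforce
qed

text \<open>After subtraction of the cubic from \<open>moment_fit\<close> the Poincare inequality holds without the mean value term, and
  can be iterated from order \<open>i + j\<close> up to order four. Each step costs a factor \<open>2 h\<^sup>2\<close> for each of two derivatives.\<close>

lemma bramble_hilbert:
  assumes D: "open D" "bounded D" "convex D" "D \<noteq> {}" and h: "\<And>x y. x \<in> D \<Longrightarrow> y \<in> D \<Longrightarrow> norm (x - y) \<le> h"
    and G: "weak_family 4 D G"
  obtains c where "deg_le 3 c"
    "\<And>i j. i + j \<le> 4 \<Longrightarrow> (\<integral>x. (G i j x - indicator D x * pol c i j x)\<^sup>2 \<partial>lborel)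
       \<le> (4 * h\<^sup>2) ^ (4 - (i + j)) * (\<Sum>(i, j) | i + j = 4. sqnorm (G i j))"
proof -
  define V where "V = measure lborel D"
  have V: "V > 0" unfolding V_def by (rule measure_open_pos[OF D(1,2,4)])
  define \<mu> where "\<mu> p q = (\<integral>x. indicator D x * (((e1 \<bullet> (x - 0)) ^ p / fact p) * ((e2 \<bullet> (x - 0)) ^ q / fact q)) \<partial>lborel)" for p q :: nat
  have \<mu>0: "\<mu> 0 0 = V" by (simp add: \<mu>_def V_def)
  obtain c where c: "deg_le 3 c" and fit: "\<And>i j. i + j \<le> 3 \<Longrightarrow> (\<Sum>p\<le>3. \<Sum>q\<le>3. c (p + i) (q + j) * \<mu> p q) = (\<integral>x. G i j x \<partial>lborel)"
    using moment_fit[of \<mu> "\<lambda>i j. \<integral>x. G i j x \<partial>lborel"] V \<mu>0 by auto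
  have P: "partials (pol c i j) (pol c (Suc i) j) (pol c i (Suc j))" for i j by (rule cub_partials[OF c])
  have Pint: "(\<integral>x. indicator D x * pol c i j x \<partial>lborel) = (\<Sum>p\<le>3. \<Sum>q\<le>3. c (p + i) (q + j) * \<mu> p q)" for i j
  proof -
    have i: "integrable lborel (\<lambda>x. indicator D x * (((e1 \<bullet> (x - 0)) ^ p / fact p) * ((e2 \<bullet> (x - 0)) ^ q / fact q)))" for p q
      using D by (intro integrable_indicator_continuous continuous_intros) auto
    have "(\<integral>x. indicator D x * pol c i j x \<partial>lborel) = (\<integral>x. (\<Sum>p\<le>3. \<Sum>q\<le>3. c (p + i) (q + j) *
        (indicator D x * (((e1 \<bullet> (x - 0)) ^ p / fact p) * ((e2 \<bullet> (x - 0)) ^ q / fact q)))) \<partial>lborel)"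
      by (simp add: cub_def jet_axis sum_distrib_left mult_ac)
    also have "\<dots> = (\<Sum>p\<le>3. \<Sum>q\<le>3. c (p + i) (q + j) * \<mu> p q)"
      unfolding \<mu>_def
      by (subst Bochner_Integration.integral_sum; (intro Bochner_Integration.integrable_sum integrable_mult_right i)?)
        (subst Bochner_Integration.integral_sum; (intro integrable_mult_right i)?; simp only: integral_mult_right_zero)
    finally show ?thesis .
  qed
  define H where "H i j x = G i j x - indicator D x * pol c i j x" for i j x
  have wP: "weak_family 4 D (\<lambda>i j x. indicator D x * pol c i j x)"
    by (rule weak_family_smooth[OF D(1,2), of "\<lambda>i j. pol c i j"]) (rule P)
  have H: "weak_family 4 D H"
    unfolding H_def[abs_def] by (rule weak_family_diff[OF D(1,2) G wP])
  have Hmean: "(\<integral>x. H i j x \<partial>lborel) = 0" if "i + j \<le> 3" for i j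
  proof -
    have ij: "i + j \<le> 4" using that by simp
    show ?thesis
      unfolding H_def
      using weak_family_integrable[OF D(1,2) G ij] weak_family_integrable[OF D(1,2) wP ij] Pint[of i j] fit[OF that]
      by simp
  qed
  have "\<forall>n. \<exists>\<eta>. mollifier (1 / real (Suc n)) \<eta>" using ex_mollifier by simp
  then obtain \<eta> where \<eta>: "\<And>n. mollifier (1 / real (Suc n)) (\<eta> n)" by metis
  interpret H: mollified_family D 4 H \<eta>
    by unfold_locales (use D H \<eta> in auto)
  define E where "E = (\<Sum>(i, j) | i + j = 4. sqnorm (G i j))"
  have E0: "E \<ge> 0" unfolding E_def by (intro sum_nonneg) auto
  have step: "sqnorm (H i j) \<le> 2 * h\<^sup>2 * (sqnorm (H (Suc i) j) + sqnorm (H i (Suc j)))"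
    if "i + j \<le> 3" for i j
  proof -
    have "V * sqnorm (H i j) \<le> V * (2 * h\<^sup>2 * (sqnorm (H (Suc i) j) + sqnorm (H i (Suc j))))"
      using H.poincare_weak[OF h, of i j] that Hmean[OF that] by (simp add: V_def mult_ac)
    then show ?thesis using V by simp
  qed
  have "sqnorm (H i j) \<le> (4 * h\<^sup>2) ^ k * E" if "i + j + k = 4" for i j k
    using that
  proof (induction k arbitrary: i j)
    case 0
    have "jet c e1 e2 i j = (\<lambda>p q. 0)"
      using jet_vanishes[OF c] 0 by (auto simp: fun_eq_iff)
    then have "H i j x = G i j x" for x by (simp add: H_def cub_def)
    moreover have "sqnorm (G i j) \<le> E"
      unfolding E_def
      using member_le_sum[of "(i, j)" "{(i, j). i + j = 4}" "\<lambda>(i, j). sqnorm (G i j)"] 0 finite_pairs[of 4]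
      by auto
    ultimately show ?case by simp
  next
    case (Suc k)
    have "sqnorm (H i j) \<le> 2 * h\<^sup>2 * (sqnorm (H (Suc i) j) + sqnorm (H i (Suc j)))"
      using Suc.prems by (intro step) simp
    also have "\<dots> \<le> 2 * h\<^sup>2 * ((4 * h\<^sup>2) ^ k * E + (4 * h\<^sup>2) ^ k * E)"
      using Suc.prems by (intro mult_left_mono add_mono Suc.IH) auto
    also have "\<dots> = (4 * h\<^sup>2) ^ Suc k * E" by (simp add: algebra_simps)
    finally show ?case .
  qed
  then have "sqnorm (H i j) \<le> (4 * h\<^sup>2) ^ (4 - (i + j)) * E" if "i + j \<le> 4" for i j
    using that by simp
  then show ?thesis
    using that[OF c] unfolding H_def E_def by blast
qed

text \<open>The pointwise bounds come from \<open>sobolev_weak\<close> for the family of \<open>u - p\<close>, whose norms are bounded by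
  \<open>bramble_hilbert\<close>.\<close>

lemma cubic_approximation:
  assumes D: "open D" "bounded D" "convex D" "D \<noteq> {}" and h: "\<And>x y. x \<in> D \<Longrightarrow> y \<in> D \<Longrightarrow> norm (x - y) \<le> h"
    and u: "sobolev 4 D u"
    and d: "\<And>x. x \<in> D \<Longrightarrow> (u has_derivative (\<lambda>h. g1 x * h $ 1 + g2 x * h $ 2)) (at x)"
    and c: "continuous_on D g1" "continuous_on D g2"
  obtains G p L E where "weak_family 4 D G" "represents D u (G 0 0)" "deg_le 3 p"
    "E = (\<Sum>(i, j) | i + j = 4. sqnorm (G i j))"
    "\<And>i j. i + j \<le> 4 \<Longrightarrow> (\<integral>x. (G i j x - indicator D x * pol p i j x)\<^sup>2 \<partial>lborel) \<le> (4 * h\<^sup>2) ^ (4 - (i + j)) * E"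
    "\<And>x. x \<in> D \<Longrightarrow> measure lborel D * (u x - pol p 0 0 x)\<^sup>2 \<le> 1344 * h ^ 8 * E"
    "\<And>x. x \<in> D \<Longrightarrow> measure lborel D * (g1 x - pol p 1 0 x)\<^sup>2 \<le> 336 * h ^ 6 * E"
    "\<And>x. x \<in> D \<Longrightarrow> measure lborel D * (g2 x - pol p 0 1 x)\<^sup>2 \<le> 336 * h ^ 6 * E"
    "\<And>x y. x \<in> D \<Longrightarrow> y \<in> D \<Longrightarrow> \<bar>u x - u y\<bar> \<le> L * norm (x - y)"
    "\<And>x y. x \<in> D \<Longrightarrow> y \<in> D \<Longrightarrow> \<bar>g1 x - g1 y\<bar> \<le> L * norm (x - y)"
    "\<And>x y. x \<in> D \<Longrightarrow> y \<in> D \<Longrightarrow> \<bar>g2 x - g2 y\<bar> \<le> L * norm (x - y)"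
proof -
  obtain G where G: "weak_family 4 D G" and r: "represents D u (G 0 0)"
    using sobolev_imp_weak_family[OF D(1) u] by blast
  obtain p where p: "deg_le 3 p" and bh: "\<And>i j. i + j \<le> 4 \<Longrightarrow> (\<integral>x. (G i j x - indicator D x * pol p i j x)\<^sup>2 \<partial>lborel)
       \<le> (4 * h\<^sup>2) ^ (4 - (i + j)) * (\<Sum>(i, j) | i + j = 4. sqnorm (G i j))"
    using bramble_hilbert[OF D h G] by blast
  define E where "E = (\<Sum>(i, j) | i + j = 4. sqnorm (G i j))"
  have P: "partials (pol p i j) (pol p (Suc i) j) (pol p i (Suc j))" for i j by (rule cub_partials[OF p])
  have cP: "continuous_on S (pol p i j)" for i j S using partials_continuous[OF P] by (rule continuous_on_subset) simp
  define H where "H i j x = G i j x - indicator D x * pol p i j x" for i j x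
  have H: "weak_family 4 D H"
    unfolding H_def[abs_def]
    by (rule weak_family_diff[OF D(1,2) G weak_family_smooth[OF D(1,2), of "\<lambda>i j. pol p i j"]]) (rule P)
  have bH: "sqnorm (H i j) \<le> (4 * h\<^sup>2) ^ (4 - (i + j)) * E" if "i + j \<le> 4" for i j
    using bh[OF that] by (simp add: H_def E_def)
  have bH': "sqnorm (H i j) \<le> (4 * h\<^sup>2) ^ k * E" if "i + j + k = 4" for i j k
  proof -
    have "k = 4 - (i + j)" "i + j \<le> 4" using that by auto
    then show ?thesis using bH by simp
  qed
  have "\<forall>n. \<exists>\<eta>. mollifier (1 / real (Suc n)) \<eta>" using ex_mollifier by simp
  then obtain \<eta> where \<eta>: "\<And>n. mollifier (1 / real (Suc n)) (\<eta> n)" by metis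
  interpret G: mollified_family D 4 G \<eta> by unfold_locales (use D G \<eta> in auto)
  interpret H: mollified_family D 4 H \<eta> by unfold_locales (use D H \<eta> in auto)
  have ae: "AE x in lborel. x \<in> D \<longrightarrow> u x = G 0 0 x" using r by (simp add: represents_def)
  then have aeH: "AE x in lborel. x \<in> D \<longrightarrow> u x - pol p 0 0 x = H 0 0 x"
    by eventually_elim (simp add: H_def)
  have dH: "((\<lambda>x. u x - pol p 0 0 x) has_derivative (\<lambda>h. (g1 x - pol p 1 0 x) * h $ 1 + (g2 x - pol p 0 1 x) * h $ 2)) (at x)" if "x \<in> D" for x
    using has_derivative_diff[OF d[OF that] P[of 0 0, unfolded partials_def, rule_format, of x]] by (simp add: algebra_simps)
  have cH: "continuous_on D (\<lambda>x. g1 x - pol p 1 0 x)" "continuous_on D (\<lambda>x. g2 x - pol p 0 1 x)"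
    by (intro continuous_intros c cP)+
  have limG: "(\<lambda>n. G.F n 0 0 x) \<longlonglongrightarrow> u x" "(\<lambda>n. G.F n 1 0 x) \<longlonglongrightarrow> g1 x" "(\<lambda>n. G.F n 0 1 x) \<longlonglongrightarrow> g2 x"
    if "x \<in> D" for x
    by (rule G.C1_limits[OF d c ae]; (assumption | rule that))+
  have limH: "(\<lambda>n. H.F n 0 0 x) \<longlonglongrightarrow> u x - pol p 0 0 x" "(\<lambda>n. H.F n 1 0 x) \<longlonglongrightarrow> g1 x - pol p 1 0 x"
    "(\<lambda>n. H.F n 0 1 x) \<longlonglongrightarrow> g2 x - pol p 0 1 x" if "x \<in> D" for x
    by (rule H.C1_limits[OF dH cH aeH]; (assumption | rule that))+
  obtain L1 where L1: "L1 \<ge> 0" "\<And>x y. x \<in> D \<Longrightarrow> y \<in> D \<Longrightarrow> \<bar>u x - u y\<bar> \<le> L1 * norm (x - y)"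
    using G.limit_Lipschitz[OF D(4) _ limG(1)] by auto
  obtain L2 where L2: "L2 \<ge> 0" "\<And>x y. x \<in> D \<Longrightarrow> y \<in> D \<Longrightarrow> \<bar>g1 x - g1 y\<bar> \<le> L2 * norm (x - y)"
    using G.limit_Lipschitz[OF D(4) _ limG(2)] by auto
  obtain L3 where L3: "L3 \<ge> 0" "\<And>x y. x \<in> D \<Longrightarrow> y \<in> D \<Longrightarrow> \<bar>g2 x - g2 y\<bar> \<le> L3 * norm (x - y)"
    using G.limit_Lipschitz[OF D(4) _ limG(3)] by auto
  define L where "L = L1 + L2 + L3"
  have LL: "L1 * norm (x - y) \<le> L * norm (x - y)" "L2 * norm (x - y) \<le> L * norm (x - y)" "L3 * norm (x - y) \<le> L * norm (x - y)" for x y :: pt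
    using L1(1) L2(1) L3(1) by (auto simp: L_def intro!: mult_right_mono)
  have b0: "H.sobolev_bound h 0 0 \<le> 1344 * h ^ 8 * E"
  proof -
    have "H.sobolev_bound h 0 0 \<le> 3 * ((4 * h\<^sup>2) ^ 4 * E) + 3 * h\<^sup>2 * ((4 * h\<^sup>2) ^ 3 * E + (4 * h\<^sup>2) ^ 3 * E)
       + 3 * h ^ 4 * ((4 * h\<^sup>2)\<^sup>2 * E + 2 * ((4 * h\<^sup>2)\<^sup>2 * E) + (4 * h\<^sup>2)\<^sup>2 * E)"
      unfolding H.sobolev_bound_def
      by (intro add_mono mult_left_mono bH') simp_all
    also have "\<dots> = 1344 * h ^ 8 * E"
      by (simp add: power_mult_distrib power_mult[symmetric] power_add[symmetric] algebra_simps)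
    finally show ?thesis .
  qed
  have b1: "H.sobolev_bound h 1 0 \<le> 336 * h ^ 6 * E" "H.sobolev_bound h 0 1 \<le> 336 * h ^ 6 * E"
  proof -
    have e: "3 * ((4 * h\<^sup>2) ^ 3 * E) + 3 * h\<^sup>2 * ((4 * h\<^sup>2)\<^sup>2 * E + (4 * h\<^sup>2)\<^sup>2 * E)
       + 3 * h ^ 4 * ((4 * h\<^sup>2) ^ 1 * E + 2 * ((4 * h\<^sup>2) ^ 1 * E) + (4 * h\<^sup>2) ^ 1 * E) = 336 * h ^ 6 * E"
      by (simp add: power_mult_distrib power_mult[symmetric] power_add[symmetric] algebra_simps)
    have "H.sobolev_bound h 1 0 \<le> 3 * ((4 * h\<^sup>2) ^ 3 * E) + 3 * h\<^sup>2 * ((4 * h\<^sup>2)\<^sup>2 * E + (4 * h\<^sup>2)\<^sup>2 * E)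
       + 3 * h ^ 4 * ((4 * h\<^sup>2) ^ 1 * E + 2 * ((4 * h\<^sup>2) ^ 1 * E) + (4 * h\<^sup>2) ^ 1 * E)"
      unfolding H.sobolev_bound_def
      by (intro add_mono mult_left_mono bH') simp_all
    then show "H.sobolev_bound h 1 0 \<le> 336 * h ^ 6 * E" unfolding e .
    have "H.sobolev_bound h 0 1 \<le> 3 * ((4 * h\<^sup>2) ^ 3 * E) + 3 * h\<^sup>2 * ((4 * h\<^sup>2)\<^sup>2 * E + (4 * h\<^sup>2)\<^sup>2 * E)
       + 3 * h ^ 4 * ((4 * h\<^sup>2) ^ 1 * E + 2 * ((4 * h\<^sup>2) ^ 1 * E) + (4 * h\<^sup>2) ^ 1 * E)"
      unfolding H.sobolev_bound_def
      by (intro add_mono mult_left_mono bH') simp_all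
    then show "H.sobolev_bound h 0 1 \<le> 336 * h ^ 6 * E" unfolding e .
  qed
  show ?thesis
  proof (rule that[of G p E L])
    show "weak_family 4 D G" "represents D u (G 0 0)" "deg_le 3 p" by fact+
    show "E = (\<Sum>(i, j) | i + j = 4. sqnorm (G i j))" by (rule E_def)
    show "\<And>i j. i + j \<le> 4 \<Longrightarrow> (\<integral>x. (G i j x - indicator D x * pol p i j x)\<^sup>2 \<partial>lborel) \<le> (4 * h\<^sup>2) ^ (4 - (i + j)) * E"
      unfolding E_def by (rule bh)
    show "measure lborel D * (u x - pol p 0 0 x)\<^sup>2 \<le> 1344 * h ^ 8 * E" if "x \<in> D" for x
      using H.sobolev_weak[OF h that _ limH(1)[OF that]] b0 by simp
    show "measure lborel D * (g1 x - pol p 1 0 x)\<^sup>2 \<le> 336 * h ^ 6 * E" if "x \<in> D" for x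
      using H.sobolev_weak[OF h that _ limH(2)[OF that]] b1(1) by simp
    show "measure lborel D * (g2 x - pol p 0 1 x)\<^sup>2 \<le> 336 * h ^ 6 * E" if "x \<in> D" for x
      using H.sobolev_weak[OF h that _ limH(3)[OF that]] b1(2) by simp
    show "\<bar>u x - u y\<bar> \<le> L * norm (x - y)" "\<bar>g1 x - g1 y\<bar> \<le> L * norm (x - y)" "\<bar>g2 x - g2 y\<bar> \<le> L * norm (x - y)"
      if "x \<in> D" "y \<in> D" for x y
      using L1(2)[OF that] L2(2)[OF that] L3(2)[OF that] LL[of x y] by linarith+
  qed
qed

section \<open>The local HCT function\<close>

lemma exists_3: "(\<exists>i::3. P i) \<longleftrightarrow> P 1 \<or> P 2 \<or> P 3"
  by (metis exhaust_3)

lemma third_index: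
  assumes "i \<noteq> (j::3)"
  obtains l where "l \<noteq> i" "l \<noteq> j" "\<And>k. k = i \<or> k = j \<or> k = l"
proof -
  have "(UNIV :: 3 set) - {i, j} \<noteq> {}"
  proof
    assume "(UNIV :: 3 set) - {i, j} = {}"
    then have "card (UNIV :: 3 set) \<le> card {i, j}" by (intro card_mono) auto
    then show False using assms by simp
  qed
  then obtain l where l: "l \<noteq> i" "l \<noteq> j" by auto
  have "{i, j, l} = (UNIV :: 3 set)"
    using assms l by (intro card_subset_eq) auto
  then show ?thesis using that[OF l] by blast
qed

text \<open>The geometry of a split triangle with vertices \<open>V j\<close>: \<open>\<beta>\<close> are the barycentric coordinates of the splitting
  point \<open>Z\<close> and \<open>\<ll> i\<close> is the gradient of the \<open>i\<close>-th barycentric coordinate.\<close>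

locale hct_frame =
  fixes V :: "3 \<Rightarrow> pt" and Z :: pt and \<beta> :: "3 \<Rightarrow> real" and \<ll> :: "3 \<Rightarrow> pt"
  assumes \<beta>_pos: "0 < \<beta> i" and \<beta>_sum: "(\<Sum>i\<in>UNIV. \<beta> i) = 1"
    and dual: "\<ll> i \<bullet> (V j - Z) = (if i = j then 1 else 0) - \<beta> i"
    and expand: "(\<Sum>k\<in>UNIV. (\<ll> k \<bullet> X) *\<^sub>R (V k - Z)) = X"
    and centre: "(\<Sum>k\<in>UNIV. \<beta> k *\<^sub>R (V k - Z)) = 0"
begin

definition v :: "3 \<Rightarrow> pt" where "v k = V k - Z"

text \<open>In \<open>cone i\<close>, which is spanned at \<open>Z\<close> by the two vertices other than \<open>V i\<close>, the coordinate along \<open>v k\<close> is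
  \<open>sc i k \<bullet> (x - Z)\<close>. It vanishes for \<open>k = i\<close>.\<close>

definition sc :: "3 \<Rightarrow> 3 \<Rightarrow> pt" where "sc i k = \<ll> k - (\<beta> k / \<beta> i) *\<^sub>R \<ll> i"

definition cone :: "3 \<Rightarrow> pt set" where "cone i = {x. \<forall>k. 0 \<le> sc i k \<bullet> (x - Z)}"

lemma \<beta>_nz[simp]: "\<beta> i \<noteq> 0" using \<beta>_pos[of i] by simp

lemma sc_self[simp]: "sc i i = 0" by (simp add: sc_def)

lemma sc_v: "i \<noteq> j \<Longrightarrow> sc i k \<bullet> v j = (if k = j then 1 else 0)"
  by (simp add: sc_def v_def inner_diff_left dual)

lemma centre_v: "(\<Sum>k\<in>UNIV. \<beta> k *\<^sub>R v k) = 0" using centre by (simp add: v_def)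

lemma sc_expand: "(\<Sum>k\<in>UNIV. (sc i k \<bullet> X) *\<^sub>R v k) = X"
proof -
  have "(\<Sum>k\<in>UNIV. (sc i k \<bullet> X) *\<^sub>R v k) = (\<Sum>k\<in>UNIV. (\<ll> k \<bullet> X) *\<^sub>R v k) - (\<ll> i \<bullet> X / \<beta> i) *\<^sub>R (\<Sum>k\<in>UNIV. \<beta> k *\<^sub>R v k)"
    by (simp add: sc_def inner_diff_left scaleR_diff_left sum_subtractf scaleR_sum_right mult.commute)
  then show ?thesis using expand[of X] by (simp add: centre_v, simp add: v_def)
qed

lemma sc_eq: "sc i k \<bullet> X = \<beta> k * (\<ll> k \<bullet> X / \<beta> k - \<ll> i \<bullet> X / \<beta> i)"
  by (simp add: sc_def inner_diff_left field_simps)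

lemma in_cone_iff: "x \<in> cone i \<longleftrightarrow> (\<forall>k. \<ll> i \<bullet> (x - Z) / \<beta> i \<le> \<ll> k \<bullet> (x - Z) / \<beta> k)"
  unfolding cone_def sc_eq using \<beta>_pos by (simp add: zero_le_mult_iff not_less less_le_not_le)

lemma closed_cone: "closed (cone i)"
proof -
  have "cone i = (\<Inter>k. {x. 0 \<le> sc i k \<bullet> (x - Z)})" by (auto simp: cone_def)
  then show ?thesis by (auto intro!: closed_INT closed_Collect_le continuous_intros)
qed

lemma cone_cover: "\<exists>i. x \<in> cone i"
proof -
  let ?a = "\<lambda>k. \<ll> k \<bullet> (x - Z) / \<beta> k"
  have "finite (range ?a)" by simp
  then have "Min (range ?a) \<in> range ?a" by (intro Min_in) auto
  then obtain i where i: "Min (range ?a) = ?a i" by (rule imageE)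
  have "x \<in> cone i" unfolding in_cone_iff i[symmetric] by (auto intro!: Min_le)
  then show ?thesis ..
qed

text \<open>A cone that contains \<open>x\<close>; ties do not matter by \<open>cone_overlap\<close>.\<close>

definition idx :: "pt \<Rightarrow> 3" where "idx x = (if x \<in> cone 1 then 1 else if x \<in> cone 2 then 2 else 3)"

lemma idx: "x \<in> cone (idx x)" unfolding idx_def using cone_cover[of x] by (auto simp: exists_3)

lemma cone_overlap: "x \<in> cone i \<Longrightarrow> x \<in> cone j \<Longrightarrow> sc i k \<bullet> (x - Z) = sc j k \<bullet> (x - Z)"
  unfolding sc_eq in_cone_iff by (metis order_antisym)

lemma V_in_cone: "i \<noteq> j \<Longrightarrow> V j \<in> cone i"
  using sc_v[of i j] by (auto simp: cone_def v_def)

lemma overlap_negligible: "i \<noteq> j \<Longrightarrow> negligible (cone i \<inter> cone j)"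
proof -
  assume ij: "i \<noteq> j"
  define a where "a = (1 / \<beta> i) *\<^sub>R \<ll> i - (1 / \<beta> j) *\<^sub>R \<ll> j"
  have "a \<bullet> v i = 1 / \<beta> i"
    using ij by (simp add: a_def v_def inner_diff_left dual field_simps)
  then have "a \<noteq> 0" by (metis \<beta>_nz divide_eq_0_iff inner_zero_left zero_neq_one)
  then have "negligible {x. a \<bullet> x = a \<bullet> Z}" by (intro negligible_hyperplane) simp
  moreover have "cone i \<inter> cone j \<subseteq> {x. a \<bullet> x = a \<bullet> Z}"
  proof
    fix x assume "x \<in> cone i \<inter> cone j"
    then have "\<ll> i \<bullet> (x - Z) / \<beta> i = \<ll> j \<bullet> (x - Z) / \<beta> j" unfolding in_cone_iff Int_iff by (metis order_antisym)
    then have "a \<bullet> (x - Z) = 0" by (simp add: a_def inner_diff_left)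
    then show "x \<in> {x. a \<bullet> x = a \<bullet> Z}" by (simp add: inner_diff_right)
  qed
  ultimately show ?thesis by (rule negligible_subset)
qed

end

text \<open>A cubic in the cone coordinates; the last sum has the coefficients \<open>D j j\<close> for \<open>t j ^ 3\<close> and \<open>3 * D j k\<close> for
  \<open>(t j)\<^sup>2 * t k\<close>. Products of three different coordinates vanish on every cone. The three pieces are restrictions
  of one expression, so that they fit along the rays.\<close>

definition Pol :: "real \<Rightarrow> (3 \<Rightarrow> real) \<Rightarrow> (3 \<Rightarrow> 3 \<Rightarrow> real) \<Rightarrow> (3 \<Rightarrow> 3 \<Rightarrow> real) \<Rightarrow> (3 \<Rightarrow> real) \<Rightarrow> real" where
  "Pol z \<gamma> Q D t = z + (\<Sum>j\<in>UNIV. \<gamma> j * t j) + (\<Sum>j\<in>UNIV. \<Sum>k\<in>UNIV. Q j k * t j * t k)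
     + (\<Sum>j\<in>UNIV. (t j)\<^sup>2 * (3 * (\<Sum>k\<in>UNIV. D j k * t k) - 2 * D j j * t j))"

definition dPol :: "(3 \<Rightarrow> real) \<Rightarrow> (3 \<Rightarrow> 3 \<Rightarrow> real) \<Rightarrow> (3 \<Rightarrow> 3 \<Rightarrow> real) \<Rightarrow> (3 \<Rightarrow> real) \<Rightarrow> 3 \<Rightarrow> real" where
  "dPol \<gamma> Q D t k = \<gamma> k + 2 * (\<Sum>j\<in>UNIV. Q k j * t j) + 6 * t k * (\<Sum>j\<in>UNIV. D k j * t j)
     + 3 * (\<Sum>j\<in>UNIV. D j k * (t j)\<^sup>2) - 6 * D k k * (t k)\<^sup>2"

lemma Pol_has_derivative:
  assumes t: "\<And>k. (\<tau> k has_derivative \<tau>' k) (at x within S)" and Q: "\<And>j k. Q j k = Q k j"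
  shows "((\<lambda>x. Pol z \<gamma> Q D (\<lambda>k. \<tau> k x)) has_derivative (\<lambda>h. \<Sum>k\<in>UNIV. dPol \<gamma> Q D (\<lambda>k. \<tau> k x) k * \<tau>' k h)) (at x within S)"
proof -
  have Qs: "Q 2 1 = Q 1 2" "Q 3 1 = Q 1 3" "Q 3 2 = Q 2 3" using Q by auto
  show ?thesis
    unfolding Pol_def dPol_def sum_3
    by (rule has_derivative_eq_rhs, (rule derivative_intros t)+)
      (simp add: fun_eq_iff Qs power2_eq_square algebra_simps)
qed

text \<open>The twelve parameters of the HCT space in a form adapted to the geometry: \<open>g j\<close> is the gradient at \<open>V j\<close>, \<open>M j j\<close>
  together with it determines the value there, and \<open>M j k\<close> for \<open>j \<noteq> k\<close> the normal derivative at the midpoint of the side from \<open>V j\<close>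
  to \<open>V k\<close>.\<close>

locale hct_data = hct_frame +
  fixes g :: "3 \<Rightarrow> pt" and M :: "3 \<Rightarrow> 3 \<Rightarrow> real"
  assumes M_sym: "M j k = M k j"
begin

text \<open>The gradient is continuous across the rays if the weighted sums of \<open>\<gamma>\<close> and of the rows of \<open>Q\<close> and \<open>D\<close> with
  weights \<open>\<beta>\<close> vanish. The following coefficients solve these equations for an arbitrary symmetric \<open>M\<close>; \<open>D j k\<close> is
  fixed by the gradient at \<open>V j\<close>.\<close>

definition ee :: "3 \<Rightarrow> real" where "ee j = (\<Sum>k\<in>UNIV. \<beta> k * M j k)"
definition zz :: real where "zz = (\<Sum>j\<in>UNIV. \<beta> j * ee j)"
definition \<gamma> :: "3 \<Rightarrow> real" where "\<gamma> j = 3 * (ee j - zz)"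
definition Q :: "3 \<Rightarrow> 3 \<Rightarrow> real" where "Q j k = 3 * (M j k - zz) - (\<gamma> j + \<gamma> k)"
definition D :: "3 \<Rightarrow> 3 \<Rightarrow> real" where "D j k = (g j \<bullet> v k - \<gamma> k - 2 * Q j k) / 3"

abbreviation "PP \<equiv> Pol zz \<gamma> Q D"
abbreviation "dP \<equiv> dPol \<gamma> Q D"

lemma Q_sym: "Q j k = Q k j" by (simp add: Q_def M_sym)

lemma \<beta>\<gamma>: "(\<Sum>k\<in>UNIV. \<beta> k * \<gamma> k) = 0"
proof -
  have "(\<Sum>k\<in>UNIV. \<beta> k * \<gamma> k) = 3 * (\<Sum>k\<in>UNIV. \<beta> k * ee k) - 3 * zz * (\<Sum>k\<in>UNIV. \<beta> k)"
    by (simp add: \<gamma>_def sum_3 algebra_simps)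
  then show ?thesis using \<beta>_sum by (simp add: zz_def)
qed

lemma \<beta>Q: "(\<Sum>k\<in>UNIV. \<beta> k * Q j k) = 0"
proof -
  have "(\<Sum>k\<in>UNIV. \<beta> k * Q j k) = 3 * (\<Sum>k\<in>UNIV. \<beta> k * M j k) - (3 * zz + \<gamma> j) * (\<Sum>k\<in>UNIV. \<beta> k) - (\<Sum>k\<in>UNIV. \<beta> k * \<gamma> k)"
    by (simp add: Q_def sum_3 algebra_simps)
  then show ?thesis by (simp add: \<beta>\<gamma> \<beta>_sum, simp add: ee_def[symmetric] \<gamma>_def)
qed

lemma \<beta>D: "(\<Sum>k\<in>UNIV. \<beta> k * D j k) = 0"
proof -
  have "(\<Sum>k\<in>UNIV. \<beta> k * D j k) = (g j \<bullet> (\<Sum>k\<in>UNIV. \<beta> k *\<^sub>R v k) - (\<Sum>k\<in>UNIV. \<beta> k * \<gamma> k) - 2 * (\<Sum>k\<in>UNIV. \<beta> k * Q j k)) / 3"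
    by (simp add: D_def sum_3 inner_add_right algebra_simps add_divide_distrib diff_divide_distrib)
  then show ?thesis by (simp add: \<beta>\<gamma> \<beta>Q centre_v)
qed

definition ray :: "3 \<Rightarrow> real \<Rightarrow> 3 \<Rightarrow> real" where "ray j s k = (if k = j then s else 0)"

lemma dP_ray: "dP (ray j s) k = \<gamma> k + 2 * s * Q j k + 3 * s\<^sup>2 * D j k"
proof -
  have "(\<Sum>l\<in>UNIV. Q k l * ray j s l) = Q k j * s" "(\<Sum>l\<in>UNIV. D k l * ray j s l) = D k j * s"
    "(\<Sum>l\<in>UNIV. D l k * (ray j s l)\<^sup>2) = D j k * s\<^sup>2"
    by (simp_all add: ray_def if_distrib[of "(*) _"] if_distrib[of "\<lambda>x. x\<^sup>2"] cong: if_cong)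
  then show ?thesis unfolding dPol_def Q_sym[of k j] by (simp add: ray_def power2_eq_square)
qed

lemma PP_ray: "PP (ray j s) = zz + s * \<gamma> j + s\<^sup>2 * Q j j + s ^ 3 * D j j"
  unfolding Pol_def using exhaust_3[of j]
  by (auto simp: ray_def sum_3 power2_eq_square power3_eq_cube algebra_simps)

text \<open>Across the ray through \<open>V j\<close> the gradient jumps by a multiple of this sum.\<close>

lemma \<beta>_dP_ray: "(\<Sum>k\<in>UNIV. \<beta> k * dP (ray j s) k) = 0"
proof -
  have "(\<Sum>k\<in>UNIV. \<beta> k * dP (ray j s) k) = (\<Sum>k\<in>UNIV. \<beta> k * \<gamma> k) + 2 * s * (\<Sum>k\<in>UNIV. \<beta> k * Q j k) + 3 * s\<^sup>2 * (\<Sum>k\<in>UNIV. \<beta> k * D j k)"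
    unfolding dP_ray by (simp add: sum_3 algebra_simps)
  then show ?thesis by (simp add: \<beta>\<gamma> \<beta>Q \<beta>D)
qed

definition piece :: "3 \<Rightarrow> pt \<Rightarrow> real" where "piece i x = PP (\<lambda>k. sc i k \<bullet> (x - Z))"
definition gpiece :: "3 \<Rightarrow> pt \<Rightarrow> pt" where "gpiece i x = (\<Sum>k\<in>UNIV. dP (\<lambda>k. sc i k \<bullet> (x - Z)) k *\<^sub>R sc i k)"

definition hf :: "pt \<Rightarrow> real" where "hf x = piece (idx x) x"
definition hg :: "pt \<Rightarrow> pt" where "hg x = gpiece (idx x) x"

lemma hf_eq: "x \<in> cone i \<Longrightarrow> hf x = piece i x"
  unfolding hf_def piece_def using cone_overlap[OF idx, of x i] by simp

lemma hg_eq: "x \<in> cone i \<Longrightarrow> hg x = gpiece i x"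
proof -
  assume x: "x \<in> cone i"
  let ?j = "idx x"
  define t where "t k = sc i k \<bullet> (x - Z)" for k
  have t': "(\<lambda>k. sc ?j k \<bullet> (x - Z)) = t" using cone_overlap[OF idx x] by (auto simp: t_def)
  show ?thesis
  proof (cases "?j = i")
    case False
    have "t i = 0" by (simp add: t_def)
    moreover have "t ?j = 0" using fun_cong[OF t', of ?j] by simp
    ultimately obtain l s where l: "t = ray l s"
    proof -
      obtain l where "l \<noteq> i" "l \<noteq> ?j" "\<And>k. k = i \<or> k = ?j \<or> k = l"
        using third_index[of i ?j] False by metis
      then have "t = ray l (t l)" using \<open>t i = 0\<close> \<open>t ?j = 0\<close> unfolding ray_def fun_eq_iff by metis
      then show ?thesis using that by blast
    qed
    have "gpiece ?j x - gpiece i x = (\<Sum>k\<in>UNIV. dP t k *\<^sub>R (sc ?j k - sc i k))"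
      unfolding gpiece_def t' t_def[symmetric] by (simp add: scaleR_diff_right sum_subtractf)
    also have "\<dots> = (\<Sum>k\<in>UNIV. (\<beta> k * dP t k) *\<^sub>R ((1 / \<beta> i) *\<^sub>R \<ll> i - (1 / \<beta> ?j) *\<^sub>R \<ll> ?j))"
      by (intro sum.cong refl) (simp add: sc_def scaleR_diff_right mult.commute)
    also have "\<dots> = 0"
      unfolding scaleR_sum_left[symmetric] l \<beta>_dP_ray by simp
    finally show ?thesis by (simp add: hg_def)
  qed (simp add: hg_def)
qed

lemma piece_has_derivative: "(piece i has_derivative (\<lambda>h. gpiece i x \<bullet> h)) (at x within S)"
proof -
  have "((\<lambda>x. sc i k \<bullet> (x - Z)) has_derivative (\<lambda>h. sc i k \<bullet> h)) (at x within S)" for k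
    by (auto intro!: derivative_eq_intros)
  from Pol_has_derivative[of "\<lambda>k x. sc i k \<bullet> (x - Z)", OF this Q_sym]
  show ?thesis by (simp add: piece_def[abs_def] gpiece_def inner_sum_left)
qed

lemma gpiece_continuous: "continuous_on S (gpiece i)"
  unfolding gpiece_def[abs_def] dPol_def by (intro continuous_intros)

text \<open>The three closed cones cover the plane, and within each of them the derivative is the one of its piece.\<close>

lemma hf_has_derivative: "(hf has_derivative (\<lambda>h. hg x \<bullet> h)) (at x)"
proof -
  have w: "(hf has_derivative (\<lambda>h. hg x \<bullet> h)) (at x within cone i)" for i
  proof (cases "x \<in> cone i")
    case True
    show ?thesis
      by (rule has_derivative_transform[OF True _ piece_has_derivative[of i x "cone i", folded hg_eq[OF True]]])
        (simp add: hf_eq)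
  next
    case False
    then have "at x within cone i = bot"
      using closed_cone not_in_closure_trivial_limitI by (metis closure_closed)
    then show ?thesis by (simp add: has_derivative_def bounded_linear_inner_right)
  qed
  have U: "UNIV = cone 1 \<union> cone 2 \<union> cone 3"
    using cone_cover by (auto simp: exists_3)
  have "(hf has_derivative (\<lambda>h. hg x \<bullet> h)) (at x within (cone 1 \<union> cone 2 \<union> cone 3))"
    using w[of 1] w[of 2] w[of 3] unfolding has_derivative_within
    by (simp add: at_within_union filterlim_sup)
  then show ?thesis using U by simp
qed

lemma hg_continuous: "continuous_on S hg"
proof -
  have "continuous_on (\<Union>i\<in>UNIV. cone i) hg"
  proof (rule continuous_on_closed_Union)
    show "continuous_on (cone i) hg" for i
      using gpiece_continuous by (rule continuous_on_eq) (simp add: hg_eq)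
  qed (auto simp: closed_cone)
  moreover have "(\<Union>i\<in>UNIV. cone i) = UNIV" using cone_cover by auto
  ultimately show ?thesis by (metis continuous_on_subset subset_UNIV)
qed

lemma vertex_ray: "i \<noteq> j \<Longrightarrow> (\<lambda>k. sc i k \<bullet> (V j - Z)) = ray j 1"
  using sc_v[of i j] by (auto simp: ray_def v_def fun_eq_iff)

lemma ex_other: "\<exists>i. i \<noteq> (j::3)"
proof -
  have "card (UNIV :: 3 set) \<noteq> card {j}" by simp
  then have "(UNIV :: 3 set) \<noteq> {j}" by metis
  then show ?thesis by blast
qed

lemma hf_vertex: "hf (V j) = M j j + g j \<bullet> v j / 3"
proof -
  obtain i where i: "i \<noteq> j" using ex_other by blast
  have "hf (V j) = PP (ray j 1)" using hf_eq[OF V_in_cone[OF i]] by (simp add: piece_def vertex_ray[OF i])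
  then show ?thesis unfolding PP_ray by (simp add: D_def Q_def field_simps)
qed

lemma hg_vertex: "hg (V j) = g j"
proof -
  obtain i where i: "i \<noteq> j" using ex_other by blast
  have hg: "hg (V j) = (\<Sum>k\<in>UNIV. (g j \<bullet> v k) *\<^sub>R sc i k)"
  proof -
    have "\<gamma> k + 2 * 1 * Q j k + 3 * 1\<^sup>2 * D j k = g j \<bullet> v k" for k by (simp add: D_def field_simps)
    then show ?thesis unfolding hg_eq[OF V_in_cone[OF i]] gpiece_def vertex_ray[OF i] dP_ray by (simp only:)
  qed
  have "hg (V j) \<bullet> X = g j \<bullet> X" for X
  proof -
    have "hg (V j) \<bullet> X = g j \<bullet> (\<Sum>k\<in>UNIV. (sc i k \<bullet> X) *\<^sub>R v k)"
      unfolding hg by (simp add: inner_sum_left inner_sum_right mult.commute)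
    then show ?thesis by (simp add: sc_expand)
  qed
  then show ?thesis using vector_eq_rdot by blast
qed

lemma hg_midpoint:
  assumes ij: "j \<noteq> k"
  defines "b \<equiv> (1/2) *\<^sub>R (V j + V k)"
  shows "hg b \<bullet> v j = dP (\<lambda>l. if l = j \<or> l = k then 1/2 else 0) j"
    and "hg b \<bullet> v k = dP (\<lambda>l. if l = j \<or> l = k then 1/2 else 0) k"
proof -
  obtain i where i: "i \<noteq> j" "i \<noteq> k" using third_index[OF ij] by metis
  have X: "b - Z = (1/2) *\<^sub>R v j + (1/2) *\<^sub>R v k"
    by (simp add: b_def v_def vec_eq_iff forall_2 field_simps)
  have t: "(\<lambda>l. sc i l \<bullet> (b - Z)) = (\<lambda>l. if l = j \<or> l = k then 1/2 else 0)"
    using ij unfolding X by (auto simp: inner_add_right sc_v[OF i(1)] sc_v[OF i(2)] fun_eq_iff)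
  have b: "b \<in> cone i" using fun_cong[OF t] by (auto simp: cone_def)
  have "hg b \<bullet> v m = dP (\<lambda>l. if l = j \<or> l = k then 1/2 else 0) m" if "m \<noteq> i" for m
    unfolding hg_eq[OF b] gpiece_def t using sc_v[OF that[symmetric]]
    by (simp add: inner_sum_left if_distrib[of "(*) _"] cong: if_cong)
  then show "hg b \<bullet> v j = dP (\<lambda>l. if l = j \<or> l = k then 1/2 else 0) j"
    and "hg b \<bullet> v k = dP (\<lambda>l. if l = j \<or> l = k then 1/2 else 0) k" using i by auto
qed

lemma dP_edge:
  assumes jk: "j \<noteq> k"
  shows "dP (\<lambda>l. if l = j \<or> l = k then 1/2 else 0) j
     = \<gamma> j + Q j j + Q j k + 3/4 * D j j + 3/2 * D j k + 3/4 * D k j"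
proof -
  have e: "(\<Sum>l\<in>UNIV. f l * (if l = j \<or> l = k then 1/2 else 0)) = f j / 2 + f k / 2" for f :: "3 \<Rightarrow> real"
  proof -
    have "(\<Sum>l\<in>UNIV. f l * (if l = j \<or> l = k then 1/2 else 0)) = (\<Sum>l\<in>{j, k}. f l / 2)"
      by (rule sum.mono_neutral_cong_right) auto
    then show ?thesis using jk by simp
  qed
  have e2: "(if l = j \<or> l = k then 1/2 else 0)\<^sup>2 = (1/2) * (if l = j \<or> l = k then 1/2 else 0 :: real)" for l
    by (simp add: power2_eq_square)
  have "(\<Sum>l\<in>UNIV. D l j * (if l = j \<or> l = k then 1/2 else 0)\<^sup>2) = (D j j + D k j) / 4"
    unfolding e2 using e[of "\<lambda>l. D l j * (1/2)"] by (simp add: mult.assoc)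
  then show ?thesis unfolding dPol_def e by (simp add: power2_eq_square field_simps)
qed

text \<open>The tangential derivative at the midpoint of a side depends only on the vertex data, since the restriction to
  the side is a cubic. The derivative in the direction from \<open>Z\<close> to the midpoint is affine in \<open>M j k\<close>, and so any
  normal derivative can be attained by the choice of \<open>M j k\<close>.\<close>

lemma midpoint_derivatives:
  assumes jk: "j \<noteq> k"
  defines "b \<equiv> (1/2) *\<^sub>R (V j + V k)"
  shows "hg b \<bullet> (v k - v j) = 3/2 * (hf (V k) - hf (V j)) - 1/4 * ((g j + g k) \<bullet> (v k - v j))"
    and "hg b \<bullet> ((1/2) *\<^sub>R (v j + v k)) = 3/8 * (g j \<bullet> v k + g k \<bullet> v j) + 3/4 * (hf (V j) + hf (V k))
       - 1/8 * (g j \<bullet> v j + g k \<bullet> v k) - 3/2 * M j k"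
proof -
  have c: "(\<lambda>l. if l = j \<or> l = k then 1/2 else 0) = (\<lambda>l. if l = k \<or> l = j then 1/2 else (0::real))" by auto
  have j: "hg b \<bullet> v j = \<gamma> j + Q j j + Q j k + 3/4 * D j j + 3/2 * D j k + 3/4 * D k j"
    unfolding b_def hg_midpoint(1)[OF jk] dP_edge[OF jk] ..
  have k: "hg b \<bullet> v k = \<gamma> k + Q k k + Q j k + 3/4 * D k k + 3/2 * D k j + 3/4 * D j k"
    unfolding b_def hg_midpoint(2)[OF jk] c dP_edge[OF jk[symmetric]] Q_sym[of k j] ..
  show "hg b \<bullet> (v k - v j) = 3/2 * (hf (V k) - hf (V j)) - 1/4 * ((g j + g k) \<bullet> (v k - v j))"
    unfolding inner_diff_right j k hf_vertex inner_add_left D_def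
    by (simp add: Q_def M_sym[of k j] field_simps)
  show "hg b \<bullet> ((1/2) *\<^sub>R (v j + v k)) = 3/8 * (g j \<bullet> v k + g k \<bullet> v j) + 3/4 * (hf (V j) + hf (V k))
       - 1/8 * (g j \<bullet> v j + g k \<bullet> v k) - 3/2 * M j k"
    unfolding inner_scaleR_right inner_add_right j k hf_vertex D_def
    by (simp add: Q_def M_sym[of k j] field_simps)
qed

end

definition p1 :: "3 \<Rightarrow> 3" where "p1 i = (if i = 1 then 2 else 1)"
definition p2 :: "3 \<Rightarrow> 3" where "p2 i = (if i = 3 then 2 else 3)"

lemma p12: "p1 i \<noteq> i" "p2 i \<noteq> i" "p1 i \<noteq> p2 i"
  by (cases i rule: exhaust_3[THEN disjE]; auto simp: p1_def p2_def)+

lemma p12_cover: "k = i \<or> k = p1 i \<or> k = p2 i"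
  using exhaust_3[of i] exhaust_3[of k] by (auto simp: p1_def p2_def)

lemma sum_p12: "(\<Sum>k\<in>UNIV. f k) = f i + f (p1 i) + (f (p2 i) :: 'a::comm_monoid_add)"
proof -
  have U: "(UNIV :: 3 set) = {i, p1 i, p2 i}" using p12_cover by auto
  show ?thesis unfolding U using p12[of i] by (simp add: add.assoc)
qed

definition cub_coeffs :: "real \<Rightarrow> real \<Rightarrow> real \<Rightarrow> real \<Rightarrow> real \<Rightarrow> real \<Rightarrow> real \<Rightarrow> real \<Rightarrow> real \<Rightarrow> real \<Rightarrow> nat \<Rightarrow> nat \<Rightarrow> real" where
  "cub_coeffs c00 c10 c01 c20 c11 c02 c30 c21 c12 c03 i j =
    (if i = 0 then (if j = 0 then c00 else if j = 1 then c01 else if j = 2 then c02 else if j = 3 then c03 else 0)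
     else if i = 1 then (if j = 0 then c10 else if j = 1 then c11 else if j = 2 then c12 else 0)
     else if i = 2 then (if j = 0 then c20 else if j = 1 then c21 else 0)
     else if i = 3 \<and> j = 0 then c30 else 0)"

lemma deg_le_cub_coeffs: "deg_le 3 (cub_coeffs c00 c10 c01 c20 c11 c02 c30 c21 c12 c03)"
  by (auto simp: deg_le_def cub_coeffs_def)

lemma cub_expand:
  assumes "deg_le 3 c"
  defines "s \<equiv> \<lambda>a x z. (a::pt) \<bullet> (x - z)"
  shows "cub c a b z x = c 0 0 + c 1 0 * s a x z + c 0 1 * s b x z + c 2 0 * (s a x z)\<^sup>2 / 2 + c 1 1 * s a x z * s b x z
    + c 0 2 * (s b x z)\<^sup>2 / 2 + c 3 0 * s a x z ^ 3 / 6 + c 2 1 * (s a x z)\<^sup>2 / 2 * s b x z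
    + c 1 2 * s a x z * (s b x z)\<^sup>2 / 2 + c 0 3 * s b x z ^ 3 / 6"
proof -
  have z: "c 1 3 = 0" "c 2 2 = 0" "c 2 3 = 0" "c 3 1 = 0" "c 3 2 = 0" "c 3 3 = 0" "c (Suc 0) 3 = 0" "c 3 (Suc 0) = 0"
    using assms(1) by (simp_all add: deg_le_def)
  have S: "{..3::nat} = {0, 1, 2, 3}" by auto
  have f: "fact 2 = (2::real)" "fact 3 = (6::real)" by (simp_all add: fact_numeral)
  show ?thesis unfolding cub_def s_def S by (simp add: z f)
qed

lemma cub_coeffs_cases:
  assumes "P 0" "P c00" "P c10" "P c01" "P c20" "P c11" "P c02" "P c30" "P c21" "P c12" "P c03"
  shows "P (cub_coeffs c00 c10 c01 c20 c11 c02 c30 c21 c12 c03 i j)"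
  using assms by (simp add: cub_coeffs_def)

context hct_data
begin

definition co :: "3 \<Rightarrow> nat \<Rightarrow> nat \<Rightarrow> real" where
  "co i = (let p = p1 i; q = p2 i in
     cub_coeffs zz (\<gamma> p) (\<gamma> q) (2 * Q p p) (2 * Q p q) (2 * Q q q) (6 * D p p) (6 * D p q) (6 * D q p) (6 * D q q))"

lemma deg_le_co: "deg_le 3 (co i)"
  by (simp add: co_def Let_def deg_le_cub_coeffs)

text \<open>The coordinate with index \<open>i\<close> is zero in piece \<open>i\<close>, which is thus a cubic in the other two.\<close>

lemma piece_eq_cub: "piece i = cub (co i) (sc i (p1 i)) (sc i (p2 i)) Z"
proof
  fix x
  define s t where "s = sc i (p1 i) \<bullet> (x - Z)" "t = sc i (p2 i) \<bullet> (x - Z)"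
  have "piece i x = zz + \<gamma> (p1 i) * s + \<gamma> (p2 i) * t + Q (p1 i) (p1 i) * s\<^sup>2 + 2 * Q (p1 i) (p2 i) * s * t + Q (p2 i) (p2 i) * t\<^sup>2
    + D (p1 i) (p1 i) * s ^ 3 + 3 * D (p1 i) (p2 i) * s\<^sup>2 * t + 3 * D (p2 i) (p1 i) * s * t\<^sup>2 + D (p2 i) (p2 i) * t ^ 3"
    unfolding piece_def Pol_def sum_p12[of _ i] sc_self inner_zero_left s_t_def[symmetric] Q_sym[of "p2 i" "p1 i"]
    by (simp add: power2_eq_square power3_eq_cube algebra_simps)
  moreover have "cub (co i) (sc i (p1 i)) (sc i (p2 i)) Z x = \<dots>"
    unfolding cub_expand[OF deg_le_co] s_t_def[symmetric]
    by (simp add: co_def Let_def cub_coeffs_def algebra_simps)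
  ultimately show "piece i x = cub (co i) (sc i (p1 i)) (sc i (p2 i)) Z x" by simp
qed

lemma co_bound:
  assumes M: "\<And>j k. \<bar>M j k\<bar> \<le> B" and g: "\<And>j k. \<bar>g j \<bullet> v k\<bar> \<le> B"
  shows "\<bar>co i a b\<bar> \<le> 108 * B"
proof -
  have avg: "\<bar>\<Sum>k\<in>UNIV. \<beta> k * x k\<bar> \<le> B" if "\<And>k. \<bar>x k\<bar> \<le> B" for x
  proof -
    have "\<bar>\<Sum>k\<in>UNIV. \<beta> k * x k\<bar> \<le> (\<Sum>k\<in>UNIV. \<beta> k * B)"
    proof (rule order_trans[OF sum_abs], rule sum_mono)
      show "\<bar>\<beta> k * x k\<bar> \<le> \<beta> k * B" for k
        using that[of k] \<beta>_pos[of k] by (simp add: abs_mult)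
    qed
    then show ?thesis by (simp add: sum_distrib_right[symmetric] \<beta>_sum)
  qed
  have ee: "\<bar>ee j\<bar> \<le> B" for j unfolding ee_def by (rule avg) (rule M)
  have zz: "\<bar>zz\<bar> \<le> B" unfolding zz_def by (rule avg) (rule ee)
  have \<gamma>: "\<bar>\<gamma> j\<bar> \<le> 6 * B" for j using ee[of j] zz by (simp add: \<gamma>_def)
  have Q: "\<bar>Q j k\<bar> \<le> 18 * B" for j k using M[of j k] zz \<gamma>[of j] \<gamma>[of k] by (simp add: Q_def)
  have D: "\<bar>D j k\<bar> \<le> 18 * B" for j k using g[of j k] \<gamma>[of k] Q[of j k] by (simp add: D_def)
  have B: "B \<ge> 0" using zz by linarith
  have s: "\<bar>2 * Q j k\<bar> \<le> 108 * B" "\<bar>6 * D j k\<bar> \<le> 108 * B" for j k using Q[of j k] D[of j k] B by auto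
  have "\<bar>zz\<bar> \<le> 108 * B" "\<bar>\<gamma> j\<bar> \<le> 108 * B" for j using zz \<gamma>[of j] B by auto
  then show ?thesis unfolding co_def Let_def
    by (intro cub_coeffs_cases[where P = "\<lambda>x. \<bar>x\<bar> \<le> 108 * B"] s) (use B in simp_all)
qed

end

lemma plane_decomposition:
  fixes w E \<nu> :: pt
  assumes "norm \<nu> = 1" "\<nu> \<bullet> E = 0" "E \<noteq> 0"
  shows "w = ((w \<bullet> E) / (E \<bullet> E)) *\<^sub>R E + (w \<bullet> \<nu>) *\<^sub>R \<nu>"
proof -
  define r where "r = w - (((w \<bullet> E) / (E \<bullet> E)) *\<^sub>R E + (w \<bullet> \<nu>) *\<^sub>R \<nu>)"
  have nn: "\<nu> \<bullet> \<nu> = 1" using assms(1) by (simp add: norm_eq_1)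
  have EE: "E \<bullet> E \<noteq> 0" using assms(3) by simp
  have 1: "r \<bullet> E = 0" using EE assms(2) by (simp add: r_def inner_diff_left inner_add_left)
  have 2: "r \<bullet> \<nu> = 0" using nn assms(2) by (simp add: r_def inner_diff_left inner_add_left inner_commute[of E \<nu>])
  have n: "\<nu> $ 1 * \<nu> $ 1 + \<nu> $ 2 * \<nu> $ 2 = 1" using nn by (simp add: inner_pt)
  have "(r \<bullet> r) * (E \<bullet> E) * (\<nu> \<bullet> \<nu>) = 0"
  proof -
    have "\<nu> $ 1 * E $ 1 + \<nu> $ 2 * E $ 2 = 0" "r $ 1 * E $ 1 + r $ 2 * E $ 2 = 0" "r $ 1 * \<nu> $ 1 + r $ 2 * \<nu> $ 2 = 0"
      using assms(2) 1 2 by (simp_all add: inner_pt)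
    moreover have "E $ 1 * E $ 1 + E $ 2 * E $ 2 \<noteq> 0" using EE by (simp add: inner_pt)
    ultimately show ?thesis using n unfolding inner_pt by algebra
  qed
  then have "r = 0" using EE nn by simp
  then show ?thesis by (simp add: r_def)
qed

context hct_frame
begin

text \<open>The derivative at the midpoint of a side in the direction from \<open>Z\<close> that the data call for: its tangential part is
  prescribed by Hermite interpolation, its normal part is \<open>n j k\<close>.\<close>

definition RR :: "(3 \<Rightarrow> 3 \<Rightarrow> pt) \<Rightarrow> (3 \<Rightarrow> real) \<Rightarrow> (3 \<Rightarrow> pt) \<Rightarrow> (3 \<Rightarrow> 3 \<Rightarrow> real) \<Rightarrow> 3 \<Rightarrow> 3 \<Rightarrow> real" where
  "RR \<nu> f g n j k =
     (((1/2) *\<^sub>R (v j + v k)) \<bullet> (v k - v j)) / ((v k - v j) \<bullet> (v k - v j)) * (3/2 * (f k - f j) - 1/4 * ((g j + g k) \<bullet> (v k - v j)))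
     + (((1/2) *\<^sub>R (v j + v k)) \<bullet> \<nu> j k) * n j k"

text \<open>The equations \<open>hf_vertex\<close> and \<open>midpoint_derivatives\<close> solved for \<open>M\<close>, given vertex values \<open>f\<close>, vertex gradients
  \<open>g\<close> and normal derivatives \<open>n\<close> with respect to unit normals \<open>\<nu>\<close>.\<close>

definition MM :: "(3 \<Rightarrow> 3 \<Rightarrow> pt) \<Rightarrow> (3 \<Rightarrow> real) \<Rightarrow> (3 \<Rightarrow> pt) \<Rightarrow> (3 \<Rightarrow> 3 \<Rightarrow> real) \<Rightarrow> 3 \<Rightarrow> 3 \<Rightarrow> real" where
  "MM \<nu> f g n j k = (if j = k then f j - g j \<bullet> v j / 3
     else 2/3 * (3/8 * (g j \<bullet> v k + g k \<bullet> v j) + 3/4 * (f j + f k) - 1/8 * (g j \<bullet> v j + g k \<bullet> v k) - RR \<nu> f g n j k))"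

lemma MM_sym:
  assumes "\<And>j k. \<nu> j k = \<nu> k j" "\<And>j k. n j k = n k j"
  shows "MM \<nu> f g n j k = MM \<nu> f g n k j"
proof -
  have E: "v k - v j = - (v j - v k)" by simp
  have 1: "((1/2) *\<^sub>R (v k + v j)) \<bullet> (v k - v j) = - (((1/2) *\<^sub>R (v k + v j)) \<bullet> (v j - v k))"
    unfolding E inner_minus_right ..
  have 2: "(v k - v j) \<bullet> (v k - v j) = (v j - v k) \<bullet> (v j - v k)"
    unfolding E by (simp only: inner_minus_left inner_minus_right minus_minus)
  have 3: "3/2 * (f k - f j) - 1/4 * ((g j + g k) \<bullet> (v k - v j)) = - (3/2 * (f j - f k) - 1/4 * ((g k + g j) \<bullet> (v j - v k)))"
    unfolding E add.commute[of "g k"] inner_minus_right by (simp add: field_simps)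
  have "RR \<nu> f g n j k = RR \<nu> f g n k j"
    unfolding RR_def 1 2 3 assms(1)[of j k] assms(2)[of j k] add.commute[of "v j" "v k"]
    by (simp only: divide_minus_left mult_minus_left mult_minus_right minus_minus)
  then show ?thesis by (auto simp: MM_def add.commute)
qed

lemma MM_linear:
  "MM \<nu> (\<lambda>j. a * f j + b * f' j) (\<lambda>j. a *\<^sub>R g j + b *\<^sub>R g' j) (\<lambda>j k. a * n j k + b * n' j k) j k
    = a * MM \<nu> f g n j k + b * MM \<nu> f' g' n' j k"
  unfolding MM_def RR_def by (simp add: inner_add_left algebra_simps add_divide_distrib diff_divide_distrib)

lemma v_independent: "j \<noteq> k \<Longrightarrow> v k - v j \<noteq> 0"
proof
  assume jk: "j \<noteq> k" and 0: "v k - v j = 0"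
  obtain i where i: "i \<noteq> j" "i \<noteq> k" using third_index[OF jk] by metis
  have "sc i k \<bullet> (v k - v j) = 1" using sc_v[OF i(1), of k] sc_v[OF i(2), of k] jk by (simp add: inner_diff_right)
  then show False using 0 by simp
qed

lemma hct_normal:
  assumes \<nu>: "\<And>j k. j \<noteq> k \<Longrightarrow> norm (\<nu> j k) = 1" "\<And>j k. j \<noteq> k \<Longrightarrow> \<nu> j k \<bullet> (v k - v j) = 0"
    and "hct_data V Z \<beta> \<ll> (MM \<nu> f g n)" and jk: "j \<noteq> k"
  shows "hct_data.hg V Z \<beta> \<ll> g (MM \<nu> f g n) ((1/2) *\<^sub>R (V j + V k)) \<bullet> \<nu> j k = n j k"
proof -
  interpret hct_data V Z \<beta> \<ll> g "MM \<nu> f g n" by fact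
  let ?b = "(1/2) *\<^sub>R (V j + V k)" and ?E = "v k - v j" and ?w = "(1/2) *\<^sub>R (v j + v k)"
  define \<tau> where "\<tau> = (?w \<bullet> ?E) / (?E \<bullet> ?E)"
  define \<sigma> where "\<sigma> = ?w \<bullet> \<nu> j k"
  have w: "?w = \<tau> *\<^sub>R ?E + \<sigma> *\<^sub>R \<nu> j k"
    unfolding \<tau>_def \<sigma>_def by (rule plane_decomposition) (use \<nu> jk v_independent in auto)
  have f: "hf (V j) = f j" for j by (simp add: hf_vertex MM_def)
  have E: "hg ?b \<bullet> ?E = 3/2 * (f k - f j) - 1/4 * ((g j + g k) \<bullet> ?E)"
    using midpoint_derivatives(1)[OF jk] by (simp add: f)
  have "hg ?b \<bullet> ?w = RR \<nu> f g n j k"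
    unfolding midpoint_derivatives(2)[OF jk] f using jk by (simp add: MM_def field_simps)
  also have "\<dots> = \<tau> * (hg ?b \<bullet> ?E) + \<sigma> * n j k" unfolding RR_def E \<tau>_def \<sigma>_def ..
  finally have "\<tau> * (hg ?b \<bullet> ?E) + \<sigma> * (hg ?b \<bullet> \<nu> j k) = \<tau> * (hg ?b \<bullet> ?E) + \<sigma> * n j k"
    by (subst (asm) w) (simp add: inner_add_right)
  moreover have "\<sigma> \<noteq> 0"
  proof
    assume 0: "\<sigma> = 0"
    obtain i where i: "i \<noteq> j" "i \<noteq> k" using third_index[OF jk] by metis
    have "sc i j \<bullet> ?w = 1/2" "sc i k \<bullet> ?w = 1/2" "sc i j \<bullet> ?E = -1" "sc i k \<bullet> ?E = 1"
      using sc_v[OF i(1)] sc_v[OF i(2)] jk by (simp_all add: inner_add_right inner_diff_right)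
    then show False using w 0 by simp
  qed
  ultimately show ?thesis by simp
qed

end

section \<open>Reproduction of cubic polynomials\<close>

lemma pol_taylor:
  fixes c Z
  assumes c: "deg_le 3 c"
  defines "C \<equiv> \<lambda>i j. pol c i j Z"
  shows "pol c 0 0 (Z + X) = C 0 0 + C 1 0 * X $ 1 + C 0 1 * X $ 2 + C 2 0 * (X $ 1)\<^sup>2 / 2 + C 1 1 * X $ 1 * X $ 2 + C 0 2 * (X $ 2)\<^sup>2 / 2
     + C 3 0 * (X $ 1) ^ 3 / 6 + C 2 1 * (X $ 1)\<^sup>2 / 2 * X $ 2 + C 1 2 * X $ 1 * (X $ 2)\<^sup>2 / 2 + C 0 3 * (X $ 2) ^ 3 / 6"
    and "pol c 1 0 (Z + X) = C 1 0 + C 2 0 * X $ 1 + C 1 1 * X $ 2 + C 3 0 * (X $ 1)\<^sup>2 / 2 + C 2 1 * X $ 1 * X $ 2 + C 1 2 * (X $ 2)\<^sup>2 / 2"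
    and "pol c 0 1 (Z + X) = C 0 1 + C 1 1 * X $ 1 + C 0 2 * X $ 2 + C 2 1 * (X $ 1)\<^sup>2 / 2 + C 1 2 * X $ 1 * X $ 2 + C 0 3 * (X $ 2)\<^sup>2 / 2"
proof -
  have z: "c i j = 0" if "i + j > 3" for i j using c that by (simp add: deg_le_def)
  have n3: "Suc (Suc (Suc 0)) = 3" by simp
  have a: "e1 \<bullet> y = y $ 1" "e2 \<bullet> y = y $ 2" for y :: pt by (simp_all add: inner_pt axis_def)
  note ex = cub_expand[OF deg_le_jet[OF c], where z = 0]
  show "pol c 0 0 (Z + X) = C 0 0 + C 1 0 * X $ 1 + C 0 1 * X $ 2 + C 2 0 * (X $ 1)\<^sup>2 / 2 + C 1 1 * X $ 1 * X $ 2 + C 0 2 * (X $ 2)\<^sup>2 / 2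
     + C 3 0 * (X $ 1) ^ 3 / 6 + C 2 1 * (X $ 1)\<^sup>2 / 2 * X $ 2 + C 1 2 * X $ 1 * (X $ 2)\<^sup>2 / 2 + C 0 3 * (X $ 2) ^ 3 / 6"
    unfolding C_def ex jet_axis diff_zero a by (simp add: z n3 power2_eq_square power3_eq_cube field_simps)
  show "pol c 1 0 (Z + X) = C 1 0 + C 2 0 * X $ 1 + C 1 1 * X $ 2 + C 3 0 * (X $ 1)\<^sup>2 / 2 + C 2 1 * X $ 1 * X $ 2 + C 1 2 * (X $ 2)\<^sup>2 / 2"
    unfolding C_def ex jet_axis diff_zero a by (simp add: z n3 power2_eq_square power3_eq_cube field_simps)
  show "pol c 0 1 (Z + X) = C 0 1 + C 1 1 * X $ 1 + C 0 2 * X $ 2 + C 2 1 * (X $ 1)\<^sup>2 / 2 + C 1 2 * X $ 1 * X $ 2 + C 0 3 * (X $ 2)\<^sup>2 / 2"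
    unfolding C_def ex jet_axis diff_zero a by (simp add: z n3 power2_eq_square power3_eq_cube field_simps)
qed

definition gradp :: "(nat \<Rightarrow> nat \<Rightarrow> real) \<Rightarrow> pt \<Rightarrow> pt" where
  "gradp c x = pol c 1 0 x *\<^sub>R e1 + pol c 0 1 x *\<^sub>R e2"

lemma gradp_inner: "gradp c x \<bullet> h = pol c 1 0 x * h $ 1 + pol c 0 1 x * h $ 2"
  unfolding gradp_def by (simp add: inner_add_left inner_pt axis_def)

context hct_frame
begin

lemma average_affine: "(\<Sum>k\<in>UNIV. \<beta> k * (a + p * v k $ 1 + q * v k $ 2)) = a"
proof -
  have "(\<Sum>k\<in>UNIV. \<beta> k * v k $ i) = 0" for i
    using arg_cong[OF centre_v, of "\<lambda>x. x $ i"] by (simp add: sum_3)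
  moreover have "(\<Sum>k\<in>UNIV. \<beta> k * (a + p * v k $ 1 + q * v k $ 2)) = a * (\<Sum>k\<in>UNIV. \<beta> k)
      + p * (\<Sum>k\<in>UNIV. \<beta> k * v k $ 1) + q * (\<Sum>k\<in>UNIV. \<beta> k * v k $ 2)"
    by (simp add: sum_3 algebra_simps)
  ultimately show ?thesis using \<beta>_sum by simp
qed

text \<open>With \<open>B\<close> and \<open>T\<close> the quadratic and cubic parts of the Taylor expansion at \<open>Z\<close> as symmetric multilinear forms,
  the data of a cubic lead to a matrix \<open>M\<close> whose averages with weights \<open>\<beta>\<close> recover value and gradient at \<open>Z\<close>,
  because the weighted mean of an affine function over the vertices is its value at \<open>Z\<close> (\<open>average_affine\<close>).\<close>

lemma hct_reproduces_cubics:
  fixes c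
  assumes c: "deg_le 3 c"
    and \<nu>: "\<And>j k. j \<noteq> k \<Longrightarrow> norm (\<nu> j k) = 1" "\<And>j k. j \<noteq> k \<Longrightarrow> \<nu> j k \<bullet> (v k - v j) = 0"
  defines "f \<equiv> \<lambda>j. pol c 0 0 (V j)" and "g \<equiv> \<lambda>j. gradp c (V j)"
    and "n \<equiv> \<lambda>j k. gradp c ((1/2) *\<^sub>R (V j + V k)) \<bullet> \<nu> j k"
  assumes "hct_data V Z \<beta> \<ll> (MM \<nu> f g n)"
  shows "hct_data.piece V Z \<beta> \<ll> g (MM \<nu> f g n) i x = pol c 0 0 x"
proof -
  interpret hct_data V Z \<beta> \<ll> g "MM \<nu> f g n" by fact
  define C where "C i j = pol c i j Z" for i j
  define G where "G X = C 1 0 * X $ 1 + C 0 1 * X $ 2" for X :: pt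
  define B where "B X Y = (C 2 0 * X $ 1 * Y $ 1 + C 1 1 * (X $ 1 * Y $ 2 + X $ 2 * Y $ 1) + C 0 2 * X $ 2 * Y $ 2) / 2" for X Y :: pt
  define T where "T X Y W = (C 3 0 * X $ 1 * Y $ 1 * W $ 1 + C 2 1 * (X $ 1 * Y $ 1 * W $ 2 + X $ 1 * Y $ 2 * W $ 1 + X $ 2 * Y $ 1 * W $ 1)
     + C 1 2 * (X $ 1 * Y $ 2 * W $ 2 + X $ 2 * Y $ 1 * W $ 2 + X $ 2 * Y $ 2 * W $ 1) + C 0 3 * X $ 2 * Y $ 2 * W $ 2) / 6" for X Y W :: pt
  have F: "pol c 0 0 (Z + X) = C 0 0 + G X + B X X + T X X X" for X
    unfolding pol_taylor(1)[OF c] G_def B_def T_def C_def[symmetric]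
    by (simp add: power2_eq_square power3_eq_cube field_simps)
  have dF: "gradp c (Z + X) \<bullet> Y = G Y + 2 * B X Y + 3 * T X X Y" for X Y
    unfolding gradp_inner pol_taylor(2,3)[OF c] G_def B_def T_def C_def[symmetric]
    by (simp add: power2_eq_square power3_eq_cube field_simps)
  have Vv: "Z + v j = V j" for j by (simp add: v_def)
  have f: "f j = C 0 0 + G (v j) + B (v j) (v j) + T (v j) (v j) (v j)" for j
    unfolding f_def F[symmetric] Vv ..
  have g: "g j \<bullet> Y = G Y + 2 * B (v j) Y + 3 * T (v j) (v j) Y" for j Y
    unfolding g_def dF[symmetric] Vv ..
  have mid: "(1/2) *\<^sub>R (V j + V k) = Z + (1/2) *\<^sub>R (v j + v k)" for j k
    unfolding v_def by (simp add: vec_eq_iff field_simps)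
  have Gw: "G ((1/2) *\<^sub>R (X + Y)) = (G X + G Y) / 2" "G (Y - X) = G Y - G X" for X Y
    unfolding G_def by (simp_all add: field_simps)
  have Bs: "B Y X = B X Y" for X Y unfolding B_def by (simp add: field_simps)
  have Bw: "B ((1/2) *\<^sub>R (X + Y)) ((1/2) *\<^sub>R (X + Y)) = (B X X + 2 * B X Y + B Y Y) / 4"
    "B ((1/2) *\<^sub>R (X + Y)) (Y - X) = (B Y Y - B X X) / 2" "B X (Y - X) = B X Y - B X X" "B Y (Y - X) = B Y Y - B X Y" for X Y
    unfolding B_def by (simp_all add: field_simps)
  have Tw: "T ((1/2) *\<^sub>R (X + Y)) ((1/2) *\<^sub>R (X + Y)) ((1/2) *\<^sub>R (X + Y)) = (T X X X + 3 * T X X Y + 3 * T Y Y X + T Y Y Y) / 8"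
    "T ((1/2) *\<^sub>R (X + Y)) ((1/2) *\<^sub>R (X + Y)) (Y - X) = (T Y Y Y + T Y Y X - T X X Y - T X X X) / 4"
    "T X X (Y - X) = T X X Y - T X X X" "T Y Y (Y - X) = T Y Y Y - T Y Y X" for X Y
    unfolding T_def by (simp_all add: field_simps)
  have hermite: "gradp c (Z + (1/2) *\<^sub>R (v j + v k)) \<bullet> (v k - v j) = 3/2 * (f k - f j) - 1/4 * ((g j + g k) \<bullet> (v k - v j))" for j k
    unfolding inner_add_left g f dF Gw Bw Tw by (simp add: field_simps)
  have R: "RR \<nu> f g n j k = gradp c (Z + (1/2) *\<^sub>R (v j + v k)) \<bullet> ((1/2) *\<^sub>R (v j + v k))" if jk: "j \<noteq> k" for j k
  proof -
    have "(1/2) *\<^sub>R (v j + v k) = ((((1/2) *\<^sub>R (v j + v k)) \<bullet> (v k - v j)) / ((v k - v j) \<bullet> (v k - v j))) *\<^sub>R (v k - v j)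
       + (((1/2) *\<^sub>R (v j + v k)) \<bullet> \<nu> j k) *\<^sub>R \<nu> j k"
      by (rule plane_decomposition) (use \<nu> jk v_independent in auto)
    then have "gradp c (Z + (1/2) *\<^sub>R (v j + v k)) \<bullet> ((1/2) *\<^sub>R (v j + v k)) = gradp c (Z + (1/2) *\<^sub>R (v j + v k)) \<bullet>
       (((((1/2) *\<^sub>R (v j + v k)) \<bullet> (v k - v j)) / ((v k - v j) \<bullet> (v k - v j))) *\<^sub>R (v k - v j)
       + (((1/2) *\<^sub>R (v j + v k)) \<bullet> \<nu> j k) *\<^sub>R \<nu> j k)"
      by (rule arg_cong)
    also have "\<dots> = RR \<nu> f g n j k"
      unfolding RR_def n_def mid hermite[symmetric] inner_add_right[of "gradp c _"] inner_scaleR_right[of "gradp c _"] ..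
    finally show ?thesis by (rule sym)
  qed
  have M: "MM \<nu> f g n j k = C 0 0 + (G (v j) + G (v k)) / 3 + B (v j) (v k) / 3" for j k
  proof (cases "j = k")
    case True
    then show ?thesis unfolding MM_def g f by (simp add: field_simps)
  next
    case False
    show ?thesis unfolding MM_def if_not_P[OF False] R[OF False] dF g f Gw Bw Tw Bs[of "v k" "v j"] by (simp add: field_simps)
  qed
  have ee: "ee j = C 0 0 + G (v j) / 3" for j
  proof -
    have "ee j = (\<Sum>k\<in>UNIV. \<beta> k * ((C 0 0 + G (v j) / 3) + (C 1 0 / 3 + (C 2 0 * v j $ 1 + C 1 1 * v j $ 2) / 6) * v k $ 1
        + (C 0 1 / 3 + (C 1 1 * v j $ 1 + C 0 2 * v j $ 2) / 6) * v k $ 2))"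
      unfolding ee_def M by (intro sum.cong refl) (simp add: G_def B_def field_simps)
    then show ?thesis by (simp only: average_affine)
  qed
  have zz: "zz = C 0 0"
  proof -
    have "zz = (\<Sum>k\<in>UNIV. \<beta> k * (C 0 0 + (C 1 0 / 3) * v k $ 1 + (C 0 1 / 3) * v k $ 2))"
      unfolding zz_def ee by (intro sum.cong refl) (simp add: G_def field_simps)
    then show ?thesis by (simp only: average_affine)
  qed
  have \<gamma>: "\<gamma> j = G (v j)" for j by (simp add: \<gamma>_def ee zz)
  have Q: "Q j k = B (v j) (v k)" for j k unfolding Q_def M zz \<gamma> by (simp add: field_simps)
  have D: "D j k = T (v j) (v j) (v k)" for j k unfolding D_def g \<gamma> Q by (simp add: field_simps)
  let ?i = i let ?p = "p1 ?i" and ?q = "p2 ?i"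
  define s t where "s = sc ?i ?p \<bullet> (x - Z)" "t = sc ?i ?q \<bullet> (x - Z)"
  have X: "x = Z + (s *\<^sub>R v ?p + t *\<^sub>R v ?q)"
    using sc_expand[of ?i "x - Z"] unfolding sum_p12[of _ ?i] by (simp add: s_t_def algebra_simps)
  have "pol c 0 0 x = C 0 0 + G (s *\<^sub>R v ?p + t *\<^sub>R v ?q) + B (s *\<^sub>R v ?p + t *\<^sub>R v ?q) (s *\<^sub>R v ?p + t *\<^sub>R v ?q)
     + T (s *\<^sub>R v ?p + t *\<^sub>R v ?q) (s *\<^sub>R v ?p + t *\<^sub>R v ?q) (s *\<^sub>R v ?p + t *\<^sub>R v ?q)"
    by (subst X) (rule F)
  also have "\<dots> = zz + \<gamma> ?p * s + \<gamma> ?q * t + Q ?p ?p * s\<^sup>2 + 2 * Q ?p ?q * s * t + Q ?q ?q * t\<^sup>2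
    + D ?p ?p * s ^ 3 + 3 * D ?p ?q * s\<^sup>2 * t + 3 * D ?q ?p * s * t\<^sup>2 + D ?q ?q * t ^ 3"
    unfolding zz \<gamma> Q D G_def B_def T_def by (simp add: power2_eq_square power3_eq_cube field_simps)
  also have "\<dots> = piece ?i x"
    unfolding piece_eq_cub cub_expand[OF deg_le_co] s_t_def[symmetric]
    by (simp add: co_def Let_def cub_coeffs_def algebra_simps)
  finally show ?thesis by (rule sym)
qed

end

text \<open>Expansion of the affine coordinates into the Cartesian ones.\<close>

lemma cub_P3:
  assumes "deg_le 3 c"
  shows "P3_on S (cub c a b z)"
proof -
  define s0 t0 where "s0 = - (a \<bullet> z)" "t0 = - (b \<bullet> z)"
  define C where "C i j = c i j + c (i+1) j * s0 + c i (j+1) * t0 + c (i+2) j * s0\<^sup>2 / 2 + c (i+1) (j+1) * s0 * t0 + c i (j+2) * t0\<^sup>2 / 2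
     + c (i+3) j * s0 ^ 3 / 6 + c (i+2) (j+1) * s0\<^sup>2 * t0 / 2 + c (i+1) (j+2) * s0 * t0\<^sup>2 / 2 + c i (j+3) * t0 ^ 3 / 6" for i j
  let ?a1 = "a $ 1" and ?a2 = "a $ 2" and ?b1 = "b $ 1" and ?b2 = "b $ 2"
  define m where "m = cub_coeffs (C 0 0) (C 1 0 * ?a1 + C 0 1 * ?b1) (C 1 0 * ?a2 + C 0 1 * ?b2)
     (C 2 0 * ?a1\<^sup>2 / 2 + C 1 1 * ?a1 * ?b1 + C 0 2 * ?b1\<^sup>2 / 2)
     (C 2 0 * ?a1 * ?a2 + C 1 1 * (?a1 * ?b2 + ?a2 * ?b1) + C 0 2 * ?b1 * ?b2)
     (C 2 0 * ?a2\<^sup>2 / 2 + C 1 1 * ?a2 * ?b2 + C 0 2 * ?b2\<^sup>2 / 2)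
     (C 3 0 * ?a1 ^ 3 / 6 + C 2 1 * ?a1\<^sup>2 * ?b1 / 2 + C 1 2 * ?a1 * ?b1\<^sup>2 / 2 + C 0 3 * ?b1 ^ 3 / 6)
     (C 3 0 * ?a1\<^sup>2 * ?a2 / 2 + C 2 1 * (?a1\<^sup>2 * ?b2 + 2 * ?a1 * ?a2 * ?b1) / 2 + C 1 2 * (2 * ?a1 * ?b1 * ?b2 + ?a2 * ?b1\<^sup>2) / 2 + C 0 3 * ?b1\<^sup>2 * ?b2 / 2)
     (C 3 0 * ?a1 * ?a2\<^sup>2 / 2 + C 2 1 * (2 * ?a1 * ?a2 * ?b2 + ?a2\<^sup>2 * ?b1) / 2 + C 1 2 * (?a1 * ?b2\<^sup>2 + 2 * ?a2 * ?b1 * ?b2) / 2 + C 0 3 * ?b1 * ?b2\<^sup>2 / 2)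
     (C 3 0 * ?a2 ^ 3 / 6 + C 2 1 * ?a2\<^sup>2 * ?b2 / 2 + C 1 2 * ?a2 * ?b2\<^sup>2 / 2 + C 0 3 * ?b2 ^ 3 / 6)"
  have z: "c i j = 0" if "i + j > 3" for i j using assms that by (simp add: deg_le_def)
  have n3: "Suc (Suc 0) = 2" "Suc (Suc (Suc 0)) = 3" by simp_all
  have S: "{(i, j). i + j \<le> 3} = {(0::nat, 0::nat), (1, 0), (0, 1), (2, 0), (1, 1), (0, 2), (3, 0), (2, 1), (1, 2), (0, 3)}"
    (is "?L = ?R")
  proof
    show "?L \<subseteq> ?R"
    proof (rule subsetI)
      fix y assume "y \<in> ?L"
      then obtain i j where y: "y = (i, j)" and ij: "i + j \<le> 3" by auto
      then consider "i = 0" | "i = 1" | "i = 2" | "i = 3" by linarith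
      then show "y \<in> ?R"
      proof cases
        case 1
        then have "j = 0 \<or> j = 1 \<or> j = 2 \<or> j = 3" using ij by linarith
        then show ?thesis using 1 y by auto
      next
        case 2
        then have "j = 0 \<or> j = 1 \<or> j = 2" using ij by linarith
        then show ?thesis using 2 y by auto
      next
        case 3
        then have "j = 0 \<or> j = 1" using ij by linarith
        then show ?thesis using 3 y by auto
      qed (use ij y in auto)
    qed
    show "?R \<subseteq> ?L" by auto
  qed
  have "cub c a b z x = (\<Sum>(i, j) | i + j \<le> 3. m i j * (x $ 1) ^ i * (x $ 2) ^ j)" for x
  proof -
    define \<sigma> \<tau> where "\<sigma> = ?a1 * x $ 1 + ?a2 * x $ 2" "\<tau> = ?b1 * x $ 1 + ?b2 * x $ 2"
    have st: "a \<bullet> (x - z) = s0 + \<sigma>" "b \<bullet> (x - z) = t0 + \<tau>"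
      by (simp_all add: s0_t0_def \<sigma>_\<tau>_def inner_diff_right inner_pt[of _ x])
    have "cub c a b z x = C 0 0 + C 1 0 * \<sigma> + C 0 1 * \<tau> + C 2 0 * \<sigma>\<^sup>2 / 2 + C 1 1 * \<sigma> * \<tau> + C 0 2 * \<tau>\<^sup>2 / 2
      + C 3 0 * \<sigma> ^ 3 / 6 + C 2 1 * \<sigma>\<^sup>2 * \<tau> / 2 + C 1 2 * \<sigma> * \<tau>\<^sup>2 / 2 + C 0 3 * \<tau> ^ 3 / 6"
      unfolding cub_expand[OF assms] st C_def by (simp add: z n3 power2_eq_square power3_eq_cube field_simps)
    also have "\<dots> = (\<Sum>(i, j) | i + j \<le> 3. m i j * (x $ 1) ^ i * (x $ 2) ^ j)"
      unfolding S \<sigma>_\<tau>_def by (simp add: m_def cub_coeffs_def power2_eq_square power3_eq_cube field_simps)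
    finally show ?thesis .
  qed
  then show ?thesis unfolding P3_on_def by blast
qed

section \<open>Weak derivatives of piecewise polynomials\<close>

lemma C1_Lipschitz_on_ball:
  assumes P: "partials P P1 P2" and c: "continuous_on UNIV P1" "continuous_on UNIV P2"
  obtains M where "M \<ge> 0" "\<And>x y. norm x \<le> R \<Longrightarrow> norm y \<le> R \<Longrightarrow> \<bar>P x - P y\<bar> \<le> M * norm (x - y)"
proof -
  have "bounded (f ` cball 0 R)" if "continuous_on UNIV f" for f :: "pt \<Rightarrow> real"
    by (intro compact_imp_bounded compact_continuous_image continuous_on_subset[OF that]) auto
  then obtain B1 B2 where B1: "\<And>x. x \<in> cball 0 R \<Longrightarrow> \<bar>P1 x\<bar> \<le> B1" and B2: "\<And>x. x \<in> cball 0 R \<Longrightarrow> \<bar>P2 x\<bar> \<le> B2"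
    using c unfolding bounded_iff by (metis image_eqI real_norm_def)
  have "\<bar>P x - P y\<bar> \<le> (\<bar>B1\<bar> + \<bar>B2\<bar>) * norm (x - y)" if "norm x \<le> R" "norm y \<le> R" for x y
  proof -
    have "norm (P x - P y) \<le> (\<bar>B1\<bar> + \<bar>B2\<bar>) * norm (x - y)"
    proof (rule differentiable_bound[of "cball 0 R" _ "\<lambda>z h. P1 z * h $ 1 + P2 z * h $ 2"])
      fix z :: pt assume z: "z \<in> cball 0 R"
      show "(P has_derivative (\<lambda>h. P1 z * h $ 1 + P2 z * h $ 2)) (at z within cball 0 R)"
        using P unfolding partials_def by (blast intro: has_derivative_at_withinI)
      show "onorm (\<lambda>h::pt. P1 z * h $ 1 + P2 z * h $ 2) \<le> \<bar>B1\<bar> + \<bar>B2\<bar>"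
      proof (rule onorm_bound)
        fix h :: pt
        have "\<bar>P1 z * h $ 1 + P2 z * h $ 2\<bar> \<le> \<bar>B1\<bar> * norm h + \<bar>B2\<bar> * norm h"
          using B1[OF z] B2[OF z] component_le_norm_cart[of h 1] component_le_norm_cart[of h 2]
          by (intro order_trans[OF abs_triangle_ineq] add_mono) (auto simp: abs_mult intro!: mult_mono)
        then show "norm (P1 z * h $ 1 + P2 z * h $ 2) \<le> (\<bar>B1\<bar> + \<bar>B2\<bar>) * norm h" by (simp add: algebra_simps)
      qed simp
    qed (use that in auto)
    then show ?thesis by simp
  qed
  then show ?thesis by (intro that[of "\<bar>B1\<bar> + \<bar>B2\<bar>"]) auto
qed

lemma integrable_bounded_support:
  fixes h :: "pt \<Rightarrow> real"
  assumes m: "h \<in> borel_measurable borel" and z: "\<And>x. norm x \<ge> R \<Longrightarrow> h x = 0" and b: "\<And>x. norm x \<le> R \<Longrightarrow> \<bar>h x\<bar> \<le> B"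
  shows "integrable lborel h"
proof (rule Bochner_Integration.integrable_bound)
  show "integrable lborel (\<lambda>x::pt. B * indicator (cball 0 R) x :: real)"
    using integrable_indicator_bounded[of "cball 0 R"] by (intro integrable_mult_right) auto
  show "h \<in> borel_measurable lborel" using m by simp
  have "\<bar>h x\<bar> \<le> \<bar>B * indicator (cball 0 R) x\<bar>" for x
    using b[of x] z[of x] by (cases "norm x \<le> R") auto
  then show "AE x in lborel. norm (h x) \<le> norm (B * indicator (cball 0 R) x :: real)"
    by (intro AE_I2) simp
qed

context hct_frame
begin

lemma piecewise_measurable:
  assumes "\<And>i. P i \<in> borel_measurable borel"
  shows "(\<lambda>x. P (idx x) x :: real) \<in> borel_measurable borel"
proof -
  have [measurable]: "cone i \<in> sets borel" for i using closed_cone by simp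
  note [measurable] = assms
  have "(\<lambda>x. P (idx x) x) = (\<lambda>x. if x \<in> cone 1 then P 1 x else if x \<in> cone 2 then P 2 x else P 3 x)"
    by (auto simp: idx_def)
  then show ?thesis by simp
qed

lemma piecewise_Lipschitz:
  assumes f: "\<And>i x. x \<in> cone i \<Longrightarrow> f x = P i x" and P: "\<And>i. partials (P i) (P1 i) (P2 i)"
    and c: "\<And>i. continuous_on UNIV (P1 i)" "\<And>i. continuous_on UNIV (P2 i)"
  obtains M where "M \<ge> 0" "\<And>x y. norm x \<le> R \<Longrightarrow> norm y \<le> R \<Longrightarrow> \<bar>f x - f y\<bar> \<le> M * norm (x - y)"
proof -
  have "\<forall>i. \<exists>M\<ge>0. \<forall>x y. norm x \<le> R \<longrightarrow> norm y \<le> R \<longrightarrow> \<bar>P i x - P i y\<bar> \<le> M * norm (x - y)"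
    using C1_Lipschitz_on_ball[OF P c] by metis
  then obtain m where m: "\<And>i. m i \<ge> 0" "\<And>i x y. norm x \<le> R \<Longrightarrow> norm y \<le> R \<Longrightarrow> \<bar>P i x - P i y\<bar> \<le> m i * norm (x - y)"
    by metis
  define M where "M = (\<Sum>i\<in>UNIV. m i)"
  have mM: "m i \<le> M" for i unfolding M_def using m(1) by (intro member_le_sum) auto
  have M0: "M \<ge> 0" using mM[of 1] m(1)[of 1] by linarith
  have PM: "\<bar>P i x - P i y\<bar> \<le> M * norm (x - y)" if "norm x \<le> R" "norm y \<le> R" for i x y
    using m(2)[OF that] mM[of i] by (meson mult_right_mono norm_ge_zero order_trans)
  have "\<bar>f x - f y\<bar> \<le> M * norm (x - y)" if xy: "norm x \<le> R" "norm y \<le> R" for x y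
  proof -
    define p where "p t = (1 - t) *\<^sub>R x + t *\<^sub>R y" for t :: real
    define U where "U i = {0..1} \<inter> p -` cone i" for i
    have cp: "continuous_on A p" for A unfolding p_def by (intro continuous_intros)
    have pR: "norm (p t) \<le> R" if "t \<in> {0..1}" for t
    proof -
      have "p t \<in> cball 0 R" unfolding p_def
        using convex_cball[of "0::pt" R] xy that unfolding convex_alt by auto
      then show ?thesis by simp
    qed
    have "(M * norm (x - y))-lipschitz_on {0..1} (\<lambda>t. f (p t))"
    proof (rule lipschitz_on_closed_Union)
      show "(M * norm (x - y))-lipschitz_on (U i) (\<lambda>t. f (p t))" for i
      proof (rule lipschitz_onI)
        fix s t assume st: "s \<in> U i" "t \<in> U i"
        have "f (p s) = P i (p s)" "f (p t) = P i (p t)" using st by (auto simp: U_def intro!: f)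
        then have "dist (f (p s)) (f (p t)) = \<bar>P i (p s) - P i (p t)\<bar>" by (simp only: dist_real_def)
        also have "\<dots> \<le> M * norm (p s - p t)" using st pR by (intro PM) (auto simp: U_def)
        also have "p s - p t = (t - s) *\<^sub>R (x - y)" by (simp add: p_def algebra_simps)
        finally show "dist (f (p s)) (f (p t)) \<le> M * norm (x - y) * dist s t"
          by (simp add: dist_real_def abs_minus_commute mult_ac)
      qed (use M0 in simp)
      show "closed (U i)" for i unfolding U_def
        by (intro continuous_closed_preimage cp closed_cone) simp
      show "{0..1} \<subseteq> (\<Union>i\<in>UNIV. U i)" using cone_cover by (auto simp: U_def)
    qed (use M0 in auto)
    then have "dist (f (p 0)) (f (p 1)) \<le> M * norm (x - y) * dist (0::real) 1"
      by (rule lipschitz_onD) auto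
    then show ?thesis by (simp add: p_def dist_real_def)
  qed
  then show ?thesis using M0 that by blast
qed

text \<open>A continuous piecewise smooth function is Lipschitz on bounded sets, and differentiable off the rays, which are
  negligible; so \<open>integral_directional_derivative_zero\<close> applies to its product with a test function.\<close>

lemma piecewise_integration_by_parts:
  assumes f: "\<And>i x. x \<in> cone i \<Longrightarrow> f x = P i x" and P: "\<And>i. partials (P i) (P1 i) (P2 i)"
    and c: "\<And>i. continuous_on UNIV (P1 i)" "\<And>i. continuous_on UNIV (P2 i)" and t: "test_function S \<phi>"
  shows "(\<integral>x. f x * partial 1 \<phi> x \<partial>lborel) = - (\<integral>x. P1 (idx x) x * \<phi> x \<partial>lborel)"
    and "(\<integral>x. f x * partial 2 \<phi> x \<partial>lborel) = - (\<integral>x. P2 (idx x) x * \<phi> x \<partial>lborel)"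
proof -
  obtain R where R: "R > 0" "\<And>x. norm x \<ge> R \<Longrightarrow> \<phi> x = 0" using test_function_support[OF t] by blast
  have sm: "smooth \<phi>" using t by (simp add: test_function_def)
  have c\<phi>: "continuous_on UNIV \<phi>" "continuous_on UNIV (partial i \<phi>)" for i
    using test_function_continuous[OF t] test_function_continuous[OF test_function_partial[OF t]] by auto
  have zp: "partial i \<phi> x = 0" if "norm x > R" for i x
  proof (rule partial_zero_outside_support)
    have "closure {x. \<phi> x \<noteq> 0} \<subseteq> cball 0 R" using R(2) by (intro closure_minimal) (auto simp: not_less intro: ccontr)
    then show "x \<notin> closure {x. \<phi> x \<noteq> 0}" using that by auto
  qed
  have zp': "partial i \<phi> x = 0" if "norm x \<ge> R + 1" for i x using zp[of x i] that by simp
  obtain M where M: "M \<ge> 0" "\<And>x y. norm x \<le> R + 1 \<Longrightarrow> norm y \<le> R + 1 \<Longrightarrow> \<bar>f x - f y\<bar> \<le> M * norm (x - y)"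
    using piecewise_Lipschitz[where f = f and P = P and R = "R + 1", OF f P c] by blast
  obtain B where B: "B > 0" "\<And>x. \<bar>\<phi> x\<bar> \<le> B" using compact_support_bounded[OF c\<phi>(1) R(2)] by blast
  obtain Bp1 where Bp1: "Bp1 > 0" "\<And>x. \<bar>partial 1 \<phi> x\<bar> \<le> Bp1" using compact_support_bounded[OF c\<phi>(2) zp'] by blast
  obtain Bp2 where Bp2: "Bp2 > 0" "\<And>x. \<bar>partial 2 \<phi> x\<bar> \<le> Bp2" using compact_support_bounded[OF c\<phi>(2) zp'] by blast
  have p\<phi>: "partials \<phi> (partial 1 \<phi>) (partial 2 \<phi>)" unfolding partials_def using smooth_has_derivative[OF sm] by blast
  have L: "\<bar>\<phi> x - \<phi> y\<bar> \<le> (Bp1 + Bp2) * norm (x - y)" for x y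
  proof -
    have "norm (\<phi> x - \<phi> y) \<le> (Bp1 + Bp2) * norm (x - y)"
    proof (rule differentiable_bound[of UNIV _ "\<lambda>z h. partial 1 \<phi> z * h $ 1 + partial 2 \<phi> z * h $ 2"])
      fix z :: pt
      show "(\<phi> has_derivative (\<lambda>h. partial 1 \<phi> z * h $ 1 + partial 2 \<phi> z * h $ 2)) (at z within UNIV)"
        using smooth_has_derivative[OF sm] by simp
      show "onorm (\<lambda>h::pt. partial 1 \<phi> z * h $ 1 + partial 2 \<phi> z * h $ 2) \<le> Bp1 + Bp2"
      proof (rule onorm_bound)
        fix h :: pt
        have "\<bar>partial 1 \<phi> z * h $ 1 + partial 2 \<phi> z * h $ 2\<bar> \<le> Bp1 * norm h + Bp2 * norm h"
          using Bp1 Bp2 component_le_norm_cart[of h 1] component_le_norm_cart[of h 2]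
          by (intro order_trans[OF abs_triangle_ineq] add_mono) (auto simp: abs_mult intro!: mult_mono intro: less_imp_le)
        then show "norm (partial 1 \<phi> z * h $ 1 + partial 2 \<phi> z * h $ 2) \<le> (Bp1 + Bp2) * norm h" by (simp add: algebra_simps)
      qed (use Bp1 Bp2 in simp)
    qed auto
    then show ?thesis by simp
  qed
  define F where "F = \<bar>f 0\<bar> + M * (R + 1)"
  have F: "\<bar>f x\<bar> \<le> F" if "norm x \<le> R + 1" for x
    using M(2)[of x 0] that R(1) mult_left_mono[OF that M(1)] by (simp add: F_def)
  have F0: "F \<ge> 0" using F[of 0] R(1) by simp
  define \<psi> where "\<psi> x = f x * \<phi> x" for x
  have z\<psi>: "\<psi> x = 0" if "norm x \<ge> R" for x using R(2)[OF that] by (simp add: \<psi>_def)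
  have lip: "\<bar>\<psi> x - \<psi> y\<bar> \<le> (F * (Bp1 + Bp2) + B * M) * norm (x - y)" for x y
  proof -
    have BM: "0 \<le> B * M * norm (x - y)" using B M by simp
    consider "norm x \<le> R" "norm y \<le> R" | "norm x \<le> R" "norm y > R" | "norm x > R" "norm y \<le> R" | "norm x > R" "norm y > R" by linarith
    then show ?thesis
    proof cases
      case 1
      have "\<psi> x - \<psi> y = f x * (\<phi> x - \<phi> y) + \<phi> y * (f x - f y)" by (simp add: \<psi>_def algebra_simps)
      then have "\<bar>\<psi> x - \<psi> y\<bar> \<le> \<bar>f x\<bar> * \<bar>\<phi> x - \<phi> y\<bar> + \<bar>\<phi> y\<bar> * \<bar>f x - f y\<bar>"
        by (metis abs_mult abs_triangle_ineq)
      also have "\<dots> \<le> F * ((Bp1 + Bp2) * norm (x - y)) + B * (M * norm (x - y))"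
        using 1 F[of x] L[of x y] B M(2)[of x y] F0 by (intro add_mono mult_mono) auto
      finally show ?thesis by (simp add: algebra_simps)
    next
      case 2
      have "\<bar>\<psi> x - \<psi> y\<bar> = \<bar>f x\<bar> * \<bar>\<phi> x - \<phi> y\<bar>" using R(2)[of y] 2 by (simp add: \<psi>_def abs_mult)
      also have "\<dots> \<le> F * ((Bp1 + Bp2) * norm (x - y))" using 2 F[of x] L[of x y] F0 by (intro mult_mono) auto
      finally show ?thesis using BM by (simp add: algebra_simps)
    next
      case 3
      have "\<bar>\<psi> x - \<psi> y\<bar> = \<bar>f y\<bar> * \<bar>\<phi> x - \<phi> y\<bar>" using R(2)[of x] 3 by (simp add: \<psi>_def abs_mult)
      also have "\<dots> \<le> F * ((Bp1 + Bp2) * norm (x - y))" using 3 F[of y] L[of x y] F0 by (intro mult_mono) auto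
      finally show ?thesis using BM by (simp add: algebra_simps)
    next
      case 4
      have "0 \<le> (F * (Bp1 + Bp2) + B * M) * norm (x - y)"
        using F0 Bp1(1) Bp2(1) B(1) M(1) by (intro mult_nonneg_nonneg add_nonneg_nonneg) auto
      then show ?thesis using 4 z\<psi>[of x] z\<psi>[of y] by simp
    qed
  qed
  have cP: "continuous_on UNIV (P i)" for i by (rule partials_continuous[OF P])
  have m: "(\<lambda>x. P1 (idx x) x) \<in> borel_measurable borel" "(\<lambda>x. P2 (idx x) x) \<in> borel_measurable borel" "f \<in> borel_measurable borel"
  proof -
    have fe: "f = (\<lambda>x. P (idx x) x)" using f idx by auto
    show "f \<in> borel_measurable borel"
      by (subst fe, rule piecewise_measurable, rule borel_measurable_continuous_onI, rule cP)
    show "(\<lambda>x. P1 (idx x) x) \<in> borel_measurable borel"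
      by (rule piecewise_measurable, rule borel_measurable_continuous_onI, rule c(1))
    show "(\<lambda>x. P2 (idx x) x) \<in> borel_measurable borel"
      by (rule piecewise_measurable, rule borel_measurable_continuous_onI, rule c(2))
  qed
  have m\<phi>: "\<phi> \<in> borel_measurable borel" "partial i \<phi> \<in> borel_measurable borel" for i
    using c\<phi> by (auto intro: borel_measurable_continuous_onI)
  define q1 where "q1 x = P1 (idx x) x * \<phi> x + f x * partial 1 \<phi> x" for x
  define q2 where "q2 x = P2 (idx x) x * \<phi> x + f x * partial 2 \<phi> x" for x
  have mq: "q1 \<in> borel_measurable borel" "q2 \<in> borel_measurable borel"
    unfolding q1_def q2_def using m m\<phi> by auto
  have "negligible (cone 1 \<inter> cone 2 \<union> (cone 1 \<inter> cone 3 \<union> cone 2 \<inter> cone 3))"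
    by (intro negligible_Un overlap_negligible) auto
  from negligible_imp_AE[OF this]
  have ae: "AE x in lborel. \<forall>j. j \<noteq> idx x \<longrightarrow> x \<notin> cone j"
  proof eventually_elim
    case (elim x)
    then show ?case using idx[of x] exhaust_3[of "idx x"] by (auto simp: forall_3)
  qed
  have d: "(\<psi> has_derivative (\<lambda>h. q1 x * h $ 1 + q2 x * h $ 2)) (at x)" if x: "\<forall>j. j \<noteq> idx x \<longrightarrow> x \<notin> cone j" for x
  proof -
    let ?i = "idx x"
    define W where "W = - (\<Union>j\<in>-{?i}. cone j)"
    have W: "open W" "x \<in> W" unfolding W_def using x closed_cone by (auto intro!: open_Compl closed_UN)
    have cW: "y \<in> cone ?i" if "y \<in> W" for y using cone_cover[of y] that by (auto simp: W_def)
    have "P ?i y = f y" if "y \<in> W" for y using f[OF cW[OF that]] ..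
    then have "(f has_derivative (\<lambda>h. P1 ?i x * h $ 1 + P2 ?i x * h $ 2)) (at x)"
      by (rule has_derivative_transform_within_open[OF P[unfolded partials_def, rule_format] W])
    from has_derivative_mult[OF this smooth_has_derivative[OF sm, of x]]
    show ?thesis by (simp add: \<psi>_def[abs_def] q1_def q2_def algebra_simps)
  qed
  have lim: "AE x in lborel. (\<lambda>n. (\<psi> (x + (1 / real (Suc n)) *\<^sub>R e1) - \<psi> x) * real (Suc n)) \<longlonglongrightarrow> q1 x"
    "AE x in lborel. (\<lambda>n. (\<psi> (x + (1 / real (Suc n)) *\<^sub>R e2) - \<psi> x) * real (Suc n)) \<longlonglongrightarrow> q2 x"
  proof -
    have a: "e1 $ 1 = 1" "e1 $ 2 = 0" "e2 $ 1 = 0" "e2 $ 2 = 1" by (simp_all add: axis_def)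
    show "AE x in lborel. (\<lambda>n. (\<psi> (x + (1 / real (Suc n)) *\<^sub>R e1) - \<psi> x) * real (Suc n)) \<longlonglongrightarrow> q1 x"
      using ae by eventually_elim (use directional_quotient_tendsto[OF d, of _ e1] in \<open>simp only: a mult_1_right mult_zero_right add_0_right\<close>)
    show "AE x in lborel. (\<lambda>n. (\<psi> (x + (1 / real (Suc n)) *\<^sub>R e2) - \<psi> x) * real (Suc n)) \<longlonglongrightarrow> q2 x"
      using ae by eventually_elim (use directional_quotient_tendsto[OF d, of _ e2] in \<open>simp only: a mult_1_right mult_zero_right add_0_left\<close>)
  qed
  have i0: "integral\<^sup>L lborel q1 = 0" "integral\<^sup>L lborel q2 = 0"
    by (rule integral_directional_derivative_zero(1)[OF lip z\<psi> mq(1) lim(1)], assumption)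
      (rule integral_directional_derivative_zero(1)[OF lip z\<psi> mq(2) lim(2)], assumption)
  have ip: "integrable lborel (\<lambda>x. Q (idx x) x * \<phi> x)" if Q: "\<And>i. continuous_on UNIV (Q i)" for Q :: "3 \<Rightarrow> pt \<Rightarrow> real"
  proof -
    have "bounded (Q i ` cball 0 R)" for i
      by (intro compact_imp_bounded compact_continuous_image continuous_on_subset[OF Q]) auto
    then have "\<exists>b'. \<forall>x. norm x \<le> R \<longrightarrow> \<bar>Q i x\<bar> \<le> b'" for i
    proof -
      assume bd: "\<And>i. bounded (Q i ` cball 0 R)"
      obtain r where "\<forall>y\<in>Q i ` cball 0 R. norm y \<le> r" using bd[of i] unfolding bounded_iff by blast
      then show ?thesis by (intro exI[of _ r] allI impI) simp
    qed
    then obtain b where b: "\<And>i x. norm x \<le> R \<Longrightarrow> \<bar>Q i x\<bar> \<le> b i" by metis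
    have b': "\<bar>Q i x\<bar> \<le> (\<Sum>i\<in>UNIV. \<bar>b i\<bar>)" if "norm x \<le> R" for i x
      using b[OF that, of i] member_le_sum[of i UNIV "\<lambda>i. \<bar>b i\<bar>"] by auto
    show ?thesis
    proof (rule integrable_bounded_support[where R = R and B = "(\<Sum>i\<in>UNIV. \<bar>b i\<bar>) * B"])
      show "(\<lambda>x. Q (idx x) x * \<phi> x) \<in> borel_measurable borel"
        by (rule borel_measurable_times, rule piecewise_measurable, rule borel_measurable_continuous_onI, rule Q, rule m\<phi>(1))
      show "\<bar>Q (idx x) x * \<phi> x\<bar> \<le> (\<Sum>i\<in>UNIV. \<bar>b i\<bar>) * B" if "norm x \<le> R" for x
        unfolding abs_mult using b'[OF that] B(2) by (intro mult_mono) (auto intro: sum_nonneg)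
    qed (use R(2) in simp)
  qed
  have if1: "integrable lborel (\<lambda>x. f x * partial i \<phi> x)" for i
  proof (rule integrable_bounded_support[where R = "R + 1" and B = "F * (Bp1 + Bp2)"])
    show "(\<lambda>x. f x * partial i \<phi> x) \<in> borel_measurable borel" using m m\<phi> by auto
    show "f x * partial i \<phi> x = 0" if "norm x \<ge> R + 1" for x using zp'[OF that] by simp
    show "\<bar>f x * partial i \<phi> x\<bar> \<le> F * (Bp1 + Bp2)" if "norm x \<le> R + 1" for x
    proof -
      have "\<bar>partial i \<phi> x\<bar> \<le> Bp1 + Bp2" using Bp1(2)[of x] Bp2(2)[of x] Bp1(1) Bp2(1) exhaust_2[of i] by auto
      then show ?thesis unfolding abs_mult using F[OF that] F0 by (intro mult_mono) auto
    qed
  qed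
  have "integral\<^sup>L lborel q1 = (\<integral>x. P1 (idx x) x * \<phi> x \<partial>lborel) + (\<integral>x. f x * partial 1 \<phi> x \<partial>lborel)"
    unfolding q1_def by (rule Bochner_Integration.integral_add[OF ip[OF c(1)] if1])
  then show "(\<integral>x. f x * partial 1 \<phi> x \<partial>lborel) = - (\<integral>x. P1 (idx x) x * \<phi> x \<partial>lborel)" using i0 by simp
  have "integral\<^sup>L lborel q2 = (\<integral>x. P2 (idx x) x * \<phi> x \<partial>lborel) + (\<integral>x. f x * partial 2 \<phi> x \<partial>lborel)"
    unfolding q2_def by (rule Bochner_Integration.integral_add[OF ip[OF c(2)] if1])
  then show "(\<integral>x. f x * partial 2 \<phi> x \<partial>lborel) = - (\<integral>x. P2 (idx x) x * \<phi> x \<partial>lborel)" using i0 by simp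
qed

end

lemma partials_unique:
  assumes "partials f f1 f2" "partials f g1 g2"
  shows "f1 = g1" "f2 = g2"
proof -
  have a: "e1 $ 1 = 1" "e1 $ 2 = 0" "e2 $ 1 = 0" "e2 $ 2 = 1" by (simp_all add: axis_def)
  have e: "(\<lambda>h::pt. f1 x * h $ 1 + f2 x * h $ 2) = (\<lambda>h. g1 x * h $ 1 + g2 x * h $ 2)" for x
    using assms unfolding partials_def by (blast intro: has_derivative_unique)
  show "f1 = g1" using fun_cong[OF e, of _ e1] by (simp add: a fun_eq_iff)
  show "f2 = g2" using fun_cong[OF e, of _ e2] by (simp add: a fun_eq_iff)
qed

lemma partials_family_unique:
  assumes F: "\<And>i j. partials (F i j) (F (Suc i) j) (F i (Suc j))" and G: "\<And>i j. partials (G i j) (G (Suc i) j) (G i (Suc j))"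
    and "F 0 0 = G 0 0"
  shows "F i j = G i j"
proof (induction i)
  case 0
  show ?case
  proof (induction j)
    case (Suc j)
    then show ?case using partials_unique(2)[OF F[of 0 j]] G[of 0 j] by metis
  qed (rule assms(3))
next
  case (Suc i)
  then show ?case using partials_unique(1)[OF F[of i j]] G[of i j] by metis
qed

lemma partials_add:
  assumes "partials f f1 f2" "partials g g1 g2"
  shows "partials (\<lambda>x. f x + g x) (\<lambda>x. f1 x + g1 x) (\<lambda>x. f2 x + g2 x)"
  unfolding partials_def
proof
  fix x
  show "((\<lambda>x. f x + g x) has_derivative (\<lambda>h. (f1 x + g1 x) * h $ 1 + (f2 x + g2 x) * h $ 2)) (at x)"
    using has_derivative_add[OF assms(1)[unfolded partials_def, rule_format, of x] assms(2)[unfolded partials_def, rule_format, of x]]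
    by (simp add: algebra_simps)
qed

context hct_data
begin

text \<open>The partial derivatives of the pieces, of any order.\<close>

definition pc :: "3 \<Rightarrow> nat \<Rightarrow> nat \<Rightarrow> pt \<Rightarrow> real" where
  "pc i a b = cub (jet (co i) (sc i (p1 i)) (sc i (p2 i)) a b) (sc i (p1 i)) (sc i (p2 i)) Z"

definition hderiv :: "nat \<Rightarrow> nat \<Rightarrow> pt \<Rightarrow> real" where "hderiv a b x = pc (idx x) a b x"

lemma pc_partials: "partials (pc i a b) (pc i (Suc a) b) (pc i a (Suc b))"
  unfolding pc_def by (rule cub_partials[OF deg_le_co])

lemma pc_continuous: "continuous_on S (pc i a b)"
  using partials_continuous[OF pc_partials] by (rule continuous_on_subset) simp

lemma pc_0: "pc i 0 0 = piece i"
  by (simp add: pc_def jet_simps piece_eq_cub)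

lemma gpiece_pc: "gpiece i x = pc i 1 0 x *\<^sub>R e1 + pc i 0 1 x *\<^sub>R e2"
proof -
  have "(piece i has_derivative (\<lambda>h. pc i 1 0 x * h $ 1 + pc i 0 1 x * h $ 2)) (at x)"
    using pc_partials[of i 0 0] by (simp add: partials_def pc_0)
  then have "(\<lambda>h. gpiece i x \<bullet> h) = (\<lambda>h. pc i 1 0 x * h $ 1 + pc i 0 1 x * h $ 2)"
    using piece_has_derivative by (rule has_derivative_unique[rotated])
  then have "gpiece i x \<bullet> h = (pc i 1 0 x *\<^sub>R e1 + pc i 0 1 x *\<^sub>R e2) \<bullet> h" for h
    unfolding fun_eq_iff by (simp add: inner_add_left inner_axis')
  then show ?thesis using vector_eq_rdot by blast
qed

lemma hderiv_eq:
  assumes "x \<in> cone i" "a + b \<le> 1"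
  shows "hderiv a b x = pc i a b x"
proof -
  have a: "e1 $ 1 = 1" "e1 $ 2 = 0" "e2 $ 1 = 0" "e2 $ 2 = 1" by (simp_all add: axis_def)
  have 0: "hderiv 0 0 x = pc i 0 0 x" using hf_eq[OF assms(1)] by (simp add: hderiv_def pc_0 hf_def)
  have "gpiece (idx x) x = gpiece i x" using hg_eq[OF assms(1)] by (simp add: hg_def)
  then have g: "pc (idx x) 1 0 x *\<^sub>R e1 + pc (idx x) 0 1 x *\<^sub>R e2 = pc i 1 0 x *\<^sub>R e1 + pc i 0 1 x *\<^sub>R e2"
    by (simp only: gpiece_pc)
  have "hderiv 1 0 x = pc i 1 0 x" "hderiv 0 1 x = pc i 0 1 x"
    using arg_cong[OF g, of "\<lambda>y. y $ 1"] arg_cong[OF g, of "\<lambda>y. y $ 2"] by (simp_all add: hderiv_def a)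
  moreover have "(a = 0 \<and> b = 0) \<or> (a = 1 \<and> b = 0) \<or> (a = 0 \<and> b = 1)" using assms(2) by linarith
  ultimately show ?thesis using 0 by auto
qed

lemma hderiv_0: "hderiv 0 0 = hf"
  by (auto simp: hderiv_def pc_0 hf_def)

lemma hderiv_measurable: "hderiv a b \<in> borel_measurable borel"
  unfolding hderiv_def[abs_def] by (rule piecewise_measurable, rule borel_measurable_continuous_onI, rule pc_continuous)

lemma hderiv_bounded:
  obtains B where "\<And>x. norm x \<le> R \<Longrightarrow> \<bar>hderiv a b x\<bar> \<le> B"
proof -
  have "bounded (pc i a b ` cball 0 R)" for i
    by (intro compact_imp_bounded compact_continuous_image pc_continuous) auto
  then have "\<exists>B'. \<forall>x. norm x \<le> R \<longrightarrow> \<bar>pc i a b x\<bar> \<le> B'" for i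
  proof -
    assume bd: "\<And>i. bounded (pc i a b ` cball 0 R)"
    obtain r where "\<forall>y\<in>pc i a b ` cball 0 R. norm y \<le> r" using bd[of i] unfolding bounded_iff by blast
    then show ?thesis by (intro exI[of _ r] allI impI) simp
  qed
  then obtain B where B: "\<And>i x. norm x \<le> R \<Longrightarrow> \<bar>pc i a b x\<bar> \<le> B i" by metis
  have "\<bar>hderiv a b x\<bar> \<le> (\<Sum>i\<in>UNIV. \<bar>B i\<bar>)" if "norm x \<le> R" for x
    using B[OF that, of "idx x"] member_le_sum[of "idx x" UNIV "\<lambda>i. \<bar>B i\<bar>"] by (auto simp: hderiv_def)
  then show ?thesis by (rule that)
qed

text \<open>Two integrations by parts are possible, because values and gradient of the pieces agree along the rays.\<close>

lemma hct_weak_family: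
  assumes S: "open S" "bounded S"
  shows "weak_family 2 S (\<lambda>a b x. indicator S x * hderiv a b x)"
  unfolding weak_family_def
proof (intro allI impI conjI)
  fix a b :: nat assume ab: "a + b \<le> 2"
  have [measurable]: "S \<in> sets borel" using S by simp
  note [measurable] = hderiv_measurable
  show "(\<lambda>x. indicator S x * hderiv a b x) \<in> borel_measurable borel" by measurable
  show "indicator S x * hderiv a b x = 0" if "x \<notin> S" for x using that by simp
  obtain R where R: "\<forall>x\<in>S. norm x \<le> R" using S(2) by (auto simp: bounded_iff)
  obtain B where B: "\<And>x. norm x \<le> \<bar>R\<bar> + 1 \<Longrightarrow> \<bar>hderiv a b x\<bar> \<le> B" using hderiv_bounded by blast
  show "integrable lborel (\<lambda>x. (indicator S x * hderiv a b x)\<^sup>2)"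
  proof (rule integrable_bounded_support[where R = "\<bar>R\<bar> + 1" and B = "B\<^sup>2"])
    show "(indicator S x * hderiv a b x)\<^sup>2 = 0" if "norm x \<ge> \<bar>R\<bar> + 1" for x
    proof -
      have "x \<notin> S" using R that by fastforce
      then show ?thesis by simp
    qed
    show "\<bar>(indicator S x * hderiv a b x)\<^sup>2\<bar> \<le> B\<^sup>2" if "norm x \<le> \<bar>R\<bar> + 1" for x
    proof -
      have "\<bar>hderiv a b x\<bar>\<^sup>2 \<le> B\<^sup>2" using B[OF that] by (intro power_mono) auto
      then show ?thesis by (cases "x \<in> S") auto
    qed
  qed measurable
  fix \<phi> assume t: "test_function S \<phi>"
  have cU: "continuous_on UNIV (pc i a b)" for i a b by (rule pc_continuous)
  have ibp1: "(\<integral>x. hderiv a b x * partial 1 \<psi> x \<partial>lborel) = - (\<integral>x. hderiv (Suc a) b x * \<psi> x \<partial>lborel)"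
    and ibp2: "(\<integral>x. hderiv a b x * partial 2 \<psi> x \<partial>lborel) = - (\<integral>x. hderiv a (Suc b) x * \<psi> x \<partial>lborel)"
    if "a + b \<le> 1" "test_function S \<psi>" for a b \<psi>
    using piecewise_integration_by_parts[where f = "hderiv a b" and P = "\<lambda>i. pc i a b", OF hderiv_eq[OF _ that(1)] pc_partials cU cU that(2)]
    by (simp_all add: hderiv_def)
  have "(\<integral>x. hderiv 0 0 x * mixed_deriv (a, b) \<phi> x \<partial>lborel) = (-1) ^ (a + b) * (\<integral>x. hderiv a b x * \<phi> x \<partial>lborel)"
  proof -
    note t1 = test_function_partial[OF t, of 1] and t2 = test_function_partial[OF t, of 2]
    have c: "(a = 0 \<and> b = 0) \<or> (a = 1 \<and> b = 0) \<or> (a = 0 \<and> b = 1) \<or> (a = 2 \<and> b = 0) \<or> (a = 1 \<and> b = 1) \<or> (a = 0 \<and> b = 2)"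
      using ab by linarith
    then show ?thesis
      using ibp1[of 0 0, OF _ t] ibp2[of 0 0, OF _ t] ibp1[of 0 0, OF _ t1] ibp1[of 0 0, OF _ t2] ibp2[of 0 0, OF _ t2]
        ibp1[of 1 0, OF _ t] ibp2[of 1 0, OF _ t] ibp2[of 0 1, OF _ t]
      by (elim disjE) (simp_all add: mixed_deriv_def numeral_2_eq_2)
  qed
  then show "(\<integral>x. indicator S x * hderiv 0 0 x * mixed_deriv (a, b) \<phi> x \<partial>lborel) = (-1) ^ (a + b) * (\<integral>x. indicator S x * hderiv a b x * \<phi> x \<partial>lborel)"
    using indicator_times_test[OF test_function_mixed_deriv[OF t], of "hderiv 0 0"] indicator_times_test[OF t, of "hderiv a b"] by simp
qed

end

section \<open>The interpolation error of the local HCT function\<close>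

lemma dof_combination_bounds:
  fixes a b c d p q e :: real
  assumes "\<bar>a\<bar> \<le> e" "\<bar>b\<bar> \<le> e" "\<bar>c\<bar> \<le> e" "\<bar>d\<bar> \<le> e" "\<bar>p\<bar> \<le> e" "\<bar>q\<bar> \<le> e"
  shows "\<bar>3/2 * (b - a) - 1/4 * (d + q - (c + p))\<bar> \<le> 4 * e"
    and "\<bar>r\<bar> \<le> e' \<Longrightarrow> \<bar>3/8 * (d + p) + 3/4 * (a + b) - 1/8 * (c + q) - r\<bar> \<le> 5/2 * e + e'"
proof -
  have s: "-e \<le> a" "a \<le> e" "-e \<le> b" "b \<le> e" "-e \<le> c" "c \<le> e" "-e \<le> d" "d \<le> e" "-e \<le> p" "p \<le> e" "-e \<le> q" "q \<le> e"
    using assms by (simp_all add: abs_le_iff)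
  have "\<bar>b - a\<bar> \<le> 2 * e" by (rule abs_leI) (use s in linarith)+
  then have 1: "\<bar>3/2 * (b - a)\<bar> \<le> 3 * e" by simp
  have "\<bar>d + q - (c + p)\<bar> \<le> \<bar>d\<bar> + \<bar>q\<bar> + (\<bar>c\<bar> + \<bar>p\<bar>)"
    by (meson abs_triangle_ineq abs_triangle_ineq4 add_mono order_trans)
  then have "\<bar>d + q - (c + p)\<bar> \<le> 4 * e" using assms by linarith
  then have 2: "\<bar>1/4 * (d + q - (c + p))\<bar> \<le> e" by simp
  show "\<bar>3/2 * (b - a) - 1/4 * (d + q - (c + p))\<bar> \<le> 4 * e"
    using abs_triangle_ineq4[of "3/2 * (b - a)" "1/4 * (d + q - (c + p))"] 1 2 by linarith
  have "\<bar>d + p\<bar> \<le> 2 * e" "\<bar>a + b\<bar> \<le> 2 * e" "\<bar>c + q\<bar> \<le> 2 * e" by (rule abs_leI; use s in linarith)+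
  then have 3: "\<bar>3/8 * (d + p)\<bar> \<le> 3/4 * e" "\<bar>3/4 * (a + b)\<bar> \<le> 3/2 * e" "\<bar>1/8 * (c + q)\<bar> \<le> 1/4 * e" by simp_all
  show "\<bar>3/8 * (d + p) + 3/4 * (a + b) - 1/8 * (c + q) - r\<bar> \<le> 5/2 * e + e'" if r: "\<bar>r\<bar> \<le> e'"
  proof -
    have "\<bar>x + y - z - r\<bar> \<le> \<bar>x\<bar> + \<bar>y\<bar> + \<bar>z\<bar> + \<bar>r\<bar>" for x y z :: real by linarith
    from this[of "3/8 * (d + p)" "3/4 * (a + b)" "1/8 * (c + q)"] 3 r show ?thesis by linarith
  qed
qed

context hct_frame
begin

lemma piece_add:
  assumes A: "hct_data V Z \<beta> \<ll> M" and B: "hct_data V Z \<beta> \<ll> M'"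
  shows "hct_data.piece V Z \<beta> \<ll> (\<lambda>j. g j + g' j) (\<lambda>j k. M j k + M' j k) i x
    = hct_data.piece V Z \<beta> \<ll> g M i x + hct_data.piece V Z \<beta> \<ll> g' M' i x"
proof -
  interpret A: hct_data V Z \<beta> \<ll> g M by fact
  interpret B: hct_data V Z \<beta> \<ll> g' M' by fact
  interpret C: hct_data V Z \<beta> \<ll> "\<lambda>j. g j + g' j" "\<lambda>j k. M j k + M' j k"
    by unfold_locales (simp add: A.M_sym B.M_sym)
  have ee: "C.ee j = A.ee j + B.ee j" for j
    unfolding C.ee_def A.ee_def B.ee_def by (simp add: sum.distrib distrib_left)
  have zz: "C.zz = A.zz + B.zz"
    unfolding C.zz_def A.zz_def B.zz_def ee by (simp add: sum.distrib distrib_left)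
  have \<gamma>: "C.\<gamma> j = A.\<gamma> j + B.\<gamma> j" for j unfolding C.\<gamma>_def A.\<gamma>_def B.\<gamma>_def ee zz by simp
  have Q: "C.Q j k = A.Q j k + B.Q j k" for j k unfolding C.Q_def A.Q_def B.Q_def zz \<gamma> by simp
  have D: "C.D j k = A.D j k + B.D j k" for j k
    unfolding C.D_def A.D_def B.D_def Q \<gamma> by (simp add: inner_add_left field_simps)
  show ?thesis
    unfolding C.piece_def A.piece_def B.piece_def Pol_def zz \<gamma> Q D
    by (simp add: sum_3 algebra_simps)
qed

text \<open>By linearity and \<open>hct_reproduces_cubics\<close> the difference is the HCT function whose data are the errors, of size
  \<open>\<epsilon>\<close> for values and \<open>\<epsilon>/h\<close> for derivatives. Its parameters are \<open>O(K \<epsilon>)\<close>, each differentiation costs a factor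
  \<open>2 K / h\<close>, and the coordinates are bounded by \<open>K\<close>; the exponent 11 collects one, four and six such factors.\<close>

lemma interpolation_error:
  fixes c
  assumes c: "deg_le 3 c" and \<nu>: "\<And>j k. j \<noteq> k \<Longrightarrow> norm (\<nu> j k) = 1" "\<And>j k. j \<noteq> k \<Longrightarrow> \<nu> j k \<bullet> (v k - v j) = 0" "\<And>j k. \<nu> j k = \<nu> k j"
    and n: "\<And>j k. n j k = n k j"
    and h: "h > 0" and K: "K \<ge> 1" and vh: "\<And>j. norm (v j) \<le> h" and sck: "\<And>i k. norm (sc i k) \<le> K / h"
    and E: "\<And>j k. j \<noteq> k \<Longrightarrow> norm (v k - v j) \<ge> h / K"
    and f: "\<And>j. \<bar>f j - pol c 0 0 (V j)\<bar> \<le> \<epsilon>" and g: "\<And>j. norm (g j - gradp c (V j)) \<le> \<epsilon> / h"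
    and nn: "\<And>j k. j \<noteq> k \<Longrightarrow> \<bar>n j k - gradp c ((1/2) *\<^sub>R (V j + V k)) \<bullet> \<nu> j k\<bar> \<le> \<epsilon> / h"
    and x: "norm (x - Z) \<le> h" and ab: "a + b \<le> 4"
  shows "\<bar>hct_data.hderiv V Z \<beta> \<ll> g (MM \<nu> f g n) a b x - pol c a b x\<bar> \<le> 138240 * K ^ 11 * (\<epsilon> / h ^ (a + b))"
    and "\<bar>hct_data.pc V Z \<beta> \<ll> g (MM \<nu> f g n) i a b x - pol c a b x\<bar> \<le> 138240 * K ^ 11 * (\<epsilon> / h ^ (a + b))"
proof -
  define fq where "fq j = pol c 0 0 (V j)" for j
  define gq where "gq j = gradp c (V j)" for j
  define nq where "nq j k = gradp c ((1/2) *\<^sub>R (V j + V k)) \<bullet> \<nu> j k" for j k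
  define f' where "f' j = f j - fq j" for j
  define g' where "g' j = g j - gq j" for j
  define n' where "n' j k = n j k - nq j k" for j k
  have nqs: "nq j k = nq k j" for j k unfolding nq_def by (simp add: add.commute \<nu>(3)[of j k])
  have n's: "n' j k = n' k j" for j k unfolding n'_def by (simp add: nqs[of j k] n[of j k])
  have Mq: "hct_data V Z \<beta> \<ll> (MM \<nu> fq gq nq)" by unfold_locales (rule MM_sym[OF \<nu>(3) nqs])
  have M': "hct_data V Z \<beta> \<ll> (MM \<nu> f' g' n')" by unfold_locales (rule MM_sym[OF \<nu>(3) n's])
  have M: "hct_data V Z \<beta> \<ll> (MM \<nu> f g n)" by unfold_locales (rule MM_sym[OF \<nu>(3) n])
  interpret U: hct_data V Z \<beta> \<ll> g "MM \<nu> f g n" by (rule M)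
  interpret W: hct_data V Z \<beta> \<ll> g' "MM \<nu> f' g' n'" by (rule M')
  have split: "f = (\<lambda>j. 1 * fq j + 1 * f' j)" "g = (\<lambda>j. 1 *\<^sub>R gq j + 1 *\<^sub>R g' j)" "n = (\<lambda>j k. 1 * nq j k + 1 * n' j k)"
    by (auto simp: f'_def g'_def n'_def)
  have MMs: "MM \<nu> f g n = (\<lambda>j k. MM \<nu> fq gq nq j k + MM \<nu> f' g' n' j k)"
    by (intro ext, subst split(1), subst split(2), subst split(3), subst MM_linear) simp
  have gs: "g = (\<lambda>j. gq j + g' j)" by (auto simp: g'_def)
  have "U.piece i x = pol c 0 0 x + W.piece i x" for i x
  proof -
    have "hct_data.piece V Z \<beta> \<ll> (\<lambda>j. gq j + g' j) (\<lambda>j k. MM \<nu> fq gq nq j k + MM \<nu> f' g' n' j k) i x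
      = hct_data.piece V Z \<beta> \<ll> gq (MM \<nu> fq gq nq) i x + W.piece i x"
      by (rule piece_add[OF Mq M'])
    moreover have "hct_data.piece V Z \<beta> \<ll> gq (MM \<nu> fq gq nq) i x = pol c 0 0 x"
      using hct_reproduces_cubics[OF c \<nu>(1,2), of i x] Mq unfolding fq_def gq_def nq_def by simp
    ultimately show ?thesis unfolding MMs[symmetric] gs[symmetric] by simp
  qed
  then have base: "U.pc i 0 0 = (\<lambda>x. pol c 0 0 x + W.pc i 0 0 x)" for i
    by (simp add: U.pc_0 W.pc_0 fun_eq_iff)
  have pcs: "U.pc i a b = (\<lambda>x. pol c a b x + W.pc i a b x)" for i
    by (rule partials_family_unique[of "U.pc i" "\<lambda>a b x. pol c a b x + W.pc i a b x"])
      (auto intro!: U.pc_partials partials_add cub_partials[OF c] W.pc_partials base)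
  have \<epsilon>: "\<epsilon> \<ge> 0" using f[of 1] by linarith
  have f'b: "\<bar>f' j\<bar> \<le> \<epsilon>" for j using f[of j] by (simp add: f'_def fq_def)
  have g'n: "norm (g' j) \<le> \<epsilon> / h" for j using g[of j] by (simp add: g'_def gq_def)
  have g'b: "\<bar>g' j \<bullet> v k\<bar> \<le> \<epsilon>" for j k
  proof -
    have "\<bar>g' j \<bullet> v k\<bar> \<le> norm (g' j) * norm (v k)" by (rule Cauchy_Schwarz_ineq2)
    also have "\<dots> \<le> (\<epsilon> / h) * h" using g'n vh \<epsilon> h by (intro mult_mono) auto
    finally show ?thesis using h by simp
  qed
  have RR: "\<bar>RR \<nu> f' g' n' j k\<bar> \<le> 5 * K * \<epsilon>" if jk: "j \<noteq> k" for j k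
  proof -
    let ?w = "(1/2) *\<^sub>R (v j + v k)" and ?E = "v k - v j"
    have w: "norm ?w \<le> h" using norm_triangle_ineq[of "v j" "v k"] vh[of j] vh[of k] by simp
    have E0: "norm ?E > 0" using E[OF jk] h K by (metis divide_pos_pos less_le_trans zero_less_one)
    have \<tau>: "\<bar>(?w \<bullet> ?E) / (?E \<bullet> ?E)\<bar> \<le> K"
    proof -
      have "\<bar>?w \<bullet> ?E\<bar> \<le> h * norm ?E"
        using Cauchy_Schwarz_ineq2[of ?w ?E] w by (meson mult_right_mono norm_ge_zero order_trans)
      also have "\<dots> \<le> (K * norm ?E) * norm ?E"
        using E[OF jk] K by (intro mult_right_mono) (auto simp: field_simps)
      finally have "\<bar>?w \<bullet> ?E\<bar> \<le> K * (?E \<bullet> ?E)" by (simp add: power2_norm_eq_inner[symmetric] power2_eq_square mult.assoc)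
      moreover have "?E \<bullet> ?E > 0" using E0 by simp
      ultimately show ?thesis by (simp add: abs_divide divide_le_eq)
    qed
    have A: "\<bar>3/2 * (f' k - f' j) - 1/4 * ((g' j + g' k) \<bullet> ?E)\<bar> \<le> 4 * \<epsilon>"
      unfolding inner_add_left inner_diff_right
      by (rule dof_combination_bounds(1)[OF f'b[of j] f'b[of k] g'b[of j j] g'b[of j k] g'b[of k j] g'b[of k k]])
    have s: "\<bar>?w \<bullet> \<nu> j k\<bar> \<le> h"
      using Cauchy_Schwarz_ineq2[of ?w "\<nu> j k"] w \<nu>(1)[OF jk] by simp
    have "\<bar>n' j k\<bar> \<le> \<epsilon> / h" using nn[OF jk] by (simp add: n'_def nq_def)
    then have "\<bar>(?w \<bullet> \<nu> j k) * n' j k\<bar> \<le> h * (\<epsilon> / h)" unfolding abs_mult using s h by (intro mult_mono) auto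
    moreover have "\<bar>(?w \<bullet> ?E) / (?E \<bullet> ?E) * (3/2 * (f' k - f' j) - 1/4 * ((g' j + g' k) \<bullet> ?E))\<bar> \<le> K * (4 * \<epsilon>)"
      unfolding abs_mult using \<tau> A K by (intro mult_mono) auto
    ultimately have "\<bar>RR \<nu> f' g' n' j k\<bar> \<le> K * (4 * \<epsilon>) + \<epsilon>"
      unfolding RR_def using h by (intro order_trans[OF abs_triangle_ineq] add_mono) auto
    also have "\<dots> \<le> 5 * K * \<epsilon>" using mult_right_mono[OF K \<epsilon>] by simp
    finally show ?thesis .
  qed
  have K\<epsilon>: "\<epsilon> \<le> K * \<epsilon>" using mult_right_mono[OF K \<epsilon>] by simp
  have Mb: "\<bar>MM \<nu> f' g' n' j k\<bar> \<le> 5 * K * \<epsilon>" for j k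
  proof (cases "j = k")
    case True
    then show ?thesis using f'b[of j] g'b[of j j] K\<epsilon> \<epsilon> by (simp add: MM_def)
  next
    case False
    have "\<bar>3/8 * (g' j \<bullet> v k + g' k \<bullet> v j) + 3/4 * (f' j + f' k) - 1/8 * (g' j \<bullet> v j + g' k \<bullet> v k) - RR \<nu> f' g' n' j k\<bar> \<le> 5/2 * \<epsilon> + 5 * K * \<epsilon>"
      by (rule dof_combination_bounds(2)[OF f'b[of j] f'b[of k] g'b[of j j] g'b[of j k] g'b[of k j] g'b[of k k] RR[OF False]])
    moreover have "\<bar>2/3 * y\<bar> \<le> 5 * K * \<epsilon>" if "\<bar>y\<bar> \<le> 5/2 * \<epsilon> + 5 * K * \<epsilon>" for y
      using that K\<epsilon> \<epsilon> unfolding abs_mult by simp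
    ultimately show ?thesis unfolding MM_def if_not_P[OF False] by blast
  qed
  have "\<epsilon> \<le> 5 * K * \<epsilon>" using K\<epsilon> \<epsilon> by linarith
  then have g'b5: "\<bar>g' j \<bullet> v k\<bar> \<le> 5 * K * \<epsilon>" for j k using g'b[of j k] by linarith
  have cob: "\<bar>W.co i p q\<bar> \<le> 540 * K * \<epsilon>" for i p q
    using W.co_bound[OF Mb g'b5, of i p q] by simp
  have Kh: "K / h \<ge> 0" using K h by simp
  have pcb: "\<bar>W.pc i a b x\<bar> \<le> 138240 * K ^ 11 * (\<epsilon> / h ^ (a + b))" for i
  proof -
    have "\<bar>sc i k \<bullet> (x - Z)\<bar> \<le> K" for k
    proof -
      have "\<bar>sc i k \<bullet> (x - Z)\<bar> \<le> norm (sc i k) * norm (x - Z)" by (rule Cauchy_Schwarz_ineq2)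
      also have "\<dots> \<le> (K / h) * h" using sck x Kh by (intro mult_mono) auto
      finally show ?thesis using h by simp
    qed
    then have "\<bar>W.pc i a b x\<bar> \<le> 16 * ((2 * (K / h)) ^ (a + b) * (540 * K * \<epsilon>)) * K ^ 6"
      unfolding W.pc_def using K by (intro cub_bound jet_bound cob sck) auto
    also have "\<dots> = 8640 * K ^ 7 * (2 * K) ^ (a + b) * (\<epsilon> / h ^ (a + b))"
      by (simp add: power_divide power_mult_distrib field_simps power_Suc[symmetric] del: power_Suc)
    also have "\<dots> \<le> 8640 * K ^ 7 * (2 * K) ^ 4 * (\<epsilon> / h ^ (a + b))"
      using K ab \<epsilon> h by (intro mult_right_mono mult_left_mono power_increasing) auto
    also have "\<dots> = 138240 * K ^ 11 * (\<epsilon> / h ^ (a + b))"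
      by (simp add: power_mult_distrib power_add[symmetric])
    finally show ?thesis .
  qed
  show "\<bar>U.pc i a b x - pol c a b x\<bar> \<le> 138240 * K ^ 11 * (\<epsilon> / h ^ (a + b))"
    using pcb[of i] unfolding pcs by simp
  show "\<bar>U.hderiv a b x - pol c a b x\<bar> \<le> 138240 * K ^ 11 * (\<epsilon> / h ^ (a + b))"
    unfolding U.hderiv_def using pcb[of "idx x"] unfolding pcs by simp
qed

end

section \<open>Shape regularity\<close>

definition det2 :: "pt \<Rightarrow> pt \<Rightarrow> real" where "det2 x y = x $ 1 * y $ 2 - x $ 2 * y $ 1"

definition perp :: "pt \<Rightarrow> pt" where "perp x = (\<chi> i. if i = 1 then - x $ 2 else x $ 1)"

lemma perp_inner: "perp x \<bullet> y = det2 x y"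
  by (simp add: perp_def det2_def inner_vec_def sum_2)

lemma norm_perp: "norm (perp x) = norm x"
  by (simp add: norm_eq_sqrt_inner inner_vec_def sum_2 perp_def add.commute)

lemma det2_square: "(det2 x y)\<^sup>2 + (x \<bullet> y)\<^sup>2 = (norm x * norm y)\<^sup>2"
  unfolding power_mult_distrib power2_norm_eq_inner
  by (simp add: det2_def inner_vec_def sum_2 power2_eq_square algebra_simps)

lemma det2_le: "\<bar>det2 x y\<bar> \<le> norm x * norm y"
proof -
  have "\<bar>det2 x y\<bar>\<^sup>2 \<le> (norm x * norm y)\<^sup>2" using det2_square[of x y] zero_le_power2[of "x \<bullet> y"] unfolding power2_abs by linarith
  then show ?thesis by (rule power2_le_imp_le) simp
qed

lemma sine_le_det2:
  assumes \<theta>: "\<theta> > 0" "\<theta> \<le> arccos ((x \<bullet> y) / (norm x * norm y))" and "x \<noteq> 0" "y \<noteq> 0" and acute: "x \<bullet> y \<ge> 0"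
  shows "sin (min \<theta> (pi/2)) * (norm x * norm y) \<le> \<bar>det2 x y\<bar>"
proof -
  define t where "t = min \<theta> (pi/2)"
  define P where "P = norm x * norm y"
  have P: "P > 0" using assms by (simp add: P_def)
  define q where "q = (x \<bullet> y) / P"
  have q: "0 \<le> q" "q \<le> 1" using acute P norm_cauchy_schwarz[of x y] by (simp_all add: q_def P_def[symmetric])
  have t: "0 \<le> t" "t \<le> arccos q" "t \<le> pi" using \<theta> pi_gt_zero by (auto simp: t_def q_def P_def min_def)
  have "arccos q \<le> pi" using arccos_ubound q by simp
  then have "cos (arccos q) \<le> cos t" using t by (intro cos_monotone_0_pi_le) auto
  then have qt: "q \<le> cos t" using q by simp
  then have "q\<^sup>2 \<le> (cos t)\<^sup>2" using q by (intro power_mono) auto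
  then have "(sin t)\<^sup>2 \<le> 1 - q\<^sup>2" by (simp add: sin_squared_eq)
  then have "(sin t)\<^sup>2 * P\<^sup>2 \<le> (1 - q\<^sup>2) * P\<^sup>2" by (intro mult_right_mono) auto
  also have "\<dots> = P\<^sup>2 - (x \<bullet> y)\<^sup>2" using P by (simp add: q_def power_divide left_diff_distrib)
  also have "\<dots> = \<bar>det2 x y\<bar>\<^sup>2" using det2_square[of x y] by (simp add: P_def)
  finally have "(sin t * P)\<^sup>2 \<le> \<bar>det2 x y\<bar>\<^sup>2" by (simp add: power_mult_distrib)
  then show ?thesis unfolding t_def P_def by (rule power2_le_imp_le) simp
qed

text \<open>Twice the area of a triangle with minimum angle \<open>\<theta>\<close> is at least this multiple of the square of its longest side.\<close>

definition shape :: "real \<Rightarrow> real" where "shape \<theta> = sin (min \<theta> (pi/2)) / 2"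

lemma shape: "\<theta> > 0 \<Longrightarrow> 0 < shape \<theta>" "shape \<theta> \<le> 1"
proof -
  show "0 < shape \<theta>" if "\<theta> > 0"
    unfolding shape_def using that pi_gt_zero by (auto intro!: sin_gt_zero simp: min_def)
  show "shape \<theta> \<le> 1" unfolding shape_def using sin_le_one[of "min \<theta> (pi/2)"] by linarith
qed

text \<open>The two angles at the longest side are acute, so the minimum angle bounds their sines from below. One of the
  other two sides has at least half the length of the longest one.\<close>

lemma det2_ge_longest_side:
  assumes \<theta>: "\<theta> > 0" and m: "min_angle_ge \<theta> {a, b, c}" and ne: "a \<noteq> b" "b \<noteq> c" "a \<noteq> c"
    and ab: "norm (a - b) \<le> norm (b - c)" and ac: "norm (a - c) \<le> norm (b - c)"
  shows "shape \<theta> * (norm (b - c))\<^sup>2 \<le> \<bar>det2 (b - a) (c - a)\<bar>"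
proof -
  let ?s = "sin (min \<theta> (pi/2))"
  have s: "?s \<ge> 0" using shape(1)[OF \<theta>] by (simp add: shape_def)
  have acute: "x \<bullet> y \<ge> 0" if "norm (x - y) \<le> norm y" for x y :: pt
  proof -
    have "(norm (x - y))\<^sup>2 \<le> (norm y)\<^sup>2" using that by (intro power_mono) auto
    then have "x \<bullet> x \<le> 2 * (x \<bullet> y)"
      unfolding power2_norm_eq_inner by (simp add: inner_diff_left inner_diff_right inner_commute)
    then show ?thesis using inner_ge_zero[of x] by linarith
  qed
  have B: "?s * (norm (a - b) * norm (c - b)) \<le> \<bar>det2 (a - b) (c - b)\<bar>"
    using m ne ac by (intro sine_le_det2[OF \<theta>] acute) (auto simp: min_angle_ge_def norm_minus_commute)
  have C: "?s * (norm (a - c) * norm (b - c)) \<le> \<bar>det2 (a - c) (b - c)\<bar>"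
    using m ne ab by (intro sine_le_det2[OF \<theta>] acute) (auto simp: min_angle_ge_def norm_minus_commute)
  have e: "\<bar>det2 (a - b) (c - b)\<bar> = \<bar>det2 (b - a) (c - a)\<bar>" "\<bar>det2 (a - c) (b - c)\<bar> = \<bar>det2 (b - a) (c - a)\<bar>"
  proof -
    have "det2 (a - b) (c - b) = - det2 (b - a) (c - a)" "det2 (a - c) (b - c) = det2 (b - a) (c - a)"
      by (simp_all add: det2_def algebra_simps)
    then show "\<bar>det2 (a - b) (c - b)\<bar> = \<bar>det2 (b - a) (c - a)\<bar>" "\<bar>det2 (a - c) (b - c)\<bar> = \<bar>det2 (b - a) (c - a)\<bar>" by simp_all
  qed
  let ?l = "norm (b - c)"
  have "?l \<le> norm (a - b) + norm (a - c)" using norm_triangle_ineq4[of "a - c" "a - b"] by (simp add: add.commute)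
  then consider "norm (a - b) \<ge> ?l / 2" | "norm (a - c) \<ge> ?l / 2" by linarith
  then show ?thesis
  proof cases
    case 1
    have "shape \<theta> * ?l\<^sup>2 = ?s * (?l / 2 * ?l)" by (simp add: shape_def power2_eq_square)
    also have "\<dots> \<le> ?s * (norm (a - b) * norm (c - b))"
      using 1 s by (intro mult_left_mono mult_mono) (auto simp: norm_minus_commute)
    finally show ?thesis using B e by linarith
  next
    case 2
    have "shape \<theta> * ?l\<^sup>2 = ?s * (?l / 2 * ?l)" by (simp add: shape_def power2_eq_square)
    also have "\<dots> \<le> ?s * (norm (a - c) * norm (b - c))"
      using 2 s by (intro mult_left_mono mult_mono) auto
    finally show ?thesis using C e by linarith
  qed
qed

lemma det2_ge:
  assumes \<theta>: "\<theta> > 0" and m: "min_angle_ge \<theta> {a, b, c}" and ne: "a \<noteq> b" "b \<noteq> c" "a \<noteq> c"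
    and xy: "x \<in> {a, b, c}" "y \<in> {a, b, c}"
  shows "shape \<theta> * (norm (x - y))\<^sup>2 \<le> \<bar>det2 (b - a) (c - a)\<bar>"
proof -
  have c: "det2 (c - b) (a - b) = det2 (b - a) (c - a)" "det2 (a - c) (b - c) = det2 (b - a) (c - a)"
    by (simp_all add: det2_def algebra_simps)
  have m2: "min_angle_ge \<theta> {b, c, a}" "min_angle_ge \<theta> {c, a, b}" using m by (simp_all add: insert_commute)
  let ?bc = "norm (b - c)" and ?ca = "norm (c - a)" and ?ab = "norm (a - b)"
  have n: "norm (a - c) = ?ca" "norm (b - a) = ?ab" "norm (c - b) = ?bc" by (simp_all add: norm_minus_commute)
  have "\<exists>l. l \<ge> ?bc \<and> l \<ge> ?ca \<and> l \<ge> ?ab \<and> shape \<theta> * l\<^sup>2 \<le> \<bar>det2 (b - a) (c - a)\<bar>"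
  proof -
    consider "?ab \<le> ?bc" "?ca \<le> ?bc" | "?bc \<le> ?ca" "?ab \<le> ?ca" | "?ca \<le> ?ab" "?bc \<le> ?ab" by linarith
    then show ?thesis
    proof cases
      case 1
      then show ?thesis using det2_ge_longest_side[OF \<theta> m] ne n by (intro exI[of _ ?bc]) auto
    next
      case 2
      then show ?thesis using det2_ge_longest_side[OF \<theta> m2(1)] ne n c by (intro exI[of _ ?ca]) auto
    next
      case 3
      then show ?thesis using det2_ge_longest_side[OF \<theta> m2(2)] ne n c by (intro exI[of _ ?ab]) auto
    qed
  qed
  then obtain l where l: "l \<ge> ?bc" "l \<ge> ?ca" "l \<ge> ?ab" "shape \<theta> * l\<^sup>2 \<le> \<bar>det2 (b - a) (c - a)\<bar>" by blast
  have "norm (x - y) \<le> l"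
    using xy l(1-3) n order_trans[OF norm_ge_zero l(1)] by auto
  then have "shape \<theta> * (norm (x - y))\<^sup>2 \<le> shape \<theta> * l\<^sup>2"
    using shape(1)[OF \<theta>] by (intro mult_left_mono power_mono) auto
  then show ?thesis using l(4) by linarith
qed

definition nx :: "3 \<Rightarrow> 3" where "nx i = (if i = 1 then 2 else if i = 2 then 3 else 1)"
definition pv :: "3 \<Rightarrow> 3" where "pv i = (if i = 1 then 3 else if i = 2 then 1 else 2)"

lemma nx_pv: "nx i \<noteq> i" "pv i \<noteq> i" "nx i \<noteq> pv i"
  using exhaust_3[of i] by (auto simp: nx_def pv_def)

lemma nx_pv_cover: "j \<noteq> k \<Longrightarrow> \<exists>i. (j = nx i \<and> k = pv i) \<or> (j = pv i \<and> k = nx i)"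
  using exhaust_3[of j] exhaust_3[of k] by (auto simp: nx_def pv_def exists_3)

lemma opposite_side_det2:
  fixes V :: "3 \<Rightarrow> pt"
  defines "W \<equiv> det2 (V 2 - V 1) (V 3 - V 1)"
  shows "det2 (V (pv i) - V (nx i)) (V j - V k) = W * ((if i = j then 1 else 0) - (if i = k then 1 else 0))"
  using exhaust_3[of i] exhaust_3[of j] exhaust_3[of k]
  by (elim disjE) (simp_all add: W_def nx_def pv_def det2_def algebra_simps)

text \<open>Cramer's rule: the gradient of a barycentric coordinate is the rotated opposite side divided by twice the area.\<close>

lemma hct_frame_of_triangle:
  fixes V :: "3 \<Rightarrow> pt"
  defines "W \<equiv> det2 (V 2 - V 1) (V 3 - V 1)"
  assumes W: "W \<noteq> 0" and pos: "\<And>i. 0 < \<beta> i" and sum1: "(\<Sum>i\<in>UNIV. \<beta> i) = 1" and Z: "Z = (\<Sum>i\<in>UNIV. \<beta> i *\<^sub>R V i)"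
  shows "hct_frame V Z \<beta> (\<lambda>i. (1 / W) *\<^sub>R perp (V (pv i) - V (nx i)))"
proof
  show "0 < \<beta> i" for i by (rule pos)
  show "(\<Sum>i\<in>UNIV. \<beta> i) = 1" by (rule sum1)
  have VZ: "V j - Z = (\<Sum>k\<in>UNIV. \<beta> k *\<^sub>R (V j - V k))" for j
  proof -
    have "(\<Sum>k\<in>UNIV. \<beta> k *\<^sub>R (V j - V k)) = (\<Sum>k\<in>UNIV. \<beta> k) *\<^sub>R V j - Z"
      by (simp add: Z scaleR_diff_right sum_subtractf scaleR_sum_left)
    then show ?thesis using sum1 by simp
  qed
  have "(\<Sum>k\<in>UNIV. \<beta> k *\<^sub>R (V k - Z)) = Z - (\<Sum>k\<in>UNIV. \<beta> k) *\<^sub>R Z"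
    by (simp add: scaleR_diff_right sum_subtractf scaleR_sum_left Z[symmetric])
  then show "(\<Sum>k\<in>UNIV. \<beta> k *\<^sub>R (V k - Z)) = 0" using sum1 by simp
  show "((1 / W) *\<^sub>R perp (V (pv i) - V (nx i))) \<bullet> (V j - Z) = (if i = j then 1 else 0) - \<beta> i" for i j
  proof -
    have "((1 / W) *\<^sub>R perp (V (pv i) - V (nx i))) \<bullet> (V j - Z)
      = (\<Sum>k\<in>UNIV. \<beta> k * ((1 / W) * det2 (V (pv i) - V (nx i)) (V j - V k)))"
      unfolding VZ inner_sum_right by (simp add: perp_inner mult.left_commute)
    also have "\<dots> = (\<Sum>k\<in>UNIV. \<beta> k * (if i = j then 1 else 0) - \<beta> k * (if i = k then 1 else 0))"
      using W unfolding opposite_side_det2 W_def[symmetric] by (intro sum.cong refl) (simp add: right_diff_distrib)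
    also have "\<dots> = (if i = j then 1 else 0) - \<beta> i"
      by (simp only: sum_subtractf sum_distrib_right[symmetric] sum1) (simp add: if_distrib[of "(*) _"] cong: if_cong)
    finally show ?thesis .
  qed
  show "(\<Sum>k\<in>UNIV. (((1 / W) *\<^sub>R perp (V (pv k) - V (nx k))) \<bullet> X) *\<^sub>R (V k - Z)) = X" for X
  proof -
    let ?d = "\<lambda>k. det2 (V (pv k) - V (nx k)) X"
    have 1: "(\<Sum>k\<in>UNIV. ?d k *\<^sub>R V k) = W *\<^sub>R X"
      by (simp add: vec_eq_iff forall_2 sum_3 nx_def pv_def det2_def W_def algebra_simps)
    have 2: "(\<Sum>k\<in>UNIV. ?d k) = 0" by (simp add: sum_3 nx_def pv_def det2_def algebra_simps)
    have "(\<Sum>k\<in>UNIV. (((1 / W) *\<^sub>R perp (V (pv k) - V (nx k))) \<bullet> X) *\<^sub>R (V k - Z))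
      = (1 / W) *\<^sub>R ((\<Sum>k\<in>UNIV. ?d k *\<^sub>R V k) - (\<Sum>k\<in>UNIV. ?d k) *\<^sub>R Z)"
      by (simp add: perp_inner scaleR_diff_right sum_subtractf scaleR_sum_left scaleR_sum_right)
    then show ?thesis unfolding 1 2 using W by simp
  qed
qed

lemma is_cellD:
  assumes "is_cell \<Omega> K"
  shows "compact (region K)" "convex (region K)" "triangle K \<subseteq> region K" "interior (triangle K) \<noteq> {}"
    "interior (region K) \<noteq> {}" "finite (verts K)" "verts K \<subseteq> region K"
proof -
  have c: "card (verts K) = 3" "centre K \<in> interior (triangle K)" using assms by (auto simp: is_cell_def)
  show f: "finite (verts K)" using c(1) by (metis card.infinite zero_neq_numeral)
  have T: "compact (triangle K)" "convex (triangle K)"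
    unfolding triangle_def by (auto intro: finite_imp_compact_convex_hull f)
  show "compact (region K)" "convex (region K)" and t: "triangle K \<subseteq> region K"
    using assms T by (auto simp: is_cell_def)
  show "interior (triangle K) \<noteq> {}" "interior (region K) \<noteq> {}" using c(2) interior_mono[OF t] by auto
  show "verts K \<subseteq> region K" using t hull_subset[of "verts K" convex] by (auto simp: triangle_def)
qed

text \<open>The angle condition on the three subtriangles keeps the splitting point away from the sides, \<open>\<beta> i \<ge> shape \<theta> ^ 3\<close>,
  and hence the cone coordinates are bounded. Sides, areas and \<open>h\<close> are comparable, so all constants depend only on
  \<open>\<theta>\<close> and \<open>\<kappa>\<close>.\<close>

lemma cell_frame_exists:
  assumes K: "is_cell \<Omega> K" and \<theta>: "\<theta> > 0" and \<kappa>: "\<kappa> > 0"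
    and a1: "min_angle_ge \<theta> (verts K)" and a2: "\<forall>e\<in>sides K. min_angle_ge \<theta> (insert (centre K) e)"
    and d: "diameter (region K) \<le> \<kappa> * diameter (triangle K)"
  defines "h \<equiv> diameter (region K)" and "N \<equiv> 2 * \<kappa> / shape \<theta> ^ 4 + 1"
  obtains V \<beta> \<ll> where "hct_frame V (centre K) \<beta> \<ll>" "inj V" "range V = verts K"
    "\<And>i k. norm (\<ll> k - (\<beta> k / \<beta> i) *\<^sub>R \<ll> i) \<le> N / h" "\<And>j k. j \<noteq> k \<Longrightarrow> norm (V k - V j) \<ge> h / N" "h > 0"
    "measure lborel (interior (region K)) \<ge> shape \<theta> / (2 * \<kappa>\<^sup>2) * h\<^sup>2"
proof -
  note K' = is_cellD[OF K]
  have "card (verts K) = 3" using K by (simp add: is_cell_def)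
  then obtain a b c where abc: "verts K = {a, b, c}" "a \<noteq> b" "b \<noteq> c" "a \<noteq> c" by (metis card_3_iff)
  define V :: "3 \<Rightarrow> pt" where "V i = (if i = 1 then a else if i = 2 then b else c)" for i
  have V123: "V 1 = a" "V 2 = b" "V 3 = c" by (simp_all add: V_def)
  have inj: "inj V"
  proof (rule injI)
    fix i j assume "V i = V j"
    then show "i = j" using exhaust_3[of i] exhaust_3[of j] abc(2-4) by (auto simp: V_def split: if_splits)
  qed
  have "(UNIV :: 3 set) = {1, 2, 3}" using exhaust_3 by auto
  then have "range V = V ` {1, 2, 3}" by (rule arg_cong)
  then have rng: "range V = verts K" unfolding abc(1) by (simp add: V123)
  have Vin: "V i \<in> verts K" for i using rng by auto
  let ?Z = "centre K" and ?C = "shape \<theta>"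
  note C = shape(1)[OF \<theta>] shape(2)[of \<theta>]
  define W where "W = det2 (V 2 - V 1) (V 3 - V 1)"
  obtain u v where uv: "u \<in> verts K" "v \<in> verts K" "\<And>x y. x \<in> triangle K \<Longrightarrow> y \<in> triangle K \<Longrightarrow> norm (x - y) \<le> norm (u - v)"
    using simplex_extremal_le[of "verts K"] K'(6) abc(1) unfolding triangle_def by (metis insert_not_empty)
  define l where "l = norm (u - v)"
  have VT: "V i \<in> triangle K" for i using Vin hull_subset[of "verts K" convex] by (auto simp: triangle_def)
  have Vl: "norm (V i - V j) \<le> l" for i j unfolding l_def by (intro uv(3) VT)
  have l0: "l > 0" using Vl[of 1 2] abc(2) by (simp add: V123) (metis dual_order.strict_trans1 right_minus_eq zero_less_norm_iff)
  have bK: "bounded (region K)" using K'(1) compact_imp_bounded by blast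
  have lh: "l \<le> h" unfolding l_def h_def dist_norm[symmetric] using uv(1,2) K'(7) by (intro diameter_bounded_bound bK) auto
  have "diameter (triangle K) \<le> l"
    using VT[of 1] unfolding l_def by (intro diameter_le uv(3)) auto
  then have hl: "h \<le> \<kappa> * l" using d \<kappa> unfolding h_def by (meson dual_order.trans mult_le_cancel_left_pos)
  have h0: "h > 0" using lh l0 by linarith
  have Wge: "?C * l\<^sup>2 \<le> \<bar>W\<bar>"
    unfolding W_def l_def V123 using det2_ge[OF \<theta>, of a b c u v] a1 abc uv(1,2) by simp
  moreover have "0 < ?C * l\<^sup>2" using C(1) l0 by simp
  ultimately have W0: "W \<noteq> 0" by auto
  note opp = opposite_side_det2[of V, folded W_def]
  have Wle: "\<bar>W\<bar> \<le> l\<^sup>2"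
    unfolding W_def power2_eq_square using det2_le Vl l0 by (meson less_imp_le mult_mono norm_ge_zero order_trans)
  have side: "?C * l \<le> norm (V (pv i) - V (nx i))" for i
  proof -
    have "?C * l\<^sup>2 \<le> \<bar>det2 (V (pv i) - V (nx i)) (V i - V (nx i))\<bar>" using Wge nx_pv(1)[of i] by (simp add: opp)
    also have "\<dots> \<le> norm (V (pv i) - V (nx i)) * norm (V i - V (nx i))" by (rule det2_le)
    also have "\<dots> \<le> norm (V (pv i) - V (nx i)) * l" by (intro mult_left_mono Vl) simp
    finally show ?thesis using l0 by (simp add: power2_eq_square mult.assoc[symmetric])
  qed
  have "\<not> collinear {a, b, c}" using K abc by (simp add: is_cell_def collinear_3_eq_affine_dependent)
  moreover have "?Z \<in> interior (convex hull {a, b, c})" using K abc(1) by (simp add: is_cell_def triangle_def)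
  ultimately obtain x y z where xyz: "0 < x" "0 < y" "0 < z" "x + y + z = 1" "x *\<^sub>R a + y *\<^sub>R b + z *\<^sub>R c = ?Z"
    using interior_convex_hull_3_minimal[of a b c] by auto
  define \<beta> :: "3 \<Rightarrow> real" where "\<beta> i = (if i = 1 then x else if i = 2 then y else z)" for i
  have \<beta>0: "0 < \<beta> i" for i using xyz by (simp add: \<beta>_def)
  have \<beta>1: "(\<Sum>i\<in>UNIV. \<beta> i) = 1" using xyz by (simp add: \<beta>_def sum_3)
  define \<ll> where "\<ll> i = (1 / W) *\<^sub>R perp (V (pv i) - V (nx i))" for i
  have fr: "hct_frame V ?Z \<beta> \<ll>"
    unfolding \<ll>_def W_def
    by (rule hct_frame_of_triangle) (use W0 W_def \<beta>0 \<beta>1 xyz in \<open>auto simp: sum_3 \<beta>_def V123\<close>)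
  interpret hct_frame V ?Z \<beta> \<ll> by (rule fr)
  have \<beta>le: "\<beta> i \<le> 1" for i using \<beta>1 \<beta>0 member_le_sum[of i UNIV \<beta>] by (auto intro: less_imp_le)
  have \<beta>ge: "?C ^ 3 \<le> \<beta> i" for i
  proof -
    let ?p = "V (pv i)" and ?n = "V (nx i)"
    have pn: "?p \<noteq> ?n" using inj nx_pv(3)[of i] by (auto dest: injD)
    have e: "{?n, ?p} \<in> sides K" using Vin pn by (auto simp: sides_def)
    have \<beta>W: "det2 (?n - ?Z) (?p - ?Z) = \<beta> i * W"
    proof -
      have "\<ll> i \<bullet> (?n - ?Z) = - \<beta> i" using dual[of i "nx i"] nx_pv(1)[of i] by simp
      then have "det2 (?p - ?n) (?n - ?Z) = - \<beta> i * W" using W0 by (simp add: \<ll>_def perp_inner field_simps)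
      moreover have "det2 (?p - ?n) (?n - ?Z) = - det2 (?n - ?Z) (?p - ?Z)" by (simp add: det2_def algebra_simps)
      ultimately show ?thesis by simp
    qed
    have "det2 (?n - ?Z) (?p - ?Z) \<noteq> 0" using \<beta>W W0 \<beta>0[of i] by simp
    then have zn: "?Z \<noteq> ?n" "?Z \<noteq> ?p" by (auto simp: det2_def)
    have "?C * (?C * l)\<^sup>2 \<le> ?C * (norm (?p - ?n))\<^sup>2"
      using side[of i] C l0 by (intro mult_left_mono power_mono) auto
    also have "\<dots> \<le> \<bar>det2 (?n - ?Z) (?p - ?Z)\<bar>"
      using det2_ge[OF \<theta>, of ?Z ?n ?p ?p ?n] a2 e zn pn by auto
    also have "\<dots> = \<beta> i * \<bar>W\<bar>" unfolding \<beta>W using \<beta>0[of i] by (simp add: abs_mult)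
    also have "\<dots> \<le> \<beta> i * l\<^sup>2" using Wle \<beta>0[of i] by (intro mult_left_mono) auto
    finally have "?C ^ 3 * l\<^sup>2 \<le> \<beta> i * l\<^sup>2" by (simp add: power_mult_distrib power2_eq_square power3_eq_cube mult_ac)
    then show ?thesis using l0 by simp
  qed
  have \<ll>le: "norm (\<ll> i) \<le> 1 / (?C * l)" for i
  proof -
    have "norm (\<ll> i) = norm (V (pv i) - V (nx i)) / \<bar>W\<bar>" by (simp add: \<ll>_def norm_perp)
    also have "\<dots> \<le> l / (?C * l\<^sup>2)" using Vl Wge C l0 by (intro frac_le) auto
    finally show ?thesis using l0 by (simp add: power2_eq_square)
  qed
  have N: "N \<ge> 2 * \<kappa> / ?C ^ 4" "N > 0" using \<kappa> C by (auto simp: N_def intro!: add_nonneg_pos)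
  have C4: "?C ^ 4 = ?C * ?C ^ 3" "?C ^ 3 \<le> 1" using C power_le_one[of ?C 3] by (simp_all add: power_Suc[symmetric] del: power_Suc)
  have scb: "norm (\<ll> k - (\<beta> k / \<beta> i) *\<^sub>R \<ll> i) \<le> N / h" for i k
  proof -
    have "\<beta> k / \<beta> i \<le> 1 / ?C ^ 3" using \<beta>ge[of i] \<beta>le[of k] \<beta>0[of k] C by (intro frac_le) auto
    then have r: "\<bar>\<beta> k / \<beta> i\<bar> \<le> 1 / ?C ^ 3" using \<beta>0[of k] \<beta>0[of i] by simp
    have "norm (\<ll> k - (\<beta> k / \<beta> i) *\<^sub>R \<ll> i) \<le> norm (\<ll> k) + \<bar>\<beta> k / \<beta> i\<bar> * norm (\<ll> i)"
      using norm_triangle_ineq4[of "\<ll> k" "(\<beta> k / \<beta> i) *\<^sub>R \<ll> i"] by simp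
    also have "\<dots> \<le> 1 / (?C * l) + (1 / ?C ^ 3) * (1 / (?C * l))"
      using \<ll>le r C l0 by (intro add_mono mult_mono) auto
    also have "\<dots> \<le> (1 / ?C ^ 3) * (1 / (?C * l)) + (1 / ?C ^ 3) * (1 / (?C * l))"
    proof -
      have "1 \<le> 1 / ?C ^ 3" using C C4 by simp
      then have "1 * (1 / (?C * l)) \<le> (1 / ?C ^ 3) * (1 / (?C * l))" using C l0 by (intro mult_right_mono) auto
      then show ?thesis unfolding mult_1_left by (rule add_right_mono)
    qed
    also have "\<dots> = 2 / ?C ^ 4 * (1 / l)" unfolding C4(1) by simp
    also have "\<dots> \<le> 2 / ?C ^ 4 * (\<kappa> / h)"
      using hl l0 h0 C by (intro mult_left_mono) (auto simp: field_simps)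
    also have "\<dots> = (2 * \<kappa> / ?C ^ 4) / h" by simp
    also have "\<dots> \<le> N / h" using N h0 by (intro divide_right_mono) auto
    finally show ?thesis .
  qed
  \<comment> \<open>this and the bound of \<open>sc\<close> account for the value of \<open>N\<close>\<close>
  have hN: "h / N \<le> ?C * l"
  proof -
    have "\<kappa> \<le> ?C * N"
    proof -
      have "\<kappa> \<le> 2 * \<kappa> * 1" using \<kappa> by simp
      also have "\<dots> \<le> 2 * \<kappa> * (1 / ?C ^ 3)" using \<kappa> C C4 by (intro mult_left_mono) auto
      also have "\<dots> = ?C * (2 * \<kappa> / ?C ^ 4)" using C unfolding C4(1) by simp
      also have "\<dots> \<le> ?C * N" using N C by (intro mult_left_mono) auto
      finally show ?thesis .
    qed
    then have "\<kappa> * l \<le> ?C * N * l" using l0 by (intro mult_right_mono) auto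
    then have "h \<le> ?C * l * N" using hl by (simp add: mult_ac)
    then show ?thesis using N by (simp add: divide_le_eq)
  qed
  have E: "h / N \<le> norm (V k - V j)" if "j \<noteq> k" for j k
    using nx_pv_cover[OF that] side hN by (metis norm_minus_commute order_trans)
  have "shape \<theta> / (2 * \<kappa>\<^sup>2) * h\<^sup>2 \<le> shape \<theta> / (2 * \<kappa>\<^sup>2) * (\<kappa> * l)\<^sup>2"
    using hl h0 C \<kappa> by (intro mult_left_mono power_mono) auto
  also have "\<dots> \<le> \<bar>W\<bar> / 2" using Wge \<kappa> by (simp add: power_mult_distrib)
  also have "\<dots> = measure lborel (convex hull {a, b, c})"
    unfolding W_def V123 content_triangle by (simp add: det2_def algebra_simps abs_minus_commute)
  also have "\<dots> = measure lebesgue (region K \<inter> triangle K)"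
  proof -
    have "closed (convex hull {a, b, c})" using finite_imp_compact_convex_hull[of "{a, b, c}"] compact_imp_closed by auto
    moreover have "region K \<inter> triangle K = convex hull {a, b, c}" using K'(3) abc(1) by (auto simp: triangle_def)
    ultimately show ?thesis by simp
  qed
  also have "\<dots> \<le> measure lebesgue (region K)"
  proof (rule measure_mono_fmeasurable)
    have "compact (region K \<inter> triangle K)"
      unfolding triangle_def by (intro compact_Int K'(1) finite_imp_compact_convex_hull K'(6))
    then show "region K \<inter> triangle K \<in> sets lebesgue" using lmeasurable_compact fmeasurableD by blast
    show "region K \<in> lmeasurable" using K'(1) by (rule lmeasurable_compact)
  qed simp
  also have "\<dots> = measure lebesgue (interior (region K))"
  proof (rule measure_negligible_symdiff[symmetric])
    show "region K \<in> lmeasurable" using K'(1) by (rule lmeasurable_compact)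
    show "negligible (region K - interior (region K) \<union> (interior (region K) - region K))"
      by (rule negligible_subset[OF negligible_convex_frontier[OF K'(2)]])
        (use interior_subset[of "region K"] closure_subset[of "region K"] in \<open>auto simp: frontier_def\<close>)
  qed
  also have "\<dots> = measure lborel (interior (region K))" by simp
  finally have m: "shape \<theta> / (2 * \<kappa>\<^sup>2) * h\<^sup>2 \<le> measure lborel (interior (region K))" .
  show ?thesis by (rule that[OF fr inj rng scb E h0 m])
qed

section \<open>The local finite element\<close>

text \<open>At a corner the coordinate directions may leave the set, but the directions that point into a convex body span
  the plane. This gives meaning to \<^const>\<open>frechet_derivative\<close> at the vertices of a cell.\<close>

lemma has_derivative_within_unique:
  fixes f :: "pt \<Rightarrow> real"
  assumes S: "convex S" "interior S \<noteq> {}" "a \<in> S"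
    and f: "(f has_derivative f') (at a within S)" "(f has_derivative f'') (at a within S)"
  shows "f' = f''"
proof -
  define D where "D h = f' h - f'' h" for h
  have D: "((\<lambda>x. 0) has_derivative D) (at a within S)" using has_derivative_diff[OF f] by (simp add: D_def[abs_def])
  interpret D: bounded_linear D using D by (rule has_derivative_bounded_linear)
  have z: "D (y - a) = 0" if y: "y \<in> S" for y
  proof (rule ccontr)
    assume nz: "D (y - a) \<noteq> 0"
    define n where "n = norm (y - a)"
    have n: "n > 0" using nz D.zero unfolding n_def by (metis zero_less_norm_iff)
    define e where "e = \<bar>D (y - a)\<bar> / (2 * n)"
    have e: "e > 0" using n nz by (simp add: e_def)
    from D[unfolded has_derivative_within_alt] e obtain d
      where d: "d > 0" "\<forall>x\<in>S. norm (x - a) < d \<longrightarrow> norm (0 - 0 - D (x - a)) \<le> e * norm (x - a)" by blast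
    \<comment> \<open>\<open>a + t (y - a)\<close> lies in \<open>S\<close>, close enough to \<open>a\<close> for the estimate at scale \<open>d\<close>\<close>
    define t where "t = min 1 (d / (2 * n))"
    have t: "0 < t" "t \<le> 1" using d n by (auto simp: t_def)
    have "t * n \<le> (d / (2 * n)) * n" using n by (intro mult_right_mono) (auto simp: t_def)
    then have tn: "t * n < d" using d n by simp
    have "(1 - t) *\<^sub>R a + t *\<^sub>R y \<in> S" using S(1,3) y t by (intro convexD) auto
    then have "a + t *\<^sub>R (y - a) \<in> S" by (simp add: algebra_simps)
    moreover have "norm (t *\<^sub>R (y - a)) = t * n" using t by (simp add: n_def)
    ultimately have "\<bar>D (t *\<^sub>R (y - a))\<bar> \<le> e * (t * n)" using d(2) tn by (metis add_diff_cancel_left' diff_zero norm_minus_cancel real_norm_def diff_0)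
    moreover have "\<bar>D (t *\<^sub>R (y - a))\<bar> = t * \<bar>D (y - a)\<bar>" unfolding D.scaleR using t by (simp add: abs_mult)
    moreover have "e * (t * n) = t * (\<bar>D (y - a)\<bar> / 2)" using n by (simp add: e_def)
    ultimately have "t * \<bar>D (y - a)\<bar> \<le> t * (\<bar>D (y - a)\<bar> / 2)" by (simp only:)
    then show False using t nz by simp
  qed
  obtain c r where r: "r > 0" "ball c r \<subseteq> S" using S(2) by (meson ex_in_conv mem_interior)
  have "D h = 0" for h
  proof (cases "h = 0")
    case False
    define s where "s = r / (2 * norm h)"
    have s: "s > 0" using r False by (simp add: s_def)
    have "norm (s *\<^sub>R h) < r" using r False by (simp add: s_def)
    then have "c + s *\<^sub>R h \<in> S" "c \<in> S" using r by (auto simp: dist_norm subset_iff)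
    then have "D (c + s *\<^sub>R h - a) = 0" "D (c - a) = 0" using z by blast+
    then have "s * D h = 0" using D.add[of "c - a" "s *\<^sub>R h"] by (simp add: D.scaleR algebra_simps)
    then show ?thesis using s by simp
  qed (simp add: D.zero)
  then show ?thesis by (auto simp: D_def fun_eq_iff)
qed

lemma frechet_derivative_within_eq:
  fixes f :: "pt \<Rightarrow> real"
  assumes "convex S" "interior S \<noteq> {}" "a \<in> S" "(f has_derivative f') (at a within S)"
  shows "frechet_derivative f (at a within S) = f'"
proof -
  have "f differentiable (at a within S)" using assms(4) unfolding differentiable_def by blast
  then have "(f has_derivative frechet_derivative f (at a within S)) (at a within S)" by (simp only: frechet_derivative_works)
  from has_derivative_within_unique[OF assms(1-3) this assms(4)] show ?thesis .
qed

lemma side_normal: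
  assumes "a \<noteq> b"
  shows "norm (side_normal {a, b}) = 1" "side_normal {a, b} \<bullet> (b - a) = 0"
proof -
  let ?P = "\<lambda>\<nu>. norm \<nu> = 1 \<and> (\<forall>x\<in>{a, b}. \<forall>y\<in>{a, b}. \<nu> \<bullet> (x - y) = 0)"
  have 0: "perp (b - a) \<bullet> (b - a) = 0" "perp (b - a) \<bullet> (a - b) = 0" by (simp_all add: perp_inner det2_def algebra_simps)
  have "?P ((1 / norm (b - a)) *\<^sub>R perp (b - a))" using assms 0 by (simp add: norm_perp)
  then have "?P (side_normal {a, b})" unfolding side_normal_def by (rule someI)
  then show "norm (side_normal {a, b}) = 1" "side_normal {a, b} \<bullet> (b - a) = 0" by auto
qed

definition hermite :: "real \<Rightarrow> real \<Rightarrow> real \<Rightarrow> real \<Rightarrow> real \<Rightarrow> real" where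
  "hermite a b p q t = (1 - t)\<^sup>2 * (1 + 2 * t) * a + t\<^sup>2 * (3 - 2 * t) * b + t * (1 - t)\<^sup>2 * p - t\<^sup>2 * (1 - t) * q"

text \<open>Cells that share a side have the same restriction to it, because this formula depends only on the data at the end
  points.\<close>

lemma (in hct_data) hf_on_side:
  assumes jk: "j \<noteq> k" and t: "0 \<le> t" "t \<le> 1"
  shows "hf ((1 - t) *\<^sub>R V j + t *\<^sub>R V k) = hermite (hf (V j)) (hf (V k)) (g j \<bullet> (v k - v j)) (g k \<bullet> (v k - v j)) t"
proof -
  obtain i where i: "i \<noteq> j" "i \<noteq> k" "\<And>l. l = j \<or> l = k \<or> l = i" using third_index[OF jk] by metis
  let ?x = "(1 - t) *\<^sub>R V j + t *\<^sub>R V k"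
  have X: "?x - Z = (1 - t) *\<^sub>R v j + t *\<^sub>R v k" by (simp add: v_def algebra_simps)
  define \<tau> where "\<tau> l = (if l = j then 1 - t else if l = k then t else 0)" for l
  have \<tau>: "(\<lambda>l. sc i l \<bullet> (?x - Z)) = \<tau>"
    using jk unfolding X by (auto simp: inner_add_right sc_v[OF i(1)] sc_v[OF i(2)] fun_eq_iff \<tau>_def)
  have c: "?x \<in> cone i" using fun_cong[OF \<tau>] t by (auto simp: cone_def \<tau>_def)
  have S: "(\<Sum>l\<in>UNIV. F l) = F i + F j + F k" for F :: "3 \<Rightarrow> real"
  proof -
    have U: "(UNIV :: 3 set) = {i, j, k}" using i(3) by auto
    show ?thesis unfolding U using i jk by (simp add: add.assoc)
  qed
  have \<tau>v: "\<tau> i = 0" "\<tau> j = 1 - t" "\<tau> k = t" using i jk by (auto simp: \<tau>_def)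
  have "hf ?x = zz + \<gamma> j * (1 - t) + \<gamma> k * t + Q j j * (1 - t)\<^sup>2 + 2 * Q j k * (1 - t) * t + Q k k * t\<^sup>2
    + D j j * (1 - t) ^ 3 + 3 * D j k * (1 - t)\<^sup>2 * t + 3 * D k j * (1 - t) * t\<^sup>2 + D k k * t ^ 3"
    unfolding hf_eq[OF c] piece_def \<tau> Pol_def S \<tau>v Q_sym[of k j]
    by (simp add: power2_eq_square power3_eq_cube algebra_simps)
  then show ?thesis
    unfolding hf_vertex hermite_def inner_diff_right D_def Q_def M_sym[of k j]
    by (simp add: power2_eq_square power3_eq_cube field_simps)
qed

lemma (in hct_frame) piece_scale:
  assumes A: "hct_data V Z \<beta> \<ll> M"
  shows "hct_data.piece V Z \<beta> \<ll> (\<lambda>j. r *\<^sub>R g j) (\<lambda>j k. r * M j k) i x = r * hct_data.piece V Z \<beta> \<ll> g M i x"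
proof -
  interpret A: hct_data V Z \<beta> \<ll> g M by fact
  interpret C: hct_data V Z \<beta> \<ll> "\<lambda>j. r *\<^sub>R g j" "\<lambda>j k. r * M j k"
    by unfold_locales (simp add: A.M_sym)
  have ee: "C.ee j = r * A.ee j" for j
    unfolding C.ee_def A.ee_def by (simp add: sum_distrib_left mult.left_commute)
  have zz: "C.zz = r * A.zz" unfolding C.zz_def A.zz_def ee by (simp add: sum_distrib_left mult.left_commute)
  have \<gamma>: "C.\<gamma> j = r * A.\<gamma> j" for j unfolding C.\<gamma>_def A.\<gamma>_def ee zz by (simp add: algebra_simps)
  have Q: "C.Q j k = r * A.Q j k" for j k unfolding C.Q_def A.Q_def zz \<gamma> by (simp add: algebra_simps)
  have D: "C.D j k = r * A.D j k" for j k unfolding C.D_def A.D_def Q \<gamma> by (simp add: field_simps)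
  show ?thesis unfolding C.piece_def A.piece_def Pol_def zz \<gamma> Q D by (simp add: sum_3 algebra_simps)
qed

definition grad_dof :: "(dof \<Rightarrow> real) \<Rightarrow> pt \<Rightarrow> pt" where
  "grad_dof c a = c (Deriv 1 a) *\<^sub>R e1 + c (Deriv 2 a) *\<^sub>R e2"

text \<open>For degrees of freedom \<open>c\<close>, \<open>loc c\<close> is the function in the local space of \<open>K\<close> that has them, and \<open>locg c\<close> its
  gradient.\<close>

locale cell_frame = hct_frame V "centre K" \<beta> \<ll> for K :: cell and V and \<beta> and \<ll> +
  assumes range_V: "range V = verts K" and inj_V: "inj V"
    and K_convex: "convex (region K)" and K_interior: "interior (region K) \<noteq> {}" and K_verts: "verts K \<subseteq> region K"
begin

definition nrm :: "3 \<Rightarrow> 3 \<Rightarrow> pt" where "nrm j k = side_normal {V j, V k}"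
definition fd :: "(dof \<Rightarrow> real) \<Rightarrow> 3 \<Rightarrow> real" where "fd c j = c (Val (V j))"
definition gd :: "(dof \<Rightarrow> real) \<Rightarrow> 3 \<Rightarrow> pt" where "gd c j = grad_dof c (V j)"
definition nd :: "(dof \<Rightarrow> real) \<Rightarrow> 3 \<Rightarrow> 3 \<Rightarrow> real" where "nd c j k = c (Normal {V j, V k})"
definition Md :: "(dof \<Rightarrow> real) \<Rightarrow> 3 \<Rightarrow> 3 \<Rightarrow> real" where "Md c = MM nrm (fd c) (gd c) (nd c)"

definition loc :: "(dof \<Rightarrow> real) \<Rightarrow> pt \<Rightarrow> real" where "loc c = hct_data.hf V (centre K) \<beta> \<ll> (gd c) (Md c)"
definition locg :: "(dof \<Rightarrow> real) \<Rightarrow> pt \<Rightarrow> pt" where "locg c = hct_data.hg V (centre K) \<beta> \<ll> (gd c) (Md c)"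

lemma nrm_sym: "nrm j k = nrm k j" by (simp add: nrm_def insert_commute)
lemma nd_sym: "nd c j k = nd c k j" by (simp add: nd_def insert_commute)

lemma loc_data: "hct_data V (centre K) \<beta> \<ll> (Md c)"
  by unfold_locales (auto simp: Md_def intro!: MM_sym nrm_sym nd_sym)

lemma V_neq: "j \<noteq> k \<Longrightarrow> V j \<noteq> V k" using inj_V by (auto dest: injD)

lemma V_diff: "v k - v j = V k - V j" by (simp add: v_def)

lemma nrm: "j \<noteq> k \<Longrightarrow> norm (nrm j k) = 1" "j \<noteq> k \<Longrightarrow> nrm j k \<bullet> (v k - v j) = 0"
  unfolding nrm_def V_diff using side_normal[OF V_neq] by blast+

lemma V_region: "V j \<in> region K" using range_V K_verts by auto

lemma vertex_index:
  assumes "a \<in> verts K"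
  obtains j where "a = V j"
  using assms range_V by auto

lemma side_indices:
  assumes "e \<in> sides K"
  obtains j k where "j \<noteq> k" "e = {V j, V k}"
proof -
  obtain a b where ab: "e = {a, b}" "a \<noteq> b" using assms by (auto simp: sides_def card_2_iff)
  then have "a \<in> verts K" "b \<in> verts K" using assms by (auto simp: sides_def)
  then obtain j k where "a = V j" "b = V k" by (metis vertex_index)
  then show ?thesis using that[of j k] ab by auto
qed

lemma side_V: "j \<noteq> k \<Longrightarrow> {V j, V k} \<in> sides K" using V_neq range_V by (auto simp: sides_def)

lemma midpt_V: "j \<noteq> k \<Longrightarrow> midpt {V j, V k} = (1/2) *\<^sub>R (V j + V k)"
  using V_neq by (simp add: midpt_def)

lemma midpoint_region: "(1/2) *\<^sub>R (V j + V k) \<in> region K"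
  using convexD[OF K_convex V_region[of j] V_region[of k], of "1/2" "1/2"] by (simp add: scaleR_add_right)

lemma loc_has_derivative: "(loc c has_derivative (\<lambda>h. locg c x \<bullet> h)) (at x within S)"
  unfolding loc_def locg_def by (rule has_derivative_at_withinI, rule hct_data.hf_has_derivative, rule loc_data)

lemma agree_has_derivative:
  assumes "\<And>x. x \<in> region K \<Longrightarrow> f x = loc c x" "x \<in> region K"
  shows "(f has_derivative (\<lambda>h. locg c x \<bullet> h)) (at x within region K)"
  using assms(2,1) loc_has_derivative by (rule has_derivative_transform)

lemma agree_frechet:
  assumes "\<And>x. x \<in> region K \<Longrightarrow> f x = loc c x" "x \<in> region K"
  shows "frechet_derivative f (at x within region K) = (\<lambda>h. locg c x \<bullet> h)"
  by (rule frechet_derivative_within_eq[OF K_convex K_interior assms(2) agree_has_derivative[OF assms]])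

lemma loc_vertex: "loc c (V j) = c (Val (V j))"
proof -
  interpret H: hct_data V "centre K" \<beta> \<ll> "gd c" "Md c" by (rule loc_data)
  show ?thesis unfolding loc_def H.hf_vertex by (simp add: Md_def MM_def fd_def)
qed

lemma grad_dof_nth: "grad_dof c a $ i = c (Deriv i a)"
  using exhaust_2[of i] by (auto simp: grad_dof_def axis_def)

text \<open>Local basis functions are obtained by gluing, so the degrees of freedom are computed for functions that agree
  with \<open>loc c\<close> only on the cell.\<close>

lemma agree_dof_value:
  assumes f: "\<And>x. x \<in> region K \<Longrightarrow> f x = loc c x" and "d \<in> dofs K"
  shows "dof_value K f d = c d"
proof -
  interpret H: hct_data V "centre K" \<beta> \<ll> "gd c" "Md c" by (rule loc_data)
  consider (V) j where "d = Val (V j)" | (D) i j where "d = Deriv i (V j)" | (N) j k where "j \<noteq> k" "d = Normal {V j, V k}"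
    using assms(2) unfolding dofs_def by (auto elim!: vertex_index side_indices)
  then show ?thesis
  proof cases
    case V
    then show ?thesis by (simp add: f[OF V_region] loc_vertex)
  next
    case D
    then show ?thesis
      by (simp add: agree_frechet[OF f V_region] locg_def H.hg_vertex gd_def inner_axis grad_dof_nth)
  next
    case N
    have "locg c ((1/2) *\<^sub>R (V j + V k)) \<bullet> nrm j k = nd c j k"
      unfolding locg_def Md_def by (rule hct_normal[OF nrm loc_data[unfolded Md_def] N(1)])
    moreover have "frechet_derivative f (at ((1/2) *\<^sub>R (V j + V k)) within region K) = (\<lambda>h. locg c ((1/2) *\<^sub>R (V j + V k)) \<bullet> h)"
      by (rule agree_frechet[OF f midpoint_region])
    ultimately show ?thesis using N(1) by (simp add: N(2) midpt_V nrm_def nd_def)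
  qed
qed

lemma subcell_in_cone:
  assumes "i \<noteq> j" "i \<noteq> k" "j \<noteq> k"
  shows "subcell K {V j, V k} \<subseteq> cone i"
proof
  fix x assume "x \<in> subcell K {V j, V k}"
  then obtain s where s: "\<forall>a\<in>{V j, V k}. 0 \<le> s a" and x: "x = centre K + (\<Sum>a\<in>{V j, V k}. s a *\<^sub>R (a - centre K))"
    by (auto simp: subcell_def)
  have X: "x - centre K = s (V j) *\<^sub>R v j + s (V k) *\<^sub>R v k" using V_neq[OF assms(3)] by (simp add: x v_def)
  have "0 \<le> sc i l \<bullet> (x - centre K)" for l
    unfolding X inner_add_right using s sc_v[OF assms(1)] sc_v[OF assms(2)] by simp
  then show "x \<in> cone i" by (simp add: cone_def)
qed

lemma side_cone:
  assumes "e \<in> sides K"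
  obtains i where "subcell K e \<subseteq> cone i"
proof -
  obtain j k where "j \<noteq> k" "e = {V j, V k}" using side_indices[OF assms] .
  moreover obtain i where "i \<noteq> j" "i \<noteq> k" using third_index[OF \<open>j \<noteq> k\<close>] by metis
  ultimately show ?thesis using that subcell_in_cone by metis
qed

lemma agree_HCT:
  assumes f: "\<And>x. x \<in> region K \<Longrightarrow> f x = loc c x"
  shows "f \<in> HCT K"
proof -
  interpret H: hct_data V "centre K" \<beta> \<ll> "gd c" "Md c" by (rule loc_data)
  have "continuous_on (region K) (locg c)" unfolding locg_def by (rule H.hg_continuous)
  then have "C1_on (region K) f" unfolding C1_on_def using agree_has_derivative[OF f] by blast
  moreover have "P3_on (subcell K e) f" if e: "e \<in> sides K" for e
  proof -
    obtain i where i: "subcell K e \<subseteq> cone i" using side_cone[OF e] .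
    have "f x = H.piece i x" if "x \<in> subcell K e" for x
    proof -
      have "x \<in> region K" "x \<in> cone i" using that i by (auto simp: subcell_def)
      then show ?thesis using f[of x] H.hf_eq[of x i] by (simp add: loc_def)
    qed
    moreover have "P3_on (subcell K e) (H.piece i)" unfolding H.piece_eq_cub by (rule cub_P3[OF H.deg_le_co])
    ultimately show ?thesis by (simp add: P3_on_def)
  qed
  ultimately show ?thesis by (simp add: HCT_def)
qed

lemma loc_on_side:
  assumes ab: "a \<in> verts K" "b \<in> verts K" "a \<noteq> b" and t: "0 \<le> t" "t \<le> 1"
  shows "loc c ((1 - t) *\<^sub>R a + t *\<^sub>R b) = hermite (c (Val a)) (c (Val b)) (grad_dof c a \<bullet> (b - a)) (grad_dof c b \<bullet> (b - a)) t"
proof -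
  interpret H: hct_data V "centre K" \<beta> \<ll> "gd c" "Md c" by (rule loc_data)
  obtain j k where jk: "a = V j" "b = V k" using ab by (metis vertex_index)
  then have "j \<noteq> k" using ab by auto
  from H.hf_on_side[OF this t] show ?thesis
    unfolding loc_def[symmetric] loc_vertex jk gd_def V_diff .
qed

lemma dofs_V: "Val (V j) \<in> dofs K" "Deriv i (V j) \<in> dofs K" "j \<noteq> k \<Longrightarrow> Normal {V j, V k} \<in> dofs K"
  using range_V side_V by (auto simp: dofs_def)

text \<open>In particular \<open>loc c\<close> vanishes if \<open>c\<close> is supported at nodes of other cells.\<close>

lemma loc_cong:
  assumes "\<And>d. d \<in> dofs K \<Longrightarrow> c d = c' d"
  shows "loc c = loc c'"
proof -
  have f: "fd c = fd c'" and g: "gd c = gd c'"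
    using assms dofs_V by (auto simp: fd_def gd_def grad_dof_def fun_eq_iff)
  have n: "nd c j k = nd c' j k" if "j \<noteq> k" for j k using assms dofs_V(3)[OF that] by (simp add: nd_def)
  have "Md c = Md c'" unfolding Md_def f g using n by (intro ext) (simp add: MM_def RR_def)
  then show ?thesis unfolding loc_def g by simp
qed

lemma loc_piece: "loc c x = hct_data.piece V (centre K) \<beta> \<ll> (gd c) (Md c) (idx x) x"
proof -
  interpret H: hct_data V "centre K" \<beta> \<ll> "gd c" "Md c" by (rule loc_data)
  show ?thesis unfolding loc_def H.hf_def ..
qed

lemma loc_add: "loc (\<lambda>d. c d + c' d) x = loc c x + loc c' x"
proof -
  have g: "gd (\<lambda>d. c d + c' d) = (\<lambda>j. gd c j + gd c' j)" by (auto simp: gd_def grad_dof_def algebra_simps)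
  have "Md (\<lambda>d. c d + c' d) = (\<lambda>j k. Md c j k + Md c' j k)"
    using MM_linear[of nrm 1 "fd c" 1 "fd c'" "gd c" "gd c'" "nd c" "nd c'"] unfolding Md_def g
    by (simp add: fd_def[abs_def] nd_def[abs_def] fun_eq_iff)
  then show ?thesis unfolding loc_piece g using piece_add[OF loc_data loc_data] by simp
qed

lemma loc_scale: "loc (\<lambda>d. r * c d) x = r * loc c x"
proof -
  have g: "gd (\<lambda>d. r * c d) = (\<lambda>j. r *\<^sub>R gd c j)" by (auto simp: gd_def grad_dof_def algebra_simps)
  have "Md (\<lambda>d. r * c d) = (\<lambda>j k. r * Md c j k)"
    using MM_linear[of nrm r "fd c" 0 "fd c" "gd c" "gd c" "nd c" "nd c"] unfolding Md_def g
    by (simp add: fd_def[abs_def] nd_def[abs_def] fun_eq_iff)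
  then show ?thesis unfolding loc_piece g using piece_scale[OF loc_data] by simp
qed

lemma loc_sum:
  assumes "finite S"
  shows "loc (\<lambda>d. \<Sum>s\<in>S. r s * c s d) x = (\<Sum>s\<in>S. r s * loc (c s) x)"
  using assms
proof (induction S)
  case empty
  have "loc (\<lambda>d. 0) x = 0" using loc_scale[of 0 "\<lambda>d. 0" x] by simp
  then show ?case by simp
qed (simp add: loc_add loc_scale)

end

section \<open>Gluing the local elements\<close>

text \<open>Near a relatively inner point of a side of a triangle, the points on the side of the third vertex belong to the
  triangle.\<close>

lemma half_disc:
  assumes W0: "det2 (b - a) (p - a) \<noteq> 0" and t: "0 < t" "t < 1"
  obtains U where "open U" "(1 - t) *\<^sub>R a + t *\<^sub>R b \<in> U"
    "\<And>y. y \<in> U \<Longrightarrow> det2 (b - a) (y - a) * det2 (b - a) (p - a) \<ge> 0 \<Longrightarrow> y \<in> convex hull {a, b, p}"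
proof -
  define W where "W = det2 (b - a) (p - a)"
  have W: "W \<noteq> 0" using W0 by (simp add: W_def)
  \<comment> \<open>the barycentric coordinates of \<open>y\<close> at \<open>p\<close> and \<open>b\<close>\<close>
  define \<gamma> where "\<gamma> y = det2 (b - a) (y - a) / W" for y
  define \<beta> where "\<beta> y = det2 (y - a) (p - a) / W" for y
  define U where "U = {y. 0 < \<beta> y} \<inter> {y. 0 < 1 - \<beta> y - \<gamma> y}"
  have U: "open U"
    unfolding U_def \<beta>_def \<gamma>_def det2_def using W by (intro open_Int open_Collect_less continuous_intros) auto
  let ?x = "(1 - t) *\<^sub>R a + t *\<^sub>R b"
  have xa: "?x - a = t *\<^sub>R (b - a)" by (simp add: algebra_simps)
  have "\<gamma> ?x = 0" unfolding \<gamma>_def xa by (simp add: det2_def)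
  moreover have "\<beta> ?x = t"
  proof -
    have "det2 (t *\<^sub>R (b - a)) (p - a) = t * W" by (simp add: det2_def W_def algebra_simps)
    then show ?thesis unfolding \<beta>_def xa using W by simp
  qed
  ultimately have x: "?x \<in> U" using t by (simp add: U_def)
  have "y \<in> convex hull {a, b, p}" if y: "y \<in> U" "det2 (b - a) (y - a) * det2 (b - a) (p - a) \<ge> 0" for y
  proof -
    have "\<gamma> y = det2 (b - a) (y - a) * W / W\<^sup>2" using W by (simp add: \<gamma>_def power2_eq_square)
    then have g: "\<gamma> y \<ge> 0" using y(2) by (simp add: W_def)
    have "W *\<^sub>R (y - a) = det2 (y - a) (p - a) *\<^sub>R (b - a) + det2 (b - a) (y - a) *\<^sub>R (p - a)"
      by (simp add: vec_eq_iff forall_2 W_def det2_def algebra_simps)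
    then have "(1 / W) *\<^sub>R (W *\<^sub>R (y - a)) = \<beta> y *\<^sub>R (b - a) + \<gamma> y *\<^sub>R (p - a)"
      by (simp add: scaleR_add_right \<beta>_def \<gamma>_def)
    then have "y - a = \<beta> y *\<^sub>R (b - a) + \<gamma> y *\<^sub>R (p - a)" using W by simp
    then have "y = (1 - \<beta> y - \<gamma> y) *\<^sub>R a + \<beta> y *\<^sub>R b + \<gamma> y *\<^sub>R p" by (simp add: algebra_simps)
    moreover have "0 \<le> 1 - \<beta> y - \<gamma> y" "0 \<le> \<beta> y" using y(1) by (auto simp: U_def)
    ultimately show ?thesis
      unfolding convex_hull_3 using g by (intro CollectI exI[of _ "1 - \<beta> y - \<gamma> y"] exI[of _ "\<beta> y"] exI[of _ "\<gamma> y"]) auto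
  qed
  then show ?thesis using that U x by blast
qed

lemma (in cell_frame) opposite_vertex:
  assumes "a \<in> verts K" "b \<in> verts K" "a \<noteq> b"
  obtains p where "verts K = {a, b, p}" "det2 (b - a) (p - a) \<noteq> 0"
proof -
  obtain j k where jk: "a = V j" "b = V k" using assms by (metis vertex_index)
  then have ne: "j \<noteq> k" using assms by auto
  obtain i where i: "i \<noteq> j" "i \<noteq> k" "\<And>l. l = j \<or> l = k \<or> l = i" using third_index[OF ne] by metis
  have U: "(UNIV :: 3 set) = {j, k, i}" using i(3) by auto
  have vs: "verts K = {a, b, V i}" using range_V unfolding U by (simp add: jk)
  let ?E = "b - a" and ?F = "V i - a"
  have "\<ll> i \<bullet> (V k - centre K) = - \<beta> i" "\<ll> i \<bullet> (V j - centre K) = - \<beta> i" "\<ll> i \<bullet> (V i - centre K) = 1 - \<beta> i"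
    using i by (simp_all only: dual) simp_all
  then have l: "\<ll> i \<bullet> ?E = 0" "\<ll> i \<bullet> ?F = 1" unfolding jk inner_diff_right by linarith+
  have "?E = (\<ll> i \<bullet> ?F) *\<^sub>R ?E - (\<ll> i \<bullet> ?E) *\<^sub>R ?F" using l by simp
  also have "\<dots> = det2 ?E ?F *\<^sub>R (\<chi> m. if m = 1 then \<ll> i $ 2 else - \<ll> i $ 1)"
    by (simp add: vec_eq_iff forall_2 det2_def inner_vec_def sum_2 algebra_simps)
  finally have "det2 ?E ?F \<noteq> 0" using assms(3) by auto
  then show ?thesis using that vs by blast
qed

lemma is_cell_verts_region: "is_cell \<Omega> K \<Longrightarrow> verts K = {a, b, p} \<Longrightarrow> convex hull {a, b, p} \<subseteq> region K"
  using is_cellD(3)[of \<Omega> K] by (simp add: triangle_def)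

text \<open>If the third vertices were on the same side, the interiors would meet. So the two half discs lie on different
  sides and form a neighbourhood.\<close>

lemma common_side_interior:
  assumes tri: "hct_triangulation \<Omega> \<T>" and KL: "K \<in> \<T>" "L \<in> \<T>" "K \<noteq> L"
    and a: "a \<in> verts K" "a \<in> verts L" and b: "b \<in> verts K" "b \<in> verts L" and ab: "a \<noteq> b"
    and FK: "cell_frame K V \<beta> \<ll>" and FL: "cell_frame L V' \<beta>' \<ll>'" and t: "0 < t" "t < 1"
  shows "(1 - t) *\<^sub>R a + t *\<^sub>R b \<in> \<Omega>"
proof -
  let ?x = "(1 - t) *\<^sub>R a + t *\<^sub>R b"
  have cells: "is_cell \<Omega> K" "is_cell \<Omega> L" and \<Omega>: "\<Omega> = interior (\<Union>K\<in>\<T>. region K)"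
    and dj: "cell_interior K \<inter> cell_interior L = {}"
    using tri KL by (auto simp: hct_triangulation_def)
  obtain p where p: "verts K = {a, b, p}" "det2 (b - a) (p - a) \<noteq> 0"
    using cell_frame.opposite_vertex[OF FK a(1) b(1) ab] .
  obtain q where q: "verts L = {a, b, q}" "det2 (b - a) (q - a) \<noteq> 0"
    using cell_frame.opposite_vertex[OF FL a(2) b(2) ab] .
  obtain U where U: "open U" "?x \<in> U"
    "\<And>y. y \<in> U \<Longrightarrow> det2 (b - a) (y - a) * det2 (b - a) (p - a) \<ge> 0 \<Longrightarrow> y \<in> convex hull {a, b, p}"
  proof (rule half_disc[OF p(2) t])
    fix U assume "open U" "?x \<in> U"
      "\<And>y. y \<in> U \<Longrightarrow> det2 (b - a) (y - a) * det2 (b - a) (p - a) \<ge> 0 \<Longrightarrow> y \<in> convex hull {a, b, p}"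
    then show thesis by (rule that)
  qed
  obtain U' where U': "open U'" "?x \<in> U'"
    "\<And>y. y \<in> U' \<Longrightarrow> det2 (b - a) (y - a) * det2 (b - a) (q - a) \<ge> 0 \<Longrightarrow> y \<in> convex hull {a, b, q}"
  proof (rule half_disc[OF q(2) t])
    fix U assume "open U" "?x \<in> U"
      "\<And>y. y \<in> U \<Longrightarrow> det2 (b - a) (y - a) * det2 (b - a) (q - a) \<ge> 0 \<Longrightarrow> y \<in> convex hull {a, b, q}"
    then show thesis by (rule that)
  qed
  note hull = subsetD[OF is_cell_verts_region[OF cells(1) p(1)]] subsetD[OF is_cell_verts_region[OF cells(2) q(1)]]
  let ?W = "det2 (b - a) (p - a)" and ?W' = "det2 (b - a) (q - a)"
  define N where "N = U \<inter> U'"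
  have N: "open N" "?x \<in> N" using U U' by (auto simp: N_def)
  have opposite: "?W * ?W' < 0"
  proof (rule ccontr)
    assume "\<not> ?W * ?W' < 0"
    then have same: "?W * ?W' > 0" using p(2) q(2) by (simp add: not_less less_le)
    define S where "S = N \<inter> {y. 0 < det2 (b - a) (y - a) * ?W}"
    have S: "open S" unfolding S_def det2_def by (intro open_Int N open_Collect_less continuous_intros)
    have "S \<subseteq> region K" using U(3)[THEN hull(1)] by (auto simp: S_def N_def)
    moreover have "S \<subseteq> region L"
    proof
      fix y assume y: "y \<in> S"
      then have "0 < det2 (b - a) (y - a) * ?W" by (simp add: S_def)
      then have "det2 (b - a) (y - a) * ?W' \<ge> 0" using same by (auto simp: zero_less_mult_iff zero_le_mult_iff)
      then show "y \<in> region L" using U'(3)[THEN hull(2)] y by (auto simp: S_def N_def)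
    qed
    ultimately have sub: "S \<subseteq> cell_interior K \<inter> cell_interior L" using S by (simp add: interior_maximal)
    obtain e where e: "e > 0" "ball ?x e \<subseteq> N" using N by (meson openE)
    have pa: "p \<noteq> a" using p(2) by (auto simp: det2_def)
    define s where "s = e / (2 * norm (p - a))"
    have s: "s > 0" using e pa by (simp add: s_def)
    have "norm (s *\<^sub>R (p - a)) < e" using e pa by (simp add: s_def)
    then have "?x + s *\<^sub>R (p - a) \<in> N" using e(2) by (auto simp: dist_norm subset_iff)
    moreover have "det2 (b - a) (?x + s *\<^sub>R (p - a) - a) = s * ?W" by (simp add: det2_def algebra_simps)
    moreover have "0 < s * ?W * ?W"
    proof -
      have "0 < ?W * ?W" using p(2) by (auto simp: zero_less_mult_iff linorder_neq_iff)
      then show ?thesis using s by (simp only: mult.assoc zero_less_mult_iff simp_thms)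
    qed
    ultimately have "?x + s *\<^sub>R (p - a) \<in> S" unfolding S_def by simp
    then show False using dj sub by auto
  qed
  have "N \<subseteq> (\<Union>K\<in>\<T>. region K)"
  proof
    fix y assume y: "y \<in> N"
    let ?s = "det2 (b - a) (y - a)"
    have "?s * ?W \<ge> 0 \<or> ?s * ?W' \<ge> 0" using opposite by (auto simp: mult_less_0_iff zero_le_mult_iff)
    then have "y \<in> region K \<or> y \<in> region L" using y U(3)[THEN hull(1)] U'(3)[THEN hull(2)] by (auto simp: N_def)
    then show "y \<in> (\<Union>K\<in>\<T>. region K)" using KL by auto
  qed
  then show ?thesis unfolding \<Omega> using N by (meson interior_maximal subsetD)
qed

lemma loc_consistent:
  assumes tri: "hct_triangulation \<Omega> \<T>" and KL: "K \<in> \<T>" "L \<in> \<T>" "K \<noteq> L" and x: "x \<in> region K" "x \<in> region L"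
    and FK: "cell_frame K V \<beta> \<ll>" and FL: "cell_frame L V' \<beta>' \<ll>'"
  shows "cell_frame.loc K V \<beta> \<ll> c x = cell_frame.loc L V' \<beta>' \<ll>' c x"
proof -
  interpret K: cell_frame K V \<beta> \<ll> by (rule FK)
  interpret L: cell_frame L V' \<beta>' \<ll>' by (rule FL)
  have cells: "is_cell \<Omega> K" "is_cell \<Omega> L"
    and dj: "cell_interior K \<inter> cell_interior L = {}" and int: "region K \<inter> region L = convex hull (verts K \<inter> verts L)"
    using tri KL by (auto simp: hct_triangulation_def)
  let ?I = "verts K \<inter> verts L"
  have fin: "finite (verts K)" "card (verts K) = 3" using is_cellD(6)[OF cells(1)] cells by (auto simp: is_cell_def)
  have "card ?I \<noteq> 3"
  proof
    assume "card ?I = 3"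
    then have "?I = verts K" using fin by (intro card_subset_eq) auto
    then have "triangle K = region K \<inter> region L" using int by (simp add: triangle_def)
    then have "interior (triangle K) = {}" using dj by (simp add: interior_Int)
    then show False using is_cellD(4)[OF cells(1)] by simp
  qed
  moreover have "card ?I \<le> 3" using card_mono[OF fin(1), of ?I] fin(2) by simp
  ultimately consider "card ?I = 0" | "card ?I = 1" | "card ?I = 2" by linarith
  then show ?thesis
  proof cases
    case 1
    then have "?I = {}" using fin by simp
    then show ?thesis using int x by auto
  next
    case 2
    then obtain a where a: "?I = {a}" by (auto simp: card_1_singleton_iff)
    then have "x = a" using int x by auto
    moreover obtain j k where "a = V j" "a = V' k" using a by (metis Int_iff K.vertex_index L.vertex_index insertI1)
    ultimately show ?thesis using K.loc_vertex[of c j] L.loc_vertex[of c k] by simp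
  next
    case 3
    then obtain a b where ab: "?I = {a, b}" "a \<noteq> b" by (auto simp: card_2_iff)
    then have "x \<in> closed_segment a b" using int x by (auto simp: segment_convex_hull)
    then obtain t where t: "x = (1 - t) *\<^sub>R a + t *\<^sub>R b" "0 \<le> t" "t \<le> 1" by (auto simp: in_segment)
    have "a \<in> verts K" "b \<in> verts K" "a \<in> verts L" "b \<in> verts L" using ab by auto
    then show ?thesis unfolding t(1) using ab(2) t(2,3) by (simp add: K.loc_on_side L.loc_on_side)
  qed
qed

lemma finite_dofs: "is_cell \<Omega> K \<Longrightarrow> finite (dofs K)"
proof -
  assume "is_cell \<Omega> K"
  then have f: "finite (verts K)" by (rule is_cellD(6))
  have "{Deriv i a | i a. a \<in> verts K} = (\<lambda>(i, a). Deriv i a) ` (UNIV \<times> verts K)" by auto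
  moreover have "finite (sides K)" by (rule finite_subset[of _ "Pow (verts K)"]) (auto simp: sides_def f)
  ultimately show ?thesis using f by (simp add: dofs_def)
qed

text \<open>By \<open>loc_consistent\<close> the local functions with the degrees of freedom of a Kronecker delta glue to the global basis
  functions; linearity of \<open>loc\<close> identifies their combinations.\<close>

lemma nodal_interpolant_global:
  assumes tri: "hct_triangulation \<Omega> \<T>" and F: "\<And>K. K \<in> \<T> \<Longrightarrow> cell_frame K (VV K) (BB K) (LL K)"
  obtains v where "v \<in> HCT_global \<T>" "\<And>K x. K \<in> \<T> \<Longrightarrow> x \<in> region K \<Longrightarrow> v x = cell_frame.loc K (VV K) (BB K) (LL K) c x"
proof -
  define lc where "lc K = cell_frame.loc K (VV K) (BB K) (LL K)" for K
  define \<delta> :: "dof \<Rightarrow> dof \<Rightarrow> real" where "\<delta> d d' = (if d' = d then 1 else 0)" for d d'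
  define \<Phi> where "\<Phi> d x = (if \<exists>K\<in>\<T>. x \<in> region K then lc (SOME K. K \<in> \<T> \<and> x \<in> region K) (\<delta> d) x else 0)" for d x
  have fin: "finite \<T>" and cells: "\<And>K. K \<in> \<T> \<Longrightarrow> is_cell \<Omega> K" using tri by (auto simp: hct_triangulation_def)
  have \<Phi>K: "\<Phi> d x = lc K (\<delta> d) x" if K: "K \<in> \<T>" "x \<in> region K" for d x K
  proof -
    let ?L = "SOME K. K \<in> \<T> \<and> x \<in> region K"
    have L: "?L \<in> \<T> \<and> x \<in> region ?L" by (rule someI[of _ K]) (use K in simp)
    have "lc ?L (\<delta> d) x = lc K (\<delta> d) x"
    proof (cases "?L = K")
      case False
      then show ?thesis unfolding lc_def using L K by (intro loc_consistent[OF tri] F) auto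
    qed simp
    then show ?thesis using K by (auto simp: \<Phi>_def)
  qed
  have basis: "global_basis_fun \<T> d (\<Phi> d)" for d
    unfolding global_basis_fun_def
  proof (intro conjI ballI allI impI)
    fix K assume K: "K \<in> \<T>"
    interpret cell_frame K "VV K" "BB K" "LL K" by (rule F[OF K])
    have eq: "\<And>x. x \<in> region K \<Longrightarrow> \<Phi> d x = loc (\<delta> d) x" using \<Phi>K[OF K] by (simp add: lc_def)
    show "if d \<in> dofs K then dual_basis_fun K d (\<Phi> d) else \<forall>x\<in>region K. \<Phi> d x = 0"
    proof (cases "d \<in> dofs K")
      case True
      then show ?thesis using agree_HCT[OF eq] agree_dof_value[OF eq] by (simp add: dual_basis_fun_def \<delta>_def)
    next
      case False
      have "loc (\<delta> d) = loc (\<lambda>d'. 0 * \<delta> d d')" using False by (intro loc_cong) (auto simp: \<delta>_def)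
      then have "loc (\<delta> d) x = 0" for x using loc_scale[of 0 "\<delta> d" x] by simp
      then show ?thesis using False eq by simp
    qed
  qed (auto simp: \<Phi>_def)
  define w where "w x = (\<Sum>d\<in>global_dofs \<T>. c d * \<Phi> d x)" for x
  have "w \<in> HCT_global \<T>" unfolding HCT_global_def w_def[abs_def] using basis by blast
  moreover have "w x = lc K c x" if K: "K \<in> \<T>" "x \<in> region K" for K x
  proof -
    interpret cell_frame K "VV K" "BB K" "LL K" by (rule F[OF K(1)])
    have fg: "finite (global_dofs \<T>)" using fin cells finite_dofs by (auto simp: global_dofs_def)
    have "w x = (\<Sum>d\<in>global_dofs \<T>. c d * loc (\<delta> d) x)" unfolding w_def using \<Phi>K[OF K] by (simp add: lc_def)
    also have "\<dots> = loc (\<lambda>d'. \<Sum>d\<in>global_dofs \<T>. c d * \<delta> d d') x" by (rule loc_sum[OF fg, symmetric])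
    also have "loc (\<lambda>d'. \<Sum>d\<in>global_dofs \<T>. c d * \<delta> d d') = loc c"
    proof (rule loc_cong)
      fix d' assume "d' \<in> dofs K"
      then have "d' \<in> global_dofs \<T>" using K by (auto simp: global_dofs_def)
      then show "(\<Sum>d\<in>global_dofs \<T>. c d * \<delta> d d') = c d'" using fg by (simp add: \<delta>_def if_distrib[of "(*) _"] cong: if_cong)
    qed
    finally show ?thesis by (simp add: lc_def)
  qed
  ultimately show ?thesis using that by (simp add: lc_def)
qed

section \<open>The degrees of freedom of a broken Sobolev function\<close>

lemma continuous_agree_closure:
  fixes f f' :: "pt \<Rightarrow> 'a::t2_space"
  assumes f: "continuous_on (closure D) f" and f': "isCont f' x" and eq: "\<And>y. y \<in> D \<Longrightarrow> f y = f' y" and x: "x \<in> closure D"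
  shows "f x = f' x"
proof -
  obtain s where s: "\<And>n. s n \<in> D" "s \<longlonglongrightarrow> x" using x by (auto simp: closure_sequential)
  have "(\<lambda>n. f (s n)) \<longlonglongrightarrow> f x"
    using s closure_subset by (intro continuous_on_tendsto_compose[OF f s(2) x] always_eventually) auto
  moreover have "(\<lambda>n. f' (s n)) \<longlonglongrightarrow> f' x" using f' s(2) by (rule isCont_tendsto_compose)
  ultimately show ?thesis using s(1) eq LIMSEQ_unique by simp
qed

text \<open>The extensions \<open>U K\<close> and \<open>G K\<close> agree with \<open>u\<close> and \<open>g\<close> at points of \<open>\<Omega>\<close>, in particular along the relative interior
  of common sides, hence by continuity at their end points. A chain of adjacent cells transports this around a
  vertex.\<close>

lemma nodal_values:
  assumes tri: "hct_triangulation \<Omega> \<T>" and F: "\<And>K. K \<in> \<T> \<Longrightarrow> cell_frame K (VV K) (BB K) (LL K)"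
    and u: "\<And>x. x \<in> \<Omega> \<Longrightarrow> isCont u x" and g: "\<And>x. x \<in> \<Omega> \<Longrightarrow> isCont g x"
    and Uc: "\<And>K. K \<in> \<T> \<Longrightarrow> continuous_on (region K) (U K)" and Gc: "\<And>K. K \<in> \<T> \<Longrightarrow> continuous_on (region K) (G K)"
    and Ue: "\<And>K x. K \<in> \<T> \<Longrightarrow> x \<in> cell_interior K \<Longrightarrow> U K x = u x" and Ge: "\<And>K x. K \<in> \<T> \<Longrightarrow> x \<in> cell_interior K \<Longrightarrow> G K x = g x"
  obtains c where "\<And>K a. K \<in> \<T> \<Longrightarrow> a \<in> verts K \<Longrightarrow> c (Val a) = U K a" "\<And>K a. K \<in> \<T> \<Longrightarrow> a \<in> verts K \<Longrightarrow> grad_dof c a = (G K a :: pt)"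
    "\<And>K e. K \<in> \<T> \<Longrightarrow> e \<in> sides K \<Longrightarrow> c (Normal e) = G K (midpt e) \<bullet> side_normal e"
proof -
  have cells: "\<And>K. K \<in> \<T> \<Longrightarrow> is_cell \<Omega> K" using tri by (auto simp: hct_triangulation_def)
  have cl: "closure (cell_interior K) = region K" if "K \<in> \<T>" for K
    using is_cellD[OF cells[OF that]] convex_closure_interior[of "region K"] compact_imp_closed closure_closed by metis
  have inside: "U K x = u x" "G K x = g x" if K: "K \<in> \<T>" "x \<in> region K" "x \<in> \<Omega>" for K x
    using continuous_agree_closure[where D = "cell_interior K" and f = "U K" and f' = u and x = x]
      continuous_agree_closure[where D = "cell_interior K" and f = "G K" and f' = g and x = x]
      cl[OF K(1)] Uc[OF K(1)] Gc[OF K(1)] Ue[OF K(1)] Ge[OF K(1)] K u g by auto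
  have across: "U K a = U L a \<and> G K a = G L a"
    if KL: "K \<in> \<T>" "L \<in> \<T>" "K \<noteq> L" and a: "a \<in> verts K" "a \<in> verts L" and b: "b \<in> verts K" "b \<in> verts L" and ab: "a \<noteq> b" for K L a b
  proof -
    \<comment> \<open>relatively inner points of the side that tend to \<open>a\<close>\<close>
    define s where "s n = inverse (real (Suc (Suc n)))" for n
    have s: "0 < s n" "s n < 1" for n by (auto simp: s_def inverse_less_1_iff)
    have s0: "s \<longlonglongrightarrow> 0" unfolding s_def by (rule LIMSEQ_Suc[OF LIMSEQ_inverse_real_of_nat])
    define y where "y n = (1 - s n) *\<^sub>R a + s n *\<^sub>R b" for n
    have "y \<longlonglongrightarrow> (1 - 0) *\<^sub>R a + 0 *\<^sub>R b" unfolding y_def by (intro tendsto_intros s0)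
    then have ya: "y \<longlonglongrightarrow> a" by simp
    have y\<Omega>: "y n \<in> \<Omega>" for n unfolding y_def by (rule common_side_interior[OF tri KL a b ab F[OF KL(1)] F[OF KL(2)] s])
    have yr: "y n \<in> region M" if "M \<in> \<T>" "a \<in> verts M" "b \<in> verts M" for n M
      unfolding y_def using is_cellD(2,7)[OF cells[OF that(1)]] that s[of n] by (intro convexD) (auto simp: less_imp_le)
    have lim: "(\<lambda>n. u (y n)) \<longlonglongrightarrow> U M a" "(\<lambda>n. g (y n)) \<longlonglongrightarrow> G M a" if M: "M \<in> \<T>" "a \<in> verts M" "b \<in> verts M" for M
    proof -
      have aM: "a \<in> region M" using is_cellD(7)[OF cells[OF M(1)]] M by auto
      have "(\<lambda>n. U M (y n)) \<longlonglongrightarrow> U M a" "(\<lambda>n. G M (y n)) \<longlonglongrightarrow> G M a"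
        by (intro continuous_on_tendsto_compose[OF _ ya aM] always_eventually allI yr M Uc Gc)+
      then show "(\<lambda>n. u (y n)) \<longlonglongrightarrow> U M a" "(\<lambda>n. g (y n)) \<longlonglongrightarrow> G M a"
        using inside[OF M(1) yr[OF M] y\<Omega>] by simp_all
    qed
    show ?thesis using LIMSEQ_unique[OF lim(1)[OF KL(1) a(1) b(1)] lim(1)[OF KL(2) a(2) b(2)]]
        LIMSEQ_unique[OF lim(2)[OF KL(1) a(1) b(1)] lim(2)[OF KL(2) a(2) b(2)]] by simp
  qed
  have same: "U K a = U L a \<and> G K a = G L a" if KL: "K \<in> \<T>" "L \<in> \<T>" "a \<in> verts K" "a \<in> verts L" for K L a
  proof -
    have "(K, L) \<in> {(K', L'). K' \<in> \<T> \<and> L' \<in> \<T> \<and> a \<in> verts K' \<inter> verts L' \<and> adjacent K' L'}\<^sup>*"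
      using tri KL unfolding hct_triangulation_def by blast
    then show ?thesis
    proof (induction rule: rtrancl_induct)
      case (step M N)
      then have MN: "M \<in> \<T>" "N \<in> \<T>" "a \<in> verts M" "a \<in> verts N" "M \<noteq> N" "card (verts M \<inter> verts N) = 2"
        by (auto simp: adjacent_def)
      then obtain b where "b \<in> verts M" "b \<in> verts N" "a \<noteq> b" by (auto simp: card_2_iff)
      then show ?case using across[OF MN(1,2,5,3,4)] step.IH by metis
    qed simp
  qed
  define sel where "sel a = (SOME K. K \<in> \<T> \<and> a \<in> verts K)" for a
  define sid where "sid e = (SOME K. K \<in> \<T> \<and> e \<in> sides K)" for e
  define c where "c d = (case d of Val a \<Rightarrow> U (sel a) a | Deriv i a \<Rightarrow> G (sel a) a $ i | Normal e \<Rightarrow> G (sid e) (midpt e) \<bullet> side_normal e)" for d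
  have sel: "sel a \<in> \<T>" "a \<in> verts (sel a)" if "K \<in> \<T>" "a \<in> verts K" for K a
    using someI[of "\<lambda>K. K \<in> \<T> \<and> a \<in> verts K" K] that by (auto simp: sel_def)
  have sid: "sid e \<in> \<T>" "e \<in> sides (sid e)" if "K \<in> \<T>" "e \<in> sides K" for K e
    using someI[of "\<lambda>K. K \<in> \<T> \<and> e \<in> sides K" K] that by (auto simp: sid_def)
  have "c (Val a) = U K a" "grad_dof c a = G K a" if K: "K \<in> \<T>" "a \<in> verts K" for K a
  proof -
    have "U (sel a) a = U K a \<and> G (sel a) a = G K a" by (intro same sel[OF K] K)
    then show "c (Val a) = U K a" "grad_dof c a = G K a"
      by (simp_all add: c_def grad_dof_def vec_eq_iff forall_2 axis_def)
  qed
  moreover have "c (Normal e) = G K (midpt e) \<bullet> side_normal e" if K: "K \<in> \<T>" "e \<in> sides K" for K e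
  proof (cases "sid e = K")
    case False
    let ?L = "sid e"
    note L = sid[OF K]
    obtain a b where ab: "e = {a, b}" "a \<noteq> b" using K by (auto simp: sides_def card_2_iff)
    have v: "a \<in> verts K" "a \<in> verts ?L" "b \<in> verts K" "b \<in> verts ?L" using K L ab by (auto simp: sides_def)
    have m: "midpt e = (1 - 1/2) *\<^sub>R a + (1/2) *\<^sub>R b" using ab by (simp add: midpt_def algebra_simps)
    have m\<Omega>: "midpt e \<in> \<Omega>"
      unfolding m by (rule common_side_interior[OF tri L(1) K(1) False v(2,1,4,3) ab(2) F[OF L(1)] F[OF K(1)]]) auto
    have mr: "midpt e \<in> region M" if "M \<in> \<T>" "a \<in> verts M" "b \<in> verts M" for M
      unfolding m using is_cellD(2,7)[OF cells[OF that(1)]] that by (intro convexD) auto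
    have "G ?L (midpt e) = G K (midpt e)"
      using inside(2)[OF K(1) mr[OF K(1) v(1,3)] m\<Omega>] inside(2)[OF L(1) mr[OF L(1) v(2,4)] m\<Omega>] by simp
    then show ?thesis by (simp add: c_def)
  qed (simp add: c_def)
  ultimately show ?thesis using that by blast
qed

section \<open>The error estimate\<close>

lemma weak_family_restrict:
  assumes G: "weak_family m D G" and S: "open S" "S \<subseteq> D"
  shows "weak_family m S (\<lambda>i j x. indicator S x * G i j x)"
  unfolding weak_family_def
proof (intro allI impI conjI)
  fix i j :: nat assume ij: "i + j \<le> m"
  note g = weak_familyD(1,3)[OF G ij]
  have SB: "S \<in> sets borel" using S by simp
  show "(\<lambda>x. indicator S x * G i j x) \<in> borel_measurable borel" using g(1) SB by simp
  show "indicator S x * G i j x = 0" if "x \<notin> S" for x using that by simp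
  have "integrable lborel (\<lambda>x. (G i j x)\<^sup>2 * indicator S x)"
    using SB by (intro integrable_real_mult_indicator g(2)) simp
  moreover have "(\<lambda>x. (G i j x)\<^sup>2 * indicator S x) = (\<lambda>x. (indicator S x * G i j x)\<^sup>2)"
    by (auto simp: indicator_def fun_eq_iff)
  ultimately show "integrable lborel (\<lambda>x. (indicator S x * G i j x)\<^sup>2)" by simp
  fix \<phi> assume t: "test_function S \<phi>"
  show "(\<integral>x. indicator S x * G 0 0 x * mixed_deriv (i, j) \<phi> x \<partial>lborel) = (-1) ^ (i + j) * (\<integral>x. indicator S x * G i j x * \<phi> x \<partial>lborel)"
    unfolding indicator_times_test[OF t] indicator_times_test[OF test_function_mixed_deriv[OF t]]
    by (rule weak_familyD(4)[OF G ij test_function_mono[OF t S(2)]])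
qed

lemma weak_family_mono: "weak_family m S G \<Longrightarrow> l \<le> m \<Longrightarrow> weak_family l S G"
  unfolding weak_family_def by (meson order_trans)

text \<open>The two parts of the error are measured against the same cubic \<open>p\<close>: \<open>A\<close> bounds the square norms for \<open>u\<close>, and the
  pointwise bound \<open>B\<close> for the interpolant is integrated over \<open>S\<close>. The factor 5 bounds the number of derivatives of
  order \<open>l\<close>. The set \<open>S\<close> is the interior of the cell or of a subcell.\<close>

lemma broken_error:
  assumes D: "open D" "bounded D" and S: "open S" "S \<subseteq> D"
    and G: "weak_family 4 D G" and rep: "represents D u (G 0 0)" and p: "deg_le 3 p"
    and F: "weak_family m S (\<lambda>i j x. indicator S x * F i j x)" and l: "l \<le> m" "m \<le> 4"
    and w: "\<And>x. x \<in> S \<Longrightarrow> w x = F 0 0 x"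
    and A: "\<And>i j. i + j = l \<Longrightarrow> (\<integral>x. (G i j x - indicator D x * pol p i j x)\<^sup>2 \<partial>lborel) \<le> A"
    and B: "\<And>i j x. i + j = l \<Longrightarrow> x \<in> S \<Longrightarrow> \<bar>F i j x - pol p i j x\<bar> \<le> B"
    and \<mu>: "measure lborel S \<le> \<mu>"
  shows "sobolev l S (\<lambda>x. u x - w x)"
    and "(sobolev_seminorm l S (\<lambda>x. u x - w x))\<^sup>2 \<le> 5 * (2 * A + 2 * (B\<^sup>2 * \<mu>))"
proof -
  have bS: "bounded S" using D(2) S(2) by (rule bounded_subset)
  have SB: "S \<in> sets borel" using S by simp
  define H where "H i j x = indicator S x * G i j x - indicator S x * F i j x" for i j and x :: pt
  have "weak_family m S H"
    unfolding H_def[abs_def] by (intro weak_family_diff S(1) bS F weak_family_mono[OF weak_family_restrict[OF G S] l(2)])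
  then have H: "weak_family l S H" using l(1) by (rule weak_family_mono)
  have r: "u \<in> borel_measurable (lebesgue_on D)" "AE x in lborel. x \<in> D \<longrightarrow> u x = G 0 0 x" using rep by (auto simp: represents_def)
  have Hr: "represents S (\<lambda>x. u x - w x) (H 0 0)"
    unfolding represents_def
  proof (intro conjI allI impI)
    have "u \<in> borel_measurable (lebesgue_on S)" using r(1) S(2) by (rule measurable_restrict_mono)
    moreover have "w \<in> borel_measurable (lebesgue_on S)"
    proof -
      have "(\<lambda>x. indicator S x * F 0 0 x) \<in> borel_measurable (lebesgue_on S)"
        by (rule borel_imp_measurable_lebesgue_on[OF weak_familyD(1)[OF F]]) simp
      moreover have "w x = indicator S x * F 0 0 x" if "x \<in> space (lebesgue_on S)" for x using that w by simp
      ultimately show ?thesis by (subst measurable_cong)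
    qed
    ultimately show "(\<lambda>x. u x - w x) \<in> borel_measurable (lebesgue_on S)" by simp
    show "H 0 0 \<in> borel_measurable borel" by (rule weak_familyD(1)[OF H]) simp
    show "H 0 0 x = 0" if "x \<notin> S" for x using that by (simp add: H_def)
    show "AE x in lborel. x \<in> S \<longrightarrow> u x - w x = H 0 0 x"
      using r(2) by eventually_elim (use S(2) w in \<open>auto simp: H_def\<close>)
  qed
  show "sobolev l S (\<lambda>x. u x - w x)" by (rule weak_family_imp_sobolev[OF S(1) H Hr])
  have X: "sqnorm (H i j) \<le> 2 * A + 2 * (B\<^sup>2 * \<mu>)" if ij: "i + j = l" for i j
  proof -
    let ?P = "\<lambda>x. G i j x - indicator D x * pol p i j x"
    have "weak_family 4 D (\<lambda>i j x. G i j x - indicator D x * pol p i j x)"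
      by (intro weak_family_diff D G weak_family_smooth cub_partials p)
    then have iP: "integrable lborel (\<lambda>x. (?P x)\<^sup>2)" by (rule weak_familyD(3)) (use ij l in simp)
    have iS: "integrable lborel (indicator S :: pt \<Rightarrow> real)"
      using SB emeasure_bounded_finite[OF bS] by (intro integrable_real_indicator) auto
    have "sqnorm (H i j) \<le> (\<integral>x. 2 * (?P x)\<^sup>2 + 2 * (B\<^sup>2 * indicator S x) \<partial>lborel)"
    proof (rule integral_mono)
      show "square_integrable (H i j)" by (rule weak_familyD(3)[OF H]) (use ij in simp)
      show "integrable lborel (\<lambda>x. 2 * (?P x)\<^sup>2 + 2 * (B\<^sup>2 * indicator S x))" using iP iS by simp
      show "(H i j x)\<^sup>2 \<le> 2 * (?P x)\<^sup>2 + 2 * (B\<^sup>2 * indicator S x)" for x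
      proof (cases "x \<in> S")
        case True
        have "\<bar>F i j x - pol p i j x\<bar>\<^sup>2 \<le> B\<^sup>2" using B[OF ij True] by (intro power_mono) auto
        moreover have "(a - b)\<^sup>2 \<le> 2 * a\<^sup>2 + 2 * b\<^sup>2" for a b :: real
          using zero_le_power2[of "a + b"] by (simp add: power2_eq_square algebra_simps)
        from this[of "?P x" "F i j x - pol p i j x"]
        have "(H i j x)\<^sup>2 \<le> 2 * (?P x)\<^sup>2 + 2 * (F i j x - pol p i j x)\<^sup>2"
          using True S(2) by (auto simp: H_def)
        ultimately show ?thesis using True by simp
      qed (simp add: H_def)
    qed
    also have "\<dots> = 2 * (\<integral>x. (?P x)\<^sup>2 \<partial>lborel) + 2 * (B\<^sup>2 * measure lborel S)"
      using iP iS by simp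
    also have "\<dots> \<le> 2 * A + 2 * (B\<^sup>2 * \<mu>)" using A[OF ij] \<mu> by (intro add_mono mult_left_mono) auto
    finally show ?thesis .
  qed
  have pairs: "{(i, j). i + j = l} = (\<lambda>i. (i, l - i)) ` {..l}" by auto
  have fin: "finite {(i, j). i + j = l}" unfolding pairs by simp
  have card: "card {(i, j). i + j = l} \<le> 5" using card_image_le[of "{..l}" "\<lambda>i. (i, l - i)"] l unfolding pairs by simp
  have nn: "0 \<le> 2 * A + 2 * (B\<^sup>2 * \<mu>)" by (rule order_trans[OF _ X[of 0 l]]) simp_all
  have "(sobolev_seminorm l S (\<lambda>x. u x - w x))\<^sup>2 = (\<Sum>(i, j) | i + j = l. sqnorm (H i j))"
    unfolding weak_family_seminorm[OF S(1) bS H Hr order_refl] by (intro real_sqrt_pow2 sum_nonneg) (auto split: prod.splits)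
  also have "\<dots> \<le> real (card {(i, j). i + j = l}) * (2 * A + 2 * (B\<^sup>2 * \<mu>))"
    using X by (intro sum_bounded_above) (auto split: prod.splits)
  also have "\<dots> \<le> 5 * (2 * A + 2 * (B\<^sup>2 * \<mu>))" using card nn by (intro mult_right_mono) auto
  finally show "(sobolev_seminorm l S (\<lambda>x. u x - w x))\<^sup>2 \<le> 5 * (2 * A + 2 * (B\<^sup>2 * \<mu>))" .
qed

lemma Lipschitz_extension:
  fixes f :: "pt \<Rightarrow> real"
  assumes "\<And>x y. x \<in> D \<Longrightarrow> y \<in> D \<Longrightarrow> \<bar>f x - f y\<bar> \<le> L * norm (x - y)"
  obtains F where "continuous_on (closure D) F" "\<And>x. x \<in> D \<Longrightarrow> F x = f x"
proof -
  have "uniformly_continuous_on D f"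
    unfolding uniformly_continuous_on_def
  proof (intro allI impI)
    fix e :: real assume e: "e > 0"
    let ?d = "e / (\<bar>L\<bar> + 1)"
    show "\<exists>d>0. \<forall>x\<in>D. \<forall>x'\<in>D. dist x' x < d \<longrightarrow> dist (f x') (f x) < e"
    proof (intro exI[of _ ?d] conjI ballI impI)
      show "?d > 0" using e by (simp add: add_nonneg_pos)
      fix x y assume xy: "x \<in> D" "y \<in> D" "dist y x < ?d"
      have "\<bar>f y - f x\<bar> \<le> L * norm (y - x)" using assms xy by blast
      also have "\<dots> \<le> (\<bar>L\<bar> + 1) * norm (y - x)" by (intro mult_right_mono) auto
      also have "\<dots> < (\<bar>L\<bar> + 1) * ?d" using xy(3) by (intro mult_strict_left_mono) (auto simp: dist_norm)
      finally show "dist (f y) (f x) < e" by (simp add: dist_real_def)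
    qed
  qed
  then obtain F where "uniformly_continuous_on (closure D) F" "\<And>x. x \<in> D \<Longrightarrow> f x = F x"
    using uniformly_continuous_on_extension_on_closure by metis
  then show ?thesis using that[of F] uniformly_continuous_imp_continuous by auto
qed

lemma cell_interior_facts:
  assumes "is_cell \<Omega> K"
  shows "open (cell_interior K)" "bounded (cell_interior K)" "convex (cell_interior K)" "cell_interior K \<noteq> {}"
    "closure (cell_interior K) = region K"
    "\<And>x y. x \<in> region K \<Longrightarrow> y \<in> region K \<Longrightarrow> norm (x - y) \<le> diameter (region K)"
proof -
  note K = is_cellD[OF assms]
  have b: "bounded (region K)" using K(1) by (rule compact_imp_bounded)
  then show "bounded (cell_interior K)" using interior_subset by (rule bounded_subset)
  show "open (cell_interior K)" "convex (cell_interior K)" "cell_interior K \<noteq> {}" using K by (auto intro: convex_interior)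
  show "closure (cell_interior K) = region K" using convex_closure_interior[OF K(2,5)] closure_closed[OF compact_imp_closed[OF K(1)]] by simp
  show "norm (x - y) \<le> diameter (region K)" if "x \<in> region K" "y \<in> region K" for x y
    using diameter_bounded_bound[OF b that] by (simp add: dist_norm)
qed

text \<open>By \<open>cubic_approximation\<close> both \<open>u\<close> and its gradient are Lipschitz on the open cell, hence extend
  continuously to its closure.\<close>

lemma cell_extension:
  assumes K: "is_cell \<Omega> K" and u: "sobolev 4 (cell_interior K) u"
    and d: "\<And>x. x \<in> cell_interior K \<Longrightarrow> (u has_derivative (\<lambda>h. g x \<bullet> h)) (at x)" and g: "continuous_on (cell_interior K) g"
  shows "\<exists>U G. continuous_on (region K) U \<and> continuous_on (region K) G \<and> (\<forall>x\<in>cell_interior K. U x = u x \<and> G x = (g x :: pt))"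
proof -
  note D = cell_interior_facts[OF K]
  have hD: "norm (x - y) \<le> diameter (region K)" if "x \<in> cell_interior K" "y \<in> cell_interior K" for x y
    using that interior_subset[of "region K"] by (intro D(6)) auto
  have d': "(u has_derivative (\<lambda>h. g x $ 1 * h $ 1 + g x $ 2 * h $ 2)) (at x)" if "x \<in> cell_interior K" for x
    using d[OF that] by (simp add: inner_vec_def sum_2)
  have c: "continuous_on (cell_interior K) (\<lambda>x. g x $ 1)" "continuous_on (cell_interior K) (\<lambda>x. g x $ 2)"
    by (intro continuous_intros g)+
  obtain L where L: "\<And>x y. x \<in> cell_interior K \<Longrightarrow> y \<in> cell_interior K \<Longrightarrow> \<bar>u x - u y\<bar> \<le> L * norm (x - y)"
    "\<And>x y. x \<in> cell_interior K \<Longrightarrow> y \<in> cell_interior K \<Longrightarrow> \<bar>g x $ 1 - g y $ 1\<bar> \<le> L * norm (x - y)"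
    "\<And>x y. x \<in> cell_interior K \<Longrightarrow> y \<in> cell_interior K \<Longrightarrow> \<bar>g x $ 2 - g y $ 2\<bar> \<le> L * norm (x - y)"
    by (rule cubic_approximation[OF D(1-4) hD u d' c]) blast+
  obtain U where U: "continuous_on (region K) U" "\<And>x. x \<in> cell_interior K \<Longrightarrow> U x = u x"
    using Lipschitz_extension[OF L(1)] D(5) by metis
  obtain G1 where G1: "continuous_on (region K) G1" "\<And>x. x \<in> cell_interior K \<Longrightarrow> G1 x = g x $ 1"
    using Lipschitz_extension[OF L(2)] D(5) by metis
  obtain G2 where G2: "continuous_on (region K) G2" "\<And>x. x \<in> cell_interior K \<Longrightarrow> G2 x = g x $ 2"
    using Lipschitz_extension[OF L(3)] D(5) by metis
  have "continuous_on (region K) (\<lambda>x. G1 x *\<^sub>R e1 + G2 x *\<^sub>R e2)" by (intro continuous_intros G1 G2)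
  moreover have "G1 x *\<^sub>R e1 + G2 x *\<^sub>R e2 = g x" if "x \<in> cell_interior K" for x
    using G1(2)[OF that] G2(2)[OF that] by (simp add: vec_eq_iff forall_2 axis_def)
  ultimately show ?thesis using U by blast
qed

lemma measure_le_square:
  assumes "S \<in> sets borel" "x \<in> S" "\<And>y. y \<in> S \<Longrightarrow> norm (x - y) \<le> h"
  shows "measure lborel (S :: pt set) \<le> 4 * h\<^sup>2"
proof -
  have h: "h \<ge> 0" using assms(3)[OF assms(2)] by simp
  have "S \<subseteq> cball x h" using assms(3) by (auto simp: dist_norm)
  moreover have "cball x h \<in> fmeasurable lborel"
  proof (rule fmeasurableI)
    show "emeasure lborel (cball x h) < \<infinity>" by (rule emeasure_bounded_finite) simp
  qed simp
  ultimately have "measure lborel S \<le> measure lborel (cball x h)"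
    using assms(1) by (intro measure_mono_fmeasurable) simp_all
  also have "\<dots> = pi * h\<^sup>2" using h by (simp add: content_cball unit_ball_vol_2)
  also have "\<dots> \<le> 4 * h\<^sup>2" using pi_less_4 by (intro mult_right_mono) auto
  finally show ?thesis .
qed

text \<open>The factor 15 counts three subcells and five derivatives; 40 bounds the square roots of the constants in
  \<open>cubic_approximation\<close>, and \<open>\<rho> * h\<^sup>2\<close> is a lower bound for the area of the cell.\<close>

definition error_constant :: "real \<Rightarrow> real \<Rightarrow> real" where
  "error_constant N \<rho> = sqrt (15 * (512 + 8 * (138240 * N ^ 11 * (40 / sqrt \<rho>))\<^sup>2))"

text \<open>The nodal errors are bounded by \<open>cubic_approximation\<close>, extended to the closed cell by continuity, and
  \<open>interpolation_error\<close> turns them into bounds for the derivatives of the interpolant.\<close>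

lemma (in cell_frame) cell_error:
  assumes K: "is_cell \<Omega> K" and u: "sobolev 4 (cell_interior K) u"
    and d: "\<And>x. x \<in> cell_interior K \<Longrightarrow> (u has_derivative (\<lambda>h. g x \<bullet> h)) (at x)" and g: "continuous_on (cell_interior K) g"
    and U: "continuous_on (region K) U" "\<And>x. x \<in> cell_interior K \<Longrightarrow> U x = u x"
    and G: "continuous_on (region K) G" "\<And>x. x \<in> cell_interior K \<Longrightarrow> G x = g x"
    and cV: "\<And>a. a \<in> verts K \<Longrightarrow> c (Val a) = U a" and cG: "\<And>a. a \<in> verts K \<Longrightarrow> grad_dof c a = G a"
    and cN: "\<And>e. e \<in> sides K \<Longrightarrow> c (Normal e) = G (midpt e) \<bullet> side_normal e"
    and w: "\<And>x. x \<in> region K \<Longrightarrow> w x = loc c x"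
    and N: "N \<ge> 1" and \<rho>: "\<rho> > 0" and h0: "diameter (region K) > 0"
    and scN: "\<And>i k. norm (sc i k) \<le> N / diameter (region K)"
    and EN: "\<And>j k. j \<noteq> k \<Longrightarrow> diameter (region K) / N \<le> norm (V k - V j)"
    and area: "\<rho> * (diameter (region K))\<^sup>2 \<le> measure lborel (cell_interior K)" and l: "l \<le> 4"
  shows "cell_sobolev l K (\<lambda>x. u x - w x)"
    and "cell_seminorm l K (\<lambda>x. u x - w x) \<le> error_constant N \<rho> * diameter (region K) ^ (4 - l) * sobolev_seminorm 4 (cell_interior K) u"
proof -
  interpret H: hct_data V "centre K" \<beta> \<ll> "gd c" "Md c" by (rule loc_data)
  define h where "h = diameter (region K)"
  have h: "h > 0" using h0 by (simp add: h_def)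
  note D = cell_interior_facts[OF K, folded h_def]
  note scN = scN[folded h_def] and EN = EN[folded h_def] and area = area[folded h_def]
  let ?D = "cell_interior K"
  have DK: "?D \<subseteq> region K" by (rule interior_subset)
  have hD: "norm (x - y) \<le> h" if "x \<in> ?D" "y \<in> ?D" for x y using that DK by (intro D(6)) auto
  have d': "(u has_derivative (\<lambda>h. g x $ 1 * h $ 1 + g x $ 2 * h $ 2)) (at x)" if "x \<in> ?D" for x
    using d[OF that] by (simp add: inner_vec_def sum_2)
  have cg: "continuous_on ?D (\<lambda>x. g x $ 1)" "continuous_on ?D (\<lambda>x. g x $ 2)" by (intro continuous_intros g)+
  obtain W p E where W: "weak_family 4 ?D W" "represents ?D u (W 0 0)" and p: "deg_le 3 p"
    and E: "E = (\<Sum>(i, j) | i + j = 4. sqnorm (W i j))"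
    and Wp: "\<And>i j. i + j \<le> 4 \<Longrightarrow> (\<integral>x. (W i j x - indicator ?D x * pol p i j x)\<^sup>2 \<partial>lborel) \<le> (4 * h\<^sup>2) ^ (4 - (i + j)) * E"
    and b0: "\<And>x. x \<in> ?D \<Longrightarrow> measure lborel ?D * (u x - pol p 0 0 x)\<^sup>2 \<le> 1344 * h ^ 8 * E"
    and b1: "\<And>x. x \<in> ?D \<Longrightarrow> measure lborel ?D * (g x $ 1 - pol p 1 0 x)\<^sup>2 \<le> 336 * h ^ 6 * E"
    and b2: "\<And>x. x \<in> ?D \<Longrightarrow> measure lborel ?D * (g x $ 2 - pol p 0 1 x)\<^sup>2 \<le> 336 * h ^ 6 * E"
    by (rule cubic_approximation[OF D(1-4) hD u d' cg]) blast+
  have E0: "E \<ge> 0" unfolding E by (intro sum_nonneg) (auto split: prod.splits)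
  have Es: "sobolev_seminorm 4 ?D u = sqrt E" unfolding E by (rule weak_family_seminorm[OF D(1,2) W order_refl])
  \<comment> \<open>\<open>40\<^sup>2 = 1600\<close> exceeds both 1344 and \<open>2 * 336\<close>\<close>
  define r where "r = 40 / sqrt \<rho>"
  have r: "r \<ge> 0" "r\<^sup>2 = 1600 / \<rho>" using \<rho> by (simp_all add: r_def power_divide)
  define \<epsilon> where "\<epsilon> = r * h ^ 3 * sqrt E"
  have \<epsilon>2: "\<epsilon>\<^sup>2 = 1600 / \<rho> * h ^ 6 * E" using E0 r by (simp add: \<epsilon>_def power_mult_distrib power_mult[symmetric])
  have \<epsilon>0: "\<epsilon> \<ge> 0" using r h E0 by (simp add: \<epsilon>_def)
  have polc: "continuous_on S (pol p i j)" for S i j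
    using partials_continuous[OF cub_partials[OF p, of e1 e2 i j 0]] by (rule continuous_on_subset) simp
  have scale: "y \<le> C / \<rho> * h ^ n * E" if "measure lborel ?D * y \<le> C * h ^ (n + 2) * E" "y \<ge> 0" for y C n
  proof -
    have "\<rho> * h\<^sup>2 * y \<le> C * h ^ (n + 2) * E" using mult_right_mono[OF area that(2)] that(1) by linarith
    then have "(\<rho> * y) * h\<^sup>2 \<le> (C * h ^ n * E) * h\<^sup>2" by (simp add: power_add power2_eq_square mult_ac)
    then have "\<rho> * y \<le> C * h ^ n * E" using h by simp
    then show ?thesis using \<rho> by (simp add: field_simps)
  qed
  have on_closure: "f x \<le> a" if f: "continuous_on (region K) f" and x: "x \<in> region K" and le: "\<And>y. y \<in> ?D \<Longrightarrow> f y \<le> a"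
    for f :: "pt \<Rightarrow> real" and a x
    using f x by (intro continuous_le_on_closure[where S = ?D, OF _ _ le]) (simp_all add: D(5))
  have Ub: "\<bar>U x - pol p 0 0 x\<bar> \<le> \<epsilon>" if "x \<in> region K" for x
  proof (rule on_closure[OF _ that])
    show "continuous_on (region K) (\<lambda>x. \<bar>U x - pol p 0 0 x\<bar>)" by (intro continuous_intros U polc)
    fix y assume y: "y \<in> ?D"
    have "(u y - pol p 0 0 y)\<^sup>2 \<le> 1344 / \<rho> * h ^ 6 * E" using b0[OF y] by (intro scale) simp_all
    also have "\<dots> \<le> \<epsilon>\<^sup>2" unfolding \<epsilon>2 using \<rho> h E0 by (intro mult_right_mono divide_right_mono) auto
    finally have "\<bar>u y - pol p 0 0 y\<bar>\<^sup>2 \<le> \<epsilon>\<^sup>2" by simp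
    then show "\<bar>U y - pol p 0 0 y\<bar> \<le> \<epsilon>" unfolding U(2)[OF y] using \<epsilon>0 by (rule power2_le_imp_le)
  qed
  have Gb: "norm (G x - gradp p x) \<le> \<epsilon> / h" if "x \<in> region K" for x
  proof (rule on_closure[OF _ that])
    show "continuous_on (region K) (\<lambda>x. norm (G x - gradp p x))" unfolding gradp_def by (intro continuous_intros G polc)
    fix y assume y: "y \<in> ?D"
    have 1: "(g y $ 1 - pol p 1 0 y)\<^sup>2 \<le> 336 / \<rho> * h ^ 4 * E" using b1[OF y] by (intro scale) simp_all
    have 2: "(g y $ 2 - pol p 0 1 y)\<^sup>2 \<le> 336 / \<rho> * h ^ 4 * E" using b2[OF y] by (intro scale) simp_all
    have gp: "gradp p y $ 1 = pol p 1 0 y" "gradp p y $ 2 = pol p 0 1 y" by (simp_all add: gradp_def axis_def)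
    have "(norm (g y - gradp p y))\<^sup>2 = (g y $ 1 - pol p 1 0 y)\<^sup>2 + (g y $ 2 - pol p 0 1 y)\<^sup>2"
      unfolding power2_norm_eq_inner inner_vec_def sum_2 by (simp add: gp power2_eq_square)
    also have "\<dots> \<le> 336 / \<rho> * h ^ 4 * E + 336 / \<rho> * h ^ 4 * E" using 1 2 by (rule add_mono)
    also have "\<dots> = 672 / \<rho> * h ^ 4 * E" using \<rho> by (simp add: field_simps)
    also have "\<dots> \<le> 1600 / \<rho> * h ^ 4 * E" using \<rho> h E0 by (intro mult_right_mono divide_right_mono) auto
    also have "\<dots> = (\<epsilon> / h)\<^sup>2" unfolding power_divide \<epsilon>2 using h by (simp add: eval_nat_numeral)
    finally have "(norm (g y - gradp p y))\<^sup>2 \<le> (\<epsilon> / h)\<^sup>2" .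
    moreover have "0 \<le> \<epsilon> / h" using \<epsilon>0 h by simp
    ultimately show "norm (G y - gradp p y) \<le> \<epsilon> / h" unfolding G(2)[OF y] by (rule power2_le_imp_le)
  qed
  have zr: "centre K \<in> region K"
    using K interior_subset is_cellD(3)[OF K] unfolding is_cell_def by blast
  define B where "B n = 138240 * N ^ 11 * (\<epsilon> / h ^ n)" for n
  have err: "\<bar>H.hderiv a b x - pol p a b x\<bar> \<le> B (a + b)" "\<bar>H.pc i a b x - pol p a b x\<bar> \<le> B (a + b)"
    if "x \<in> region K" "a + b \<le> 4" for a b x i
  proof -
    have Vv: "V j \<in> verts K" for j using range_V by auto
    have f: "\<bar>fd c j - pol p 0 0 (V j)\<bar> \<le> \<epsilon>" for j
      using Ub[OF V_region, of j] unfolding fd_def cV[OF Vv] .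
    have gg: "norm (gd c j - gradp p (V j)) \<le> \<epsilon> / h" for j
      using Gb[OF V_region, of j] unfolding gd_def cG[OF Vv] .
    have nn: "\<bar>nd c j k - gradp p ((1/2) *\<^sub>R (V j + V k)) \<bullet> nrm j k\<bar> \<le> \<epsilon> / h" if jk: "j \<noteq> k" for j k
    proof -
      let ?m = "(1/2) *\<^sub>R (V j + V k)"
      have "nd c j k - gradp p ?m \<bullet> nrm j k = (G ?m - gradp p ?m) \<bullet> nrm j k"
        using cN[OF side_V[OF jk]] by (simp add: nd_def nrm_def midpt_V[OF jk] inner_diff_left)
      then have "\<bar>nd c j k - gradp p ?m \<bullet> nrm j k\<bar> \<le> norm (G ?m - gradp p ?m) * norm (nrm j k)"
        using Cauchy_Schwarz_ineq2 by simp
      then show ?thesis using Gb[OF midpoint_region, of j k] nrm(1)[OF jk] by simp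
    qed
    have vh: "norm (v j) \<le> h" for j unfolding v_def by (intro D(6) V_region zr)
    have EN': "norm (v k - v j) \<ge> h / N" if "j \<noteq> k" for j k unfolding V_diff by (rule EN[OF that])
    have xz: "norm (x - centre K) \<le> h" by (intro D(6) that zr)
    show "\<bar>H.hderiv a b x - pol p a b x\<bar> \<le> B (a + b)" "\<bar>H.pc i a b x - pol p a b x\<bar> \<le> B (a + b)"
      unfolding B_def Md_def
      by (rule interpolation_error[OF p nrm nrm_sym nd_sym h N vh scN EN' f gg nn xz that(2)]; assumption)+
  qed
  define A where "A = (4 * h\<^sup>2) ^ (4 - l) * E"
  have Ab: "(\<integral>x. (W i j x - indicator ?D x * pol p i j x)\<^sup>2 \<partial>lborel) \<le> A" if "i + j = l" for i j
    using Wp[of i j] that l by (simp add: A_def)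
  have small: "measure lborel S \<le> 4 * h\<^sup>2" if "S \<in> sets borel" "S \<subseteq> region K" for S
  proof (cases "S = {}")
    case False
    then obtain x where "x \<in> S" by auto
    then show ?thesis using that by (intro measure_le_square[of S x] D(6)) auto
  qed simp
  define X where "X = 5 * (2 * A + 2 * ((B l)\<^sup>2 * (4 * h\<^sup>2)))"
  have X: "15 * (2 * A + 2 * ((B l)\<^sup>2 * (4 * h\<^sup>2))) \<le> (error_constant N \<rho> * h ^ (4 - l) * sqrt E)\<^sup>2"
  proof -
    define n where "n = 4 - l"
    define q where "q = 138240 * N ^ 11 * r"
    have hn: "h ^ n * h ^ l = h ^ 4" using l by (simp add: n_def power_add[symmetric])
    have "B l * h = q * (h ^ n) * sqrt E"
    proof -
      have "B l * h = q * (h ^ 4 / h ^ l) * sqrt E"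
        by (simp add: B_def \<epsilon>_def q_def eval_nat_numeral)
      also have "h ^ 4 / h ^ l = h ^ n" using h by (simp add: hn[symmetric])
      finally show ?thesis .
    qed
    then have "(B l * h)\<^sup>2 = q\<^sup>2 * (h ^ n)\<^sup>2 * E" using E0 by (simp add: power_mult_distrib)
    then have 1: "(B l)\<^sup>2 * (4 * h\<^sup>2) = 4 * q\<^sup>2 * (h ^ n)\<^sup>2 * E" by (simp add: power_mult_distrib)
    have "(4::real) ^ n \<le> 4 ^ 4" by (intro power_increasing) (auto simp: n_def)
    then have "4 ^ n * ((h ^ n)\<^sup>2 * E) \<le> 256 * ((h ^ n)\<^sup>2 * E)" using E0 by (intro mult_right_mono) auto
    then have 2: "A \<le> 256 * ((h ^ n)\<^sup>2 * E)"
      by (simp add: A_def n_def[symmetric] power_mult_distrib power_mult[symmetric] mult.commute[of 2] mult.assoc)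
    have "15 * (2 * A + 2 * ((B l)\<^sup>2 * (4 * h\<^sup>2))) \<le> 15 * (512 + 8 * q\<^sup>2) * ((h ^ n)\<^sup>2 * E)"
      unfolding 1 using 2 by (simp add: algebra_simps)
    also have "\<dots> = (error_constant N \<rho>)\<^sup>2 * ((h ^ n)\<^sup>2 * E)"
      by (simp add: error_constant_def q_def r_def add_nonneg_nonneg)
    also have "\<dots> = (error_constant N \<rho> * h ^ (4 - l) * sqrt E)\<^sup>2" using E0 by (simp add: power_mult_distrib n_def)
    finally show ?thesis .
  qed
  have X0: "X \<ge> 0" using E0 by (simp add: X_def A_def)
  have X3: "3 * X \<le> (error_constant N \<rho> * h ^ (4 - l) * sqrt E)\<^sup>2" using X by (simp add: X_def)
  have Y0: "0 \<le> error_constant N \<rho> * h ^ (4 - l) * sqrt E"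
    using E0 h by (intro mult_nonneg_nonneg) (auto simp: error_constant_def)
  have "cell_sobolev l K (\<lambda>x. u x - w x) \<and> cell_seminorm l K (\<lambda>x. u x - w x) \<le> error_constant N \<rho> * h ^ (4 - l) * sqrt E"
  proof (cases "l \<le> 2")
    case True
    have wD: "w x = H.hderiv 0 0 x" if "x \<in> ?D" for x using w[of x] that DK by (auto simp: loc_def H.hderiv_0)
    have B1: "\<bar>H.hderiv i j x - pol p i j x\<bar> \<le> B l" if "i + j = l" "x \<in> ?D" for i j x
      using err(1)[of x i j] that l DK by auto
    have sm: "measure lborel ?D \<le> 4 * h\<^sup>2" using D(1) DK by (intro small) auto
    note be = broken_error[OF D(1,2) D(1) order_refl W p H.hct_weak_family[OF D(1,2)] True _ wD Ab B1 sm]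
    have s: "sobolev l ?D (\<lambda>x. u x - w x)" and n: "(sobolev_seminorm l ?D (\<lambda>x. u x - w x))\<^sup>2 \<le> X"
      using be by (simp_all add: X_def)
    have "(sobolev_seminorm l ?D (\<lambda>x. u x - w x))\<^sup>2 \<le> (error_constant N \<rho> * h ^ (4 - l) * sqrt E)\<^sup>2" using n X3 X0 by linarith
    then have "sobolev_seminorm l ?D (\<lambda>x. u x - w x) \<le> error_constant N \<rho> * h ^ (4 - l) * sqrt E"
      using Y0 by (rule power2_le_imp_le)
    then show ?thesis using True s by (simp add: cell_sobolev_def cell_seminorm_def)
  next
    case False
    have se: "sobolev l (interior (subcell K e)) (\<lambda>x. u x - w x) \<and> (sobolev_seminorm l (interior (subcell K e)) (\<lambda>x. u x - w x))\<^sup>2 \<le> X"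
      if e: "e \<in> sides K" for e
    proof -
      let ?S = "interior (subcell K e)"
      have sub: "subcell K e \<subseteq> region K" by (auto simp: subcell_def)
      then have SD: "?S \<subseteq> ?D" by (rule interior_mono)
      obtain i where i: "subcell K e \<subseteq> cone i" using side_cone[OF e] .
      have wS: "w x = H.pc i 0 0 x" if "x \<in> ?S" for x
      proof -
        have "x \<in> cone i" "x \<in> region K" using that i sub interior_subset by blast+
        then show ?thesis using w[of x] H.hf_eq[of x i] by (simp add: loc_def H.pc_0)
      qed
      have B1: "\<bar>H.pc i i' j x - pol p i' j x\<bar> \<le> B l" if "i' + j = l" "x \<in> ?S" for i' j x
        using err(2)[of x i' j i] that l SD DK by auto
      have sm: "measure lborel ?S \<le> 4 * h\<^sup>2" using SD DK by (intro small) auto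
      have bS: "bounded ?S" using D(2) SD by (rule bounded_subset)
      have wf: "weak_family 4 ?S (\<lambda>a b x. indicator ?S x * H.pc i a b x)"
        by (intro weak_family_smooth open_interior bS H.pc_partials)
      show ?thesis using broken_error[OF D(1,2) open_interior SD W p wf l order_refl wS Ab B1 sm] by (simp add: X_def)
    qed
    have fin: "finite (verts K)" "card (verts K) = 3" using is_cellD(6)[OF K] K by (auto simp: is_cell_def)
    have "card (sides K) = 3" unfolding sides_def using n_subsets[OF fin(1), of 2] fin(2) by (simp add: choose_two)
    then have "(\<Sum>e\<in>sides K. (sobolev_seminorm l (interior (subcell K e)) (\<lambda>x. u x - w x))\<^sup>2) \<le> 3 * X"
      using sum_bounded_above[of "sides K" "\<lambda>e. (sobolev_seminorm l (interior (subcell K e)) (\<lambda>x. u x - w x))\<^sup>2" X] se by simp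
    then have "sqrt (\<Sum>e\<in>sides K. (sobolev_seminorm l (interior (subcell K e)) (\<lambda>x. u x - w x))\<^sup>2) \<le> error_constant N \<rho> * h ^ (4 - l) * sqrt E"
      using X3 Y0 by (intro real_le_lsqrt) (auto intro: order_trans)
    then show ?thesis using False se by (simp add: cell_sobolev_def cell_seminorm_def)
  qed
  then show "cell_sobolev l K (\<lambda>x. u x - w x)"
    "cell_seminorm l K (\<lambda>x. u x - w x) \<le> error_constant N \<rho> * diameter (region K) ^ (4 - l) * sobolev_seminorm 4 (cell_interior K) u"
    unfolding Es h_def by auto
qed

lemma patch_bounds:
  assumes "finite \<T>" "K \<in> \<T>" "verts K \<noteq> {}"
  shows "diameter (region K) \<le> patch_size \<T> K" "sobolev_seminorm l (cell_interior K) u \<le> patch_seminorm l \<T> K u"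
proof -
  have K: "K \<in> patch \<T> K" "finite (patch \<T> K)" using assms by (auto simp: patch_def)
  show "diameter (region K) \<le> patch_size \<T> K" unfolding patch_size_def using K by (intro Max_ge) auto
  have "(sobolev_seminorm l (cell_interior K) u)\<^sup>2 \<le> (\<Sum>L\<in>patch \<T> K. (sobolev_seminorm l (cell_interior L) u)\<^sup>2)"
    using K by (intro member_le_sum) auto
  then show "sobolev_seminorm l (cell_interior K) u \<le> patch_seminorm l \<T> K u"
    unfolding patch_seminorm_def by (rule real_le_rsqrt)
qed

theorem theorem5:
  fixes \<Omega> :: "pt set" and \<theta> \<kappa> c\<^sub>0 :: real
  assumes "open \<Omega>" and "connected \<Omega>"
    and "\<theta> > 0" and "\<kappa> > 0" and "c\<^sub>0 > 0"
  shows "\<exists>c::real. \<forall>\<T> u.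
    hct_triangulation \<Omega> \<T> \<and> regular_mesh \<theta> \<kappa> c\<^sub>0 \<T> \<and> C1_on \<Omega> u \<and> broken_sobolev 4 \<T> u \<longrightarrow>
    (\<exists>v\<in>HCT_global \<T>. \<forall>K\<in>\<T>. \<forall>l\<le>4.
       cell_sobolev l K (\<lambda>x. u x - v x) \<and>
       cell_seminorm l K (\<lambda>x. u x - v x)
         \<le> c * patch_size \<T> K ^ (4 - l) * patch_seminorm 4 \<T> K u)"
proof -
  define N where "N = 2 * \<kappa> / shape \<theta> ^ 4 + 1"
  define \<rho> where "\<rho> = shape \<theta> / (2 * \<kappa>\<^sup>2)"
  have N: "N \<ge> 1" and \<rho>: "\<rho> > 0" using shape(1)[OF assms(3)] assms(4) by (auto simp: N_def \<rho>_def)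
  let ?c = "error_constant N \<rho>"
  have c0: "?c \<ge> 0" by (auto simp: error_constant_def)
  have "\<exists>v\<in>HCT_global \<T>. \<forall>K\<in>\<T>. \<forall>l\<le>4.
       cell_sobolev l K (\<lambda>x. u x - v x) \<and>
       cell_seminorm l K (\<lambda>x. u x - v x) \<le> ?c * patch_size \<T> K ^ (4 - l) * patch_seminorm 4 \<T> K u"
    if tri: "hct_triangulation \<Omega> \<T>" and reg: "regular_mesh \<theta> \<kappa> c\<^sub>0 \<T>" and C1: "C1_on \<Omega> u" and sob: "broken_sobolev 4 \<T> u" for \<T> u
  proof -
    have fin: "finite \<T>" and cells: "\<And>K. K \<in> \<T> \<Longrightarrow> is_cell \<Omega> K" and \<Omega>: "\<Omega> = interior (\<Union>K\<in>\<T>. region K)"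
      using tri by (auto simp: hct_triangulation_def)
    let ?frame = "\<lambda>K (V, \<beta>, \<ll>). cell_frame K V \<beta> \<ll> \<and> (\<forall>i k. norm (hct_frame.sc \<beta> \<ll> i k) \<le> N / diameter (region K))
      \<and> (\<forall>j k. j \<noteq> k \<longrightarrow> diameter (region K) / N \<le> norm (V k - V j)) \<and> diameter (region K) > 0
      \<and> \<rho> * (diameter (region K))\<^sup>2 \<le> measure lborel (cell_interior K)"
    have "\<exists>f. ?frame K f" if K: "K \<in> \<T>" for K
    proof -
      have rK: "min_angle_ge \<theta> (verts K)" "\<forall>e\<in>sides K. min_angle_ge \<theta> (insert (centre K) e)"
        "diameter (region K) \<le> \<kappa> * diameter (triangle K)" using reg K by (auto simp: regular_mesh_def)
      obtain V \<beta> \<ll> where F: "hct_frame V (centre K) \<beta> \<ll>" "inj V" "range V = verts K"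
        "\<And>i k. norm (\<ll> k - (\<beta> k / \<beta> i) *\<^sub>R \<ll> i) \<le> N / diameter (region K)"
        "\<And>j k. j \<noteq> k \<Longrightarrow> norm (V k - V j) \<ge> diameter (region K) / N" "diameter (region K) > 0"
        "measure lborel (cell_interior K) \<ge> \<rho> * (diameter (region K))\<^sup>2"
        using cell_frame_exists[OF cells[OF K] assms(3,4) rK] unfolding N_def \<rho>_def by metis
      have "cell_frame K V \<beta> \<ll>"
        using F is_cellD[OF cells[OF K]] by (auto simp: cell_frame_def cell_frame_axioms_def)
      then have "?frame K (V, \<beta>, \<ll>)" using F by (simp add: hct_frame.sc_def[OF F(1)])
      then show ?thesis ..
    qed
    then have "\<forall>K\<in>\<T>. \<exists>f. ?frame K f" by (rule ballI)
    from bchoice[OF this] obtain fr where all: "\<forall>K\<in>\<T>. ?frame K (fr K)" ..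
    have fr: "?frame K (fst (fr K), fst (snd (fr K)), snd (snd (fr K)))" if "K \<in> \<T>" for K
      using bspec[OF all that] by (simp only: prod.collapse)
    let ?V = "\<lambda>K. fst (fr K)" and ?\<beta> = "\<lambda>K. fst (snd (fr K))" and ?l = "\<lambda>K. snd (snd (fr K))"
    have F: "cell_frame K (?V K) (?\<beta> K) (?l K)" if "K \<in> \<T>" for K using fr[OF that] unfolding prod.case by blast
    obtain g where gc: "continuous_on \<Omega> g" and gd: "\<And>x. x \<in> \<Omega> \<Longrightarrow> (u has_derivative (\<lambda>h. g x \<bullet> h)) (at x)"
      using C1 at_within_open[OF _ assms(1)] unfolding C1_on_def by metis
    have D\<Omega>: "cell_interior K \<subseteq> \<Omega>" if "K \<in> \<T>" for K unfolding \<Omega> using that by (intro interior_mono) auto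
    have sK: "sobolev 4 (cell_interior K) u" if "K \<in> \<T>" for K using sob that by (simp add: broken_sobolev_def)
    have gK: "continuous_on (cell_interior K) g" "\<And>x. x \<in> cell_interior K \<Longrightarrow> (u has_derivative (\<lambda>h. g x \<bullet> h)) (at x)" if "K \<in> \<T>" for K
      using D\<Omega>[OF that] gd gc continuous_on_subset by blast+
    have "\<forall>K\<in>\<T>. \<exists>U G. continuous_on (region K) U \<and> continuous_on (region K) G \<and> (\<forall>x\<in>cell_interior K. U x = u x \<and> G x = g x)"
      by (intro ballI) (rule cell_extension[OF cells sK gK(2,1)])
    then obtain U G where UG: "\<And>K. K \<in> \<T> \<Longrightarrow> continuous_on (region K) (U K)" "\<And>K. K \<in> \<T> \<Longrightarrow> continuous_on (region K) (G K)"
      "\<And>K x. K \<in> \<T> \<Longrightarrow> x \<in> cell_interior K \<Longrightarrow> U K x = u x" "\<And>K x. K \<in> \<T> \<Longrightarrow> x \<in> cell_interior K \<Longrightarrow> G K x = g x"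
      by metis
    have uc: "isCont u x" if "x \<in> \<Omega>" for x using gd[OF that] by (rule has_derivative_continuous)
    have gcx: "isCont g x" if "x \<in> \<Omega>" for x using gc that assms(1) continuous_on_eq_continuous_at by blast
    obtain c where c: "\<And>K a. K \<in> \<T> \<Longrightarrow> a \<in> verts K \<Longrightarrow> c (Val a) = U K a" "\<And>K a. K \<in> \<T> \<Longrightarrow> a \<in> verts K \<Longrightarrow> grad_dof c a = G K a"
      "\<And>K e. K \<in> \<T> \<Longrightarrow> e \<in> sides K \<Longrightarrow> c (Normal e) = G K (midpt e) \<bullet> side_normal e"
      using nodal_values[OF tri F uc gcx UG] by metis
    obtain v where v: "v \<in> HCT_global \<T>"
      "\<And>K x. K \<in> \<T> \<Longrightarrow> x \<in> region K \<Longrightarrow> v x = cell_frame.loc K (?V K) (?\<beta> K) (?l K) c x"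
      using nodal_interpolant_global[OF tri F] by metis
    have "cell_sobolev l K (\<lambda>x. u x - v x) \<and>
       cell_seminorm l K (\<lambda>x. u x - v x) \<le> ?c * patch_size \<T> K ^ (4 - l) * patch_seminorm 4 \<T> K u"
      if K: "K \<in> \<T>" and l: "l \<le> 4" for K l
    proof -
      have fK: "\<And>i k. norm (hct_frame.sc (?\<beta> K) (?l K) i k) \<le> N / diameter (region K)"
        "\<And>j k. j \<noteq> k \<Longrightarrow> diameter (region K) / N \<le> norm (?V K k - ?V K j)" "diameter (region K) > 0"
        "\<rho> * (diameter (region K))\<^sup>2 \<le> measure lborel (cell_interior K)" using fr[OF K] unfolding prod.case by blast+
      note e = cell_frame.cell_error[OF F[OF K] cells[OF K] sK[OF K] gK(2)[OF K] gK(1)[OF K] UG(1)[OF K] UG(3)[OF K] UG(2)[OF K] UG(4)[OF K]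
          c(1)[OF K] c(2)[OF K] c(3)[OF K] v(2)[OF K] N \<rho> fK(3) fK(1) fK(2) fK(4) l]
      have "verts K \<noteq> {}" using cells[OF K] by (auto simp: is_cell_def)
      note pb = patch_bounds[OF fin K this]
      have "cell_seminorm l K (\<lambda>x. u x - v x) \<le> ?c * diameter (region K) ^ (4 - l) * sobolev_seminorm 4 (cell_interior K) u"
        by (rule e(2))
      also have "\<dots> \<le> ?c * patch_size \<T> K ^ (4 - l) * patch_seminorm 4 \<T> K u"
      proof (intro mult_mono mult_nonneg_nonneg power_mono pb c0 order_refl)
        show "0 \<le> diameter (region K)" using fK(3) by simp
        show "0 \<le> patch_size \<T> K ^ (4 - l)" using pb(1) fK(3) by simp
        show "0 \<le> sobolev_seminorm 4 (cell_interior K) u"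
          unfolding sobolev_seminorm_def by (intro real_sqrt_ge_zero sum_nonneg) simp
      qed (use fK(3) in simp_all)
      finally show ?thesis using e(1) by blast
    qed
    then show ?thesis using v(1) by blast
  qed
  then show ?thesis by blast
qed

end
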